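(* The decision problem of JavaScript regex matching without lower-bounded quantifiers is PSPACE-complete, both with and without negative lookarounds. That is, $\mathrm{JSREGTEST}_{\mathcal R}$ is PSPACE-complete (under polynomial-time many-one reductions) when $\mathcal R$ is the set of all JavaScript regexes without lower-bounded quantifiers, and also when $\mathcal R$ is the set of all JavaScript regexes without lower-bounded quantifiers and without negative lookarounds. (In particular, JavaScript regex matching is PSPACE-hard even without negative lookarounds.)
   Context: **Regexes.** Fix a finite alphabet $\Sigma$ (of the JavaScript characters) with a designated subset of word characters. JavaScript regexes are generated by: empty regex $\varepsilon$; character descriptor $cd\subseteq\Sigma$ (a single character $c$ stands for $\{c\}$); disjunction $r_1|r_2$; sequence $r_1r_2$; capture group $({}_g\,r)$ with group identifier $g$ (each identifier is used by at most one capture group of a regex); backreference $\backslash g$; quantifier $r\{min,\Delta,\kappa\}$ with $min\in\mathbb N$ the minimum number of repetitions, $\Delta\in\mathbb N\cup\{\infty\}$ the difference between maximum and minimum, and $\kappa=\top$ (greedy) or $\bot$ (lazy), the star being $r*=r\{0,\infty,\top\}$; lookaheads $(?{=}\,r)$ (positive), $(?!\,r)$ (negative); lookbehinds $(?{<}{=}\,r)$ (positive), $(?{<}!\,r)$ (negative); anchors ^, $\$$, $\backslash b$, $\backslash B$. A quantifier is *lower-bounded* if $min\neq0$. Negative lookarounds are $(?!\,r)$ and $(?{<}!\,r)$. **Semantics (ECMAScript backtracking semantics, no flags).** Fix a string $s=s_0\cdots s_{|s|-1}$ over $\Sigma$. A group map $\gamma$ assigns to each group identifier "undefined", "opened at $a$",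 or a closed range $(a,b)$, $a\le b$; $\emptyset$ is everywhere undefined. An action is a regex, $\mathrm{Aclose}\,g$, or $\mathrm{Acheck}\,k$ ($k$ a position). Directions are $\rightarrow$ and $\leftarrow$. For a list of actions $l$, position $0\le p\le|s|$, group map $\gamma$ and direction $d$, the ordered list of results (leaves of the backtracking tree, highest priority first) $L(l,p,\gamma,d)$ is given by the following rules, where $\mathbin{+\!+}$ is list concatenation and $\gamma\setminus r$ is $\gamma$ with all groups occurring in $r$ made undefined: - $L([],p,\gamma,d)=[(p,\gamma)]$. - $L(\mathrm{Acheck}\,k::l,p,\gamma,d)=L(l,p,\gamma,d)$ if $p$ is strictly further than $k$ in direction $d$ ($p>k$ if $d={\rightarrow}$, $p<k$ if $d={\leftarrow}$), else $[]$. - $L(\mathrm{Aclose}\,g::l,p,\gamma,d)=L(l,p,\gamma[g\mapsto(\min(a,p),\max(a,p))],d)$, where $g$ is opened at $a$ in $\gamma$. - $L(\varepsilon::l,p,\gamma,d)=L(l,p,\gamma,d)$. - $L(cd::l,p,\gamma,\rightarrow)=L(l,p+1,\gamma,\rightarrow)$ if $p<|s|$ and $s_p\in cd$, else $[]$; $L(cd::l,p,\gamma,\leftarrow)=L(l,p-1,\gamma,\leftarrow)$ if $p>0$ and $s_{p-1}\in cd$, else $[]$. - $L((r_1|r_2)::l,p,\gamma,d)=L(r_1::l,p,\gamma,d)\mathbin{+\!+}L(r_2::l,p,\gamma,d)$. - $L(r_1r_2::l,p,\gamma,d)$ is $L(r_1::r_2::l,p,\gamma,d)$ if $d={\rightarrow}$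 and $L(r_2::r_1::l,p,\gamma,d)$ if $d={\leftarrow}$. - $L(r\{min+1,\Delta,\kappa\}::l,p,\gamma,d)=L(r::r\{min,\Delta,\kappa\}::l,p,\gamma\setminus r,d)$. - $L(r\{0,0,\kappa\}::l,p,\gamma,d)=L(l,p,\gamma,d)$. - For $\Delta>0$, with $I=L(r::\mathrm{Acheck}\,p::r\{0,\Delta-1,\kappa\}::l,p,\gamma\setminus r,d)$ (where $\infty-1=\infty$) and $S=L(l,p,\gamma,d)$: $L(r\{0,\Delta,\top\}::l,p,\gamma,d)=I\mathbin{+\!+}S$ and $L(r\{0,\Delta,\bot\}::l,p,\gamma,d)=S\mathbin{+\!+}I$. - $L(({}_g\,r)::l,p,\gamma,d)=L(r::\mathrm{Aclose}\,g::l,p,\gamma[g\mapsto\text{opened at }p],d)$. - Lookaround with body $r$: let $M=L([r],p,\gamma,d')$ with $d'={\rightarrow}$ for lookaheads and $d'={\leftarrow}$ for lookbehinds. Positive: the result is $[]$ if $M=[]$, and $L(l,p,\gamma',d)$ if the first element of $M$ is $(p',\gamma')$. Negative: the result is $L(l,p,\gamma,d)$ if $M=[]$, and $[]$ otherwise. - Anchors: $L(l,p,\gamma,d)$ if the anchor is satisfied at $p$, else $[]$; ^ is satisfied iff $p=0$, $\$$ iff $p=|s|$, $\backslash b$ iff exactly one of "$p>0$ and $s_{p-1}$ is a word character", "$p<|s|$ and $s_p$ is a word character" holds, $\backslash B$ iff $\backslash b$ is not. - $L(\backslash g::l,p,\gamma,d)$: if $\gamma(g)$ is not a closed range, $L(l,p,\gamma,d)$;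 if $\gamma(g)=(a,b)$ and $w=s_a\cdots s_{b-1}$, then $L(l,p\pm|w|,\gamma,d)$ ($+$ if $d={\rightarrow}$, $-$ if $d={\leftarrow}$) provided $w$ is the factor of $s$ of length $|w|$ starting (resp. ending) at position $p$, else $[]$. **Problem.** For a set $\mathcal R$ of regexes, $\mathrm{JSREGTEST}_{\mathcal R}$ is: given $r\in\mathcal R$ and a string $s$, does $r$ have a match in $s$, i.e. is $L([r],k,\emptyset,\rightarrow)\neq[]$ for some starting position $0\le k\le|s|$? **Instance size.** $r$ is given by its syntax tree (numbers $\Delta$ and group identifiers in binary; regex parsing is out of scope); complexity is measured in $|s|$ and the size of $r$ (and the bit lengths of those numbers), where $|\varepsilon|=|cd|=|\text{anchor}|=|\backslash g|=1$, $|r_1|r_2|=|r_1r_2|=1+|r_1|+|r_2|$, $|r\{0,\Delta,\kappa\}|=3+|r|$, a lookaround of body $r$ has size $1+|r|$, and $|({}_g\,r)|=2+|r|$. *)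

theory Defs
  imports
    "HOL-Library.Extended_Nat"
    "HOL-Library.Countable"
    "HOL-Computational_Algebra.Polynomial"
begin

section \<open>JavaScript regexes\<close>

datatype anchor = Input_Start | Input_End | Word_Boundary | Non_Word_Boundary

datatype greediness = Greedy | Lazy

datatype direction = Forward | Backward

datatype polarity = Positive | Negative

text \<open>
  \<open>Quant r m \<Delta> \<kappa>\<close> is the quantifier with minimum \<open>m\<close> and difference \<open>\<Delta>\<close> between maximum and
  minimum. \<open>Look Forward\<close> is a lookahead and \<open>Look Backward\<close> a lookbehind.
\<close>

datatype 'a regex =
    Eps
  | Chars "'a set"
  | Alt "'a regex" "'a regex"
  | Seq "'a regex" "'a regex"
  | Group nat "'a regex"
  | Backref nat
  | Quant "'a regex" nat enat greediness
  | Look direction polarity "'a regex"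
  | Anchor anchor

primrec groups :: "'a regex \<Rightarrow> nat list" where
  "groups Eps = []"
| "groups (Chars cd) = []"
| "groups (Alt r1 r2) = groups r1 @ groups r2"
| "groups (Seq r1 r2) = groups r1 @ groups r2"
| "groups (Group g r) = g # groups r"
| "groups (Backref g) = []"
| "groups (Quant r m \<Delta> \<kappa>) = groups r"
| "groups (Look d b r) = groups r"
| "groups (Anchor a) = []"

definition js_regexes :: "'a regex set" where
  "js_regexes = {r. distinct (groups r)}"

primrec no_lower_bounds :: "'a regex \<Rightarrow> bool" where
  "no_lower_bounds Eps \<longleftrightarrow> True"
| "no_lower_bounds (Chars cd) \<longleftrightarrow> True"
| "no_lower_bounds (Alt r1 r2) \<longleftrightarrow> no_lower_bounds r1 \<and> no_lower_bounds r2"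
| "no_lower_bounds (Seq r1 r2) \<longleftrightarrow> no_lower_bounds r1 \<and> no_lower_bounds r2"
| "no_lower_bounds (Group g r) \<longleftrightarrow> no_lower_bounds r"
| "no_lower_bounds (Backref g) \<longleftrightarrow> True"
| "no_lower_bounds (Quant r m \<Delta> \<kappa>) \<longleftrightarrow> m = 0 \<and> no_lower_bounds r"
| "no_lower_bounds (Look d b r) \<longleftrightarrow> no_lower_bounds r"
| "no_lower_bounds (Anchor a) \<longleftrightarrow> True"

primrec no_neg_lookarounds :: "'a regex \<Rightarrow> bool" where
  "no_neg_lookarounds Eps \<longleftrightarrow> True"
| "no_neg_lookarounds (Chars cd) \<longleftrightarrow> True"
| "no_neg_lookarounds (Alt r1 r2) \<longleftrightarrow> no_neg_lookarounds r1 \<and> no_neg_lookarounds r2"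
| "no_neg_lookarounds (Seq r1 r2) \<longleftrightarrow> no_neg_lookarounds r1 \<and> no_neg_lookarounds r2"
| "no_neg_lookarounds (Group g r) \<longleftrightarrow> no_neg_lookarounds r"
| "no_neg_lookarounds (Backref g) \<longleftrightarrow> True"
| "no_neg_lookarounds (Quant r m \<Delta> \<kappa>) \<longleftrightarrow> no_neg_lookarounds r"
| "no_neg_lookarounds (Look d b r) \<longleftrightarrow> b = Positive \<and> no_neg_lookarounds r"
| "no_neg_lookarounds (Anchor a) \<longleftrightarrow> True"


section \<open>Backtracking semantics\<close>

datatype group_state = Undefined | Opened nat | Closed nat nat

type_synonym group_map = "nat \<Rightarrow> group_state"

datatype 'a action = Areg "'a regex" | Aclose nat | Acheck nat

definition reset :: "group_map \<Rightarrow> 'a regex \<Rightarrow> group_map" where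
  "reset \<gamma> r = (\<lambda>g. if g \<in> set (groups r) then Undefined else \<gamma> g)"

fun further :: "direction \<Rightarrow> nat \<Rightarrow> nat \<Rightarrow> bool" where
  "further Forward p k \<longleftrightarrow> p > k"
| "further Backward p k \<longleftrightarrow> p < k"

definition factor :: "'a list \<Rightarrow> nat \<Rightarrow> nat \<Rightarrow> 'a list" where
  "factor s a b = take (b - a) (drop a s)"

definition word_boundary :: "'a set \<Rightarrow> 'a list \<Rightarrow> nat \<Rightarrow> bool" where
  "word_boundary W s p \<longleftrightarrow>
     (0 < p \<and> s ! (p - 1) \<in> W) \<noteq> (p < length s \<and> s ! p \<in> W)"

fun anchor_holds :: "'a set \<Rightarrow> 'a list \<Rightarrow> anchor \<Rightarrow> nat \<Rightarrow> bool" where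
  "anchor_holds W s Input_Start p \<longleftrightarrow> p = 0"
| "anchor_holds W s Input_End p \<longleftrightarrow> p = length s"
| "anchor_holds W s Word_Boundary p \<longleftrightarrow> word_boundary W s p"
| "anchor_holds W s Non_Word_Boundary p \<longleftrightarrow> \<not> word_boundary W s p"

text \<open>
  \<open>read_factor s w p d\<close> is the position reached by reading \<open>w\<close> from position \<open>p\<close> in direction \<open>d\<close>,
  or \<open>None\<close> if \<open>w\<close> is not the factor of \<open>s\<close> found there.
\<close>

fun read_factor :: "'a list \<Rightarrow> 'a list \<Rightarrow> nat \<Rightarrow> direction \<Rightarrow> nat option" where
  "read_factor s w p Forward =
     (if factor s p (p + length w) = w then Some (p + length w) else None)"
| "read_factor s w p Backward =
     (if length w \<le> p \<and> factor s (p - length w) p = w then Some (p - length w) else None)"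

fun read_char :: "'a list \<Rightarrow> 'a set \<Rightarrow> nat \<Rightarrow> direction \<Rightarrow> nat option" where
  "read_char s cd p Forward = (if p < length s \<and> s ! p \<in> cd then Some (p + 1) else None)"
| "read_char s cd p Backward =
     (if 0 < p \<and> p \<le> length s \<and> s ! (p - 1) \<in> cd then Some (p - 1) else None)"

text \<open>
  \<open>leaves W s l p \<gamma> d\<close> is the list of results, in priority order, on the string \<open>s\<close> with word
  characters \<open>W\<close>. A group that is closed without being open does not occur when starting from a
  regex in \<open>js_regexes\<close>; the group map is then left unchanged.
\<close>

function leaves ::
  "'a set \<Rightarrow> 'a list \<Rightarrow> 'a action list \<Rightarrow> nat \<Rightarrow> group_map \<Rightarrow> direction \<Rightarrow> (nat \<times> group_map) list"
where
  "leaves W s [] p \<gamma> d = [(p, \<gamma>)]"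
| "leaves W s (Acheck k # l) p \<gamma> d =
     (if further d p k then leaves W s l p \<gamma> d else [])"
| "leaves W s (Aclose g # l) p \<gamma> d =
     (case \<gamma> g of
        Opened a \<Rightarrow> leaves W s l p (\<gamma>(g := Closed (min a p) (max a p))) d
      | _ \<Rightarrow> leaves W s l p \<gamma> d)"
| "leaves W s (Areg Eps # l) p \<gamma> d = leaves W s l p \<gamma> d"
| "leaves W s (Areg (Chars cd) # l) p \<gamma> d =
     (case read_char s cd p d of
        Some p' \<Rightarrow> leaves W s l p' \<gamma> d
      | None \<Rightarrow> [])"
| "leaves W s (Areg (Alt r1 r2) # l) p \<gamma> d =
     leaves W s (Areg r1 # l) p \<gamma> d @ leaves W s (Areg r2 # l) p \<gamma> d"
| "leaves W s (Areg (Seq r1 r2) # l) p \<gamma> d =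
     (case d of
        Forward \<Rightarrow> leaves W s (Areg r1 # Areg r2 # l) p \<gamma> d
      | Backward \<Rightarrow> leaves W s (Areg r2 # Areg r1 # l) p \<gamma> d)"
| "leaves W s (Areg (Quant r (Suc m) \<Delta> \<kappa>) # l) p \<gamma> d =
     leaves W s (Areg r # Areg (Quant r m \<Delta> \<kappa>) # l) p (reset \<gamma> r) d"
| "leaves W s (Areg (Quant r 0 \<Delta> \<kappa>) # l) p \<gamma> d =
     (if \<Delta> = 0 then leaves W s l p \<gamma> d
      else let I = leaves W s (Areg r # Acheck p # Areg (Quant r 0 (\<Delta> - 1) \<kappa>) # l) p (reset \<gamma> r) d;
               S = leaves W s l p \<gamma> d
           in case \<kappa> of Greedy \<Rightarrow> I @ S | Lazy \<Rightarrow> S @ I)"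
| "leaves W s (Areg (Group g r) # l) p \<gamma> d =
     leaves W s (Areg r # Aclose g # l) p (\<gamma>(g := Opened p)) d"
| "leaves W s (Areg (Look d' b r) # l) p \<gamma> d =
     (let M = leaves W s [Areg r] p \<gamma> d'
      in case b of
           Positive \<Rightarrow> (case M of [] \<Rightarrow> [] | (p', \<gamma>') # _ \<Rightarrow> leaves W s l p \<gamma>' d)
         | Negative \<Rightarrow> (case M of [] \<Rightarrow> leaves W s l p \<gamma> d | _ # _ \<Rightarrow> []))"
| "leaves W s (Areg (Anchor a) # l) p \<gamma> d =
     (if anchor_holds W s a p then leaves W s l p \<gamma> d else [])"
| "leaves W s (Areg (Backref g) # l) p \<gamma> d =
     (case \<gamma> g of
        Closed a b \<Rightarrow>
          (case read_factor s (factor s a b) p d of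
             Some p' \<Rightarrow> leaves W s l p' \<gamma> d
           | None \<Rightarrow> [])
      | _ \<Rightarrow> leaves W s l p \<gamma> d)"
  by pat_completeness auto

text \<open>
  Termination: \<open>m\<close> bounds the number of characters left to read in the current direction, and
  \<open>B\<close> bounds that number in any direction. After the check that follows an optional iteration,
  strictly fewer characters are left than before the iteration.
\<close>

primrec regex_weight :: "nat \<Rightarrow> 'a regex \<Rightarrow> nat \<Rightarrow> nat" where
  "regex_weight B Eps = (\<lambda>m. 1)"
| "regex_weight B (Chars cd) = (\<lambda>m. 1)"
| "regex_weight B (Alt r1 r2) = (\<lambda>m. 1 + regex_weight B r1 m + regex_weight B r2 m)"
| "regex_weight B (Seq r1 r2) = (\<lambda>m. 1 + regex_weight B r1 m + regex_weight B r2 m)"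
| "regex_weight B (Group g r) = (\<lambda>m. 2 + regex_weight B r m)"
| "regex_weight B (Backref g) = (\<lambda>m. 1)"
| "regex_weight B (Quant r k \<Delta> \<kappa>) = (\<lambda>m. (k + m + 1) * (regex_weight B r m + 3))"
| "regex_weight B (Look d b r) = (\<lambda>m. 1 + regex_weight B r B)"
| "regex_weight B (Anchor a) = (\<lambda>m. 1)"

fun remaining :: "nat \<Rightarrow> direction \<Rightarrow> nat \<Rightarrow> nat" where
  "remaining B Forward p = B - p"
| "remaining B Backward p = p"

fun actions_weight :: "nat \<Rightarrow> direction \<Rightarrow> 'a action list \<Rightarrow> nat \<Rightarrow> nat" where
  "actions_weight B d [] m = 0"
| "actions_weight B d (Areg r # l) m = regex_weight B r m + actions_weight B d l m"
| "actions_weight B d (Aclose g # l) m = 1 + actions_weight B d l m"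
| "actions_weight B d (Acheck k # l) m =
     (if remaining B d k = 0 then 1
      else 1 + actions_weight B d l (min m (remaining B d k - 1)))"

lemma regex_weight_mono: "m \<le> m' \<Longrightarrow> regex_weight B r m \<le> regex_weight B r m'"
proof (induction r arbitrary: m m')
  case (Quant r k \<Delta> \<kappa>)
  then show ?case by (simp only: regex_weight.simps) (intro mult_mono add_mono; simp)
qed (simp_all add: add_mono)

lemma regex_weight_pos: "0 < regex_weight B r m"
  by (induction r arbitrary: m) simp_all

lemma actions_weight_mono: "m \<le> m' \<Longrightarrow> actions_weight B d l m \<le> actions_weight B d l m'"
proof (induction B d l m arbitrary: m' rule: actions_weight.induct)
  case (2 B d r l m)
  then show ?case by (simp add: add_mono regex_weight_mono)
next
  case (4 B d k l m)
  have "min m (remaining B d k - 1) \<le> min m' (remaining B d k - 1)" using 4 by simp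
  then show ?case using 4 by simp
qed simp_all

lemma read_char_progress:
  assumes "read_char s cd p d = Some p'"
  shows "max (length s) p' = max (length s) p"
    and "remaining (max (length s) p) d p' \<le> remaining (max (length s) p) d p"
  using assms by (cases d; auto split: if_splits)+

lemma read_factor_progress:
  assumes "read_factor s w p d = Some p'"
  shows "max (length s) p' = max (length s) p"
    and "remaining (max (length s) p) d p' \<le> remaining (max (length s) p) d p"
proof -
  have "max (length s) p' = max (length s) p \<and>
    remaining (max (length s) p) d p' \<le> remaining (max (length s) p) d p"
  proof (cases d)
    case Forward
    then have p': "p' = p + length w" and "factor s p (p + length w) = w"
      using assms by (simp_all split: if_splits)
    then have "length (factor s p (p + length w)) = length w" by simp
    then have "length w \<le> length s - p" by (simp add: factor_def)
    with p' Forward show ?thesis by auto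
  next
    case Backward
    then have w: "length w \<le> p" and p': "p' = p - length w"
      and "factor s (p - length w) p = w"
      using assms by (simp_all split: if_splits)
    then have "length (factor s (p - length w) p) = length w" by simp
    with w have "length w \<le> length s - (p - length w)" by (simp add: factor_def)
    with w p' Backward show ?thesis by auto
  qed
  then show "max (length s) p' = max (length s) p"
    "remaining (max (length s) p) d p' \<le> remaining (max (length s) p) d p" by simp_all
qed

lemma further_remaining:
  "p \<le> B \<Longrightarrow> further d p k \<Longrightarrow> remaining B d p \<le> remaining B d k - 1 \<and> 0 < remaining B d k"
  by (cases d) auto

lemma remaining_le: "p \<le> B \<Longrightarrow> remaining B d p \<le> B"
  by (cases d) auto

lemma iteration_weight:
  "actions_weight B d (Areg r # Acheck p # Areg (Quant r 0 \<Delta>' \<kappa>) # l) (remaining B d p)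
     < actions_weight B d (Areg (Quant r 0 \<Delta> \<kappa>) # l) (remaining B d p)"
proof (cases "remaining B d p")
  case 0
  then show ?thesis by simp
next
  case (Suc n)
  have "regex_weight B r n \<le> regex_weight B r (Suc n)"
    and "actions_weight B d l n \<le> actions_weight B d l (Suc n)"
    by (simp_all add: regex_weight_mono actions_weight_mono)
  moreover from this have
    "Suc n * (regex_weight B r n + 3) \<le> Suc n * (regex_weight B r (Suc n) + 3)"
    by (intro mult_left_mono) simp_all
  ultimately show ?thesis using Suc by simp
qed

lemma read_char_weight:
  "read_char s cd p d = Some p' \<Longrightarrow>
    actions_weight (max (length s) p') d l (remaining (max (length s) p') d p')
      \<le> actions_weight (max (length s) p) d l (remaining (max (length s) p) d p)"
  by (simp only: read_char_progress actions_weight_mono)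

lemma read_factor_weight:
  "read_factor s w p d = Some p' \<Longrightarrow>
    actions_weight (max (length s) p') d l (remaining (max (length s) p') d p')
      \<le> actions_weight (max (length s) p) d l (remaining (max (length s) p) d p)"
  by (simp only: read_factor_progress actions_weight_mono)

lemma check_weight:
  "p \<le> B \<Longrightarrow> further d p k \<Longrightarrow>
    actions_weight B d l (remaining B d p) < actions_weight B d (Acheck k # l) (remaining B d p)"
  using further_remaining[of p B d k] by (simp add: min_absorb1)

lemma look_weight:
  "p \<le> B \<Longrightarrow> actions_weight B d' [Areg r] (remaining B d' p)
     < actions_weight B d (Areg (Look d' b r) # l) (remaining B d p)"
  using regex_weight_mono[OF remaining_le, of p B B r d'] by simp

termination leaves
  by (relation "measure (\<lambda>(W, s, l, p, \<gamma>, d).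
      actions_weight (max (length s) p) d l (remaining (max (length s) p) d p))",
    simp_all only: in_measure case_prod_conv wf_measure check_weight look_weight iteration_weight
      max.cobounded2,
    simp_all add: regex_weight_pos less_Suc_eq_le read_char_weight read_factor_weight)

definition has_match :: "'a set \<Rightarrow> 'a regex \<Rightarrow> 'a list \<Rightarrow> bool" where
  "has_match W r s \<longleftrightarrow> (\<exists>k \<le> length s. leaves W s [Areg r] k (\<lambda>_. Undefined) Forward \<noteq> [])"


section \<open>Encoding of instances\<close>

text \<open>
  An instance is written as the syntax tree of the regex in prefix notation, followed by the
  string. For a finite type of characters there are finitely many tokens, so that each token,
  in particular each character descriptor, has size bounded by a constant. Numbers are in binary,
  least significant bit first and without leading zeros.
\<close>

datatype 'a token =
    TEps | TChars "'a set" | TAlt | TSeq | TGroup | TBackref | TQuant greediness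
  | TLook direction polarity | TAnchor anchor | TBit bool | TComma | TInfinity | TChar 'a

instance token :: (finite) finite
proof
  have "(UNIV :: 'a token set) \<subseteq>
      {TEps, TAlt, TSeq, TGroup, TBackref, TComma, TInfinity}
      \<union> TQuant ` {Greedy, Lazy}
      \<union> (\<lambda>(d, b). TLook d b) ` ({Forward, Backward} \<times> {Positive, Negative})
      \<union> TAnchor ` {Input_Start, Input_End, Word_Boundary, Non_Word_Boundary}
      \<union> range TBit \<union> range TChars \<union> range TChar"
    (is "_ \<subseteq> ?T")
  proof
    fix t :: "'a token"
    show "t \<in> ?T"
    proof (cases t)
      case (TQuant k)
      then show ?thesis by (cases k) auto
    next
      case (TLook d b)
      then show ?thesis by (cases d; cases b) force+
    next
      case (TAnchor a)
      then show ?thesis by (cases a) auto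
    qed auto
  qed
  then show "finite (UNIV :: 'a token set)" by (rule finite_subset) simp
qed

fun nat_tokens :: "nat \<Rightarrow> 'a token list" where
  "nat_tokens n = (if n = 0 then [] else TBit (odd n) # nat_tokens (n div 2))"

declare nat_tokens.simps [simp del]

fun enat_tokens :: "enat \<Rightarrow> 'a token list" where
  "enat_tokens (enat n) = nat_tokens n"
| "enat_tokens \<infinity> = [TInfinity]"

primrec regex_tokens :: "'a regex \<Rightarrow> 'a token list" where
  "regex_tokens Eps = [TEps]"
| "regex_tokens (Chars cd) = [TChars cd]"
| "regex_tokens (Alt r1 r2) = TAlt # regex_tokens r1 @ regex_tokens r2"
| "regex_tokens (Seq r1 r2) = TSeq # regex_tokens r1 @ regex_tokens r2"
| "regex_tokens (Group g r) = TGroup # nat_tokens g @ regex_tokens r"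
| "regex_tokens (Backref g) = TBackref # nat_tokens g"
| "regex_tokens (Quant r m \<Delta> \<kappa>) =
     TQuant \<kappa> # nat_tokens m @ TComma # enat_tokens \<Delta> @ regex_tokens r"
| "regex_tokens (Look d b r) = TLook d b # regex_tokens r"
| "regex_tokens (Anchor a) = [TAnchor a]"

definition token_code :: "'a::finite token \<Rightarrow> bool list" where
  "token_code t = replicate (to_nat t) True @ [False]"

definition encode_instance :: "'a::finite regex \<Rightarrow> 'a list \<Rightarrow> bool list" where
  "encode_instance r s = concat (map token_code (regex_tokens r @ map TChar s))"

lemma token_code_append_inj:
  assumes "token_code t @ xs = token_code u @ ys"
  shows "t = u \<and> xs = ys"
proof -
  have "m = n \<and> xs = ys"
    if "replicate m True @ False # xs = replicate n True @ False # ys" for m n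
    using that
  proof (induction m arbitrary: n)
    case 0
    then show ?case by (cases n) auto
  next
    case (Suc m)
    then show ?case by (cases n) auto
  qed
  from this[of "to_nat t" "to_nat u"] assms show ?thesis by (simp add: token_code_def)
qed

lemma concat_token_code_inj:
  "concat (map token_code ts) = concat (map token_code us) \<Longrightarrow> ts = us"
proof (induction ts arbitrary: us)
  case Nil
  then show ?case by (cases us) (auto simp: token_code_def)
next
  case (Cons t ts)
  then obtain u us' where "us = u # us'"
    by (cases us) (auto simp: token_code_def)
  with Cons show ?case using token_code_append_inj[of t _ u] by fastforce
qed

fun starts_with_bit :: "'a token list \<Rightarrow> bool" where
  "starts_with_bit (TBit b # ts) \<longleftrightarrow> True"
| "starts_with_bit ts \<longleftrightarrow> False"

lemma nat_tokens_append_inj: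
  "nat_tokens m @ xs = nat_tokens n @ ys \<Longrightarrow> \<not> starts_with_bit xs \<Longrightarrow> \<not> starts_with_bit ys \<Longrightarrow>
    m = n \<and> xs = ys"
proof (induction m arbitrary: n rule: less_induct)
  case (less m)
  show ?case
  proof (cases "m = 0 \<or> n = 0")
    case True
    with less.prems show ?thesis
      by (cases "m = 0"; cases "n = 0")
        (auto simp: nat_tokens.simps[of m] nat_tokens.simps[of n] nat_tokens.simps[of 0])
  next
    case False
    then have "odd m = odd n" "nat_tokens (m div 2) @ xs = nat_tokens (n div 2) @ ys"
      using less.prems(1) by (simp_all add: nat_tokens.simps[of m] nat_tokens.simps[of n])
    moreover from this have "m div 2 = n div 2 \<and> xs = ys"
      using less.IH[of "m div 2" "n div 2"] False less.prems(2,3) by simp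
    moreover have "m = n" if "odd m = odd n" "m div 2 = n div 2"
      using that by presburger
    ultimately show ?thesis by blast
  qed
qed

lemma not_starts_with_bit_regex_tokens [simp]: "\<not> starts_with_bit (regex_tokens r @ xs)"
  by (cases r) simp_all

lemma enat_tokens_append_inj:
  assumes "enat_tokens m @ regex_tokens r @ xs = enat_tokens n @ regex_tokens r' @ ys"
  shows "m = n \<and> regex_tokens r @ xs = regex_tokens r' @ ys"
proof -
  have *: "nat_tokens k @ regex_tokens q @ zs \<noteq> TInfinity # ws" for k and q :: "'a regex" and zs ws
  proof (cases "k = 0")
    case True
    then show ?thesis by (cases q) (simp_all add: nat_tokens.simps[of 0])
  next
    case False
    then show ?thesis by (simp add: nat_tokens.simps[of k])
  qed
  show ?thesis
  proof (cases m; cases n)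
    fix k l
    assume "m = enat k" "n = enat l"
    with assms nat_tokens_append_inj[of k "regex_tokens r @ xs" l "regex_tokens r' @ ys"]
    show ?thesis by simp
  next
    fix k
    assume "m = enat k" "n = \<infinity>"
    with assms *[of k r xs "regex_tokens r' @ ys"] show ?thesis by simp
  next
    fix l
    assume "m = \<infinity>" "n = enat l"
    with assms *[of l r' ys "regex_tokens r @ xs"] show ?thesis by simp
  next
    assume "m = \<infinity>" "n = \<infinity>"
    with assms show ?thesis by simp
  qed
qed

lemma regex_tokens_append_inj:
  "regex_tokens r @ xs = regex_tokens r' @ ys \<Longrightarrow> \<not> starts_with_bit xs \<Longrightarrow> \<not> starts_with_bit ys \<Longrightarrow>
    r = r' \<and> xs = ys"
proof (induction r arbitrary: r' xs ys)
  case (Alt r1 r2)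
  from Alt.prems(1) obtain q1 q2 where "r' = Alt q1 q2" by (cases r') auto
  with Alt.prems Alt.IH(1)[of "regex_tokens r2 @ xs" q1 "regex_tokens q2 @ ys"]
    Alt.IH(2)[of xs q2 ys] show ?case by simp
next
  case (Seq r1 r2)
  from Seq.prems(1) obtain q1 q2 where "r' = Seq q1 q2" by (cases r') auto
  with Seq.prems Seq.IH(1)[of "regex_tokens r2 @ xs" q1 "regex_tokens q2 @ ys"]
    Seq.IH(2)[of xs q2 ys] show ?case by simp
next
  case (Group g r)
  from Group.prems(1) obtain h q where "r' = Group h q" by (cases r') auto
  with Group.prems Group.IH[of xs q ys]
    nat_tokens_append_inj[of g "regex_tokens r @ xs" h "regex_tokens q @ ys"] show ?case by simp
next
  case (Backref g)
  from Backref.prems(1) obtain h where "r' = Backref h" by (cases r') auto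
  with Backref.prems nat_tokens_append_inj[of g xs h ys] show ?case by simp
next
  case (Quant r m \<Delta> \<kappa>)
  from Quant.prems(1) obtain q n \<Delta>' \<kappa>' where r': "r' = Quant q n \<Delta>' \<kappa>'" by (cases r') auto
  with Quant.prems nat_tokens_append_inj[of m "TComma # enat_tokens \<Delta> @ regex_tokens r @ xs" n
      "TComma # enat_tokens \<Delta>' @ regex_tokens q @ ys"]
  have "m = n" "\<kappa> = \<kappa>'"
    and "enat_tokens \<Delta> @ regex_tokens r @ xs = enat_tokens \<Delta>' @ regex_tokens q @ ys" by simp_all
  with r' Quant.prems Quant.IH[of xs q ys] enat_tokens_append_inj[of \<Delta> r xs \<Delta>' q ys]
  show ?case by simp
next
  case (Look d b r)
  from Look.prems(1) obtain d' b' q where "r' = Look d' b' q" by (cases r') auto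
  with Look.prems Look.IH[of xs q ys] show ?case by simp
next
  case Eps
  then show ?case by (cases r') auto
next
  case (Chars cd)
  then show ?case by (cases r') auto
next
  case (Anchor a)
  then show ?case by (cases r') auto
qed

lemma encode_instance_inj:
  assumes "encode_instance r s = encode_instance r' s'"
  shows "r = r' \<and> s = s'"
proof -
  have "regex_tokens r @ map TChar s = regex_tokens r' @ map TChar s'"
    using assms concat_token_code_inj unfolding encode_instance_def by blast
  moreover have "\<not> starts_with_bit (map TChar x)" for x :: "'a list"
    by (cases x) simp_all
  ultimately have "r = r'" "map TChar s = map TChar s'"
    using regex_tokens_append_inj by blast+
  then show ?thesis by (simp add: inj_map_eq_map inj_def)
qed

definition JSREGTEST :: "'a::finite set \<Rightarrow> 'a regex set \<Rightarrow> bool list set" where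
  "JSREGTEST W R = {encode_instance r s | r s. r \<in> R \<and> has_match W r s}"


section \<open>Turing machines and PSPACE-completeness\<close>

text \<open>
  Deterministic multi-tape Turing machines with two-way infinite tapes. Languages are sets of
  words over the binary alphabet, and the input is initially on the first tape. The action of a
  transition on a tape is the symbol to be written and the head movement.
\<close>

datatype symbol = Blank | Bit bool | Aux nat

record turing_machine =
  num_tapes :: nat
  states :: "nat set"
  alphabet :: "symbol set"
  start_state :: nat
  accept_state :: nat
  reject_state :: nat
  transition :: "nat \<Rightarrow> symbol list \<Rightarrow> nat \<times> (symbol \<times> int) list"

definition halting_states :: "turing_machine \<Rightarrow> nat set" where
  "halting_states M = {accept_state M, reject_state M}"

definition well_formed_tm :: "turing_machine \<Rightarrow> bool" where
  "well_formed_tm M \<longleftrightarrow>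
     0 < num_tapes M \<and>
     finite (states M) \<and> finite (alphabet M) \<and>
     {start_state M, accept_state M, reject_state M} \<subseteq> states M \<and>
     accept_state M \<noteq> reject_state M \<and>
     {Blank, Bit False, Bit True} \<subseteq> alphabet M \<and>
     (\<forall>q \<in> states M - halting_states M. \<forall>xs \<in> lists (alphabet M). length xs = num_tapes M \<longrightarrow>
        (case transition M q xs of (q', acts) \<Rightarrow>
           q' \<in> states M \<and> length acts = num_tapes M \<and> set acts \<subseteq> alphabet M \<times> {-1, 0, 1}))"

type_synonym tape = "(int \<Rightarrow> symbol) \<times> int"

type_synonym config = "nat \<times> tape list"

definition word_contents :: "bool list \<Rightarrow> int \<Rightarrow> symbol" where
  "word_contents w = (\<lambda>i. if 0 \<le> i \<and> i < int (length w) then Bit (w ! nat i) else Blank)"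

definition initial_config :: "turing_machine \<Rightarrow> bool list \<Rightarrow> config" where
  "initial_config M w =
     (start_state M, (word_contents w, 0) # replicate (num_tapes M - 1) (word_contents [], 0))"

fun tape_action :: "tape \<Rightarrow> symbol \<times> int \<Rightarrow> tape" where
  "tape_action (c, h) (a, m) = (c(h := a), h + m)"

fun tm_step :: "turing_machine \<Rightarrow> config \<Rightarrow> config" where
  "tm_step M (q, ts) =
     (if q \<in> halting_states M then (q, ts)
      else case transition M q (map (\<lambda>(c, h). c h) ts) of
             (q', acts) \<Rightarrow> (q', map2 tape_action ts acts))"

definition tm_run :: "turing_machine \<Rightarrow> bool list \<Rightarrow> nat \<Rightarrow> config" where
  "tm_run M w t = (tm_step M ^^ t) (initial_config M w)"

definition halts_in :: "turing_machine \<Rightarrow> bool list \<Rightarrow> nat \<Rightarrow> bool" where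
  "halts_in M w q \<longleftrightarrow> q \<in> halting_states M \<and> (\<exists>t. fst (tm_run M w t) = q)"

definition decides :: "turing_machine \<Rightarrow> bool list set \<Rightarrow> bool" where
  "decides M L \<longleftrightarrow>
     (\<forall>w. halts_in M w (if w \<in> L then accept_state M else reject_state M))"

text \<open>
  All heads stay within distance \<open>b\<close> of their initial cell. Head positions on the input tape are
  counted too, which is immaterial for polynomial bounds.
\<close>

definition runs_in_space :: "turing_machine \<Rightarrow> bool list \<Rightarrow> nat \<Rightarrow> bool" where
  "runs_in_space M w b \<longleftrightarrow> (\<forall>t. \<forall>(c, h) \<in> set (snd (tm_run M w t)). \<bar>h\<bar> \<le> int b)"

definition PSPACE :: "bool list set set" where
  "PSPACE = {L. \<exists>M (p :: nat poly). well_formed_tm M \<and> decides M L \<and>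
     (\<forall>w. runs_in_space M w (poly p (length w)))}"

text \<open>The output is the content of the last tape when the machine halts in its accepting state.\<close>

definition computes_in_time ::
  "turing_machine \<Rightarrow> bool list \<Rightarrow> bool list \<Rightarrow> nat \<Rightarrow> bool" where
  "computes_in_time M w v b \<longleftrightarrow>
     (\<exists>t \<le> b. case tm_run M w t of (q, ts) \<Rightarrow>
        q = accept_state M \<and> fst (last ts) = word_contents v)"

definition polytime_computable :: "(bool list \<Rightarrow> bool list) \<Rightarrow> bool" where
  "polytime_computable f \<longleftrightarrow>
     (\<exists>M (p :: nat poly). well_formed_tm M \<and>
        (\<forall>w. computes_in_time M w (f w) (poly p (length w))))"

definition polytime_reducible :: "bool list set \<Rightarrow> bool list set \<Rightarrow> bool" where
  "polytime_reducible L L' \<longleftrightarrow>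
     (\<exists>f. polytime_computable f \<and> (\<forall>w. w \<in> L \<longleftrightarrow> f w \<in> L'))"

definition PSPACE_hard :: "bool list set \<Rightarrow> bool" where
  "PSPACE_hard L \<longleftrightarrow> (\<forall>L' \<in> PSPACE. polytime_reducible L' L)"

definition PSPACE_complete :: "bool list set \<Rightarrow> bool" where
  "PSPACE_complete L \<longleftrightarrow> L \<in> PSPACE \<and> PSPACE_hard L"

end

theory Submission
  imports Defs
begin

text \<open>
  Hardness. The configurations of a Turing machine with polynomially bounded space are words of
  polynomially many columns, and a column is a number of bounded size. A regex matching a unary
  string stores such a word in the lengths of the ranges of capture groups. Whether one configuration
  leads to another within \<open>2^k\<close> steps is tested as in Savitch's theorem: the columns of a midpoint are
  guessed by backtracking, and the two halves of the computation are checked by the two iterations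
  of a star over one and the same subregex, in which backreferences copy the ends of the current half
  into the groups of the next lower level. Hence the regex grows only by a polynomial amount per level.
  Lookaheads and lookbehinds that always succeed move the position back to the start of the string.

  Membership. The backtracking tree is traversed depth first with a stack of alternatives. Outside
  of lookarounds a branch of the tree has polynomially many nodes at which an alternative is left
  over, because an iteration of a quantifier must read a character to be followed by another one, and the
  body of a lookaround has a smaller nesting depth. So the stack has polynomial height, and with bounds
  of quantifiers in binary all configurations have polynomial size.

  Both algorithms are composed of polynomial-time functions on binary trees, which a small language with
  finitely many stacks implements and which Turing machines simulate.
\<close>

section \<open>A stack language and its compilation to Turing machines\<close>

text \<open>A positive lookaround is atomic: after its body has succeeded, no other result of the
  body is tried. This shapes the hardness construction. A guess always stands before the lookaround
  that checks it, in the same sequence, so that a failed check backtracks into the guess; of a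
  checking lookaround only the success matters, since the groups that it has changed are reset
  before they are read again. That reset at the start of each iteration of a star is also why one
  subregex can serve for both halves: both start from the same group map, while the groups of the
  level above lie outside of the body and survive. The character read per iteration is the progress
  that the star demands and at the same time the loop counter. It suffices to test for exactly
  \<open>2^k\<close> steps, since a halted machine stays where it is.

  For membership the time is irrelevant, and only the height of the stack and the size of its
  entries count. Without lower bounds every iteration of a quantifier is followed by a check for
  progress; a lower bound in binary could instead force exponentially many iterations that read
  nothing on a single branch.\<close>

text \<open>
  The registers \<open>R0\<close>, \dots, \<open>R4\<close> are stacks of bits, with the top of the stack under the head;
  \<open>RO\<close> is a write-only output. A Turing machine running a command has the residual commands as
  states, so its transition function \<open>residual\<close> does not depend on the command. A push takes two
  steps, hence the auxiliary command \<open>CWrite\<close>.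
\<close>

datatype reg = R0 | R1 | R2 | R3 | R4 | RO

datatype com =
    CSkip | CFail | CPush reg bool | CWrite reg bool | CPop reg | CEmit bool
  | CSeq com com (infixr ";;" 60) | CIf reg com com com | CWhile reg bool com

instance reg :: countable by countable_datatype
instance com :: countable by countable_datatype

type_synonym store = "reg \<Rightarrow> bool list"

text \<open>The number is the exact number of machine steps, and \<open>B\<close> bounds the length
  of a register. The extra \<open>1\<close> in the rule for sequences is the step that removes a
  finished \<open>CSkip\<close>. \<open>CFail\<close> and the auxiliary \<open>CWrite\<close> have
  no rules, because only terminating source commands are executed.\<close>

inductive exec :: "nat \<Rightarrow> com \<Rightarrow> store \<Rightarrow> nat \<Rightarrow> store \<Rightarrow> bool" for B where
  exec_Skip: "exec B CSkip s 0 s"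
| exec_Push: "r \<noteq> RO \<Longrightarrow> length (s r) < B \<Longrightarrow> exec B (CPush r b) s 2 (s(r := b # s r))"
| exec_Pop: "r \<noteq> RO \<Longrightarrow> s r = b # xs \<Longrightarrow> exec B (CPop r) s 1 (s(r := xs))"
| exec_Emit: "length (s RO) < B \<Longrightarrow> exec B (CEmit b) s 1 (s(RO := s RO @ [b]))"
| exec_Seq: "exec B c1 s n1 s1 \<Longrightarrow> exec B c2 s1 n2 s2 \<Longrightarrow> exec B (c1 ;; c2) s (n1 + 1 + n2) s2"
| exec_If_Nil: "r \<noteq> RO \<Longrightarrow> s r = [] \<Longrightarrow> exec B c0 s n s' \<Longrightarrow> exec B (CIf r c0 c1 c2) s (1 + n) s'"
| exec_If_False:
    "r \<noteq> RO \<Longrightarrow> s r = False # xs \<Longrightarrow> exec B c1 s n s' \<Longrightarrow> exec B (CIf r c0 c1 c2) s (1 + n) s'"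
| exec_If_True:
    "r \<noteq> RO \<Longrightarrow> s r = True # xs \<Longrightarrow> exec B c2 s n s' \<Longrightarrow> exec B (CIf r c0 c1 c2) s (1 + n) s'"
| exec_While_stop:
    "r \<noteq> RO \<Longrightarrow> s r = [] \<or> \<not> e \<and> s r = False # xs \<Longrightarrow> exec B (CWhile r e c) s 1 s"
| exec_While_loop:
    "r \<noteq> RO \<Longrightarrow> s r = b # xs \<Longrightarrow> b \<or> e \<Longrightarrow> exec B c s n1 s1 \<Longrightarrow> exec B (CWhile r e c) s1 n2 s2 \<Longrightarrow>
     exec B (CWhile r e c) s (1 + n1 + 1 + n2) s2"

definition store_size :: "store \<Rightarrow> nat" where
  "store_size s = length (s R0) + length (s R1) + length (s R2) + length (s R3) + length (s R4)
     + length (s RO)"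

lemma length_le_store_size: "length (s r) \<le> store_size s"
  by (cases r) (simp_all add: store_size_def)

lemma exec_store_size: "exec B c s n s' \<Longrightarrow> store_size s' \<le> store_size s + n"
proof (induction rule: exec.induct)
  case (exec_Push r s b)
  then show ?case by (cases r) (simp_all add: store_size_def)
next
  case (exec_Pop r s b xs)
  then show ?case by (cases r) (simp_all add: store_size_def)
next
  case (exec_Emit s b)
  then show ?case by (simp add: store_size_def)
qed (auto simp: store_size_def)

text \<open>A step adds at most one bit to the store, so the initial size plus the running time is
  always enough space. Hence \<open>B\<close> can be ignored wherever the time is bounded
  anyway.\<close>

lemma exec_space:
  "exec B c s n s' \<Longrightarrow> store_size s + n \<le> B' \<Longrightarrow> exec B' c s n s'"
proof (induction rule: exec.induct)
  case (exec_Push r s b)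
  have "length (s r) \<le> store_size s" by (rule length_le_store_size)
  with exec_Push show ?case by (intro exec.exec_Push) auto
next
  case (exec_Emit s b)
  have "length (s RO) \<le> store_size s" by (rule length_le_store_size)
  with exec_Emit show ?case by (intro exec.exec_Emit) auto
next
  case (exec_Seq c1 s n1 s1 c2 n2 s2)
  with exec_store_size[OF exec_Seq(1)] show ?case by (intro exec.exec_Seq) auto
next
  case (exec_While_loop r s b xs e c n1 s1 n2 s2)
  with exec_store_size[OF exec_While_loop(4)] show ?case
    by (intro exec.exec_While_loop) auto
qed (auto intro: exec.intros simp del: One_nat_def plus_1_eq_Suc)

definition no_op :: "(reg \<Rightarrow> symbol) \<Rightarrow> reg \<Rightarrow> symbol \<times> int" where
  "no_op f = (\<lambda>r. (f r, 0))"

text \<open>A tape action writes before it moves, whereas a push has to move to the free cell on the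
  left before it can write there. A pop erases the top and moves right, which one action can
  do.\<close>

fun residual :: "com \<Rightarrow> (reg \<Rightarrow> symbol) \<Rightarrow> com \<times> (reg \<Rightarrow> symbol \<times> int)" where
  "residual CSkip f = (CSkip, no_op f)"
| "residual CFail f = (CFail, no_op f)"
| "residual (CPush r b) f = (CWrite r b, (no_op f)(r := (f r, -1)))"
| "residual (CWrite r b) f = (CSkip, (no_op f)(r := (Bit b, 0)))"
| "residual (CPop r) f = (CSkip, (no_op f)(r := (Blank, 1)))"
| "residual (CEmit b) f = (CSkip, (no_op f)(RO := (Bit b, 1)))"
| "residual (CSeq c1 c2) f =
     (if c1 = CSkip then (c2, no_op f) else case residual c1 f of (c1', a) \<Rightarrow> (CSeq c1' c2, a))"
| "residual (CIf r c0 c1 c2) f =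
     (if f r = Bit True then c2 else if f r = Bit False then c1 else c0, no_op f)"
| "residual (CWhile r e c) f =
     (if f r = Bit True \<or> e \<and> f r = Bit False then c ;; CWhile r e c else CSkip, no_op f)"

text \<open>A finite set that contains the command and is closed under \<open>residual\<close>, to
  be used as the set of states.\<close>

primrec residuals :: "com \<Rightarrow> com set" where
  "residuals CSkip = {CSkip}"
| "residuals CFail = {CFail}"
| "residuals (CPush r b) = {CPush r b, CWrite r b, CSkip}"
| "residuals (CWrite r b) = {CWrite r b, CSkip}"
| "residuals (CPop r) = {CPop r, CSkip}"
| "residuals (CEmit b) = {CEmit b, CSkip}"
| "residuals (CSeq c1 c2) = (\<lambda>c. c ;; c2) ` residuals c1 \<union> residuals c2"
| "residuals (CIf r c0 c1 c2) = {CIf r c0 c1 c2} \<union> residuals c0 \<union> residuals c1 \<union> residuals c2"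
| "residuals (CWhile r e c) = {CWhile r e c, CSkip} \<union> (\<lambda>c'. c' ;; CWhile r e c) ` residuals c"

lemma finite_residuals: "finite (residuals c)"
  by (induction c) simp_all

lemma self_residuals: "c \<in> residuals c"
  by (induction c) simp_all

lemma residual_residuals: "c' \<in> residuals c \<Longrightarrow> fst (residual c' f) \<in> residuals c"
proof (induction c arbitrary: c')
  case (CSeq c1 c2)
  show ?case
  proof (cases "c' \<in> residuals c2")
    case False
    then obtain d where d: "d \<in> residuals c1" "c' = d ;; c2" using CSeq.prems by auto
    with CSeq.IH(1)[OF d(1)] show ?thesis by (auto simp: self_residuals split: prod.splits)
  qed (simp add: CSeq.IH)
next
  case (CWhile r e c)
  show ?case
  proof (cases "c' \<in> {CWhile r e c, CSkip}")
    case False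
    then obtain d where d: "d \<in> residuals c" "c' = d ;; CWhile r e c" using CWhile.prems by auto
    with CWhile.IH[OF d(1)] show ?thesis by (auto split: prod.splits)
  qed (auto simp: self_residuals)
qed (auto simp: self_residuals)

lemma snd_residual: "snd (snd (residual c f) r) \<in> {-1, 0, 1}"
  "fst (snd (residual c f) r) \<in> {f r, Blank, Bit False, Bit True}"
proof (induction c)
  case (CPush q b)
  { case 1 then show ?case by (auto simp: no_op_def) next
    case 2 then show ?case by (auto simp: no_op_def) }
next
  case (CWrite q b)
  { case 1 then show ?case by (auto simp: no_op_def) next
    case 2 then show ?case by (cases b) (auto simp: no_op_def) }
next
  case (CEmit b)
  { case 1 then show ?case by (auto simp: no_op_def) next
    case 2 then show ?case by (cases b) (auto simp: no_op_def) }
qed (auto simp: no_op_def split: prod.splits)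

section \<open>The Turing machine of a command\<close>

definition regs :: "reg list" where "regs = [R0, R1, R2, R3, R4, RO]"

fun reg_index :: "reg \<Rightarrow> nat" where
  "reg_index R0 = 0" | "reg_index R1 = 1" | "reg_index R2 = 2"
| "reg_index R3 = 3" | "reg_index R4 = 4" | "reg_index RO = 5"

lemma nth_map_regs [simp]: "map f regs ! reg_index r = f r"
  by (cases r) (simp_all add: regs_def)

definition machine :: "com \<Rightarrow> turing_machine" where
  "machine c = \<lparr>num_tapes = 6, states = to_nat ` (residuals c \<union> {CSkip, CFail}),
     alphabet = {Blank, Bit False, Bit True}, start_state = to_nat c,
     accept_state = to_nat CSkip, reject_state = to_nat CFail,
     transition = (\<lambda>q xs. case residual (from_nat q) (\<lambda>r. xs ! reg_index r) of
       (c', a) \<Rightarrow> (to_nat c', map a regs))\<rparr>"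

lemma halting_machine: "to_nat d \<in> halting_states (machine c) \<longleftrightarrow> d = CSkip \<or> d = CFail"
  by (auto simp: halting_states_def machine_def)

lemma machine_halting_states:
  "accept_state (machine c) = to_nat CSkip" "reject_state (machine c) = to_nat CFail"
  by (simp_all add: machine_def)

lemma well_formed_machine: "well_formed_tm (machine c)"
proof -
  let ?A = "{Blank, Bit False, Bit True}"
  have "case transition (machine c) q xs of (q', acts) \<Rightarrow>
           q' \<in> states (machine c) \<and> length acts = 6 \<and> set acts \<subseteq> ?A \<times> {-1, 0, 1}"
    if "q \<in> states (machine c)" "xs \<in> lists ?A" "length xs = 6" for q xs
  proof -
    from that(1) obtain d where d: "d \<in> residuals c \<union> {CSkip, CFail}" and q: "q = to_nat d"
      by (auto simp: machine_def)
    let ?f = "\<lambda>r. xs ! reg_index r"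
    have "reg_index r < 6" for r by (cases r) simp_all
    then have f: "?f r \<in> ?A" for r using that(2,3) by (metis in_listsD nth_mem)
    have "snd (residual d ?f) r \<in> ?A \<times> {-1, 0, 1}" for r
      using snd_residual[where c = d and f = ?f and r = r] f[of r]
      by (cases "snd (residual d ?f) r") auto
    moreover have "fst (residual d ?f) \<in> residuals c \<union> {CSkip, CFail}"
      using d residual_residuals by auto
    moreover obtain d' a where "residual d ?f = (d', a)" by force
    ultimately have "d' \<in> residuals c \<union> {CSkip, CFail}" "a r \<in> ?A \<times> {-1, 0, 1}"
      and "transition (machine c) q xs = (to_nat d', map a regs)" for r
      by (simp_all add: machine_def q)
    then show ?thesis by (auto simp del: insert_iff simp: machine_def regs_def)
  qed
  then show ?thesis
    by (auto simp: well_formed_tm_def self_residuals finite_residuals machine_def)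
qed

text \<open>Stacks grow to the left from a fixed bottom at cell \<open>m\<close>. For
  \<open>R0\<close> the bottom is at \<open>n\<close>, the length of the input, because the input is
  initially written on the cells from \<open>0\<close> on and has to be a stack with its top at
  \<open>0\<close>. The output tape grows to the right.\<close>

definition reg_tape :: "nat \<Rightarrow> reg \<Rightarrow> bool list \<Rightarrow> tape" where
  "reg_tape n r xs =
     (if r = RO then (word_contents xs, int (length xs))
      else let m = (if r = R0 then int n else 0); h = m - int (length xs)
           in (\<lambda>i. if h \<le> i \<and> i < m then Bit (xs ! nat (i - h)) else Blank, h))"

definition scanned :: "tape \<Rightarrow> symbol" where
  "scanned t = fst t (snd t)"

lemma scanned_reg_tape:
  "r \<noteq> RO \<Longrightarrow> scanned (reg_tape n r xs) = (case xs of [] \<Rightarrow> Blank | b # _ \<Rightarrow> Bit b)"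
  by (auto simp: scanned_def reg_tape_def Let_def split: list.splits)

lemma reg_tape_Cons:
  assumes "r \<noteq> RO"
  shows "reg_tape n r (b # xs) = ((fst (reg_tape n r xs))(snd (reg_tape n r xs) - 1 := Bit b),
    snd (reg_tape n r xs) - 1)"
proof -
  define m where "m = (if r = R0 then int n else 0)"
  have nth: "(b # xs) ! nat (i - (m - (1 + int (length xs)))) =
      (if i = m - (1 + int (length xs)) then b else xs ! nat (i - (m - int (length xs))))"
    if "m - (1 + int (length xs)) \<le> i" for i
  proof (cases "i = m - (1 + int (length xs))")
    case False
    then have "nat (i - (m - (1 + int (length xs)))) = Suc (nat (i - (m - int (length xs))))"
      using that by linarith
    with False show ?thesis by simp
  qed simp
  show ?thesis using assms
    by (auto simp: reg_tape_def m_def[symmetric] Let_def fun_eq_iff nth simp del: nth_Cons_pos nth_Cons_numeral)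
qed

lemma push_reg_tape:
  "r \<noteq> RO \<Longrightarrow> tape_action (tape_action (reg_tape n r xs) (scanned (reg_tape n r xs), -1)) (Bit b, 0) =
    reg_tape n r (b # xs)"
  by (cases "reg_tape n r xs") (simp add: reg_tape_Cons scanned_def)

lemma pop_reg_tape:
  "r \<noteq> RO \<Longrightarrow> tape_action (reg_tape n r (b # xs)) (Blank, 1) = reg_tape n r xs"
  by (simp add: reg_tape_Cons) (auto simp: reg_tape_def Let_def)

lemma emit_reg_tape:
  "tape_action (reg_tape n RO xs) (Bit b, 1) = reg_tape n RO (xs @ [b])"
  by (auto simp: reg_tape_def word_contents_def fun_eq_iff nth_append nat_less_iff)

lemma tape_action_scanned: "tape_action t (scanned t, 0) = t"
  by (cases t) (simp add: scanned_def)

definition ustep :: "com \<times> (reg \<Rightarrow> tape) \<Rightarrow> com \<times> (reg \<Rightarrow> tape)" where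
  "ustep = (\<lambda>(c, T). case residual c (\<lambda>r. scanned (T r)) of
     (c', a) \<Rightarrow> (c', \<lambda>r. tape_action (T r) (a r)))"

definition heads_within :: "nat \<Rightarrow> (reg \<Rightarrow> tape) \<Rightarrow> bool" where
  "heads_within b T \<longleftrightarrow> (\<forall>r. \<bar>snd (T r)\<bar> \<le> int b)"

inductive path :: "nat \<Rightarrow> com \<times> (reg \<Rightarrow> tape) \<Rightarrow> nat \<Rightarrow> com \<times> (reg \<Rightarrow> tape) \<Rightarrow> bool" for b where
  path_refl: "heads_within b T \<Longrightarrow> path b (c, T) 0 (c, T)"
| path_step: "c \<noteq> CSkip \<Longrightarrow> c \<noteq> CFail \<Longrightarrow> heads_within b T \<Longrightarrow> path b (ustep (c, T)) n X \<Longrightarrow>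
    path b (c, T) (Suc n) X"

lemma path_trans: "path b X n Y \<Longrightarrow> path b Y m Z \<Longrightarrow> path b X (n + m) Z"
  by (induction rule: path.induct) (auto intro: path.intros)

lemma path_Seq: "path b X n Y \<Longrightarrow> path b (fst X ;; d, snd X) n (fst Y ;; d, snd Y)"
proof (induction rule: path.induct)
  case (path_step c T n X)
  have "ustep (c ;; d, T) = (fst (ustep (c, T)) ;; d, snd (ustep (c, T)))"
    using path_step(1) by (simp add: ustep_def split: prod.splits)
  with path_step show ?case by (auto intro: path.path_step)
qed (simp add: path_refl)

lemma path_one:
  assumes "ustep (c, T) = (c', T')" "c \<noteq> CSkip" "c \<noteq> CFail" "heads_within b T" "heads_within b T'"
  shows "path b (c, T) 1 (c', T')"
  using assms path_step[of c b T 0 "(c', T')"] by (simp add: path_refl)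

lemma ustep_noop:
  "residual c (\<lambda>r. scanned (T r)) = (c', no_op (\<lambda>r. scanned (T r))) \<Longrightarrow> ustep (c, T) = (c', T)"
  by (simp add: ustep_def no_op_def tape_action_scanned)

abbreviation tapes_of :: "nat \<Rightarrow> store \<Rightarrow> reg \<Rightarrow> tape" where
  "tapes_of n s \<equiv> \<lambda>r. reg_tape n r (s r)"

lemma heads_within_tapes_of:
  assumes "\<And>r. length (s r) \<le> B"
  shows "heads_within (B + n) (tapes_of n s)"
proof -
  have "\<bar>snd (reg_tape n r (s r))\<bar> \<le> int (B + n)" for r
    using assms[of r] by (auto simp: reg_tape_def Let_def)
  then show ?thesis by (simp add: heads_within_def)
qed

lemma ustep_single:
  assumes "residual c (\<lambda>r. scanned (T r)) = (c', (no_op (\<lambda>r. scanned (T r)))(r := a))"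
  shows "ustep (c, T) = (c', T(r := tape_action (T r) a))"
  using assms by (auto simp: ustep_def no_op_def tape_action_scanned)

lemma tapes_of_upd: "(tapes_of n s)(r := reg_tape n r xs) = tapes_of n (s(r := xs))"
  by auto

text \<open>The distance \<open>B + n\<close> accounts for \<open>R0\<close>, whose bottom is at
  cell \<open>n\<close>. The bound on the register lengths is part of the induction, since it is
  what keeps the heads in range after each subcommand.\<close>

lemma exec_path:
  assumes "exec B c s m s'" "\<And>r. length (s r) \<le> B"
  shows "path (B + n) (c, tapes_of n s) m (CSkip, tapes_of n s') \<and> (\<forall>r. length (s' r) \<le> B)"
  using assms
proof (induction rule: exec.induct)
  case (exec_Skip s)
  then show ?case by (simp add: path_refl heads_within_tapes_of)
next
  case (exec_Push r s b)
  let ?T = "tapes_of n s"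
  let ?T1 = "?T(r := tape_action (?T r) (scanned (?T r), -1))"
  have hb: "heads_within (B + n) ?T" by (rule heads_within_tapes_of) (rule exec_Push)
  have "\<bar>snd (?T1 r)\<bar> \<le> int (B + n)"
    using exec_Push(1,2) by (auto simp: reg_tape_def Let_def)
  with hb have hb1: "heads_within (B + n) ?T1" by (auto simp: heads_within_def)
  have len: "length ((s(r := b # s r)) q) \<le> B" for q using exec_Push by simp
  have s1: "ustep (CPush r b, ?T) = (CWrite r b, ?T1)" by (rule ustep_single) simp
  have "ustep (CWrite r b, ?T1) = (CSkip, ?T1(r := tape_action (?T1 r) (Bit b, 0)))"
    by (rule ustep_single) simp
  also have "?T1(r := tape_action (?T1 r) (Bit b, 0)) = ?T(r := reg_tape n r (b # s r))"
    using push_reg_tape[OF exec_Push(1)] by simp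
  also have "\<dots> = tapes_of n (s(r := b # s r))" by (rule tapes_of_upd)
  finally have s2: "ustep (CWrite r b, ?T1) = (CSkip, tapes_of n (s(r := b # s r)))" .
  have "path (B + n) (CPush r b, ?T) (1 + 1) (CSkip, tapes_of n (s(r := b # s r)))"
    using path_trans[OF path_one[OF s1 _ _ hb hb1] path_one[OF s2 _ _ hb1 heads_within_tapes_of]] len
    by simp
  with len show ?case by (simp add: numeral_2_eq_2)
next
  case (exec_Pop r s b xs)
  let ?T = "tapes_of n s"
  have len: "length ((s(r := xs)) q) \<le> B" for q
    using exec_Pop(3)[of q] exec_Pop(2) by (auto split: if_splits)
  have "ustep (CPop r, ?T) = (CSkip, ?T(r := tape_action (?T r) (Blank, 1)))"
    by (rule ustep_single) simp
  also have "?T(r := tape_action (?T r) (Blank, 1)) = tapes_of n (s(r := xs))"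
    using pop_reg_tape[OF exec_Pop(1)] exec_Pop(2) by (simp add: tapes_of_upd)
  finally show ?case
    using len exec_Pop(3) by (intro conjI path_one heads_within_tapes_of) auto
next
  case (exec_Emit s b)
  let ?T = "tapes_of n s"
  have len: "length ((s(RO := s RO @ [b])) q) \<le> B" for q using exec_Emit by simp
  have "ustep (CEmit b, ?T) = (CSkip, ?T(RO := tape_action (?T RO) (Bit b, 1)))"
    by (rule ustep_single) simp
  also have "?T(RO := tape_action (?T RO) (Bit b, 1)) = tapes_of n (s(RO := s RO @ [b]))"
    by (simp add: emit_reg_tape tapes_of_upd)
  finally show ?case
    using len exec_Emit(2) by (intro conjI path_one heads_within_tapes_of) auto
next
  case (exec_Seq c1 s n1 s1 c2 n2 s2)
  then have 1: "path (B + n) (c1, tapes_of n s) n1 (CSkip, tapes_of n s1)"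
    and len: "\<And>r. length (s1 r) \<le> B" by auto
  have 2: "path (B + n) (CSkip ;; c2, tapes_of n s1) 1 (c2, tapes_of n s1)"
    using len by (intro path_one ustep_noop heads_within_tapes_of) auto
  from exec_Seq.IH(2)[OF len] path_trans[OF path_trans[OF path_Seq[OF 1, of c2, simplified] 2]] show ?case
    by simp
next
  case (exec_If_Nil r s c0 m s' c1 c2)
  have "path (B + n) (CIf r c0 c1 c2, tapes_of n s) 1 (c0, tapes_of n s)"
    using exec_If_Nil by (intro path_one ustep_noop heads_within_tapes_of) (auto simp: scanned_reg_tape)
  with exec_If_Nil show ?case using path_trans by blast
next
  case (exec_If_False r s xs c1 m s' c0 c2)
  have "path (B + n) (CIf r c0 c1 c2, tapes_of n s) 1 (c1, tapes_of n s)"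
    using exec_If_False by (intro path_one ustep_noop heads_within_tapes_of) (auto simp: scanned_reg_tape)
  with exec_If_False show ?case using path_trans by blast
next
  case (exec_If_True r s xs c2 m s' c0 c1)
  have "path (B + n) (CIf r c0 c1 c2, tapes_of n s) 1 (c2, tapes_of n s)"
    using exec_If_True by (intro path_one ustep_noop heads_within_tapes_of) (auto simp: scanned_reg_tape)
  with exec_If_True show ?case using path_trans by blast
next
  case (exec_While_stop r s e xs c)
  have "path (B + n) (CWhile r e c, tapes_of n s) 1 (CSkip, tapes_of n s)"
    using exec_While_stop
    by (intro path_one ustep_noop heads_within_tapes_of) (auto simp: scanned_reg_tape)
  with exec_While_stop show ?case by blast
next
  case (exec_While_loop r s b xs e c n1 s1 n2 s2)
  let ?W = "CWhile r e c"
  have 0: "path (B + n) (?W, tapes_of n s) 1 (c ;; ?W, tapes_of n s)"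
    using exec_While_loop
    by (intro path_one ustep_noop heads_within_tapes_of) (auto simp: scanned_reg_tape)
  from exec_While_loop have 1: "path (B + n) (c, tapes_of n s) n1 (CSkip, tapes_of n s1)"
    and len: "\<And>r. length (s1 r) \<le> B" by auto
  have 2: "path (B + n) (CSkip ;; ?W, tapes_of n s1) 1 (?W, tapes_of n s1)"
    using len by (intro path_one ustep_noop heads_within_tapes_of) auto
  from exec_While_loop.IH(2)[OF len]
    path_trans[OF path_trans[OF path_trans[OF 0 path_Seq[OF 1, of ?W, simplified]] 2]]
  show ?case by simp
qed

lemma tm_step_machine:
  assumes "ustep (c, T) = (c', T')" "c \<noteq> CSkip" "c \<noteq> CFail"
  shows "tm_step (machine d) (to_nat c, map T regs) = (to_nat c', map T' regs)"
proof -
  have sc: "(\<lambda>(c, h). c h) = scanned" by (auto simp: scanned_def)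
  have "map2 tape_action (map T regs) (map a regs) = map (\<lambda>r. tape_action (T r) (a r)) regs" for a
    by (simp add: regs_def)
  with assms show ?thesis
    by (simp add: halting_machine)
      (auto simp: machine_def ustep_def sc comp_def split: prod.splits)
qed

lemma path_machine:
  assumes "path b (c, T) m (c', T')"
  shows "(tm_step (machine d) ^^ m) (to_nat c, map T regs) = (to_nat c', map T' regs) \<and>
    (\<forall>t\<le>m. \<forall>(c, h) \<in> set (snd ((tm_step (machine d) ^^ t) (to_nat c, map T regs))). \<bar>h\<bar> \<le> int b)"
  using assms
proof (induction "(c, T)" m "(c', T')" arbitrary: c T rule: path.induct)
  case path_refl
  then show ?case by (auto simp: heads_within_def) (metis snd_conv)
next
  case (path_step c T n)
  obtain c1 T1 where u: "ustep (c, T) = (c1, T1)" by force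
  note s = tm_step_machine[OF u path_step(1,2), of d]
  have "\<forall>(c, h)\<in>set (snd ((tm_step (machine d) ^^ t) (to_nat c, map T regs))). \<bar>h\<bar> \<le> int b"
    if "t \<le> Suc n" for t
  proof (cases t)
    case 0
    with path_step(3) show ?thesis by (auto simp: heads_within_def) (metis snd_conv)
  next
    case (Suc t')
    with that path_step(5)[OF u] s show ?thesis by (simp add: funpow_Suc_right del: funpow.simps)
  qed
  with path_step(5)[OF u] s show ?case by (simp add: funpow_Suc_right del: funpow.simps)
qed

definition input_store :: "bool list \<Rightarrow> store" where
  "input_store w = (\<lambda>r. [])(R0 := w)"

lemma initial_config_machine:
  "initial_config (machine c) w = (to_nat c, map (tapes_of (length w) (input_store w)) regs)"
  by (auto simp: initial_config_def machine_def regs_def input_store_def reg_tape_def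
      word_contents_def numeral_eq_Suc fun_eq_iff)

lemma exec_tm_run:
  assumes "exec B c (input_store w) m s" "length w \<le> B"
  shows "tm_run (machine c) w m = (to_nat CSkip, map (tapes_of (length w) s) regs)"
proof -
  have "length (input_store w r) \<le> B" for r using assms(2) by (simp add: input_store_def)
  from path_machine[OF conjunct1[OF exec_path[OF assms(1) this, of "length w"]], of c]
  show ?thesis by (simp add: tm_run_def initial_config_machine)
qed

lemma polytime_computableI:
  assumes "\<And>w. \<exists>B m s. exec B c (input_store w) m s \<and> m \<le> poly p (length w) \<and> s RO = f w"
  shows "polytime_computable f"
proof -
  have "computes_in_time (machine c) w (f w) (poly p (length w))" for w
  proof -
    from assms[of w] obtain B m s where e: "exec B c (input_store w) m s"
      and m: "m \<le> poly p (length w)" and s: "s RO = f w" by blast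
    have "exec (store_size (input_store w) + m) c (input_store w) m s"
      by (rule exec_space[OF e]) simp
    from exec_tm_run[OF this] have "tm_run (machine c) w m =
        (to_nat CSkip, map (tapes_of (length w) s) regs)"
      by (simp add: store_size_def input_store_def)
    with m s show ?thesis
      by (auto simp: computes_in_time_def machine_def regs_def reg_tape_def intro!: exI[of _ m])
  qed
  then show ?thesis using well_formed_machine unfolding polytime_computable_def by blast
qed

lemma tm_step_halted: "fst X \<in> halting_states M \<Longrightarrow> (tm_step M ^^ t) X = X"
  by (induction t) (cases X; simp)+

text \<open>The answer is the top bit of \<open>R0\<close>; the appended conditional turns it into
  the accepting command \<open>CSkip\<close> or the rejecting command \<open>CFail\<close>. Only
  space is bounded, so \<open>m\<close> may be exponential.\<close>

lemma PSPACE_I: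
  assumes "\<And>w. length w \<le> poly p (length w) \<and>
    (\<exists>m s xs. exec (poly p (length w)) c (input_store w) m s \<and> s R0 = (w \<in> L) # xs)"
  shows "L \<in> PSPACE"
proof -
  let ?d = "c ;; CIf R0 CFail CFail CSkip"
  let ?M = "machine ?d"
  let ?q = "\<lambda>w. if w \<in> L then CSkip else CFail"
  have main: "halts_in ?M w (to_nat (?q w)) \<and> runs_in_space ?M w (poly p (length w) + length w)" for w
  proof -
    let ?B = "poly p (length w)"
    let ?b = "?B + length w"
    let ?T = "tapes_of (length w)"
    from assms[of w] obtain m s xs where e: "exec ?B c (input_store w) m s"
      and s: "s R0 = (w \<in> L) # xs" and "length w \<le> ?B" by blast
    then have ln: "length (input_store w r) \<le> ?B" for r by (simp add: input_store_def)
    note ep = exec_path[OF e ln, of "length w"]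
    then have hb: "heads_within ?b (?T s)" by (intro heads_within_tapes_of) blast
    have "path ?b (?d, ?T (input_store w)) m (CSkip ;; CIf R0 CFail CFail CSkip, ?T s)"
      using path_Seq[OF conjunct1[OF ep]] by simp
    moreover have "path ?b (CSkip ;; CIf R0 CFail CFail CSkip, ?T s) 1 (CIf R0 CFail CFail CSkip, ?T s)"
      using hb by (intro path_one ustep_noop) auto
    moreover have "path ?b (CIf R0 CFail CFail CSkip, ?T s) 1 (?q w, ?T s)"
      using hb s by (intro path_one ustep_noop) (auto simp: scanned_reg_tape)
    ultimately obtain k where "path ?b (?d, ?T (input_store w)) k (?q w, ?T s)"
      by (blast intro: path_trans)
    from path_machine[OF this, of ?d]
    have run: "tm_run ?M w k = (to_nat (?q w), map (?T s) regs)"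
      and sp: "\<forall>t\<le>k. \<forall>(c, h)\<in>set (snd (tm_run ?M w t)). \<bar>h\<bar> \<le> int ?b"
      by (simp_all add: tm_run_def initial_config_machine)
    have halt: "to_nat (?q w) \<in> halting_states ?M" by (simp add: halting_machine)
    \<comment> \<open>The space bound is demanded at all times, also after halting, where the
      configuration no longer changes.\<close>
    have late: "tm_run ?M w t = tm_run ?M w k" if "t > k" for t
    proof -
      define u where "u = t - k"
      then have "t = u + k" using that by simp
      then have "tm_run ?M w t = (tm_step ?M ^^ u) (tm_run ?M w k)"
        by (simp only: tm_run_def funpow_add comp_apply)
      also have "\<dots> = tm_run ?M w k" using run halt by (intro tm_step_halted) simp
      finally show ?thesis .
    qed
    have "\<forall>(c, h)\<in>set (snd (tm_run ?M w t)). \<bar>h\<bar> \<le> int ?b" for t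
    proof (cases "t \<le> k")
      case True
      with sp show ?thesis by blast
    next
      case False
      then have "tm_run ?M w t = tm_run ?M w k" by (intro late) simp
      with sp[rule_format, OF order_refl] show ?thesis by simp
    qed
    then have "runs_in_space ?M w ?b" unfolding runs_in_space_def by blast
    moreover have "halts_in ?M w (to_nat (?q w))"
      using run halt unfolding halts_in_def by (metis fst_conv)
    ultimately show ?thesis by blast
  qed
  have "decides ?M L"
    unfolding decides_def
  proof
    fix w
    show "halts_in ?M w (if w \<in> L then accept_state ?M else reject_state ?M)"
      using main[of w] by (cases "w \<in> L") (simp_all add: machine_halting_states)
  qed
  moreover have "runs_in_space ?M w (poly (p + [:0, 1:]) (length w))" for w
    using main[of w] by simp
  ultimately show ?thesis using well_formed_machine unfolding PSPACE_def by blast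
qed

section \<open>Polynomial-time functions on binary trees\<close>

lemma poly_nat_mono: "m \<le> n \<Longrightarrow> poly (p :: nat poly) m \<le> poly p n"
  by (induction p) (simp_all add: add_mono mult_mono)

text \<open>Closed under the arithmetic operations; so running times can be stated as plain terms
  without exhibiting a polynomial for each.\<close>

definition poly_bounded :: "(nat \<Rightarrow> nat) \<Rightarrow> bool" where
  "poly_bounded f \<longleftrightarrow> (\<exists>p :: nat poly. \<forall>n. f n \<le> poly p n)"

lemma poly_bounded_const: "poly_bounded (\<lambda>n. k)"
  unfolding poly_bounded_def by (rule exI[of _ "[:k:]"]) simp

lemma poly_bounded_id: "poly_bounded (\<lambda>n. n)"
  unfolding poly_bounded_def by (rule exI[of _ "[:0, 1:]"]) simp

lemma poly_bounded_add: "poly_bounded f \<Longrightarrow> poly_bounded g \<Longrightarrow> poly_bounded (\<lambda>n. f n + g n)"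
  unfolding poly_bounded_def by (metis add_mono poly_add)

lemma poly_bounded_mult: "poly_bounded f \<Longrightarrow> poly_bounded g \<Longrightarrow> poly_bounded (\<lambda>n. f n * g n)"
  unfolding poly_bounded_def by (metis mult_le_mono poly_mult)

lemma poly_bounded_poly: "poly_bounded f \<Longrightarrow> poly_bounded (\<lambda>n. poly p (f n))"
  unfolding poly_bounded_def by (metis poly_nat_mono poly_pcompose)

lemma poly_bounded_power: "poly_bounded f \<Longrightarrow> poly_bounded (\<lambda>n. f n ^ k)"
  by (induction k) (simp_all add: poly_bounded_const poly_bounded_mult)

lemma poly_bounded_Suc: "poly_bounded f \<Longrightarrow> poly_bounded (\<lambda>n. Suc (f n))"
  using poly_bounded_add[OF _ poly_bounded_const, of f 1] by simp

lemmas poly_bounded_intros = poly_bounded_const poly_bounded_id poly_bounded_add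
  poly_bounded_mult poly_bounded_poly poly_bounded_power poly_bounded_Suc

text \<open>An upper bound on the time with the space left open; \<open>runs_exec\<close> recovers
  the space from the time.\<close>

definition runs :: "nat \<Rightarrow> com \<Rightarrow> store \<Rightarrow> store \<Rightarrow> bool" where
  "runs n c s s' \<longleftrightarrow> (\<exists>B m. m \<le> n \<and> exec B c s m s')"

lemma runs_cong: "runs n c s s1 \<Longrightarrow> s1 = s2 \<Longrightarrow> n \<le> m \<Longrightarrow> runs m c s s2"
  unfolding runs_def using order.trans by blast

lemma runs_store_size: "runs n c s s' \<Longrightarrow> store_size s' \<le> store_size s + n"
  unfolding runs_def using exec_store_size by fastforce

lemma runs_exec: "runs n c s s' \<Longrightarrow> store_size s + n \<le> B \<Longrightarrow> \<exists>m\<le>n. exec B c s m s'"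
  unfolding runs_def using exec_space by (metis add_mono le_trans order_refl)

lemma runs_Seq:
  assumes "runs n1 c1 s s1" "runs n2 c2 s1 s2"
  shows "runs (n1 + 1 + n2) (c1 ;; c2) s s2"
proof -
  from assms obtain B1 m1 B2 m2 where m: "m1 \<le> n1" "m2 \<le> n2"
    and e: "exec B1 c1 s m1 s1" "exec B2 c2 s1 m2 s2" by (auto simp: runs_def)
  let ?B = "store_size s + m1 + store_size s1 + m2"
  have "exec ?B c1 s m1 s1" by (rule exec_space[OF e(1)]) simp
  moreover have "exec ?B c2 s1 m2 s2" by (rule exec_space[OF e(2)]) simp
  ultimately have "exec ?B (c1 ;; c2) s (m1 + 1 + m2) s2" by (rule exec_Seq)
  moreover have "m1 + 1 + m2 \<le> n1 + 1 + n2" using m by simp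
  ultimately show ?thesis unfolding runs_def by blast
qed

lemma runs_Skip: "runs 0 CSkip s s"
  unfolding runs_def by (blast intro: exec_Skip)

lemma runs_Push: "r \<noteq> RO \<Longrightarrow> runs 2 (CPush r b) s (s(r := b # s r))"
  unfolding runs_def by (blast intro: exec_Push[of _ _ "Suc (length (s r))"])

lemma runs_Pop: "r \<noteq> RO \<Longrightarrow> s r \<noteq> [] \<Longrightarrow> runs 1 (CPop r) s (s(r := tl (s r)))"
  unfolding runs_def by (metis exec_Pop list.exhaust_sel order_refl)

lemma runs_Emit: "runs 1 (CEmit b) s (s(RO := s RO @ [b]))"
  unfolding runs_def by (blast intro: exec_Emit[of _ "Suc (length (s RO))"])

lemma runs_If_False:
  "r \<noteq> RO \<Longrightarrow> s r = False # xs \<Longrightarrow> runs n c1 s s' \<Longrightarrow> runs (1 + n) (CIf r c0 c1 c2) s s'"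
  unfolding runs_def by (meson add_le_mono exec_If_False order_refl)

lemma runs_If_True:
  "r \<noteq> RO \<Longrightarrow> s r = True # xs \<Longrightarrow> runs n c2 s s' \<Longrightarrow> runs (1 + n) (CIf r c0 c1 c2) s s'"
  unfolding runs_def by (meson add_le_mono exec_If_True order_refl)

lemma runs_While_stop:
  "r \<noteq> RO \<Longrightarrow> s r = [] \<or> \<not> e \<and> s r = False # xs \<Longrightarrow> runs 1 (CWhile r e c) s s"
  unfolding runs_def by (blast intro: exec_While_stop)

lemma runs_While_loop:
  assumes "r \<noteq> RO" "s r = b # xs" "b \<or> e" "runs n1 c s s1" "runs n2 (CWhile r e c) s1 s2"
  shows "runs (1 + n1 + 1 + n2) (CWhile r e c) s s2"
proof -
  from assms obtain B1 m1 B2 m2 where m: "m1 \<le> n1" "m2 \<le> n2"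
    and e: "exec B1 c s m1 s1" "exec B2 (CWhile r e c) s1 m2 s2" by (auto simp: runs_def)
  let ?B = "store_size s + m1 + store_size s1 + m2"
  have "exec ?B c s m1 s1" by (rule exec_space[OF e(1)]) simp
  moreover have "exec ?B (CWhile r e c) s1 m2 s2" by (rule exec_space[OF e(2)]) simp
  ultimately have "exec ?B (CWhile r e c) s (1 + m1 + 1 + m2) s2"
    using assms(1-3) by (blast intro: exec_While_loop)
  moreover have "1 + m1 + 1 + m2 \<le> 1 + n1 + 1 + n2" using m by simp
  ultimately show ?thesis unfolding runs_def by blast
qed

section \<open>Binary trees as bit strings on stacks\<close>

datatype tree = Leaf | Node tree tree

text \<open>A prefix code: \<open>True\<close> opens two further trees and \<open>False\<close>
  closes one, so a counter of the trees still expected finds the end of a code inside of a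
  stack.\<close>

primrec enc :: "tree \<Rightarrow> bool list" where
  "enc Leaf = [False]"
| "enc (Node a b) = True # enc a @ enc b"

abbreviation tsize :: "tree \<Rightarrow> nat" where "tsize t \<equiv> length (enc t)"

primrec car :: "tree \<Rightarrow> tree" where "car Leaf = Leaf" | "car (Node a b) = a"

primrec cdr :: "tree \<Rightarrow> tree" where "cdr Leaf = Leaf" | "cdr (Node a b) = b"

text \<open>
  Moves the topmost tree on \<open>r\<close>, reversed, to \<open>R1\<close>. The number of trees still to be read is kept in
  unary on \<open>R2\<close>, and the number of bits moved on \<open>R3\<close>.
\<close>

definition grab_body :: "reg \<Rightarrow> com" where
  "grab_body r = CPush R3 True ;; CIf r CSkip (CPop r ;; CPush R1 False ;; CPop R2)
     (CPop r ;; CPush R1 True ;; CPush R2 True)"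

text \<open>The bits \<open>False\<close> are sentinels below the unary counters; they stop the
  loops and protect whatever the stacks hold underneath. The one on \<open>R3\<close> remains for
  the loop that moves the tree back.\<close>

definition grab :: "reg \<Rightarrow> com" where
  "grab r = CPush R2 False ;; CPush R2 True ;; CPush R3 False ;; CWhile R2 False (grab_body r) ;; CPop R2"

lemma runs_grab_body:
  assumes "r = R0 \<or> r = R4" "s r = b # xs" "s R2 = True # zs"
  shows "runs 15 (grab_body r) s
    (s(r := xs, R1 := b # s R1, R2 := (if b then True # True # zs else zs), R3 := True # s R3))"
proof -
  have r: "r \<noteq> RO" "r \<noteq> R1" "r \<noteq> R2" "r \<noteq> R3" using assms(1) by auto
  show ?thesis
  proof (cases b)
    case True
    show ?thesis unfolding grab_body_def
      by (rule runs_cong, rule runs_Seq, rule runs_Push, simp, rule runs_If_True[where xs = xs],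
          rule r, use r True assms in simp,
          rule runs_Seq, rule runs_Pop, rule r, use r assms in simp, rule runs_Seq, rule runs_Push, simp,
          rule runs_Push, simp) (use r True assms in \<open>auto simp: fun_eq_iff\<close>)
  next
    case False
    show ?thesis unfolding grab_body_def
      by (rule runs_cong, rule runs_Seq, rule runs_Push, simp, rule runs_If_False[where xs = xs],
          rule r, use r False assms in simp,
          rule runs_Seq, rule runs_Pop, rule r, use r assms in simp, rule runs_Seq, rule runs_Push, simp,
          rule runs_Pop, simp, use r assms in simp) (use r False assms in \<open>auto simp: fun_eq_iff\<close>)
  qed
qed

lemma runs_grab_loop:
  assumes "r = R0 \<or> r = R4"
    and "s r = concat (map enc ts) @ xs" "s R2 = replicate (length ts) True @ False # zs"
  shows "runs (20 * length (concat (map enc ts)) + 1) (CWhile R2 False (grab_body r)) s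
    (s(r := xs, R1 := rev (concat (map enc ts)) @ s R1, R2 := False # zs,
       R3 := replicate (length (concat (map enc ts))) True @ s R3))"
  using assms(2,3)
proof (induction "length (concat (map enc ts))" arbitrary: ts s rule: less_induct)
  case less
  have r: "r \<noteq> RO" "r \<noteq> R1" "r \<noteq> R2" "r \<noteq> R3" using assms(1) by auto
  show ?case
  proof (cases ts)
    case Nil
    with less.prems show ?thesis
      by (intro runs_cong[OF runs_While_stop[where xs = zs]]) (auto simp: fun_eq_iff)
  next
    case (Cons t us)
    define b ts' where "b = (t \<noteq> Leaf)" and "ts' = (case t of Leaf \<Rightarrow> us | Node p q \<Rightarrow> p # q # us)"
    have enc_ts: "concat (map enc ts) = b # concat (map enc ts')"
      by (cases t) (simp_all add: Cons b_def ts'_def)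
    have len: "replicate (length ts) True = True # replicate (length us) True" by (simp add: Cons)
    have rep: "(if b then True # True # replicate (length us) True @ False # zs
        else replicate (length us) True @ False # zs) = replicate (length ts') True @ False # zs"
      by (cases t) (simp_all add: b_def ts'_def)
    let ?s1 = "s(r := concat (map enc ts') @ xs, R1 := b # s R1,
      R2 := replicate (length ts') True @ False # zs, R3 := True # s R3)"
    have 1: "runs 15 (grab_body r) s ?s1"
      unfolding rep[symmetric] using less.prems
      by (intro runs_grab_body[OF assms(1)]) (simp_all add: enc_ts len)
    have 2: "runs (20 * length (concat (map enc ts')) + 1) (CWhile R2 False (grab_body r)) ?s1
      (?s1(r := xs, R1 := rev (concat (map enc ts')) @ ?s1 R1, R2 := False # zs,
       R3 := replicate (length (concat (map enc ts'))) True @ ?s1 R3))"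
      by (rule less.hyps) (use r in \<open>simp_all add: enc_ts\<close>)
    show ?thesis
    proof (rule runs_cong[OF runs_While_loop[OF _ _ _ 1 2]])
      show "s R2 = True # (replicate (length us) True @ False # zs)" using less.prems len by simp
    qed (use r in \<open>auto simp: enc_ts fun_eq_iff replicate_append_same[symmetric]\<close>)
  qed
qed

lemma runs_grab:
  assumes "r = R0 \<or> r = R4" "s r = enc t @ xs"
  shows "runs (20 * tsize t + 12) (grab r) s
    (s(r := xs, R1 := rev (enc t) @ s R1, R3 := replicate (tsize t) True @ False # s R3))"
proof -
  have r: "r \<noteq> RO" "r \<noteq> R1" "r \<noteq> R2" "r \<noteq> R3" using assms(1) by auto
  show ?thesis unfolding grab_def
    by (rule runs_cong, rule runs_Seq, rule runs_Push, simp, rule runs_Seq, rule runs_Push, simp,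
        rule runs_Seq, rule runs_Push, simp, rule runs_Seq,
        rule runs_grab_loop[where ts = "[t]" and xs = xs, OF assms(1)],
        use r assms in simp, use r assms in simp, rule runs_Pop, simp)
      (use r in \<open>auto simp: fun_eq_iff\<close>)
qed

text \<open>\<open>R1\<close> holds the tree in reverse, so popping it and pushing elsewhere
  restores the order. The flags select which of \<open>R0\<close> and \<open>R4\<close> receive a
  copy.\<close>

definition put_body :: "bool \<Rightarrow> bool \<Rightarrow> com" where
  "put_body p q = CPop R3 ;; CIf R1 CSkip
     (CPop R1 ;; (if p then CPush R0 False else CSkip) ;; (if q then CPush R4 False else CSkip))
     (CPop R1 ;; (if p then CPush R0 True else CSkip) ;; (if q then CPush R4 True else CSkip))"

lemma runs_put_body:
  assumes "s R1 = b # zs" "s R3 = c # ws"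
  shows "runs 15 (put_body p q) s (s(R1 := zs, R3 := ws,
    R0 := (if p then [b] else []) @ s R0, R4 := (if q then [b] else []) @ s R4))"
proof -
  have P: "runs 2 (if p then CPush r x else CSkip) s (s(r := (if p then [x] else []) @ s r))"
    if "r \<noteq> RO" for r s p x
    using that by (auto intro: runs_cong[OF runs_Push] runs_cong[OF runs_Skip])
  show ?thesis
  proof (cases b)
    case True
    show ?thesis unfolding put_body_def
      by (rule runs_cong, rule runs_Seq, rule runs_Pop, simp, use assms in simp,
          rule runs_If_True[where xs = zs], simp, use True assms in simp,
          rule runs_Seq, rule runs_Pop, simp, use assms in simp,
          rule runs_Seq, rule P, simp, rule P, simp)
        (use True assms in \<open>auto simp: fun_eq_iff\<close>)
  next
    case False
    show ?thesis unfolding put_body_def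
      by (rule runs_cong, rule runs_Seq, rule runs_Pop, simp, use assms in simp,
          rule runs_If_False[where xs = zs], simp, use False assms in simp,
          rule runs_Seq, rule runs_Pop, simp, use assms in simp,
          rule runs_Seq, rule P, simp, rule P, simp)
        (use False assms in \<open>auto simp: fun_eq_iff\<close>)
  qed
qed

lemma runs_put_loop:
  assumes "s R1 = rev ys @ zs" "s R3 = replicate (length ys) True @ False # ws"
  shows "runs (20 * length ys + 1) (CWhile R3 False (put_body p q)) s (s(R1 := zs, R3 := False # ws,
    R0 := (if p then ys else []) @ s R0, R4 := (if q then ys else []) @ s R4))"
  using assms
proof (induction ys arbitrary: s rule: rev_induct)
  case Nil
  then show ?case by (intro runs_cong[OF runs_While_stop[where xs = ws]]) (auto simp: fun_eq_iff)
next
  case (snoc y ys)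
  let ?s1 = "s(R1 := rev ys @ zs, R3 := replicate (length ys) True @ False # ws,
    R0 := (if p then [y] else []) @ s R0, R4 := (if q then [y] else []) @ s R4)"
  have 1: "runs 15 (put_body p q) s ?s1"
    using snoc.prems by (intro runs_put_body) simp_all
  have 2: "runs (20 * length ys + 1) (CWhile R3 False (put_body p q)) ?s1
    (?s1(R1 := zs, R3 := False # ws,
    R0 := (if p then ys else []) @ ?s1 R0, R4 := (if q then ys else []) @ ?s1 R4))"
    by (rule snoc.IH) simp_all
  show ?case
  proof (rule runs_cong[OF runs_While_loop[OF _ _ _ 1 2]])
    show "s R3 = True # (replicate (length ys) True @ False # ws)" using snoc.prems by simp
  qed (auto simp: fun_eq_iff)
qed

definition move :: "reg \<Rightarrow> bool \<Rightarrow> bool \<Rightarrow> com" where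
  "move r p q = grab r ;; CWhile R3 False (put_body p q) ;; CPop R3"

lemma runs_move:
  assumes "r = R0 \<or> r = R4" "s r = enc t @ xs"
  shows "runs (40 * tsize t + 20) (move r p q) s
    (s(r := xs, R0 := (if p then enc t else []) @ (s(r := xs)) R0,
       R4 := (if q then enc t else []) @ (s(r := xs)) R4))"
  using assms(1) unfolding move_def
  by (intro runs_cong[OF runs_Seq[OF runs_grab[where r = r and s = s and t = t and xs = xs, OF assms] runs_Seq[OF runs_put_loop[where ys = "enc t" and
          zs = "s R1" and ws = "s R3"] runs_Pop]]]) (auto simp: fun_eq_iff)

definition drop_code :: com where "drop_code = move R0 False False"
text \<open>One move gives at most one copy to each register; two copies on \<open>R0\<close>
  therefore need the detour via \<open>R4\<close>.\<close>

definition dup_code :: com where "dup_code = move R0 False True ;; move R4 True True ;; move R4 True False"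
definition stash_code :: com where "stash_code = move R0 False True"
definition unstash_code :: com where "unstash_code = move R4 True False"

lemma runs_drop: "s R0 = enc t @ xs \<Longrightarrow> runs (40 * tsize t + 20) drop_code s (s(R0 := xs))"
  unfolding drop_code_def by (rule runs_cong, rule runs_move) (auto simp: fun_eq_iff)

lemma runs_stash: "s R0 = enc t @ xs \<Longrightarrow> runs (40 * tsize t + 20) stash_code s
    (s(R0 := xs, R4 := enc t @ s R4))"
  unfolding stash_code_def by (rule runs_cong, rule runs_move) (auto simp: fun_eq_iff)

lemma runs_unstash: "s R4 = enc t @ xs \<Longrightarrow> runs (40 * tsize t + 20) unstash_code s
    (s(R4 := xs, R0 := enc t @ s R0))"
  unfolding unstash_code_def by (rule runs_cong, rule runs_move) (auto simp: fun_eq_iff)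

lemma runs_dup: "s R0 = enc t @ xs \<Longrightarrow> runs (120 * tsize t + 62) dup_code s
    (s(R0 := enc t @ enc t @ xs))"
  unfolding dup_code_def
  by (rule runs_cong, rule runs_Seq, rule runs_move[where t = t and xs = xs], simp, simp,
      rule runs_Seq, rule runs_move[where t = t and xs = "s R4"], simp, simp,
      rule runs_move[where t = t and xs = "s R4"], simp, simp)
    (auto simp: fun_eq_iff)

text \<open>Only the topmost tree on \<open>R0\<close> is replaced. Everything below it and all
  other registers survive, so intermediate results can be parked there while another function is
  computed.\<close>

definition realizes :: "com \<Rightarrow> nat poly \<Rightarrow> (tree \<Rightarrow> tree) \<Rightarrow> bool" where
  "realizes c p f \<longleftrightarrow> (\<forall>t s xs. s R0 = enc t @ xs \<longrightarrow>
     runs (poly p (tsize t)) c s (s(R0 := enc (f t) @ xs)))"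

definition FP :: "(tree \<Rightarrow> tree) \<Rightarrow> bool" where
  "FP f \<longleftrightarrow> (\<exists>c p. realizes c p f)"

lemma realizesD:
  "realizes c p f \<Longrightarrow> s R0 = enc t @ xs \<Longrightarrow> runs (poly p (tsize t)) c s (s(R0 := enc (f t) @ xs))"
  unfolding realizes_def by blast

lemma realizes_size: "realizes c p f \<Longrightarrow> tsize (f t) \<le> tsize t + poly p (tsize t)"
  using runs_store_size[OF realizesD[of c p f "(\<lambda>_. [])(R0 := enc t)" t "[]"]]
  by (simp add: store_size_def)

lemma FP_size:
  assumes "FP f"
  obtains q where "\<And>t. tsize (f t) \<le> poly q (tsize t)"
proof -
  from assms obtain c p where "realizes c p f" by (auto simp: FP_def)
  then have "tsize (f t) \<le> poly ([:0, 1:] + p) (tsize t)" for t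
    using realizes_size[of c p f t] by simp
  then show thesis by (rule that)
qed

lemma FP_I:
  assumes "poly_bounded b"
    and "\<And>t s xs. s R0 = enc t @ xs \<Longrightarrow> runs (b (tsize t)) c s (s(R0 := enc (f t) @ xs))"
  shows "FP f"
  using assms unfolding FP_def realizes_def poly_bounded_def by (blast intro: runs_cong)

lemma FP_id: "FP (\<lambda>t. t)"
  by (rule FP_I[OF poly_bounded_const[of 0], of CSkip]) (metis fun_upd_triv runs_Skip)

lemma FP_comp:
  assumes "FP g" "FP f"
  shows "FP (\<lambda>t. g (f t))"
proof -
  from assms obtain c p d q where c: "realizes c p f" and d: "realizes d q g" by (auto simp: FP_def)
  show ?thesis
  proof (rule FP_I)
    show "poly_bounded (\<lambda>n. poly p n + 1 + poly q (n + poly p n))"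
      by (intro poly_bounded_intros)
    fix t s xs assume s: "s R0 = enc t @ xs"
    show "runs (poly p (tsize t) + 1 + poly q (tsize t + poly p (tsize t))) (c ;; d) s
      (s(R0 := enc (g (f t)) @ xs))"
      by (rule runs_cong[OF runs_Seq[OF realizesD[OF c, where s = s and t = t and xs = xs, OF s] realizesD[OF d, where t = "f t" and xs = xs]]])
        (simp_all add: poly_nat_mono realizes_size[OF c])
  qed
qed

primrec push_bits :: "bool list \<Rightarrow> com" where
  "push_bits [] = CSkip"
| "push_bits (b # bs) = push_bits bs ;; CPush R0 b"

lemma runs_push_bits: "runs (3 * length bs) (push_bits bs) s (s(R0 := bs @ s R0))"
proof (induction bs)
  case (Cons b bs)
  show ?case unfolding push_bits.simps
    by (rule runs_cong[OF runs_Seq[OF Cons.IH runs_Push]]) auto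
qed (simp add: runs_Skip)

lemma FP_const: "FP (\<lambda>t. k)"
proof (rule FP_I)
  show "poly_bounded (\<lambda>n. 40 * n + 20 + 1 + 3 * tsize k)" by (intro poly_bounded_intros)
  fix t s xs assume "s R0 = enc t @ xs"
  then show "runs (40 * tsize t + 20 + 1 + 3 * tsize k) (drop_code ;; push_bits (enc k)) s
    (s(R0 := enc k @ xs))"
    by (intro runs_cong[OF runs_Seq[OF runs_drop runs_push_bits]]) auto
qed

text \<open>The code of a pair is \<open>True\<close> followed by the two codes. So once the second
  result is on \<open>R0\<close> and the first one has been put on top of it, a single push
  completes the pair.\<close>

lemma FP_Node:
  assumes "FP f" "FP g"
  shows "FP (\<lambda>t. Node (f t) (g t))"
proof -
  from assms obtain c p d q where c: "realizes c p f" and d: "realizes d q g" by (auto simp: FP_def)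
  show ?thesis
  proof (rule FP_I)
    show "poly_bounded (\<lambda>n. 120 * n + poly p n + 80 * (n + poly p n) + poly q n + 200)"
      by (intro poly_bounded_intros)
    fix t s xs assume s: "s R0 = enc t @ xs"
    show "runs (120 * tsize t + poly p (tsize t) + 80 * (tsize t + poly p (tsize t)) + poly q (tsize t) + 200)
      (dup_code ;; c ;; stash_code ;; d ;; unstash_code ;; CPush R0 True) s
      (s(R0 := enc (Node (f t) (g t)) @ xs))"
      by (rule runs_cong, rule runs_Seq, rule runs_dup, rule s,
          rule runs_Seq, rule realizesD[OF c, where t = t and xs = "enc t @ xs"], simp,
          rule runs_Seq, rule runs_stash[where t = "f t" and xs = "enc t @ xs"], simp,
          rule runs_Seq, rule realizesD[OF d, where t = t and xs = xs], simp,
          rule runs_Seq, rule runs_unstash[where t = "f t" and xs = "s R4"], simp,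
          rule runs_Push, simp)
        (use realizes_size[OF c, of t] in \<open>auto simp: fun_eq_iff\<close>)
  qed
qed

lemma FP_car: "FP car"
proof (rule FP_I)
  show "poly_bounded (\<lambda>n. 200 * n + 200)" by (intro poly_bounded_intros)
  let ?c = "CIf R0 CSkip CSkip (CPop R0 ;; stash_code ;; drop_code ;; unstash_code)"
  fix t s xs assume s: "s R0 = enc t @ xs"
  show "runs (200 * tsize t + 200) ?c s (s(R0 := enc (car t) @ xs))"
  proof (cases t)
    case Leaf
    with s show ?thesis
      by (intro runs_cong[OF runs_If_False[where xs = xs, OF _ _ runs_Skip]]) (auto simp: fun_eq_iff)
  next
    case (Node a b)
    show ?thesis
      by (rule runs_cong, rule runs_If_True[where xs = "enc a @ enc b @ xs"], simp, use s Node in simp,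
          rule runs_Seq, rule runs_Pop, simp, use s Node in simp,
          rule runs_Seq, rule runs_stash[where t = a and xs = "enc b @ xs"], use s Node in simp,
          rule runs_Seq, rule runs_drop[where t = b and xs = xs], simp,
          rule runs_unstash[where t = a and xs = "s R4"], simp)
        (use Node in \<open>auto simp: fun_eq_iff\<close>)
  qed
qed

lemma FP_cdr: "FP cdr"
proof (rule FP_I)
  show "poly_bounded (\<lambda>n. 200 * n + 200)" by (intro poly_bounded_intros)
  let ?c = "CIf R0 CSkip CSkip (CPop R0 ;; drop_code)"
  fix t s xs assume s: "s R0 = enc t @ xs"
  show "runs (200 * tsize t + 200) ?c s (s(R0 := enc (cdr t) @ xs))"
  proof (cases t)
    case Leaf
    with s show ?thesis
      by (intro runs_cong[OF runs_If_False[where xs = xs, OF _ _ runs_Skip]]) (auto simp: fun_eq_iff)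
  next
    case (Node a b)
    show ?thesis
      by (rule runs_cong, rule runs_If_True[where xs = "enc a @ enc b @ xs"], simp, use s Node in simp,
          rule runs_Seq, rule runs_Pop, simp, use s Node in simp,
          rule runs_drop[where t = a and xs = "enc b @ xs"], use s Node in simp)
        (use Node in \<open>auto simp: fun_eq_iff\<close>)
  qed
qed

text \<open>The first bit of a code decides whether the tree is \<open>Leaf\<close>; this is the
  only primitive test, and all other tests are reduced to it.\<close>

lemma FP_if_Leaf:
  assumes "FP f" "FP g" "FP h"
  shows "FP (\<lambda>t. if f t = Leaf then g t else h t)"
proof -
  from assms obtain c p d q e u where c: "realizes c p f" and d: "realizes d q g"
    and e: "realizes e u h" by (auto simp: FP_def)
  show ?thesis
  proof (rule FP_I)
    show "poly_bounded (\<lambda>n. 120 * n + poly p n + 40 * (n + poly p n) + poly q n + poly u n + 200)"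
      by (intro poly_bounded_intros)
    fix t s xs assume s: "s R0 = enc t @ xs"
    show "runs (120 * tsize t + poly p (tsize t) + 40 * (tsize t + poly p (tsize t)) + poly q (tsize t)
        + poly u (tsize t) + 200)
      (dup_code ;; c ;; CIf R0 CSkip (drop_code ;; d) (drop_code ;; e)) s
      (s(R0 := enc (if f t = Leaf then g t else h t) @ xs))"
    proof (cases "f t")
      case Leaf
      show ?thesis
        by (rule runs_cong, rule runs_Seq, rule runs_dup, rule s,
            rule runs_Seq, rule realizesD[OF c, where t = t and xs = "enc t @ xs"], simp,
            rule runs_If_False[where xs = "enc t @ xs"], simp, simp add: Leaf,
            rule runs_Seq, rule runs_drop[where t = "f t" and xs = "enc t @ xs"], simp,
            rule realizesD[OF d, where t = t and xs = xs], simp)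
          (use realizes_size[OF c, of t] Leaf in \<open>auto simp: fun_eq_iff\<close>)
    next
      case (Node a b)
      show ?thesis
        by (rule runs_cong, rule runs_Seq, rule runs_dup, rule s,
            rule runs_Seq, rule realizesD[OF c, where t = t and xs = "enc t @ xs"], simp,
            rule runs_If_True[where xs = "enc a @ enc b @ enc t @ xs"], simp, simp add: Node,
            rule runs_Seq, rule runs_drop[where t = "f t" and xs = "enc t @ xs"], simp,
            rule realizesD[OF e, where t = t and xs = xs], simp)
          (use realizes_size[OF c, of t] Node in \<open>auto simp: fun_eq_iff\<close>)
    qed
  qed
qed

subsection \<open>Lists of trees and bounded iteration\<close>

text \<open>Every tree is the list of the left subtrees on its right spine.\<close>

primrec els :: "tree \<Rightarrow> tree list" where
  "els Leaf = []"
| "els (Node a b) = a # els b"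

primrec tlist :: "tree list \<Rightarrow> tree" where
  "tlist [] = Leaf"
| "tlist (a # as) = Node a (tlist as)"

lemma els_tlist [simp]: "els (tlist xs) = xs"
  by (induction xs) simp_all

lemma tlist_els [simp]: "tlist (els t) = t"
  by (induction t) simp_all

lemma tree_eqI: "els x = els y \<Longrightarrow> x = y"
  by (metis tlist_els)

lemma tsize_tlist: "tsize (tlist xs) = 1 + length xs + (\<Sum>x\<leftarrow>xs. tsize x)"
  by (induction xs) simp_all

lemma tsize_tlist_append [simp]: "tsize (tlist (xs @ ys)) + 1 = tsize (tlist xs) + tsize (tlist ys)"
  by (simp add: tsize_tlist)

lemma tsize_take: "tsize (tlist (take k xs)) \<le> tsize (tlist xs)"
proof (induction xs arbitrary: k)
  case (Cons a xs)
  from Cons[of "k - 1"] show ?case by (cases k) auto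
qed simp

lemma length_els_le: "length (els t) < tsize t"
  by (induction t) simp_all

text \<open>The list is on \<open>R4\<close> and the accumulator on \<open>R0\<close>. Popping the
  bit \<open>True\<close> of the first list cell exposes the head \<open>a\<close>; moving it onto
  the accumulator \<open>v\<close> and pushing \<open>True\<close> yields the code of
  \<open>Node a v\<close>, the argument of the step function.\<close>

definition loop_body :: "com \<Rightarrow> com" where
  "loop_body c = CPop R4 ;; unstash_code ;; CPush R0 True ;; c"

lemma runs_loop:
  assumes "realizes c p g"
    and "\<And>k. tsize (foldl (\<lambda>v a. g (Node a v)) v (take k xs)) \<le> M"
    and "tsize (tlist xs) \<le> M"
    and "s R4 = enc (tlist xs) @ zs" "s R0 = enc v @ ys"
  shows "runs (length xs * (50 * M + poly p (2 * M + 1) + 50) + 1) (CWhile R4 False (loop_body c)) s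
    (s(R4 := False # zs, R0 := enc (foldl (\<lambda>v a. g (Node a v)) v xs) @ ys))"
  using assms(2-)
proof (induction xs arbitrary: v s)
  case Nil
  then show ?case by (intro runs_cong[OF runs_While_stop[where xs = zs]]) (auto simp: fun_eq_iff)
next
  case (Cons a xs)
  let ?v = "g (Node a v)"
  let ?s1 = "s(R4 := enc (tlist xs) @ zs, R0 := enc ?v @ ys)"
  have sz: "tsize a \<le> M" "tsize v \<le> M" using Cons.prems(1)[of 0] Cons.prems(2) by simp_all
  have "poly p (tsize (Node a v)) \<le> poly p (2 * M + 1)" using sz by (intro poly_nat_mono) simp
  then have "runs (50 * M + poly p (2 * M + 1) + 40) (loop_body c) s ?s1" unfolding loop_body_def
    by (intro runs_cong[OF runs_Seq[OF runs_Pop runs_Seq[OF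
          runs_unstash[where t = a and xs = "enc (tlist xs) @ zs"] runs_Seq[OF runs_Push
          realizesD[OF assms(1), where t = "Node a v" and xs = ys]]]]])
      (use Cons.prems sz in \<open>auto simp: fun_eq_iff\<close>)
  moreover have "runs (length xs * (50 * M + poly p (2 * M + 1) + 50) + 1) (CWhile R4 False (loop_body c)) ?s1
      (?s1(R4 := False # zs, R0 := enc (foldl (\<lambda>v a. g (Node a v)) ?v xs) @ ys))"
  proof (rule Cons.IH)
    show "tsize (foldl (\<lambda>v a. g (Node a v)) ?v (take k xs)) \<le> M" for k
      using Cons.prems(1)[of "Suc k"] by simp
  qed (use Cons.prems in simp_all)
  ultimately have "runs (1 + (50 * M + poly p (2 * M + 1) + 40) + 1 + (length xs * (50 * M + poly p (2 * M + 1) + 50) + 1))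
      (CWhile R4 False (loop_body c)) s
      (?s1(R4 := False # zs, R0 := enc (foldl (\<lambda>v a. g (Node a v)) ?v xs) @ ys))"
    using Cons.prems by (intro runs_While_loop[where b = True]) simp_all
  then show ?case by (rule runs_cong) (auto simp: fun_eq_iff algebra_simps)
qed

text \<open>A polynomial number of polynomial-time steps can still be exponential if the accumulator
  is, say, squared in each step. Hence the size of every intermediate accumulator has to be bounded
  in terms of the input.\<close>

lemma FP_foldl_bounded:
  assumes "FP g" "FP x" "FP v"
    and bound: "\<And>t k. tsize (foldl (\<lambda>v a. g (Node a v)) (v t) (take k (els (x t)))) \<le> poly q (tsize t)"
  shows "FP (\<lambda>t. foldl (\<lambda>v a. g (Node a v)) (v t) (els (x t)))"
proof -
  from assms(1) obtain c p where c: "realizes c p g" by (auto simp: FP_def)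
  from FP_Node[OF assms(2,3)] obtain d u where d: "realizes d u (\<lambda>t. Node (x t) (v t))" by (auto simp: FP_def)
  define M where "M = (\<lambda>n. n + poly u n + poly q n)"
  let ?f = "\<lambda>t. foldl (\<lambda>v a. g (Node a v)) (v t) (els (x t))"
  let ?c = "d ;; CPop R0 ;; stash_code ;; CWhile R4 False (loop_body c) ;; CPop R4"
  show ?thesis
  proof (rule FP_I)
    show "poly_bounded (\<lambda>n. poly u n + 40 * M n + M n * (50 * M n + poly p (2 * M n + 1) + 50) + 50)"
      unfolding M_def by (intro poly_bounded_intros)
    fix t s ys assume s: "s R0 = enc t @ ys"
    let ?M = "M (tsize t)"
    have sz: "tsize (x t) + tsize (v t) < ?M"
      using realizes_size[OF d, of t] by (simp add: M_def)
    have l: "runs (length (els (x t)) * (50 * ?M + poly p (2 * ?M + 1) + 50) + 1) (CWhile R4 False (loop_body c)) s'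
        (s'(R4 := False # s R4, R0 := enc (?f t) @ ys))"
      if "s' R4 = enc (x t) @ s R4" "s' R0 = enc (v t) @ ys" for s'
    proof (rule runs_loop[OF c])
      show "tsize (foldl (\<lambda>v a. g (Node a v)) (v t) (take k (els (x t)))) \<le> ?M" for k
        using bound[of t k] by (simp add: M_def)
    qed (use that sz in simp_all)
    have "length (els (x t)) \<le> ?M" using length_els_le[of "x t"] sz by simp
    then have total: "40 * tsize (x t) + length (els (x t)) * (50 * ?M + poly p (Suc (2 * ?M)) + 50)
        \<le> 40 * ?M + ?M * (50 * ?M + poly p (Suc (2 * ?M)) + 50)" using sz by (intro add_le_mono mult_le_mono1) simp_all
    show "runs (poly u (tsize t) + 40 * ?M + ?M * (50 * ?M + poly p (2 * ?M + 1) + 50) + 50) ?c s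
        (s(R0 := enc (?f t) @ ys))"
      by - (rule runs_cong, rule runs_Seq, rule realizesD[OF d], rule s,
          rule runs_Seq, rule runs_Pop, simp, simp,
          rule runs_Seq, rule runs_stash[where t = "x t" and xs = "enc (v t) @ ys"], simp,
          rule runs_Seq, rule l, simp, simp, rule runs_Pop, simp, simp,
          use s in \<open>simp add: fun_eq_iff\<close>, use total in simp)
  qed
qed

lemma FP_foldl_tree:
  assumes "FP g"
    and "\<And>xs v. tsize (foldl (\<lambda>v a. g (Node a v)) v xs) \<le> poly q (tsize (tlist xs) + tsize v)"
  shows "FP (\<lambda>t. foldl (\<lambda>v a. g (Node a v)) (cdr t) (els (car t)))"
proof (rule FP_foldl_bounded[OF assms(1) FP_car FP_cdr])
  fix t k
  have "tsize (tlist (take k (els (car t)))) + tsize (cdr t) \<le> Suc (tsize t)"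
    using tsize_take[of k "els (car t)"] by (cases t) simp_all
  from order.trans[OF assms(2) poly_nat_mono[OF this]]
  show "tsize (foldl (\<lambda>v a. g (Node a v)) (cdr t) (take k (els (car t)))) \<le> poly (q \<circ>\<^sub>p [:1, 1:]) (tsize t)"
    by (simp add: poly_pcompose)
qed

lemma FP_pair_comp: "FP (\<lambda>t. h (car t) (cdr t)) \<Longrightarrow> FP f \<Longrightarrow> FP g \<Longrightarrow> FP (\<lambda>t. h (f t) (g t))"
  using FP_comp[of "\<lambda>t. h (car t) (cdr t)" "\<lambda>t. Node (f t) (g t)"] FP_Node by simp

lemma FP_car': "FP f \<Longrightarrow> FP (\<lambda>t. car (f t))" and FP_cdr': "FP f \<Longrightarrow> FP (\<lambda>t. cdr (f t))"
  using FP_comp[OF FP_car] FP_comp[OF FP_cdr] by auto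

named_theorems FP_intros

lemmas [FP_intros] = FP_id FP_const FP_car' FP_cdr' FP_Node

text \<open>If a step enlarges the accumulator by an amount that depends only on the list element
  and a fixed parameter, then the increments add up to a polynomial, and no bound on the
  intermediate accumulators has to be supplied.\<close>

lemma FP_foldl:
  assumes "FP (\<lambda>t. h (car t) (car (cdr t)) (cdr (cdr t)))"
    and "\<And>a v c. tsize (h a v c) \<le> tsize v + poly q (tsize a + tsize c)"
    and "FP x" "FP v" "FP c"
  shows "FP (\<lambda>t. foldl (\<lambda>v a. h a v (c t)) (v t) (els (x t)))"
proof -
  \<comment> \<open>The parameter \<open>c\<close> is carried along as the second component of the
    accumulator.\<close>
  let ?g = "\<lambda>t. Node (h (car t) (car (cdr t)) (cdr (cdr t))) (cdr (cdr t))"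
  have g: "FP ?g" using assms(1) by (intro FP_intros)
  have car_g: "foldl (\<lambda>v a. ?g (Node a v)) (Node v c) xs = Node (foldl (\<lambda>v a. h a v c) v xs) c" for v c xs
    by (induction xs arbitrary: v) simp_all
  have h_size: "tsize (foldl (\<lambda>v a. h a v c) v xs) \<le> tsize v + length xs * poly q (tsize (tlist xs) + tsize c)" for xs v c
  proof (induction xs arbitrary: v)
    case (Cons a xs)
    have "tsize (foldl (\<lambda>v a. h a v c) (h a v c) xs)
        \<le> tsize (h a v c) + length xs * poly q (tsize (tlist xs) + tsize c)" by (rule Cons.IH)
    also have "tsize (h a v c) \<le> tsize v + poly q (tsize a + tsize c)" by (rule assms(2))
    also have "poly q (tsize a + tsize c) \<le> poly q (tsize (tlist (a # xs)) + tsize c)"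
      by (rule poly_nat_mono) simp
    also have "length xs * poly q (tsize (tlist xs) + tsize c)
        \<le> length xs * poly q (tsize (tlist (a # xs)) + tsize c)"
      by (intro mult_le_mono2 poly_nat_mono) simp
    finally show ?case by simp
  qed simp
  define r where "r = [:1, 2:] + [:0, 1:] * q + [:1::nat:]"
  have "tsize (foldl (\<lambda>v a. ?g (Node a v)) v xs) \<le> poly r (tsize (tlist xs) + tsize v)" for xs v
  \<comment> \<open>An arbitrary tree \<open>v\<close> need not be a pair. After at least one step
    the accumulator is one, built from \<open>car v\<close> and \<open>cdr v\<close>.\<close>
  proof (cases "xs = []")
    case True
    then show ?thesis by (simp add: r_def)
  next
    case False
    define u w where "u = car v" and "w = cdr v"
    have eq: "foldl (\<lambda>v a. ?g (Node a v)) v xs = Node (foldl (\<lambda>v a. h a v w) u xs) w"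
    proof -
      from False obtain a ys where "xs = a # ys" by (cases xs) auto
      then show ?thesis using car_g[of "h a u w" w ys] by (simp add: u_def w_def)
    qed
    have uw: "tsize u \<le> tsize v" "tsize w \<le> tsize v" by (cases v; simp add: u_def w_def)+
    have "length xs * poly q (tsize (tlist xs) + tsize w) \<le>
        (tsize (tlist xs) + tsize v) * poly q (tsize (tlist xs) + tsize v)"
      using uw length_els_le[of "tlist xs"] by (intro mult_le_mono poly_nat_mono) simp_all
    with h_size[of w u xs] uw show ?thesis unfolding eq by (simp add: r_def algebra_simps)
  qed
  from FP_foldl_tree[OF g this]
  have "FP (\<lambda>t. foldl (\<lambda>v a. ?g (Node a v)) (cdr t) (els (car t)))" .
  from FP_car'[OF FP_pair_comp[OF this assms(3) FP_Node[OF assms(4,5)]]]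
  show ?thesis by (simp only: car.simps cdr.simps car_g[unfolded car.simps cdr.simps])
qed

section \<open>Truth values and tests\<close>

definition tb :: "bool \<Rightarrow> tree" where "tb b = (if b then Node Leaf Leaf else Leaf)"

lemma tb_simps [simp]: "tb b = Leaf \<longleftrightarrow> \<not> b" "tb b = tb b' \<longleftrightarrow> b = b'" "tb True = Node Leaf Leaf"
  "tb False = Leaf"
  by (auto simp: tb_def)

definition FPb :: "(tree \<Rightarrow> bool) \<Rightarrow> bool" where "FPb P \<longleftrightarrow> FP (\<lambda>t. tb (P t))"

lemma FP_if:
  assumes "FPb P" "FP g" "FP h"
  shows "FP (\<lambda>t. if P t then g t else h t)"
proof -
  have "(\<lambda>t. if tb (P t) = Leaf then h t else g t) = (\<lambda>t. if P t then g t else h t)" by auto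
  with FP_if_Leaf[OF assms(1)[unfolded FPb_def] assms(3,2)] show ?thesis by simp
qed

lemma FP_tb: "FPb P \<Longrightarrow> FP (\<lambda>t. tb (P t))" by (simp add: FPb_def)

lemma FPb_if: "FPb P \<Longrightarrow> FPb Q \<Longrightarrow> FPb R \<Longrightarrow> FPb (\<lambda>t. if P t then Q t else R t)"
  unfolding FPb_def[of Q] FPb_def[of R] using FP_if[of P "\<lambda>t. tb (Q t)" "\<lambda>t. tb (R t)"]
  by (simp add: FPb_def if_distrib cong: if_cong)

lemma FPb_const: "FPb (\<lambda>t. b)" by (simp add: FPb_def FP_const)

lemma FPb_conj: "FPb P \<Longrightarrow> FPb Q \<Longrightarrow> FPb (\<lambda>t. P t \<and> Q t)"
  by (rule back_subst[of FPb, OF FPb_if[of P Q "\<lambda>_. False"]]) (auto simp: FPb_const)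

lemma FPb_disj: "FPb P \<Longrightarrow> FPb Q \<Longrightarrow> FPb (\<lambda>t. P t \<or> Q t)"
  by (rule back_subst[of FPb, OF FPb_if[of P "\<lambda>_. True" Q]]) (auto simp: FPb_const)

lemma FPb_not: "FPb P \<Longrightarrow> FPb (\<lambda>t. \<not> P t)"
  by (rule back_subst[of FPb, OF FPb_if[of P "\<lambda>_. False" "\<lambda>_. True"]]) (auto simp: FPb_const)

lemma FPb_eq: "FPb P \<Longrightarrow> FPb Q \<Longrightarrow> FPb (\<lambda>t. P t \<longleftrightarrow> Q t)"
  by (rule back_subst[of FPb, OF FPb_if[of P Q "\<lambda>t. \<not> Q t"]]) (auto simp: FPb_not)

lemma FPb_Leaf: "FP f \<Longrightarrow> FPb (\<lambda>t. f t = Leaf)"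
  unfolding FPb_def using FP_if_Leaf[of f "\<lambda>_. tb True" "\<lambda>_. tb False"]
  by (simp add: FP_const tb_def cong: if_cong)

lemma FPb_eq_const: "FP f \<Longrightarrow> FPb (\<lambda>t. f t = k)"
proof (induction k arbitrary: f)
  case (Node a b)
  have "FPb (\<lambda>t. \<not> f t = Leaf \<and> car (f t) = a \<and> cdr (f t) = b)"
    by (intro FPb_conj FPb_not FPb_Leaf Node FP_car' FP_cdr')
  also have "(\<lambda>t. \<not> f t = Leaf \<and> car (f t) = a \<and> cdr (f t) = b) = (\<lambda>t. f t = Node a b)"
    by (rule ext) (case_tac "f t"; auto)
  finally show ?case .
qed (rule FPb_Leaf)

text \<open>The elements of \<open>S\<close> are hard-wired into the program. In this way every
  function and relation on the finite alphabet is available as a table.\<close>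

lemma FPb_mem: "FP f \<Longrightarrow> finite S \<Longrightarrow> FPb (\<lambda>t. f t \<in> S)"
proof (induction S rule: infinite_finite_induct)
  case (insert k S)
  then have "FPb (\<lambda>t. f t = k \<or> f t \<in> S)" by (intro FPb_disj FPb_eq_const) auto
  then show ?case by simp
qed (simp_all add: FPb_const)

lemmas [FP_intros] = FP_if FPb_if FP_tb FPb_const FPb_conj FPb_disj FPb_not FPb_eq FPb_Leaf FPb_eq_const FPb_mem

section \<open>List functions\<close>

definition rapp :: "tree \<Rightarrow> tree \<Rightarrow> tree" where
  "rapp x y = foldl (\<lambda>v a. Node a v) y (els x)"

definition app :: "tree \<Rightarrow> tree \<Rightarrow> tree" where
  "app x y = rapp (rapp x Leaf) y"

lemma els_rapp [simp]: "els (rapp x y) = rev (els x) @ els y"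
proof -
  have "els (foldl (\<lambda>v a. Node a v) y xs) = rev xs @ els y" for xs
    by (induction xs arbitrary: y) simp_all
  then show ?thesis by (simp add: rapp_def)
qed

lemma els_app [simp]: "els (app x y) = els x @ els y"
  by (simp add: app_def)

lemma app_tlist [simp]: "app (tlist xs) (tlist ys) = tlist (xs @ ys)"
  by (rule tree_eqI) simp

lemma rapp_tlist [simp]: "rapp (tlist xs) (tlist ys) = tlist (rev xs @ ys)"
  by (rule tree_eqI) simp

lemma tsize_app: "tsize (app x y) + 1 = tsize x + tsize y"
  using tsize_tlist_append[of "els x" "els y"] by (metis els_app tlist_els)

lemma FP_rapp [FP_intros]: "FP f \<Longrightarrow> FP g \<Longrightarrow> FP (\<lambda>t. rapp (f t) (g t))"
  unfolding rapp_def
  by (rule FP_foldl[where h = "\<lambda>a v c. Node a v" and q = "[:1, 1:]" and c = "\<lambda>_. Leaf"])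
    (intro FP_intros | simp)+

lemma FP_app [FP_intros]: "FP f \<Longrightarrow> FP g \<Longrightarrow> FP (\<lambda>t. app (f t) (g t))"
  unfolding app_def by (intro FP_intros)

definition tmaps :: "(tree \<Rightarrow> tree) \<Rightarrow> tree \<Rightarrow> tree" where
  "tmaps h x = foldl (\<lambda>v a. app v (h a)) Leaf (els x)"

lemma els_tmaps [simp]: "els (tmaps h x) = concat (map (\<lambda>a. els (h a)) (els x))"
proof -
  have "els (foldl (\<lambda>v a. app v (h a)) v xs) = els v @ concat (map (\<lambda>a. els (h a)) xs)" for v xs
    by (induction xs arbitrary: v) simp_all
  then show ?thesis by (simp add: tmaps_def)
qed

lemma FP_tmaps [FP_intros]:
  assumes "FP (\<lambda>t. h (car t) (cdr t))" "FP f" "FP c"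
  shows "FP (\<lambda>t. tmaps (\<lambda>a. h a (c t)) (f t))"
proof -
  from FP_size[OF assms(1)] obtain q where q: "\<And>t. tsize (h (car t) (cdr t)) \<le> poly q (tsize t)" by blast
  show ?thesis unfolding tmaps_def
  proof (rule FP_foldl[where h = "\<lambda>a v c. app v (h a c)" and q = "q \<circ>\<^sub>p [:1, 1:]" and v = "\<lambda>_. Leaf"])
    show "FP (\<lambda>t. app (car (cdr t)) (h (car t) (cdr (cdr t))))"
      by (intro FP_intros FP_pair_comp[of h, OF assms(1)])
    show "tsize (app v (h a c)) \<le> tsize v + poly (q \<circ>\<^sub>p [:1, 1:]) (tsize a + tsize c)" for a v c
      using q[of "Node a c"] tsize_app[of v "h a c"] by (simp add: poly_pcompose)
  qed (rule assms FP_const)+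
qed

definition tmap :: "(tree \<Rightarrow> tree) \<Rightarrow> tree \<Rightarrow> tree" where
  "tmap h x = tmaps (\<lambda>a. Node (h a) Leaf) x"

lemma els_tmap [simp]: "els (tmap h x) = map h (els x)"
  by (simp add: tmap_def)

lemma tmap_tlist [simp]: "tmap h (tlist xs) = tlist (map h xs)"
  by (rule tree_eqI) simp

lemma FP_tmap [FP_intros]:
  "FP (\<lambda>t. h (car t) (cdr t)) \<Longrightarrow> FP f \<Longrightarrow> FP c \<Longrightarrow> FP (\<lambda>t. tmap (\<lambda>a. h a (c t)) (f t))"
  unfolding tmap_def by (rule FP_tmaps[where h = "\<lambda>a c. Node (h a c) Leaf"]) (intro FP_intros | assumption)+

text \<open>Only the length of \<open>x\<close> matters. With numbers in unary, as lists of leaves,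
  the same function is truncated subtraction, and whether its result is \<open>Leaf\<close> compares
  two numbers.\<close>

definition tdrop :: "tree \<Rightarrow> tree \<Rightarrow> tree" where
  "tdrop x y = foldl (\<lambda>v a. cdr v) y (els x)"

lemma els_tdrop [simp]: "els (tdrop x y) = drop (length (els x)) (els y)"
proof -
  have cdr: "els (cdr v) = drop 1 (els v)" for v by (cases v) simp_all
  have "els (foldl (\<lambda>v a. cdr v) y xs) = drop (length xs) (els y)" for xs
    by (induction xs arbitrary: y) (simp_all add: cdr)
  then show ?thesis by (simp add: tdrop_def)
qed

lemma FP_tdrop [FP_intros]: "FP f \<Longrightarrow> FP g \<Longrightarrow> FP (\<lambda>t. tdrop (f t) (g t))"
  unfolding tdrop_def
proof (rule FP_foldl[where h = "\<lambda>a v c. cdr v" and q = 0 and c = "\<lambda>_. Leaf"])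
  show "tsize (cdr v) \<le> tsize v + poly 0 (tsize a + tsize c)" for a v c :: tree by (cases v) simp_all
qed (intro FP_intros | assumption)+

definition ttake :: "tree \<Rightarrow> tree \<Rightarrow> tree" where
  "ttake x y = rapp (tdrop (tdrop x y) (rapp y Leaf)) Leaf"

lemma els_ttake [simp]: "els (ttake x y) = take (length (els x)) (els y)"
  by (cases "length (els x) \<le> length (els y)") (simp_all add: ttake_def drop_rev)

lemma FP_ttake [FP_intros]: "FP f \<Longrightarrow> FP g \<Longrightarrow> FP (\<lambda>t. ttake (f t) (g t))"
  unfolding ttake_def by (intro FP_intros)

definition un :: "nat \<Rightarrow> tree" where "un n = tlist (replicate n Leaf)"

lemma els_un [simp]: "els (un n) = replicate n Leaf" by (simp add: un_def)

lemma un_inj [simp]: "un m = un n \<longleftrightarrow> m = n"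
  by (metis els_un length_replicate)

lemma un_simps [simp]: "un 0 = Leaf" "un (Suc n) = Node Leaf (un n)" "un n = Leaf \<longleftrightarrow> n = 0"
  by (simp_all add: un_def) (cases n; simp)

lemma tsize_un [simp]: "tsize (un n) = 2 * n + 1"
  by (induction n) simp_all

subsection \<open>From functions on trees to functions and languages of words\<close>

definition blist :: "bool list \<Rightarrow> tree" where "blist w = tlist (map tb w)"

lemma blist_simps [simp]: "blist [] = Leaf" "blist (b # w) = Node (tb b) (blist w)"
  "els (blist w) = map tb w"
  by (simp_all add: blist_def)

lemma tsize_blist: "tsize (blist w) \<le> 4 * length w + 1"
  by (induction w) (simp_all add: tb_def)

definition input_body :: com where
  "input_body = CIf R0 CSkip (CPop R0 ;; CPush R4 False ;; CPush R4 True)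
     (CPop R0 ;; CPush R4 False ;; CPush R4 False ;; CPush R4 True ;; CPush R4 True)"

lemma runs_input_body:
  "s R0 = b # w \<Longrightarrow> runs 20 input_body s (s(R0 := w, R4 := True # enc (tb b) @ s R4))"
proof (cases b)
  case True
  assume "s R0 = b # w"
  with True show ?thesis unfolding input_body_def
    by (intro runs_cong[OF runs_If_True[where xs = w, OF _ _ runs_Seq[OF runs_Pop runs_Seq[OF runs_Push
      runs_Seq[OF runs_Push runs_Seq[OF runs_Push runs_Push]]]]]]) (auto simp: fun_eq_iff)
next
  case False
  assume "s R0 = b # w"
  with False show ?thesis unfolding input_body_def
    by (intro runs_cong[OF runs_If_False[where xs = w, OF _ _ runs_Seq[OF runs_Pop runs_Seq[OF runs_Push
      runs_Push]]]]) (auto simp: fun_eq_iff)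
qed

lemma runs_input_loop:
  "s R0 = w \<Longrightarrow> s R4 = enc (blist v) @ zs \<Longrightarrow> runs (25 * length w + 1) (CWhile R0 True input_body) s
    (s(R0 := [], R4 := enc (blist (rev w @ v)) @ zs))"
proof (induction w arbitrary: s v)
  case Nil
  then show ?case by (intro runs_cong[OF runs_While_stop]) (auto simp: fun_eq_iff)
next
  case (Cons b w)
  let ?s1 = "s(R0 := w, R4 := True # enc (tb b) @ s R4)"
  have 1: "runs 20 input_body s ?s1" using Cons.prems by (intro runs_input_body)
  have 2: "runs (25 * length w + 1) (CWhile R0 True input_body) ?s1
    (?s1(R0 := [], R4 := enc (blist (rev w @ (b # v))) @ zs))"
    using Cons.prems by (intro Cons.IH) simp_all
  show ?case
    by (rule runs_cong[OF runs_While_loop[OF _ _ _ 1 2]]) (use Cons.prems in \<open>auto simp: fun_eq_iff\<close>)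
qed

definition input_code :: com where
  "input_code = CPush R4 False ;; CWhile R0 True input_body ;; unstash_code"

lemma runs_input_code:
  "runs (200 * length w + 100) input_code (input_store w) ((\<lambda>_. [])(R0 := enc (blist (rev w))))"
  unfolding input_code_def
  by (rule runs_cong, rule runs_Seq, rule runs_Push, simp,
      rule runs_Seq, rule runs_input_loop[where w = w and v = "[]" and zs = "[]"],
      simp add: input_store_def, simp add: input_store_def,
      rule runs_unstash[where t = "blist (rev w)" and xs = "[]"], simp)
    (use tsize_blist[of "rev w"] in \<open>auto simp: input_store_def fun_eq_iff\<close>)

definition output_body :: com where
  "output_body = CPop R0 ;; CIf R0 CSkip (CPop R0 ;; CEmit False) (CPop R0 ;; CPop R0 ;; CPop R0 ;; CEmit True)"

lemma runs_output_body:
  "s R0 = True # enc (tb b) @ xs \<Longrightarrow> runs 20 output_body s (s(R0 := xs, RO := s RO @ [b]))"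
proof (cases b)
  case True
  assume "s R0 = True # enc (tb b) @ xs"
  with True show ?thesis unfolding output_body_def
    by (intro runs_cong[OF runs_Seq[OF runs_Pop runs_If_True[where xs = "False # False # xs",
        OF _ _ runs_Seq[OF runs_Pop runs_Seq[OF runs_Pop
      runs_Seq[OF runs_Pop runs_Emit]]]]]]) (auto simp: fun_eq_iff)
next
  case False
  assume "s R0 = True # enc (tb b) @ xs"
  with False show ?thesis unfolding output_body_def
    by (intro runs_cong[OF runs_Seq[OF runs_Pop runs_If_False[where xs = xs, OF _ _ runs_Seq[OF runs_Pop
      runs_Emit]]]]) (auto simp: fun_eq_iff)
qed

lemma runs_output_loop:
  "s R0 = enc (blist v) @ xs \<Longrightarrow> runs (25 * length v + 1) (CWhile R0 False output_body) s
    (s(R0 := False # xs, RO := s RO @ v))"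
proof (induction v arbitrary: s)
  case Nil
  then show ?case by (intro runs_cong[OF runs_While_stop[where xs = xs]]) (auto simp: fun_eq_iff)
next
  case (Cons b v)
  let ?s1 = "s(R0 := enc (blist v) @ xs, RO := s RO @ [b])"
  have 1: "runs 20 output_body s ?s1" using Cons.prems by (intro runs_output_body) simp
  have 2: "runs (25 * length v + 1) (CWhile R0 False output_body) ?s1
    (?s1(R0 := False # xs, RO := ?s1 RO @ v))"
    by (rule Cons.IH) simp_all
  show ?case
    by (rule runs_cong[OF runs_While_loop[where b = True, OF _ _ _ 1 2]])
      (use Cons.prems in \<open>auto simp: fun_eq_iff\<close>)
qed

text \<open>Reading the input from its front and stacking the bits reverses the word. The reversal
  \<open>rapp\<close> is itself in \<open>FP\<close> and is absorbed into the code
  \<open>c\<close>.\<close>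

lemma FP_on_reversed:
  assumes "FP f"
  obtains c p where "\<And>w. runs (poly p (length w)) (input_code ;; c) (input_store w)
    ((\<lambda>_. [])(R0 := enc (f (blist w))))"
proof -
  have "FP (\<lambda>t. f (rapp t Leaf))" by (intro FP_comp[OF assms] FP_intros)
  then obtain c p where c: "realizes c p (\<lambda>t. f (rapp t Leaf))" by (auto simp: FP_def)
  let ?p = "[:101, 200:] + p \<circ>\<^sub>p [:1, 4:]"
  have "runs (poly ?p (length w)) (input_code ;; c) (input_store w)
    ((\<lambda>_. [])(R0 := enc (f (blist w))))" for w
  proof -
    have "rapp (blist (rev w)) Leaf = blist w" by (rule tree_eqI) (simp add: rev_map)
    moreover have "poly p (tsize (blist (rev w))) \<le> poly p (1 + 4 * length w)"
      using tsize_blist[of "rev w"] by (intro poly_nat_mono) simp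
    ultimately show ?thesis
      by (intro runs_cong[OF runs_Seq[OF runs_input_code
          realizesD[OF c, where t = "blist (rev w)" and xs = "[]"]]])
        (simp_all add: poly_pcompose algebra_simps)
  qed
  then show thesis by (rule that)
qed

theorem FP_polytime_computable:
  assumes "FP f" "\<And>w. f (blist w) = blist (g w)"
  shows "polytime_computable g"
proof -
  obtain c p where c: "\<And>w. runs (poly p (length w)) (input_code ;; c) (input_store w)
    ((\<lambda>_. [])(R0 := enc (f (blist w))))"
    using FP_on_reversed[OF assms(1)] by blast
  obtain q where q: "\<And>t. tsize (f t) \<le> poly q (tsize t)" using FP_size[OF assms(1)] by blast
  let ?p = "p + [:2:] + smult 25 (q \<circ>\<^sub>p [:1, 4:])"
  have "\<exists>B m s. exec B ((input_code ;; c) ;; CWhile R0 False output_body) (input_store w) m s \<and>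
    m \<le> poly ?p (length w) \<and> s RO = g w" for w
  proof -
    have "length (g w) \<le> tsize (blist (g w))"
      using length_els_le[of "blist (g w)"] by simp
    also have "\<dots> \<le> poly q (tsize (blist w))" using q[of "blist w"] assms(2) by simp
    also have "\<dots> \<le> poly q (1 + 4 * length w)" using tsize_blist[of w] by (intro poly_nat_mono) simp
    finally have len: "length (g w) \<le> poly q (1 + 4 * length w)" .
    let ?s = "(\<lambda>_. [])(R0 := enc (f (blist w)))"
    have "runs (poly ?p (length w)) ((input_code ;; c) ;; CWhile R0 False output_body) (input_store w)
      (?s(R0 := [False], RO := ?s RO @ g w))"
      using len by (intro runs_cong[OF runs_Seq[OF c runs_output_loop[where v = "g w" and xs = "[]"]]])
        (simp_all add: assms(2) poly_pcompose algebra_simps)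
    then show ?thesis by (force simp: runs_def)
  qed
  then show ?thesis by (rule polytime_computableI)
qed

text \<open>
  The first component of a configuration is \<open>Leaf\<close> if the computation is finished, and the second
  one is then the answer.
\<close>

theorem FP_loop_PSPACE:
  assumes "FP init" "FP step"
    and conf: "\<And>w. \<exists>N. (\<forall>i\<le>N. tsize ((step ^^ i) (init (blist w))) \<le> poly q (length w) \<and>
        (step ^^ i) (init (blist w)) \<noteq> Leaf) \<and>
      (\<forall>i<N. car ((step ^^ i) (init (blist w))) \<noteq> Leaf) \<and>
      car ((step ^^ N) (init (blist w))) = Leaf \<and>
      (cdr ((step ^^ N) (init (blist w))) \<noteq> Leaf \<longleftrightarrow> w \<in> L)"
  shows "L \<in> PSPACE"
proof -
  obtain c p where c: "\<And>w. runs (poly p (length w)) (input_code ;; c) (input_store w)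
    ((\<lambda>_. [])(R0 := enc (init (blist w))))"
    using FP_on_reversed[OF assms(1)] by blast
  from assms(2) obtain d u where d: "realizes d u step" by (auto simp: FP_def)
  let ?body = "CPush R0 True ;; d ;; CPop R0"
  let ?code = "(input_code ;; c) ;; CPop R0 ;; CWhile R0 False ?body ;; CPop R0"
  define r where "r = [:10, 1:] + p + q + u \<circ>\<^sub>p q"
  have "length w \<le> poly r (length w) \<and>
    (\<exists>m s xs. exec (poly r (length w)) ?code (input_store w) m s \<and> s R0 = (w \<in> L) # xs)" for w
  proof -
    let ?B = "poly r (length w)"
    define cf where "cf i = (step ^^ i) (init (blist w))" for i
    \<comment> \<open>The leading \<open>True\<close> of the pair is left out, so that the top bit
      of \<open>R0\<close> is the first bit of the first component, which is \<open>True\<close>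
      exactly as long as the loop has to continue. The body restores the missing bit before it
      applies \<open>step\<close>.\<close>
    define st where "st i = (\<lambda>_. [])(R0 := tl (enc (cf i)))" for i
    from conf[of w] obtain N where sz: "\<And>i. i \<le> N \<Longrightarrow> tsize (cf i) \<le> poly q (length w)"
      and nl: "\<And>i. i \<le> N \<Longrightarrow> cf i \<noteq> Leaf" and go: "\<And>i. i < N \<Longrightarrow> car (cf i) \<noteq> Leaf"
      and stop: "car (cf N) = Leaf" and ans: "cdr (cf N) \<noteq> Leaf \<longleftrightarrow> w \<in> L"
      unfolding cf_def by blast
    have enc_cf: "enc (cf i) = True # enc (car (cf i)) @ enc (cdr (cf i))" if "i \<le> N" for i
      using nl[OF that] by (cases "cf i") simp_all
    have size_st: "store_size (st i) \<le> poly q (length w)" if "i \<le> N" for i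
      using sz[OF that] by (simp add: st_def store_size_def)
    have loop: "\<exists>m. exec ?B (CWhile R0 False ?body) (st i) m (st N)" if "i \<le> N" for i
      using that
    proof (induction i rule: inc_induct)
      case base
      have "st N R0 = False # enc (cdr (cf N))" using enc_cf[of N] stop by (simp add: st_def)
      then show ?case using exec_While_stop[of R0 "st N" False "enc (cdr (cf N))"] by blast
    next
      case (step i)
      then have i: "i \<le> N" "Suc i \<le> N" by simp_all
      have "poly u (tsize (cf i)) \<le> poly u (poly q (length w))" by (intro poly_nat_mono sz i)
      then have rb: "runs (poly u (poly q (length w)) + 5) ?body (st i) (st (Suc i))"
        using enc_cf[OF i(1)] enc_cf[OF i(2)]
        by (intro runs_cong[OF runs_Seq[OF runs_Push runs_Seq[OF
            realizesD[OF d, where t = "cf i" and xs = "[]"] runs_Pop]]])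
          (auto simp: st_def cf_def fun_eq_iff)
      \<comment> \<open>Only a single iteration needs a time bound: its space is at most the size of
        the configuration plus its time. The number \<open>N\<close> of iterations does not
        enter.\<close>
      have "store_size (st i) + (poly u (poly q (length w)) + 5) \<le> ?B"
        using size_st[OF i(1)] by (simp add: r_def poly_pcompose)
      from runs_exec[OF rb this] obtain m where "exec ?B ?body (st i) m (st (Suc i))" by blast
      moreover obtain b xs where "st i R0 = True # xs"
        using enc_cf[OF i(1)] go[of i] i by (cases "car (cf i)") (auto simp: st_def)
      ultimately show ?case using step.IH by (blast intro: exec_While_loop)
    qed
    have ri: "runs (poly p (length w) + 2) (input_code ;; c) (input_store w) ((\<lambda>_. [])(R0 := enc (cf 0)))"
      by (intro runs_cong[OF c]) (simp_all add: cf_def)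
    have "store_size (input_store w) + (poly p (length w) + 2) \<le> ?B"
      by (simp add: r_def store_size_def input_store_def)
    from runs_exec[OF ri this]
    obtain m0 where m0: "exec ?B (input_code ;; c) (input_store w) m0 ((\<lambda>_. [])(R0 := enc (cf 0)))"
      by blast
    have m1: "exec ?B (CPop R0) ((\<lambda>_. [])(R0 := enc (cf 0))) 1 (st 0)"
      using exec_Pop[of R0 "(\<lambda>_. [])(R0 := enc (cf 0))" True "tl (enc (cf 0))" ?B] enc_cf[of 0]
      by (auto simp: st_def)
    from loop[of 0] obtain m2 where m2: "exec ?B (CWhile R0 False ?body) (st 0) m2 (st N)" by auto
    have m3: "exec ?B (CPop R0) (st N) 1 ((st N)(R0 := enc (cdr (cf N))))"
      using exec_Pop[of R0 "st N" False "enc (cdr (cf N))" ?B] enc_cf[of N] stop by (simp add: st_def)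
    have "\<exists>xs. enc (cdr (cf N)) = (w \<in> L) # xs" using ans by (cases "cdr (cf N)") auto
    with exec_Seq[OF m0 exec_Seq[OF m1 exec_Seq[OF m2 m3]]] show ?thesis
      by (auto simp: r_def) (metis fun_upd_same)
  qed
  then show ?thesis by (rule PSPACE_I)
qed

section \<open>Compositional semantics of regexes\<close>

text \<open>The rest of a list of actions is run from each leaf of the part before it, in priority
  order, and lookarounds evaluate their bodies without the rest. So a continuation can be factored
  out.\<close>

lemma leaves_append:
  "leaves W s (l1 @ l2) p \<gamma> d =
    concat (map (\<lambda>(p', \<gamma>'). leaves W s l2 p' \<gamma>' d) (leaves W s l1 p \<gamma> d))"
  by (induction W s l1 p \<gamma> d rule: leaves.induct)
    (auto simp: Let_def fun_upd_def split: option.splits group_state.splits direction.splits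
      greediness.splits polarity.splits list.splits)

text \<open>Matching depends only on whether there is a result at all. The order matters in one
  place, the choice of the first result of a positive lookaround, and the regexes constructed below
  make that choice harmless.\<close>

definition outs :: "'a set \<Rightarrow> 'a list \<Rightarrow> 'a regex \<Rightarrow> nat \<Rightarrow> group_map \<Rightarrow> direction \<Rightarrow> (nat \<times> group_map) set"
  where "outs W s r p \<gamma> d = set (leaves W s [Areg r] p \<gamma> d)"

lemma leaves_Cons:
  "leaves W s (Areg r # l) p \<gamma> d =
    concat (map (\<lambda>(p', \<gamma>'). leaves W s l p' \<gamma>' d) (leaves W s [Areg r] p \<gamma> d))"
  using leaves_append[of W s "[Areg r]" l] by simp

lemma set_leaves_Cons:
  "set (leaves W s (Areg r # l) p \<gamma> d) = (\<Union>(p', \<gamma>') \<in> outs W s r p \<gamma> d. set (leaves W s l p' \<gamma>' d))"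
  by (subst leaves_Cons) (auto simp: outs_def)

fun action_groups :: "'a action \<Rightarrow> nat set" where
  "action_groups (Areg r) = set (groups r)"
| "action_groups (Aclose g) = {g}"
| "action_groups (Acheck k) = {}"

lemma leaves_other_groups:
  "(p', \<gamma>') \<in> set (leaves W s l p \<gamma> d) \<Longrightarrow> \<forall>a \<in> set l. g \<notin> action_groups a \<Longrightarrow> \<gamma>' g = \<gamma> g"
proof (induction W s l p \<gamma> d arbitrary: p' \<gamma>' rule: leaves.induct)
  case (11 W s d' b r l p \<gamma> d)
  show ?case
  proof (cases "leaves W s [Areg r] p \<gamma> d'")
    case Nil
    with 11 show ?thesis by (cases b) auto
  next
    case (Cons x xs)
    obtain q \<delta> where x: "x = (q, \<delta>)" by force
    show ?thesis
    proof (cases b)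
      case Positive
      have "\<delta> g = \<gamma> g" using 11(1)[of q \<delta>] 11(5) Cons x by auto
      with 11 Cons x Positive show ?thesis by fastforce
    next
      case Negative
      with 11 Cons show ?thesis by auto
    qed
  qed
next
  case (5 W s cd l p \<gamma> d)
  then show ?case by (cases "read_char s cd p d") auto
next
  case (13 W s h l p \<gamma> d)
  then show ?case
    \<comment> \<open>The definite descriptions denote the ends of the range of the group in the
      case where it is closed, before the case distinction has given them names.\<close>
    by (cases "\<gamma> h"; cases "read_factor s (factor s (THE a. \<exists>b. \<gamma> h = Closed a b) (THE b. \<exists>a. \<gamma> h = Closed a b)) p d") auto
qed (auto simp: Let_def reset_def fun_upd_def
    split: option.splits group_state.splits direction.splits greediness.splits if_splits)

lemma outs_other_groups: "(p', \<gamma>') \<in> outs W s r p \<gamma> d \<Longrightarrow> g \<notin> set (groups r) \<Longrightarrow> \<gamma>' g = \<gamma> g"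
  unfolding outs_def using leaves_other_groups[of p' \<gamma>' W s "[Areg r]"] by simp

definition ranges_within :: "nat \<Rightarrow> group_map \<Rightarrow> bool" where
  "ranges_within n \<gamma> \<longleftrightarrow> (\<forall>g a b. \<gamma> g = Closed a b \<longrightarrow> a \<le> b \<and> b \<le> n) \<and>
     (\<forall>g a. \<gamma> g = Opened a \<longrightarrow> a \<le> n)"

lemma ranges_within_reset: "ranges_within n \<gamma> \<Longrightarrow> ranges_within n (reset \<gamma> r)"
  by (simp add: ranges_within_def reset_def)

lemma read_char_within: "read_char s cd p d = Some p' \<Longrightarrow> p \<le> length s \<Longrightarrow> p' \<le> length s"
  by (cases d) (auto split: if_splits)

lemma read_factor_within: "read_factor s w p d = Some p' \<Longrightarrow> p \<le> length s \<Longrightarrow> p' \<le> length s"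
  using read_factor_progress(1)[of s w p d p'] by simp

lemma ranges_within_open: "ranges_within n \<gamma> \<Longrightarrow> p \<le> n \<Longrightarrow> ranges_within n (\<gamma>(g := Opened p))"
  by (simp add: ranges_within_def)

lemma ranges_within_close:
  "ranges_within n \<gamma> \<Longrightarrow> p \<le> n \<Longrightarrow> \<gamma> g = Opened a \<Longrightarrow> ranges_within n (\<gamma>(g := Closed (min a p) (max a p)))"
  by (auto simp: ranges_within_def)

lemma leaves_within:
  "(p', \<gamma>') \<in> set (leaves W s l p \<gamma> d) \<Longrightarrow> p \<le> length s \<Longrightarrow> ranges_within (length s) \<gamma> \<Longrightarrow>
    p' \<le> length s \<and> ranges_within (length s) \<gamma>'"
proof (induction W s l p \<gamma> d arbitrary: p' \<gamma>' rule: leaves.induct)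
  case (11 W s d' b r l p \<gamma> d)
  show ?case
  proof (cases "leaves W s [Areg r] p \<gamma> d'")
    case Nil
    with 11 show ?thesis by (cases b) auto
  next
    case (Cons x xs)
    obtain q \<delta> where x: "x = (q, \<delta>)" by force
    show ?thesis
    proof (cases b)
      case Positive
      have "ranges_within (length s) \<delta>" using 11(1)[of q \<delta>] 11(5,6) Cons x by auto
      with 11 Cons x Positive show ?thesis by fastforce
    next
      case Negative
      with 11 Cons show ?thesis by auto
    qed
  qed
next
  case (10 W s g r l p \<gamma> d)
  then show ?case using ranges_within_open[of "length s" \<gamma> p g] by (auto simp: fun_upd_def)
next
  case (3 W s g l p \<gamma> d)
  then show ?case using ranges_within_close[of "length s" \<gamma> p g]
    by (cases "\<gamma> g") (auto simp: fun_upd_def)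
next
  case (5 W s cd l p \<gamma> d)
  then show ?case by (cases "read_char s cd p d") (auto dest: read_char_within)
next
  case (13 W s g l p \<gamma> d)
  then show ?case
    by (cases "\<gamma> g"; cases "read_factor s (factor s (THE a. \<exists>b. \<gamma> g = Closed a b) (THE b. \<exists>a. \<gamma> g = Closed a b)) p d")
      (auto, (metis read_factor_within)+)
qed (auto simp: Let_def ranges_within_reset
    split: option.splits group_state.splits direction.splits greediness.splits if_splits)

lemma outs_within:
  "(p', \<gamma>') \<in> outs W s r p \<gamma> d \<Longrightarrow> p \<le> length s \<Longrightarrow> ranges_within (length s) \<gamma> \<Longrightarrow>
    p' \<le> length s \<and> ranges_within (length s) \<gamma>'"
  unfolding outs_def by (rule leaves_within)

lemma outs_Eps [simp]: "outs W s Eps p \<gamma> d = {(p, \<gamma>)}"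
  by (simp add: outs_def)

lemma outs_Alt [simp]: "outs W s (Alt r1 r2) p \<gamma> d = outs W s r1 p \<gamma> d \<union> outs W s r2 p \<gamma> d"
  by (simp add: outs_def)

lemma outs_Seq_Forward:
  "outs W s (Seq r1 r2) p \<gamma> Forward = (\<Union>(p', \<gamma>') \<in> outs W s r1 p \<gamma> Forward. outs W s r2 p' \<gamma>' Forward)"
  using set_leaves_Cons[of W s r1 "[Areg r2]" p \<gamma> Forward] by (simp add: outs_def)

lemma outs_Seq_Backward:
  "outs W s (Seq r1 r2) p \<gamma> Backward = (\<Union>(p', \<gamma>') \<in> outs W s r2 p \<gamma> Backward. outs W s r1 p' \<gamma>' Backward)"
  using set_leaves_Cons[of W s r2 "[Areg r1]" p \<gamma> Backward] by (simp add: outs_def)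

lemma outs_Anchor: "outs W s (Anchor a) p \<gamma> d = (if anchor_holds W s a p then {(p, \<gamma>)} else {})"
  by (simp add: outs_def)

lemma outs_Group:
  "outs W s (Group g r) p \<gamma> d = (\<Union>(p', \<gamma>') \<in> outs W s r p (\<gamma>(g := Opened p)) d.
     {(p', case \<gamma>' g of Opened a \<Rightarrow> \<gamma>'(g := Closed (min a p') (max a p')) | _ \<Rightarrow> \<gamma>')})"
  using set_leaves_Cons[of W s r "[Aclose g]" p "\<gamma>(g := Opened p)" d]
  by (force simp: outs_def split: group_state.splits)

lemma outs_Look_empty_iff: "outs W s (Look d' Positive r) p \<gamma> d = {} \<longleftrightarrow> outs W s r p \<gamma> d' = {}"
  by (cases "leaves W s [Areg r] p \<gamma> d'") (auto simp: outs_def)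

text \<open>The set of results does not tell which one comes first, but if all have the same group
  map, then the first one has it too.\<close>

lemma outs_Look_const:
  assumes "\<And>q \<delta>. (q, \<delta>) \<in> outs W s r p \<gamma> d' \<Longrightarrow> \<delta> = \<gamma>'"
  shows "outs W s (Look d' Positive r) p \<gamma> d = (if outs W s r p \<gamma> d' = {} then {} else {(p, \<gamma>')})"
  using assms by (cases "leaves W s [Areg r] p \<gamma> d'") (auto simp: outs_def)

lemma outs_Look_pos: "(q, \<delta>) \<in> outs W s (Look d' b r) p \<gamma> d \<Longrightarrow> q = p"
  by (cases b) (auto simp: outs_def split: list.splits)

lemma outs_star:
  "outs W s (Quant r 0 \<infinity> \<kappa>) p \<gamma> d = insert (p, \<gamma>)
    (\<Union>(p', \<gamma>') \<in> outs W s r p (reset \<gamma> r) d. if further d p' p then outs W s (Quant r 0 \<infinity> \<kappa>) p' \<gamma>' d else {})"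
  using set_leaves_Cons[of W s r "[Acheck p, Areg (Quant r 0 \<infinity> \<kappa>)]" p "reset \<gamma> r" d]
  by (subst outs_def) (cases \<kappa>; force simp: Let_def outs_def split: if_splits)

section \<open>Unary strings\<close>

definition width :: "group_map \<Rightarrow> nat \<Rightarrow> nat" where
  "width \<gamma> g = (case \<gamma> g of Closed a b \<Rightarrow> b - a | _ \<Rightarrow> 0)"

definition any_star :: "'a regex" where "any_star = Quant (Chars UNIV) 0 \<infinity> Greedy"

definition char_power :: "nat \<Rightarrow> 'a regex" where
  "char_power v = foldr Seq (replicate v (Chars UNIV)) Eps"

definition at_length :: "nat \<Rightarrow> 'a regex" where
  "at_length v = Look Backward Positive (Seq (Anchor Input_Start) (char_power v))"

text \<open>Inside of a lookbehind a sequence is processed from right to left: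
  \<open>any_star\<close> runs back, the anchor keeps only the start of the string, and the
  lookahead then evaluates \<open>r\<close> from there. Being a lookaround, the whole leaves the
  position as it was.\<close>

definition restart :: "'a regex \<Rightarrow> 'a regex" where
  "restart r = Look Backward Positive (Seq (Look Forward Positive r) (Seq (Anchor Input_Start) any_star))"

text \<open>From the start of a unary string the backreference leads exactly to the position that
  equals the width of the group, and \<open>at_length\<close> succeeds at position \<open>v\<close>
  only.\<close>

definition test :: "nat \<Rightarrow> nat \<Rightarrow> 'a regex" where
  "test g v = restart (Seq (Backref g) (at_length v))"

definition alts :: "'a regex list \<Rightarrow> 'a regex" where "alts rs = foldr Alt rs (Chars {})"
definition seqs :: "'a regex list \<Rightarrow> 'a regex" where "seqs rs = foldr Seq rs Eps"

section \<open>Results on a unary string\<close>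

context
  fixes W :: "'a set" and c :: 'a and N :: nat
begin

abbreviation "uouts \<equiv> outs W (replicate N c)"
abbreviation "fits \<equiv> ranges_within N"

lemma uouts_within: "(p', \<gamma>') \<in> uouts r p \<gamma> d \<Longrightarrow> p \<le> N \<Longrightarrow> fits \<gamma> \<Longrightarrow> p' \<le> N \<and> fits \<gamma>'"
  using outs_within[of p' \<gamma>' W "replicate N c" r p \<gamma> d] by simp

lemma uouts_Chars:
  "uouts (Chars UNIV) p \<gamma> Forward = (if p < N then {(p + 1, \<gamma>)} else {})"
  "uouts (Chars UNIV) p \<gamma> Backward = (if 0 < p \<and> p \<le> N then {(p - 1, \<gamma>)} else {})"
  by (simp_all add: outs_def)

lemma uouts_Chars_empty [simp]: "uouts (Chars {}) p \<gamma> d = {}"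
  by (cases d) (simp_all add: outs_def)

lemma reset_Chars [simp]: "reset \<gamma> (Chars cd) = \<gamma>"
  by (simp add: reset_def)

lemma uouts_any_star_Forward: "p \<le> N \<Longrightarrow> uouts any_star p \<gamma> Forward = {(q, \<gamma>) | q. p \<le> q \<and> q \<le> N}"
proof (induction "N - p" arbitrary: p)
  case 0
  then have p: "p = N" by simp
  show ?case unfolding any_star_def p by (subst outs_star) (auto simp: uouts_Chars)
next
  case (Suc n)
  then have "uouts any_star (Suc p) \<gamma> Forward = {(q, \<gamma>) | q. Suc p \<le> q \<and> q \<le> N}" by simp
  with Suc show ?case unfolding any_star_def
    by (subst outs_star) (auto simp: uouts_Chars le_Suc_eq Suc_le_eq order.order_iff_strict)
qed

lemma uouts_any_star_Backward: "p \<le> N \<Longrightarrow> uouts any_star p \<gamma> Backward = {(q, \<gamma>) | q. q \<le> p}"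
proof (induction p)
  case 0
  then show ?case unfolding any_star_def by (subst outs_star) (auto simp: uouts_Chars)
next
  case (Suc p)
  then have "uouts any_star p \<gamma> Backward = {(q, \<gamma>) | q. q \<le> p}" by simp
  with Suc show ?case unfolding any_star_def
    by (subst outs_star) (auto simp: uouts_Chars le_Suc_eq)
qed

lemma uouts_char_power_Forward:
  "p \<le> N \<Longrightarrow> uouts (char_power v) p \<gamma> Forward = (if p + v \<le> N then {(p + v, \<gamma>)} else {})"
  by (induction v arbitrary: p) (auto simp: char_power_def outs_Seq_Forward uouts_Chars)

lemma uouts_char_power_Backward:
  "p \<le> N \<Longrightarrow> uouts (char_power v) p \<gamma> Backward = (if v \<le> p then {(p - v, \<gamma>)} else {})"
  by (induction v arbitrary: p) (auto simp: char_power_def outs_Seq_Backward uouts_Chars)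

lemma uouts_at_length:
  "p \<le> N \<Longrightarrow> uouts (at_length v) p \<gamma> d = (if p = v then {(p, \<gamma>)} else {})"
  unfolding at_length_def
  by (subst outs_Look_const[where \<gamma>' = \<gamma>])
    (auto simp: outs_Seq_Backward uouts_char_power_Backward outs_Anchor split: if_splits)

lemma uouts_restart_empty_iff:
  "p \<le> N \<Longrightarrow> uouts (restart r) p \<gamma> d = {} \<longleftrightarrow> uouts r 0 \<gamma> Forward = {}"
  unfolding restart_def outs_Look_empty_iff
  by (auto simp: outs_Seq_Backward uouts_any_star_Backward outs_Anchor outs_Look_empty_iff)

lemma uouts_restart_const:
  assumes "p \<le> N" "\<And>q \<delta>. (q, \<delta>) \<in> uouts r 0 \<gamma> Forward \<Longrightarrow> \<delta> = \<gamma>"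
  shows "uouts (restart r) p \<gamma> d = (if uouts r 0 \<gamma> Forward = {} then {} else {(p, \<gamma>)})"
proof -
  have L: "uouts (Look Forward Positive r) 0 \<gamma> Backward =
      (if uouts r 0 \<gamma> Forward = {} then {} else {(0, \<gamma>)})"
    by (rule outs_Look_const) (rule assms(2))
  have "uouts (Seq (Look Forward Positive r) (Seq (Anchor Input_Start) any_star)) p \<gamma> Backward =
      uouts (Look Forward Positive r) 0 \<gamma> Backward"
    using assms(1) by (auto simp: outs_Seq_Backward uouts_any_star_Backward outs_Anchor split: if_splits)
  with L show ?thesis unfolding restart_def
    by (subst outs_Look_const[where \<gamma>' = \<gamma>]) (auto split: if_splits)
qed

text \<open>On a unary string the factor captured by a group is determined by its length, so a
  backreference adds a number to the position. A group that is not closed matches the empty string,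
  in accordance with \<open>width\<close> being \<open>0\<close>.\<close>

lemma uouts_Backref:
  assumes "fits \<gamma>" "p \<le> N"
  shows "uouts (Backref g) p \<gamma> Forward = (if p + width \<gamma> g \<le> N then {(p + width \<gamma> g, \<gamma>)} else {})"
proof (cases "\<gamma> g")
  case (Closed a b)
  with assms(1) have ab: "a \<le> b" "b \<le> N" by (auto simp: ranges_within_def)
  then have f: "factor (replicate N c) a b = replicate (b - a) c" by (simp add: factor_def)
  have "factor (replicate N c) p (p + (b - a)) = replicate (b - a) c \<longleftrightarrow> p + (b - a) \<le> N"
    using assms(2) ab by (auto simp: factor_def min_def)
  with ab Closed show ?thesis by (simp add: outs_def f width_def)
qed (use assms in \<open>simp_all add: outs_def width_def\<close>)

text \<open>A pure regex is a mere test: it neither moves nor captures and has at most one result.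
  Hence alternative and sequence act as disjunction and conjunction of tests, in both
  directions.\<close>

definition pure :: "'a regex \<Rightarrow> (group_map \<Rightarrow> bool) \<Rightarrow> bool" where
  "pure r P \<longleftrightarrow> (\<forall>p \<gamma> d. p \<le> N \<longrightarrow> fits \<gamma> \<longrightarrow> uouts r p \<gamma> d = (if P \<gamma> then {(p, \<gamma>)} else {}))"

lemma pureD: "pure r P \<Longrightarrow> p \<le> N \<Longrightarrow> fits \<gamma> \<Longrightarrow> uouts r p \<gamma> d = (if P \<gamma> then {(p, \<gamma>)} else {})"
  unfolding pure_def by blast

lemma pure_test: "pure (test g v) (\<lambda>\<gamma>. width \<gamma> g = v \<and> v \<le> N)"
  unfolding pure_def
proof (intro allI impI)
  fix p \<gamma> d assume p: "p \<le> N" "fits \<gamma>"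
  have "uouts (Seq (Backref g) (at_length v)) 0 \<gamma> Forward = (if width \<gamma> g = v \<and> v \<le> N then {(v, \<gamma>)} else {})"
    using uouts_Backref[OF p(2), of 0 g] by (auto simp: outs_Seq_Forward uouts_at_length split: if_splits)
  with p show "uouts (test g v) p \<gamma> d = (if width \<gamma> g = v \<and> v \<le> N then {(p, \<gamma>)} else {})"
    unfolding test_def by (subst uouts_restart_const) (auto split: if_splits)
qed

lemma width_le: "fits \<gamma> \<Longrightarrow> width \<gamma> g \<le> N"
  by (auto simp: width_def ranges_within_def split: group_state.splits) (metis diff_le_self le_trans)

lemma pure_cong: "pure r P \<Longrightarrow> (\<And>\<gamma>. fits \<gamma> \<Longrightarrow> P \<gamma> = Q \<gamma>) \<Longrightarrow> pure r Q"
  unfolding pure_def by simp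

lemma pure_test': "pure (test g v) (\<lambda>\<gamma>. width \<gamma> g = v)"
  by (rule pure_cong[OF pure_test]) (auto dest: width_le)

lemma pure_Alt: "pure r P \<Longrightarrow> pure r' Q \<Longrightarrow> pure (Alt r r') (\<lambda>\<gamma>. P \<gamma> \<or> Q \<gamma>)"
  unfolding pure_def by auto

lemma pure_Seq: "pure r P \<Longrightarrow> pure r' Q \<Longrightarrow> pure (Seq r r') (\<lambda>\<gamma>. P \<gamma> \<and> Q \<gamma>)"
  unfolding pure_def
proof (intro allI impI)
  fix p \<gamma> d
  assume "\<forall>p \<gamma> d. p \<le> N \<longrightarrow> fits \<gamma> \<longrightarrow> uouts r p \<gamma> d = (if P \<gamma> then {(p, \<gamma>)} else {})"
    "\<forall>p \<gamma> d. p \<le> N \<longrightarrow> fits \<gamma> \<longrightarrow> uouts r' p \<gamma> d = (if Q \<gamma> then {(p, \<gamma>)} else {})" "p \<le> N" "fits \<gamma>"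
  then show "uouts (Seq r r') p \<gamma> d = (if P \<gamma> \<and> Q \<gamma> then {(p, \<gamma>)} else {})"
    by (cases d) (simp_all add: outs_Seq_Forward outs_Seq_Backward)
qed

lemma pure_alts:
  assumes "\<And>x. x \<in> set xs \<Longrightarrow> pure (f x) (P x)"
  shows "pure (alts (map f xs)) (\<lambda>\<gamma>. \<exists>x\<in>set xs. P x \<gamma>)"
  using assms
proof (induction xs)
  case Nil
  then show ?case by (simp add: alts_def pure_def)
next
  case (Cons x xs)
  then show ?case using pure_Alt[of "f x" "P x" "alts (map f xs)"] by (simp add: alts_def)
qed

lemma pure_seqs:
  assumes "\<And>x. x \<in> set xs \<Longrightarrow> pure (f x) (P x)"
  shows "pure (seqs (map f xs)) (\<lambda>\<gamma>. \<forall>x\<in>set xs. P x \<gamma>)"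
  using assms
proof (induction xs)
  case Nil
  then show ?case by (simp add: seqs_def pure_def)
next
  case (Cons x xs)
  then show ?case using pure_Seq[of "f x" "P x" "seqs (map f xs)"] by (simp add: seqs_def)
qed

end

section \<open>Reachability by recursive doubling as a regex\<close>

subsection \<open>Names of groups\<close>

primrec of_bits :: "bool list \<Rightarrow> nat" where
  "of_bits [] = 0"
| "of_bits (b # bs) = of_bool b + 2 * of_bits bs"

lemma nat_tokens_of_bits: "bs = [] \<or> last bs \<Longrightarrow> nat_tokens (of_bits bs) = (map TBit bs :: 'a token list)"
proof (induction bs)
  case Nil
  show ?case by (simp add: nat_tokens.simps[of 0])
next
  case (Cons b bs)
  have pos: "of_bits bs > 0" if "bs \<noteq> []" "last bs" for bs
    using that by (induction bs) (auto split: if_splits)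
  from Cons pos[of bs] have "of_bits (b # bs) \<noteq> 0" by (cases bs) auto
  then have "nat_tokens (of_bits (b # bs)) = (TBit (odd (of_bits (b # bs))) # nat_tokens (of_bits (b # bs) div 2) :: 'a token list)"
    by (simp add: nat_tokens.simps[of "of_bits (b # bs)"] del: of_bits.simps)
  also have "odd (of_bits (b # bs)) = b" by (cases b) simp_all
  also have "of_bits (b # bs) div 2 = of_bits bs" by (cases b) simp_all
  also have "nat_tokens (of_bits bs) = (map TBit bs :: 'a token list)" using Cons by (cases "bs = []") simp_all
  finally show ?case by simp
qed

text \<open>
  The fields of a name are written in unary, and the binary representation of a name is the
  concatenation of its fields. So the names can be written down without any arithmetic.
\<close>

definition name_bits :: "nat \<Rightarrow> nat \<Rightarrow> nat \<Rightarrow> bool list" where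
  "name_bits t k j = replicate t True @ False # replicate k True @ False # replicate j True @ [False, True]"

definition name :: "nat \<Rightarrow> nat \<Rightarrow> nat \<Rightarrow> nat" where
  "name t k j = of_bits (name_bits t k j)"

text \<open>The last bit \<open>True\<close> of \<open>name_bits\<close> is the most significant
  one, so the notation has no leading zeros and is the one that the encoding prescribes.\<close>

lemma nat_tokens_name: "nat_tokens (name t k j) = map TBit (name_bits t k j)"
  unfolding name_def by (rule nat_tokens_of_bits) (simp add: name_bits_def)

lemma replicate_True_False_eq:
  "replicate m True @ False # xs = replicate n True @ False # ys \<longleftrightarrow> m = n \<and> xs = ys"
proof (induction m arbitrary: n)
  case 0
  then show ?case by (cases n) auto
next
  case (Suc m)
  then show ?case by (cases n) auto
qed

lemma name_eq [simp]: "name t k j = name t' k' j' \<longleftrightarrow> t = t' \<and> k = k' \<and> j = j'"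
proof
  assume "name t k j = name t' k' j'"
  then have "map TBit (name_bits t k j) = (map TBit (name_bits t' k' j') :: unit token list)"
    by (simp flip: nat_tokens_name)
  then have "name_bits t k j = name_bits t' k' j'" by (simp add: inj_map_eq_map inj_def)
  then show "t = t' \<and> k = k' \<and> j = j'"
    by (simp add: name_bits_def replicate_True_False_eq)
qed simp

subsection \<open>Capturing several groups in a row\<close>

fun capture_seq :: "(nat \<times> 'a regex) list \<Rightarrow> 'a regex \<Rightarrow> 'a regex" where
  "capture_seq [] rest = rest"
| "capture_seq ((g, r) # xs) rest = Seq (Group g r) (capture_seq xs rest)"

text \<open>Groups captured in a row occupy adjacent ranges, beginning at \<open>p\<close>. Their
  widths can be chosen independently as long as the sum fits into the string.\<close>

fun assign :: "nat \<Rightarrow> group_map \<Rightarrow> (nat \<Rightarrow> nat) \<Rightarrow> nat list \<Rightarrow> group_map" where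
  "assign p \<gamma> v [] = \<gamma>"
| "assign p \<gamma> v (g # gs) = assign (p + v g) (\<gamma>(g := Closed p (p + v g))) v gs"

lemma width_upd: "width (\<gamma>(h := Closed a b)) g = (if g = h then b - a else width \<gamma> g)"
  by (simp add: width_def)

lemma width_assign:
  "distinct gs \<Longrightarrow> width (assign p \<gamma> v gs) g = (if g \<in> set gs then v g else width \<gamma> g)"
proof (induction gs arbitrary: p \<gamma>)
  case (Cons h gs)
  then have "distinct gs" "h \<notin> set gs" by simp_all
  then show ?case using Cons.IH[of "p + v h" "\<gamma>(h := Closed p (p + v h))"]
    by (simp add: width_upd del: fun_upd_apply)
qed simp

lemma assign_cong: "(\<And>g. g \<in> set gs \<Longrightarrow> v g = v' g) \<Longrightarrow> assign p \<gamma> v gs = assign p \<gamma> v' gs"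
proof (induction gs arbitrary: p \<gamma>)
  case (Cons h gs)
  then have "v h = v' h" "\<And>p \<gamma>. assign p \<gamma> v gs = assign p \<gamma> v' gs" by simp_all
  then show ?case by simp
qed simp

lemma ranges_within_assign:
  "ranges_within n \<gamma> \<Longrightarrow> p + sum_list (map v gs) \<le> n \<Longrightarrow> ranges_within n (assign p \<gamma> v gs)"
proof (induction gs arbitrary: p \<gamma>)
  case (Cons h gs)
  from Cons.prems(2) have s: "p + v h + sum_list (map v gs) \<le> n" by simp
  then have "ranges_within n (\<gamma>(h := Closed p (p + v h)))"
    using Cons.prems(1) unfolding ranges_within_def fun_upd_apply by auto
  from Cons.IH[OF this s] show ?case unfolding assign.simps .
qed simp

lemma sum_list_map_bound: "(\<And>x. x \<in> set xs \<Longrightarrow> f x \<le> D) \<Longrightarrow> sum_list (map f xs) \<le> length xs * (D :: nat)"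
proof (induction xs)
  case (Cons x xs)
  then have "f x \<le> D" "sum_list (map f xs) \<le> length xs * D" by simp_all
  then show ?case by simp
qed simp

lemma groups_capture_seq: "groups (capture_seq xs r) = concat (map (\<lambda>(g, q). g # groups q) xs) @ groups r"
  by (induction xs r rule: capture_seq.induct) simp_all

subsection \<open>The regexes\<close>

text \<open>
  The groups named by the tags 0, 1, 2 hold, at level \<open>k\<close>, the start, the end and the midpoint of
  a computation of length \<open>2^k\<close>, where column \<open>j\<close> of a configuration is the length of what group
  \<open>j\<close> has captured. The group with tag 3 captures the prefix before the current position; so its
  length in the two iterations of the loop in \<open>halves\<close> is 0 and 1, and it chooses the half of
  the computation that is copied to the next lower level and checked there.
\<close>

definition bit_capture :: "nat \<Rightarrow> 'a regex" where
  "bit_capture k = Look Backward Positive (Seq (Anchor Input_Start) (Group (name 3 (Suc k) 0) any_star))"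

text \<open>The two tests exclude each other, so the copy is deterministic: \<open>g\<close> is
  copied in the first half and \<open>h\<close> in the second one.\<close>

definition select :: "nat \<Rightarrow> nat \<Rightarrow> nat \<Rightarrow> 'a regex" where
  "select k g h = Alt (Seq (test (name 3 (Suc k) 0) 0) (Backref g)) (Seq (test (name 3 (Suc k) 0) 1) (Backref h))"

definition copies :: "nat \<Rightarrow> nat \<Rightarrow> (nat \<times> 'a regex) list" where
  "copies J k = map (\<lambda>j. (name 0 k j, select k (name 0 (Suc k) j) (name 2 (Suc k) j))) [Suc 0..<Suc J] @
     map (\<lambda>j. (name 1 k j, select k (name 2 (Suc k) j) (name 1 (Suc k) j))) [Suc 0..<Suc J]"

text \<open>The copies are made inside of a lookaround, which gives them the whole string to move in
  and restores the position afterwards. The character read at the end passes the check for progress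
  of the star and sets the position that \<open>bit_capture\<close> sees in the next
  iteration.\<close>

definition half :: "nat \<Rightarrow> nat \<Rightarrow> 'a regex \<Rightarrow> 'a regex" where
  "half J k rest = Seq (bit_capture k) (Seq (restart (capture_seq (copies J k) (restart rest))) (Chars UNIV))"

text \<open>As an iteration reads one character, \<open>at_length 2\<close> at the end enforces
  exactly two iterations.\<close>

definition halves :: "nat \<Rightarrow> nat \<Rightarrow> 'a regex \<Rightarrow> 'a regex" where
  "halves J k rest = Seq (Quant (half J k rest) 0 \<infinity> Greedy) (at_length 2)"

text \<open>The midpoint is captured outside of the lookaround that checks it. So if the check
  fails, backtracking tries other lengths for the columns of the midpoint.\<close>

fun reach_regex :: "nat \<Rightarrow> 'a regex \<Rightarrow> nat \<Rightarrow> 'a regex" where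
  "reach_regex J base 0 = base"
| "reach_regex J base (Suc k) = capture_seq (map (\<lambda>j. (name 2 (Suc k) j, any_star)) [Suc 0..<Suc J])
     (restart (halves J k (reach_regex J base k)))"

definition vec :: "nat \<Rightarrow> group_map \<Rightarrow> nat \<Rightarrow> nat \<Rightarrow> nat \<Rightarrow> nat" where
  "vec J \<gamma> t k = (\<lambda>j. if 1 \<le> j \<and> j \<le> J then width \<gamma> (name t k j) else 0)"

text \<open>Midpoints vanish outside of the columns \<open>1\<close> to \<open>J\<close>, because
  only these are captured; compare \<open>vec\<close>.\<close>

fun reach :: "nat \<Rightarrow> ((nat \<Rightarrow> nat) \<Rightarrow> (nat \<Rightarrow> nat) \<Rightarrow> bool) \<Rightarrow> nat \<Rightarrow> (nat \<Rightarrow> nat) \<Rightarrow> (nat \<Rightarrow> nat) \<Rightarrow> bool" where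
  "reach J St 0 x y = St x y"
| "reach J St (Suc k) x y =
     (\<exists>m. (\<forall>j. \<not> (1 \<le> j \<and> j \<le> J) \<longrightarrow> m j = 0) \<and> reach J St k x m \<and> reach J St k m y)"

lemma groups_any_star [simp]: "groups any_star = []"
  by (simp add: any_star_def)

lemma groups_char_power [simp]: "groups (char_power v) = []"
  by (induction v) (simp_all add: char_power_def)

lemma groups_restart [simp]: "groups (restart r) = groups r"
  by (simp add: restart_def)

lemma groups_test [simp]: "groups (test g v) = []"
  by (simp add: test_def at_length_def)

lemma groups_select [simp]: "groups (select k g h) = []"
  by (simp add: select_def)

lemma groups_copies:
  "concat (map (\<lambda>(g, q). g # groups q) (copies J k)) = map (name 0 k) [Suc 0..<Suc J] @ map (name 1 k) [Suc 0..<Suc J]"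
proof -
  have "concat (map (\<lambda>j. [f j]) xs) = map f xs" for f :: "nat \<Rightarrow> nat" and xs by (induction xs) simp_all
  then show ?thesis by (simp add: copies_def comp_def del: upt_Suc)
qed

lemma groups_half:
  "groups (half J k rest) =
    name 3 (Suc k) 0 # map (name 0 k) [Suc 0..<Suc J] @ map (name 1 k) [Suc 0..<Suc J] @ groups rest"
  by (simp add: half_def bit_capture_def groups_capture_seq groups_copies del: upt_Suc)

lemma groups_reach_regex:
  "groups (reach_regex J base (Suc k)) = map (name 2 (Suc k)) [Suc 0..<Suc J] @ name 3 (Suc k) 0 #
    map (name 0 k) [Suc 0..<Suc J] @ map (name 1 k) [Suc 0..<Suc J] @ groups (reach_regex J base k)"
proof -
  have "concat (map (\<lambda>j. [f j]) xs) = map f xs" for f :: "nat \<Rightarrow> nat" and xs by (induction xs) simp_all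
  then show ?thesis
    by (simp add: halves_def groups_half groups_capture_seq at_length_def comp_def del: upt_Suc)
qed

text \<open>The regex of level \<open>k\<close> never captures the tags \<open>0\<close> and
  \<open>1\<close> of its own level, nor anything of a higher level. So what its caller has stored
  there stays intact.\<close>

lemma groups_reach_regex_names:
  "groups base = [] \<Longrightarrow> g \<in> set (groups (reach_regex J base k)) \<Longrightarrow>
    \<exists>t k' j. g = name t k' j \<and> (k' < k \<or> k' = k \<and> t \<ge> 2)"
proof (induction k)
  case (Suc k)
  from Suc.prems(2) consider "g \<in> set (groups (reach_regex J base k))" | t j where "g = name t k j"
    | t j where "g = name t (Suc k) j" "t \<ge> 2"
    unfolding groups_reach_regex by auto
  then show ?case
  proof cases
    case 1
    from Suc.IH[OF Suc.prems(1) this] obtain t k' j where "g = name t k' j" "k' < k \<or> k' = k \<and> t \<ge> 2"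
      by blast
    then show ?thesis by (intro exI[of _ t] exI[of _ k'] exI[of _ j]) auto
  qed auto
qed simp

lemma distinct_groups_reach_regex:
  assumes "groups base = []"
  shows "distinct (groups (reach_regex J base k))"
proof (induction k)
  case (Suc k)
  have "name t k' j \<notin> set (groups (reach_regex J base k))" if "k < k' \<or> k' = k \<and> t < 2" for t k' j
    using groups_reach_regex_names[OF assms, of "name t k' j" J k] that by fastforce
  with Suc show ?case unfolding groups_reach_regex
    by (auto simp: distinct_map inj_on_def)
qed (simp add: assms)

section \<open>Correctness of the reachability regex\<close>

context
  fixes W :: "'a set" and c :: 'a and N :: nat
begin

abbreviation "routs \<equiv> outs W (replicate N c)"
abbreviation "rfits \<equiv> ranges_within N"

text \<open>\<open>V g\<close> is the set of widths that the regex for \<open>g\<close> can read.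
  These may depend on groups outside of \<open>G\<close>, which still have their values from
  \<gamma>0 while earlier items are being captured. Backtracking over all items then amounts to one
  existential quantifier over the widths.\<close>

lemma routs_capture_seq:
  assumes "\<And>g r p \<gamma>'. (g, r) \<in> set items \<Longrightarrow> \<forall>h. h \<notin> G \<longrightarrow> \<gamma>' h = \<gamma>0 h \<Longrightarrow> rfits \<gamma>' \<Longrightarrow> p \<le> N \<Longrightarrow>
      routs r p \<gamma>' Forward = {(p + v, \<gamma>') | v. v \<in> V g \<and> p + v \<le> N}"
    and "fst ` set items \<subseteq> G" "distinct (map fst items)"
    and "\<forall>h. h \<notin> G \<longrightarrow> \<gamma> h = \<gamma>0 h" "rfits \<gamma>" "p \<le> N"
  shows "routs (capture_seq items rest) p \<gamma> Forward \<noteq> {} \<longleftrightarrow>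
    (\<exists>v. (\<forall>g\<in>fst ` set items. v g \<in> V g) \<and> p + sum_list (map v (map fst items)) \<le> N \<and>
      routs rest (p + sum_list (map v (map fst items))) (assign p \<gamma> v (map fst items)) Forward \<noteq> {})"
  using assms
proof (induction items arbitrary: p \<gamma>)
  case Nil
  then show ?case by simp
next
  case (Cons x items)
  obtain g r where x: "x = (g, r)" by force
  let ?gs = "map fst items"
  have g: "g \<in> G" "g \<notin> set ?gs" using Cons.prems(2,3) x by auto
  have "rfits (\<gamma>(g := Opened p))" by (rule ranges_within_open) fact+
  then have "routs r p (\<gamma>(g := Opened p)) Forward = {(p + v, \<gamma>(g := Opened p)) | v. v \<in> V g \<and> p + v \<le> N}"
    using Cons.prems(4,6) g x by (intro Cons.prems(1)) (auto simp: fun_upd_def)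
  then have G: "routs (Group g r) p \<gamma> Forward = {(p + v, \<gamma>(g := Closed p (p + v))) | v. v \<in> V g \<and> p + v \<le> N}"
    unfolding outs_Group by auto
  have IH: "routs (capture_seq items rest) (p + u) (\<gamma>(g := Closed p (p + u))) Forward \<noteq> {} \<longleftrightarrow>
      (\<exists>v. (\<forall>g\<in>fst ` set items. v g \<in> V g) \<and> (p + u) + sum_list (map v ?gs) \<le> N \<and>
      routs rest ((p + u) + sum_list (map v ?gs)) (assign (p + u) (\<gamma>(g := Closed p (p + u))) v ?gs) Forward \<noteq> {})"
    if "p + u \<le> N" for u
  proof (rule Cons.IH)
    show "rfits (\<gamma>(g := Closed p (p + u)))" using Cons.prems(5) that by (auto simp: ranges_within_def)
    show "\<forall>h. h \<notin> G \<longrightarrow> (\<gamma>(g := Closed p (p + u))) h = \<gamma>0 h" using Cons.prems(4) g by auto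
  qed (use Cons.prems(1-3) that in auto)
  have "routs (capture_seq (x # items) rest) p \<gamma> Forward \<noteq> {} \<longleftrightarrow>
      (\<exists>u. u \<in> V g \<and> p + u \<le> N \<and>
        routs (capture_seq items rest) (p + u) (\<gamma>(g := Closed p (p + u))) Forward \<noteq> {})"
    by (auto simp: x outs_Seq_Forward G)
  also have "\<dots> \<longleftrightarrow> (\<exists>v. (\<forall>g\<in>fst ` set (x # items). v g \<in> V g) \<and>
      p + sum_list (map v (map fst (x # items))) \<le> N \<and>
      routs rest (p + sum_list (map v (map fst (x # items)))) (assign p \<gamma> v (map fst (x # items))) Forward \<noteq> {})"
    (is "?L \<longleftrightarrow> ?R")
  proof
    assume ?L
    then obtain u v where u: "u \<in> V g" "p + u \<le> N" and v: "\<forall>g\<in>fst ` set items. v g \<in> V g"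
      "(p + u) + sum_list (map v ?gs) \<le> N"
      "routs rest ((p + u) + sum_list (map v ?gs)) (assign (p + u) (\<gamma>(g := Closed p (p + u))) v ?gs) Forward \<noteq> {}"
      using IH by blast
    define v' where "v' = v(g := u)"
    have same: "v' h = v h" if "h \<in> set ?gs" for h using g that by (auto simp: v'_def)
    have "sum_list (map v' ?gs) = sum_list (map v ?gs)"
      by (rule arg_cong[of _ _ sum_list], rule map_cong[OF refl same])
    moreover have "assign q \<delta> v' ?gs = assign q \<delta> v ?gs" for q \<delta> by (rule assign_cong) (rule same)
    moreover have "v' g = u" by (simp add: v'_def)
    moreover have "\<forall>h\<in>fst ` set items. v' h \<in> V h" using v(1) same by auto
    ultimately have "(\<forall>g\<in>fst ` set (x # items). v' g \<in> V g) \<and>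
      p + sum_list (map v' (map fst (x # items))) \<le> N \<and>
      routs rest (p + sum_list (map v' (map fst (x # items)))) (assign p \<gamma> v' (map fst (x # items))) Forward \<noteq> {}"
      using u v by (simp add: x add.assoc)
    then show ?R by blast
  next
    assume ?R
    then obtain v where v: "\<forall>g\<in>fst ` set (x # items). v g \<in> V g"
      "p + sum_list (map v (map fst (x # items))) \<le> N"
      "routs rest (p + sum_list (map v (map fst (x # items)))) (assign p \<gamma> v (map fst (x # items))) Forward \<noteq> {}"
      by blast
    then have "v g \<in> V g" "p + v g \<le> N" by (simp_all add: x)
    moreover have "routs (capture_seq items rest) (p + v g) (\<gamma>(g := Closed p (p + v g))) Forward \<noteq> {}"
      using v by (subst IH[OF \<open>p + v g \<le> N\<close>]) (auto simp: x add.assoc intro!: exI[of _ v])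
    ultimately show ?L by blast
  qed
  finally show ?case .
qed

text \<open>The group is read backwards, and the anchor keeps only the range that reaches to the
  start. Its width is the current position, and the result is unique, as needed for a lookaround
  whose captures are used later.\<close>

lemma routs_bit_capture:
  assumes "rfits \<gamma>" "p \<le> N"
  shows "routs (bit_capture k) p \<gamma> Forward = {(p, \<gamma>(name 3 (Suc k) 0 := Closed 0 p))}"
proof -
  have "routs (Group (name 3 (Suc k) 0) any_star) p \<gamma> Backward =
      {(q, \<gamma>(name 3 (Suc k) 0 := Closed q p)) | q. q \<le> p}"
    unfolding outs_Group uouts_any_star_Backward[OF assms(2)] by (auto simp: min_absorb2 max_absorb1)
  then have "routs (Seq (Anchor Input_Start) (Group (name 3 (Suc k) 0) any_star)) p \<gamma> Backward =
      {(0, \<gamma>(name 3 (Suc k) 0 := Closed 0 p))}"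
    by (auto simp: outs_Seq_Backward outs_Anchor split: if_splits)
  note eq = this
  show ?thesis unfolding bit_capture_def
    by (subst outs_Look_const[where \<gamma>' = "\<gamma>(name 3 (Suc k) 0 := Closed 0 p)"])
      (simp_all only: eq insert_not_empty if_False singleton_iff prod.inject)
qed

lemma routs_select:
  assumes "rfits \<gamma>" "p \<le> N" "width \<gamma> (name 3 (Suc k) 0) = b" "b \<le> 1"
  shows "routs (select k g h) p \<gamma> Forward =
    {(p + v, \<gamma>) | v. v \<in> {width \<gamma> (if b = 0 then g else h)} \<and> p + v \<le> N}"
proof -
  note t = pureD[OF pure_test' assms(2,1)]
  from assms(4) consider "b = 0" | "b = 1" by linarith
  then show ?thesis
    by cases (use assms in \<open>simp_all add: select_def outs_Seq_Forward t uouts_Backref\<close>)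
qed

text \<open>A step test at column \<open>j\<close> also looks at the columns \<open>j - 1\<close>
  and \<open>Suc j\<close>. The groups with the numbers \<open>0\<close> and \<open>Suc J\<close>
  are never captured and thus read as width \<open>0\<close>, the value of a missing
  neighbour.\<close>

definition clean :: "nat \<Rightarrow> group_map \<Rightarrow> bool" where
  "clean J \<gamma> \<longleftrightarrow> (\<forall>t\<le>1. \<forall>k. width \<gamma> (name t k 0) = 0 \<and> width \<gamma> (name t k (Suc J)) = 0)"

lemma map_fst_copies: "map fst (copies J k) = map (name 0 k) [Suc 0..<Suc J] @ map (name 1 k) [Suc 0..<Suc J]"
  by (simp add: copies_def comp_def del: upt_Suc)

text \<open>The copies are \<open>2 * J\<close> adjacent groups. If \<open>Q\<close> holds, each has
  width at most \<open>D\<close>, so they fit into the string; if they do not fit, then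
  \<open>Q\<close> fails as well, by \<open>bound\<close>. With \<open>b = 0\<close> the half from
  start to midpoint is checked, with \<open>b = 1\<close> the half from midpoint to end.\<close>

lemma half_correct:
  assumes rest: "\<And>\<gamma>. rfits \<gamma> \<Longrightarrow> clean J \<gamma> \<Longrightarrow>
      routs rest 0 \<gamma> Forward \<noteq> {} \<longleftrightarrow> Q (vec J \<gamma> 0 k) (vec J \<gamma> 1 k)"
    and bound: "\<And>x y j. Q x y \<Longrightarrow> 1 \<le> j \<Longrightarrow> j \<le> J \<Longrightarrow> x j \<le> D \<and> y j \<le> D"
    and N: "2 * J * D \<le> N" "2 \<le> N"
    and \<gamma>: "rfits \<gamma>" "clean J \<gamma>" and b: "b \<le> 1"
  shows "routs (half J k rest) b \<gamma> Forward \<noteq> {} \<longleftrightarrow>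
    Q (vec J \<gamma> (if b = 0 then 0 else 2) (Suc k)) (vec J \<gamma> (if b = 0 then 2 else 1) (Suc k))"
proof -
  define \<gamma>1 where "\<gamma>1 = \<gamma>(name 3 (Suc k) 0 := Closed 0 b)"
  have f1: "rfits \<gamma>1" using \<gamma>(1) b N(2) by (auto simp: ranges_within_def \<gamma>1_def)
  have w1: "width \<gamma>1 (name t k' j) = (if name t k' j = name 3 (Suc k) 0 then b else width \<gamma> (name t k' j))"
    for t k' j by (simp add: \<gamma>1_def width_def)
  let ?t0 = "if b = 0 then 0 else 2 :: nat"
  let ?t1 = "if b = 0 then 2 else 1 :: nat"
  \<comment> \<open>At the name of a copied group this is a singleton: the width of the source
    selected by \<open>b\<close>.\<close>
  define V where "V g = {n. \<exists>j. 1 \<le> j \<and> j \<le> J \<and> (g = name 0 k j \<and> n = width \<gamma> (name ?t0 (Suc k) j) \<or>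
    g = name 1 k j \<and> n = width \<gamma> (name ?t1 (Suc k) j))}" for g
  let ?gs = "map fst (copies J k :: (nat \<times> 'a regex) list)"
  let ?G = "set ?gs"
  have "routs (half J k rest) b \<gamma> Forward \<noteq> {} \<longleftrightarrow>
      routs (restart (capture_seq (copies J k) (restart rest))) b \<gamma>1 Forward \<noteq> {}"
  proof -
    have "routs (Chars UNIV) q \<delta> Forward \<noteq> {}"
      if "(q, \<delta>) \<in> routs (restart r) b \<gamma>1 Forward" for q \<delta> r
      using that b N(2) unfolding restart_def by (auto simp: uouts_Chars dest!: outs_Look_pos)
    then show ?thesis
      using \<gamma>(1) b N(2) by (fastforce simp: half_def outs_Seq_Forward routs_bit_capture \<gamma>1_def[symmetric])
  qed
  also have "\<dots> \<longleftrightarrow> routs (capture_seq (copies J k) (restart rest)) 0 \<gamma>1 Forward \<noteq> {}"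
    using uouts_restart_empty_iff[of b N W c] b N(2) by simp
  also have "\<dots> \<longleftrightarrow> (\<exists>v. (\<forall>g\<in>?G. v g \<in> V g) \<and> 0 + sum_list (map v ?gs) \<le> N \<and>
      routs (restart rest) (0 + sum_list (map v ?gs)) (assign 0 \<gamma>1 v ?gs) Forward \<noteq> {})"
    unfolding set_map
  proof (rule routs_capture_seq[where G = ?G and \<gamma>0 = \<gamma>1, unfolded set_map])
    fix g p \<gamma>' and r :: "'a regex" assume gr: "(g, r) \<in> set (copies J k)" and ag: "\<forall>h. h \<notin> fst ` set (copies J k :: (nat \<times> 'a regex) list) \<longrightarrow> \<gamma>' h = \<gamma>1 h"
      and p: "rfits \<gamma>'" "p \<le> N"
    have ag': "width \<gamma>' (name t (Suc k) j) = width \<gamma>1 (name t (Suc k) j)" for t j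
    proof -
      have "name t (Suc k) j \<notin> fst ` set (copies J k :: (nat \<times> 'a regex) list)"
        unfolding set_map[symmetric] map_fst_copies by auto
      with ag show ?thesis by (simp add: width_def)
    qed
    have bb: "width \<gamma>' (name 3 (Suc k) 0) = b" by (simp add: ag' w1)
    from gr consider j where "1 \<le> j" "j \<le> J" "g = name 0 k j" "r = select k (name 0 (Suc k) j) (name 2 (Suc k) j)"
      | j where "1 \<le> j" "j \<le> J" "g = name 1 k j" "r = select k (name 2 (Suc k) j) (name 1 (Suc k) j)"
      unfolding copies_def by auto
    then show "routs r p \<gamma>' Forward = {(p + v, \<gamma>') | v. v \<in> V g \<and> p + v \<le> N}"
    proof cases
      case 1
      then have "V g = {width \<gamma>' (if b = 0 then name 0 (Suc k) j else name 2 (Suc k) j)}"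
        by (auto simp: V_def ag' w1)
      with 1 show ?thesis by (simp only: routs_select[OF p bb b])
    next
      case 2
      then have "V g = {width \<gamma>' (if b = 0 then name 2 (Suc k) j else name 1 (Suc k) j)}"
        by (auto simp: V_def ag' w1)
      with 2 show ?thesis by (simp only: routs_select[OF p bb b])
    qed
  next
    show "distinct (map fst (copies J k))" unfolding map_fst_copies by (auto simp: distinct_map inj_on_def)
  qed (use f1 in auto)
  also have "\<dots> \<longleftrightarrow> Q (vec J \<gamma> ?t0 (Suc k)) (vec J \<gamma> ?t1 (Suc k))" (is "?L \<longleftrightarrow> ?R")
  proof -
    have key: "routs (restart rest) (sum_list (map v ?gs)) (assign 0 \<gamma>1 v ?gs) Forward \<noteq> {} \<longleftrightarrow> ?R"
      if v: "\<forall>g\<in>?G. v g \<in> V g" and s: "sum_list (map v ?gs) \<le> N" for v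
    proof -
      let ?\<delta> = "assign 0 \<gamma>1 v ?gs"
      have d: "distinct ?gs" unfolding map_fst_copies by (auto simp: distinct_map inj_on_def)
      have f: "rfits ?\<delta>" by (rule ranges_within_assign[OF f1]) (use s in simp)
      have w: "width ?\<delta> g = (if g \<in> ?G then v g else width \<gamma>1 g)" for g
        by (rule width_assign[OF d])
      have "name t k' 0 \<notin> ?G" "name t k' (Suc J) \<notin> ?G" for t k' unfolding map_fst_copies by auto
      then have cl: "clean J ?\<delta>" using \<gamma>(2) by (auto simp: clean_def w w1)
      have "width ?\<delta> (name 0 k j) = width \<gamma> (name ?t0 (Suc k) j)"
        "width ?\<delta> (name 1 k j) = width \<gamma> (name ?t1 (Suc k) j)" if "1 \<le> j" "j \<le> J" for j
      proof -
        have in_G: "name 0 k j \<in> ?G" "name 1 k j \<in> ?G" unfolding map_fst_copies using that by auto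
        with v have "v (name 0 k j) \<in> V (name 0 k j)" "v (name 1 k j) \<in> V (name 1 k j)" by blast+
        with in_G show "width ?\<delta> (name 0 k j) = width \<gamma> (name ?t0 (Suc k) j)"
          "width ?\<delta> (name 1 k j) = width \<gamma> (name ?t1 (Suc k) j)" by (auto simp: w V_def)
      qed
      then have "vec J ?\<delta> 0 k = vec J \<gamma> ?t0 (Suc k)" "vec J ?\<delta> 1 k = vec J \<gamma> ?t1 (Suc k)"
        by (auto simp: vec_def)
      with rest[OF f cl] uouts_restart_empty_iff[OF s, of W c rest ?\<delta> Forward] show ?thesis by simp
    qed
    show ?thesis
    proof
      assume ?L
      then obtain v where v: "\<forall>g\<in>?G. v g \<in> V g" "sum_list (map v ?gs) \<le> N"
        "routs (restart rest) (sum_list (map v ?gs)) (assign 0 \<gamma>1 v ?gs) Forward \<noteq> {}"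
        unfolding add_0 by blast
      with key[OF v(1,2)] show ?R by blast
    next
      assume R: ?R
      define v where "v g = (THE n. n \<in> V g)" for g
      have v0: "v (name 0 k j) = width \<gamma> (name ?t0 (Suc k) j)" "v (name 0 k j) \<in> V (name 0 k j)"
        and v1: "v (name 1 k j) = width \<gamma> (name ?t1 (Suc k) j)" "v (name 1 k j) \<in> V (name 1 k j)"
        if "1 \<le> j" "j \<le> J" for j
        using that by (simp_all add: v_def V_def)
      have v: "\<forall>g\<in>?G. v g \<in> V g" unfolding map_fst_copies using v0 v1 by auto
      have "v g \<le> D" if "g \<in> ?G" for g
      proof -
        from that consider j where "1 \<le> j" "j \<le> J" "g = name 0 k j" | j where "1 \<le> j" "j \<le> J" "g = name 1 k j"
          unfolding map_fst_copies by auto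
        then show ?thesis using bound[OF R] v0(1) v1(1) by cases (auto simp: vec_def)
      qed
      then have "sum_list (map v ?gs) \<le> length ?gs * D" by (rule sum_list_map_bound)
      also have "length ?gs = 2 * J" unfolding map_fst_copies by simp
      finally have "sum_list (map v ?gs) \<le> N" using N(1) by simp
      with key[OF v this] R v show ?L unfolding add_0 by blast
    qed
  qed
  finally show ?thesis .
qed

lemma routs_half_pos:
  assumes "(q, \<delta>) \<in> routs (half J k rest) p \<gamma> Forward" "rfits \<gamma>" "p \<le> N"
  shows "q = Suc p \<and> q \<le> N"
  using assms
  by (auto simp: half_def outs_Seq_Forward routs_bit_capture restart_def uouts_Chars split: if_splits
      dest!: outs_Look_pos)

text \<open>The start, midpoint and end of level \<open>Suc k\<close> are not among the groups of
  the body and survive the reset, whereas everything that the first iteration has captured is erased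
  before the second one. So both iterations check \<open>rest\<close> under the same data and differ
  in the position only.\<close>

lemma halves_correct:
  assumes rest: "\<And>\<gamma>. rfits \<gamma> \<Longrightarrow> clean J \<gamma> \<Longrightarrow>
      routs rest 0 \<gamma> Forward \<noteq> {} \<longleftrightarrow> Q (vec J \<gamma> 0 k) (vec J \<gamma> 1 k)"
    and bound: "\<And>x y j. Q x y \<Longrightarrow> 1 \<le> j \<Longrightarrow> j \<le> J \<Longrightarrow> x j \<le> D \<and> y j \<le> D"
    and N: "2 * J * D \<le> N" "2 \<le> N"
    and \<gamma>: "rfits \<gamma>" "clean J \<gamma>"
    and names: "\<And>t j. t \<le> 2 \<Longrightarrow> name t (Suc k) j \<notin> set (groups rest)"
  shows "routs (halves J k rest) 0 \<gamma> Forward \<noteq> {} \<longleftrightarrow>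
    Q (vec J \<gamma> 0 (Suc k)) (vec J \<gamma> 2 (Suc k)) \<and> Q (vec J \<gamma> 2 (Suc k)) (vec J \<gamma> 1 (Suc k))"
proof -
  let ?B = "half J k rest"
  let ?S = "Quant ?B 0 \<infinity> Greedy"
  let ?\<gamma> = "reset \<gamma> ?B"
  have f: "rfits ?\<gamma>" by (rule ranges_within_reset) (rule \<gamma>)
  have c: "clean J ?\<gamma>" using \<gamma>(2) by (auto simp: clean_def reset_def width_def)
  have v: "vec J ?\<gamma> t (Suc k) = vec J \<gamma> t (Suc k)" if "t \<le> 2" for t
  proof -
    have "name t (Suc k) j \<notin> set (groups ?B)" for j using names[OF that] that by (auto simp: groups_half)
    then show ?thesis by (auto simp: vec_def reset_def width_def)
  qed
  \<comment> \<open>An iteration advances by exactly one position; hence it always passes the check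
    for progress, and position \<open>2\<close> is reached after exactly two iterations.\<close>
  have pos: "q = Suc p" if "(q, \<delta>) \<in> routs ?B p \<delta>' Forward" "rfits \<delta>'" "p \<le> N" for q \<delta> p \<delta>'
    using routs_half_pos[OF that] by simp
  \<comment> \<open>An iteration changes only groups of its body, and those are reset.\<close>
  have again: "reset \<delta> ?B = ?\<gamma>" if "(q, \<delta>) \<in> routs ?B p ?\<gamma> Forward" for q \<delta> p
    using outs_other_groups[OF that] by (auto simp: reset_def fun_eq_iff)
  have star: "(2, \<delta>) \<in> routs ?S p \<delta>' Forward \<longleftrightarrow>
      (p = 2 \<and> \<delta> = \<delta>') \<or> (\<exists>\<delta>''. (Suc p, \<delta>'') \<in> routs ?B p (reset \<delta>' ?B) Forward \<and> (2, \<delta>) \<in> routs ?S (Suc p) \<delta>'' Forward)"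
    if "p \<le> N" "rfits \<delta>'" for p \<delta> \<delta>'
    using pos[OF _ ranges_within_reset[OF that(2)] that(1)] by (subst outs_star) (fastforce split: if_splits)
  have ge: "q \<ge> p" if "(q, \<delta>) \<in> routs ?S p \<delta>' Forward" "p \<le> N" "rfits \<delta>'" for p q \<delta> \<delta>'
    using that
  proof (induction "N - p" arbitrary: p \<delta>' rule: less_induct)
    case less
    show ?case
    proof (rule ccontr)
      assume "\<not> p \<le> q"
      with less.prems(1) obtain p' \<delta>'' where 1: "(p', \<delta>'') \<in> routs ?B p (reset \<delta>' ?B) Forward"
        "p' > p" "(q, \<delta>) \<in> routs ?S p' \<delta>'' Forward"
        by (subst (asm) outs_star) (auto split: if_splits)
      from uouts_within[OF 1(1) less.prems(2) ranges_within_reset[OF less.prems(3)]]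
      have "p' \<le> N" "rfits \<delta>''" by simp_all
      moreover from this have "N - p' < N - p" using 1(2) by simp
      ultimately show False using less.hyps[of p' \<delta>''] 1 \<open>\<not> p \<le> q\<close> by simp
    qed
  qed
  have "routs (halves J k rest) 0 \<gamma> Forward \<noteq> {} \<longleftrightarrow> (\<exists>\<delta>. (2, \<delta>) \<in> routs ?S 0 \<gamma> Forward)"
  proof -
    have al: "routs (at_length 2) q \<delta> Forward = (if q = 2 then {(q, \<delta>)} else {})"
      if "(q, \<delta>) \<in> routs ?S 0 \<gamma> Forward" for q \<delta>
      using uouts_within[OF that _ \<gamma>(1)] by (intro uouts_at_length) simp
    have eq: "routs (halves J k rest) 0 \<gamma> Forward =
        (\<Union>(q, \<delta>)\<in>routs ?S 0 \<gamma> Forward. if q = 2 then {(q, \<delta>)} else {})"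
      unfolding halves_def outs_Seq_Forward by (rule SUP_cong) (auto simp: al)
    have "x \<in> routs (halves J k rest) 0 \<gamma> Forward \<longleftrightarrow> fst x = 2 \<and> x \<in> routs ?S 0 \<gamma> Forward" for x
      unfolding eq by (cases x) (force split: if_splits)
    then show ?thesis unfolding ex_in_conv[symmetric] by auto
  qed
  also have "\<dots> \<longleftrightarrow> routs ?B 0 ?\<gamma> Forward \<noteq> {} \<and> routs ?B 1 ?\<gamma> Forward \<noteq> {}" (is "?L \<longleftrightarrow> ?R")
  proof
    assume ?L
    then obtain \<delta> \<delta>1 where 1: "(1, \<delta>1) \<in> routs ?B 0 ?\<gamma> Forward" "(2, \<delta>) \<in> routs ?S 1 \<delta>1 Forward"
      using star[of 0 \<gamma>] \<gamma>(1) by auto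
    have f1: "rfits \<delta>1" using uouts_within[OF 1(1) _ f] by simp
    from 1(2) star[of 1 \<delta>1] f1 N(2) obtain \<delta>2 where "(2, \<delta>2) \<in> routs ?B 1 (reset \<delta>1 ?B) Forward"
      by (auto simp: numeral_2_eq_2)
    with 1(1) again[OF 1(1)] show ?R by auto
  next
    assume ?R
    then obtain q1 \<delta>1 q2 \<delta>2 where 1: "(q1, \<delta>1) \<in> routs ?B 0 ?\<gamma> Forward" and 2: "(q2, \<delta>2) \<in> routs ?B 1 ?\<gamma> Forward"
      by auto
    have q: "q1 = 1" "q2 = 2" using pos[OF 1 f] pos[OF 2 f] N(2) by simp_all
    have f1: "rfits \<delta>1" using uouts_within[OF 1 _ f] by simp
    have f2: "rfits \<delta>2" using uouts_within[OF 2 _ f] N(2) by simp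
    have "(2, \<delta>2) \<in> routs ?S 2 \<delta>2 Forward" using star[of 2 \<delta>2] f2 N(2) by simp
    then have "(2, \<delta>2) \<in> routs ?S 1 \<delta>1 Forward"
      using star[of 1 \<delta>1] f1 N(2) 2 q again[OF 1] by (auto simp: numeral_2_eq_2)
    then show ?L using star[of 0 \<gamma>] \<gamma>(1) 1 q by auto
  qed
  also have "\<dots> \<longleftrightarrow>
      Q (vec J \<gamma> 0 (Suc k)) (vec J \<gamma> 2 (Suc k)) \<and> Q (vec J \<gamma> 2 (Suc k)) (vec J \<gamma> 1 (Suc k))"
  proof -
    have h: "routs ?B b ?\<gamma> Forward \<noteq> {} \<longleftrightarrow>
        Q (vec J ?\<gamma> (if b = 0 then 0 else 2) (Suc k)) (vec J ?\<gamma> (if b = 0 then 2 else 1) (Suc k))"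
      if "b \<le> 1" for b
      by (rule half_correct[where Q = Q and D = D, OF _ _ N f c that]) (fact rest, fact bound)
    from h[of 0] h[of 1] v show ?thesis by simp
  qed
  finally show ?thesis .
qed

lemma reach_bound:
  assumes "\<And>x y j. St x y \<Longrightarrow> 1 \<le> j \<Longrightarrow> j \<le> J \<Longrightarrow> x j \<le> D \<and> y j \<le> D"
  shows "reach J St k x y \<Longrightarrow> 1 \<le> j \<Longrightarrow> j \<le> J \<Longrightarrow> x j \<le> D \<and> y j \<le> D"
proof (induction k arbitrary: x y)
  case (Suc k)
  then obtain m where "reach J St k x m" "reach J St k m y" by auto
  with Suc.IH Suc.prems(2,3) show ?case by blast
qed (simp add: assms)

text \<open>The group map has to be arbitrary in the induction, since each level is evaluated under
  maps created by the levels above. By \<open>reach_bound\<close> every midpoint of a reachable pair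
  has columns of at most \<open>D\<close>, so the string is long enough to guess it.\<close>

theorem reach_regex_correct:
  assumes base: "\<And>\<gamma>. rfits \<gamma> \<Longrightarrow> clean J \<gamma> \<Longrightarrow>
      routs base 0 \<gamma> Forward \<noteq> {} \<longleftrightarrow> St (vec J \<gamma> 0 0) (vec J \<gamma> 1 0)"
    and no_groups: "groups base = []"
    and bound: "\<And>x y j. St x y \<Longrightarrow> 1 \<le> j \<Longrightarrow> j \<le> J \<Longrightarrow> x j \<le> D \<and> y j \<le> D"
    and N: "2 * J * D \<le> N" "2 \<le> N"
    and \<gamma>: "rfits \<gamma>" "clean J \<gamma>"
  shows "routs (reach_regex J base k) 0 \<gamma> Forward \<noteq> {} \<longleftrightarrow> reach J St k (vec J \<gamma> 0 k) (vec J \<gamma> 1 k)"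
  using \<gamma>
proof (induction k arbitrary: \<gamma>)
  case 0
  then show ?case using base by simp
next
  case (Suc k)
  let ?items = "map (\<lambda>j. (name 2 (Suc k) j, any_star)) [Suc 0..<Suc J] :: (nat \<times> 'a regex) list"
  let ?gs = "map (name 2 (Suc k)) [Suc 0..<Suc J]"
  let ?r = "halves J k (reach_regex J base k) :: 'a regex"
  let ?x = "vec J \<gamma> 0 (Suc k)" and ?y = "vec J \<gamma> 1 (Suc k)"
  have gs: "map fst ?items = ?gs" by (simp add: comp_def)
  have d: "distinct ?gs" by (auto simp: distinct_map inj_on_def)
  have "routs (reach_regex J base (Suc k)) 0 \<gamma> Forward \<noteq> {} \<longleftrightarrow>
      (\<exists>v. (\<forall>g\<in>fst ` set ?items. v g \<in> UNIV) \<and> 0 + sum_list (map v (map fst ?items)) \<le> N \<and>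
        routs (restart ?r) (0 + sum_list (map v (map fst ?items))) (assign 0 \<gamma> v (map fst ?items)) Forward \<noteq> {})"
    unfolding reach_regex.simps
  proof (rule routs_capture_seq[where G = "set ?gs" and \<gamma>0 = \<gamma>])
    fix g r p \<gamma>' assume "(g, r) \<in> set ?items" "p \<le> N"
    then show "routs r p \<gamma>' Forward = {(p + v, \<gamma>') |v. v \<in> UNIV \<and> p + v \<le> N}"
      by (auto simp: uouts_any_star_Forward le_iff_add)
  next
    show "distinct (map fst ?items)" using d by (simp only: gs)
  qed (use Suc.prems in auto)
  also have "\<dots> \<longleftrightarrow> (\<exists>v. sum_list (map v ?gs) \<le> N \<and>
      routs (restart ?r) (sum_list (map v ?gs)) (assign 0 \<gamma> v ?gs) Forward \<noteq> {})"
    by (simp only: gs) simp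
  also have "\<dots> \<longleftrightarrow> (\<exists>v. sum_list (map v ?gs) \<le> N \<and>
      reach J St k ?x (\<lambda>j. if 1 \<le> j \<and> j \<le> J then v (name 2 (Suc k) j) else 0) \<and>
      reach J St k (\<lambda>j. if 1 \<le> j \<and> j \<le> J then v (name 2 (Suc k) j) else 0) ?y)"
  proof (intro ex_cong1 conj_cong refl)
    fix v assume s: "sum_list (map v ?gs) \<le> N"
    let ?\<delta> = "assign 0 \<gamma> v ?gs"
    have f: "rfits ?\<delta>" by (rule ranges_within_assign[OF Suc.prems(1)]) (use s in simp)
    have w: "width ?\<delta> g = (if g \<in> set ?gs then v g else width \<gamma> g)" for g by (rule width_assign[OF d])
    have nn: "name t k' j \<notin> set ?gs" if "t \<le> 1" for t k' j using that by auto
    have w': "width ?\<delta> (name t k' j) = width \<gamma> (name t k' j)" if "t \<le> 1" for t k' j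
      by (simp only: w nn[OF that] if_False)
    then have cl: "clean J ?\<delta>" using Suc.prems(2) by (simp add: clean_def)
    have vecs: "vec J ?\<delta> t (Suc k) = vec J \<gamma> t (Suc k)" if "t \<le> 1" for t
      using w'[OF that] by (auto simp: vec_def fun_eq_iff simp del: upt_Suc)
    have vec2: "vec J ?\<delta> 2 (Suc k) = (\<lambda>j. if 1 \<le> j \<and> j \<le> J then v (name 2 (Suc k) j) else 0)"
      by (auto simp: vec_def w fun_eq_iff simp del: upt_Suc)
    have "routs (restart ?r) (sum_list (map v ?gs)) ?\<delta> Forward \<noteq> {} \<longleftrightarrow> routs ?r 0 ?\<delta> Forward \<noteq> {}"
      using uouts_restart_empty_iff[OF s, of W c ?r ?\<delta> Forward] by simp
    also have "\<dots> \<longleftrightarrow> reach J St k (vec J ?\<delta> 0 (Suc k)) (vec J ?\<delta> 2 (Suc k)) \<and>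
        reach J St k (vec J ?\<delta> 2 (Suc k)) (vec J ?\<delta> 1 (Suc k))"
    proof (rule halves_correct[where Q = "reach J St k" and D = D, OF _ _ N f cl])
      show "name t (Suc k) j \<notin> set (groups (reach_regex J base k))" if "t \<le> 2" for t j
        using groups_reach_regex_names[OF no_groups, of "name t (Suc k) j" J k] by fastforce
    qed (rule Suc.IH, assumption, assumption, rule reach_bound[where St = St and D = D], rule bound, assumption+)
    finally show "routs (restart ?r) (sum_list (map v ?gs)) ?\<delta> Forward \<noteq> {} \<longleftrightarrow>
      reach J St k ?x (\<lambda>j. if 1 \<le> j \<and> j \<le> J then v (name 2 (Suc k) j) else 0) \<and>
      reach J St k (\<lambda>j. if 1 \<le> j \<and> j \<le> J then v (name 2 (Suc k) j) else 0) ?y"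
      using vecs vec2 by simp
  qed
  also have "\<dots> \<longleftrightarrow> reach J St (Suc k) ?x ?y" (is "?L \<longleftrightarrow> ?R")
  proof
    assume ?L
    then obtain v where "reach J St k ?x (\<lambda>j. if 1 \<le> j \<and> j \<le> J then v (name 2 (Suc k) j) else 0)"
      "reach J St k (\<lambda>j. if 1 \<le> j \<and> j \<le> J then v (name 2 (Suc k) j) else 0) ?y" by blast
    then show ?R unfolding reach.simps
      by (intro exI[of _ "\<lambda>j. if 1 \<le> j \<and> j \<le> J then v (name 2 (Suc k) j) else 0"]) auto
  next
    assume ?R
    then obtain m where m: "\<forall>j. \<not> (1 \<le> j \<and> j \<le> J) \<longrightarrow> m j = 0" "reach J St k ?x m" "reach J St k m ?y" by auto
    define v where "v g = (SOME n. \<exists>j. g = name 2 (Suc k) j \<and> n = m j)" for g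
    have v: "v (name 2 (Suc k) j) = m j" for j by (simp add: v_def)
    have mv: "(\<lambda>j. if 1 \<le> j \<and> j \<le> J then v (name 2 (Suc k) j) else 0) = m" using m(1) by (auto simp: v)
    have "sum_list (map v ?gs) \<le> length ?gs * D"
    proof (rule sum_list_map_bound)
      fix g assume "g \<in> set ?gs"
      then obtain j where j: "g = name 2 (Suc k) j" "1 \<le> j" "j \<le> J" by auto
      have "?x j \<le> D \<and> m j \<le> D" by (rule reach_bound[where St = St]) (fact bound m j)+
      with j show "v g \<le> D" by (simp add: v)
    qed
    also have "\<dots> \<le> N" using N(1) by simp
    finally have "sum_list (map v ?gs) \<le> N" .
    with m mv show ?L by (intro exI[of _ v]) (simp only: mv)
  qed
  finally show ?case .
qed

end

subsection \<open>One step, and the complete regex\<close>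

definition window :: "nat \<Rightarrow> nat \<times> nat \<times> nat \<times> nat \<Rightarrow> 'a regex" where
  "window j = (\<lambda>(u, v, w, v'). Seq (test (name 0 0 (j - 1)) u) (Seq (test (name 0 0 j) v)
     (Seq (test (name 0 0 (Suc j)) w) (test (name 1 0 j) v'))))"

text \<open>The outer alternative selects one list \<open>T\<close> for all columns together. A list
  will stand for a state and the symbols scanned on all tapes, which no single window can see, as
  the heads may be far apart.\<close>

definition base_regex :: "nat \<Rightarrow> (nat \<times> nat \<times> nat \<times> nat) list list \<Rightarrow> 'a regex" where
  "base_regex J Ts = alts (map (\<lambda>T. seqs (map (\<lambda>j. alts (map (window j) T)) [Suc 0..<Suc J])) Ts)"

definition step_rel ::
  "nat \<Rightarrow> (nat \<times> nat \<times> nat \<times> nat) list list \<Rightarrow> (nat \<Rightarrow> nat) \<Rightarrow> (nat \<Rightarrow> nat) \<Rightarrow> bool" where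
  "step_rel J Ts x y \<longleftrightarrow> (\<exists>T\<in>set Ts. \<forall>j\<in>{1..J}. (x (j - 1), x j, x (Suc j), y j) \<in> set T)"

text \<open>The anchor admits the starting position \<open>0\<close> only. The initial vector is
  written down by fixed powers of a character and the final one is guessed. Acceptance is visible in
  column \<open>1\<close> already, as every column contains the state.\<close>

definition top_regex ::
  "nat \<Rightarrow> (nat \<times> nat \<times> nat \<times> nat) list list \<Rightarrow> nat list \<Rightarrow> nat \<Rightarrow> (nat \<Rightarrow> nat) \<Rightarrow> 'a regex" where
  "top_regex J Ts accs K v = Seq (Anchor Input_Start)
     (capture_seq (map (\<lambda>j. (name 0 K j, char_power (v j))) [Suc 0..<Suc J] @
         map (\<lambda>j. (name 1 K j, any_star)) [Suc 0..<Suc J])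
       (Seq (alts (map (test (name 1 K 1)) accs)) (restart (reach_regex J (base_regex J Ts) K))))"

lemma groups_alts [simp]: "groups (alts rs) = concat (map groups rs)"
  by (induction rs) (simp_all add: alts_def)

lemma groups_seqs [simp]: "groups (seqs rs) = concat (map groups rs)"
  by (induction rs) (simp_all add: seqs_def)

lemma groups_window [simp]: "groups (window j t) = []"
  by (simp add: window_def split: prod.splits)

lemma groups_base_regex [simp]: "groups (base_regex J Ts) = []"
  by (simp add: base_regex_def)

lemma top_regex_js: "top_regex J Ts accs K v \<in> js_regexes"
proof -
  have s: "concat (map (\<lambda>j. [f j]) xs) = map f xs" for f :: "nat \<Rightarrow> nat" and xs by (induction xs) simp_all
  have g: "groups (top_regex J Ts accs K v :: 'a regex) = map (name 0 K) [Suc 0..<Suc J] @ map (name 1 K) [Suc 0..<Suc J] @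
      groups (reach_regex J (base_regex J Ts) K :: 'a regex)"
    by (simp add: top_regex_def groups_capture_seq s comp_def del: upt_Suc)
  have "name t K j \<notin> set (groups (reach_regex J (base_regex J Ts) K :: 'a regex))" if "t < 2" for t j
    using groups_reach_regex_names[where base = "base_regex J Ts :: 'a regex" and g = "name t K j" and J = J and k = K] that by auto
  then show ?thesis
    using distinct_groups_reach_regex[where base = "base_regex J Ts :: 'a regex" and J = J and k = K]
    by (auto simp: js_regexes_def g distinct_map inj_on_def simp del: upt_Suc)
qed

definition plain :: "'a regex \<Rightarrow> bool" where
  "plain r \<longleftrightarrow> no_lower_bounds r \<and> no_neg_lookarounds r"

lemma plain_simps [simp]:
  "plain Eps" "plain (Chars cd)" "plain (Alt r1 r2) \<longleftrightarrow> plain r1 \<and> plain r2"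
  "plain (Seq r1 r2) \<longleftrightarrow> plain r1 \<and> plain r2" "plain (Group g r) \<longleftrightarrow> plain r" "plain (Backref g)"
  "plain (Quant r m \<Delta> \<kappa>) \<longleftrightarrow> m = 0 \<and> plain r" "plain (Look d b r) \<longleftrightarrow> b = Positive \<and> plain r"
  "plain (Anchor a)"
  by (auto simp: plain_def)

lemma plain_derived [simp]:
  fixes r :: "'b regex"
  shows "plain (any_star :: 'b regex)" "plain (char_power v :: 'b regex)" "plain (at_length v :: 'b regex)"
  "plain (restart r) \<longleftrightarrow> plain r" "plain (test g v :: 'b regex)"
  "plain (alts rs) \<longleftrightarrow> (\<forall>r\<in>set rs. plain r)" "plain (seqs rs) \<longleftrightarrow> (\<forall>r\<in>set rs. plain r)"
  "plain (capture_seq xs r) \<longleftrightarrow> (\<forall>(g, q)\<in>set xs. plain q) \<and> plain r"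
proof -
  have p: "plain (char_power v :: 'b regex)" for v by (induction v) (simp_all add: char_power_def)
  have a: "plain (any_star :: 'b regex)" by (simp add: any_star_def)
  have l: "plain (at_length v :: 'b regex)" for v by (simp add: at_length_def p)
  have r: "plain (restart r) \<longleftrightarrow> plain r" for r :: "'b regex" by (simp add: restart_def a)
  show "plain (char_power v :: 'b regex)" "plain (any_star :: 'b regex)" "plain (at_length v :: 'b regex)"
    "plain (restart r) \<longleftrightarrow> plain r"
    by (fact p a l r)+
  show "plain (test g v :: 'b regex)" by (simp add: test_def r l)
  show "plain (alts rs) \<longleftrightarrow> (\<forall>r\<in>set rs. plain r)" by (induction rs) (simp_all add: alts_def)
  show "plain (seqs rs) \<longleftrightarrow> (\<forall>r\<in>set rs. plain r)" by (induction rs) (simp_all add: seqs_def)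
  show "plain (capture_seq xs r) \<longleftrightarrow> (\<forall>(g, q)\<in>set xs. plain q) \<and> plain r"
    by (induction xs r rule: capture_seq.induct) auto
qed

lemma plain_reach_regex: "plain base \<Longrightarrow> plain (reach_regex J base k)"
proof (induction k)
  case (Suc k)
  have "plain (select k g h)" for g h by (simp add: select_def)
  with Suc show ?case
    by (auto simp: halves_def half_def bit_capture_def copies_def simp del: upt_Suc)
qed simp

lemma plain_top_regex: "plain (top_regex J Ts accs K v)"
proof -
  have "plain (base_regex J Ts :: 'a regex)" by (auto simp: base_regex_def window_def)
  from plain_reach_regex[OF this] show ?thesis by (auto simp: top_regex_def simp del: upt_Suc)
qed

section \<open>Correctness of the complete regex\<close>

context
  fixes W :: "'a set" and c :: 'a and N :: nat
begin

lemma pure_nonempty: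
  "pure W c N r P \<Longrightarrow> p \<le> N \<Longrightarrow> ranges_within N \<gamma> \<Longrightarrow> outs W (replicate N c) r p \<gamma> d \<noteq> {} \<longleftrightarrow> P \<gamma>"
  by (simp add: pureD)

lemma base_regex_correct:
  assumes "ranges_within N \<gamma>" "clean J \<gamma>"
  shows "outs W (replicate N c) (base_regex J Ts) 0 \<gamma> Forward \<noteq> {} \<longleftrightarrow>
    step_rel J Ts (vec J \<gamma> 0 0) (vec J \<gamma> 1 0)"
proof -
  let ?P = "\<lambda>j (u, v, w, v') \<gamma>. width \<gamma> (name 0 0 (j - 1)) = u \<and> width \<gamma> (name 0 0 j) = v \<and>
    width \<gamma> (name 0 0 (Suc j)) = w \<and> width \<gamma> (name 1 0 j) = v'"
  have win: "pure W c N (window j t) (?P j t)" for j t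
  proof (cases t)
    case (fields u v w v')
    show ?thesis unfolding fields window_def prod.case by (intro pure_Seq pure_test')
  qed
  have "pure W c N (base_regex J Ts)
      (\<lambda>\<gamma>. \<exists>T\<in>set Ts. \<forall>j\<in>set [Suc 0..<Suc J]. \<exists>t\<in>set T. ?P j t \<gamma>)"
    unfolding base_regex_def by (intro pure_alts pure_seqs win)
  from pure_nonempty[OF this le0 assms(1)]
  have "outs W (replicate N c) (base_regex J Ts) 0 \<gamma> Forward \<noteq> {} \<longleftrightarrow>
      (\<exists>T\<in>set Ts. \<forall>j\<in>set [Suc 0..<Suc J]. \<exists>t\<in>set T. ?P j t \<gamma>)" .
  also have "\<dots> \<longleftrightarrow> step_rel J Ts (vec J \<gamma> 0 0) (vec J \<gamma> 1 0)"
  proof -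
    have "(\<exists>t\<in>set T. ?P j t \<gamma>) \<longleftrightarrow> (vec J \<gamma> 0 0 (j - 1), vec J \<gamma> 0 0 j, vec J \<gamma> 0 0 (Suc j), vec J \<gamma> 1 0 j) \<in> set T"
      if j: "1 \<le> j" "j \<le> J" for j and T :: "(nat \<times> nat \<times> nat \<times> nat) list"
    proof -
      have v: "vec J \<gamma> 0 0 i = width \<gamma> (name 0 0 i)" if "i \<le> Suc J" for i
        using that assms(2) by (cases "i = 0"; cases "i = Suc J") (auto simp: vec_def clean_def)
      have "vec J \<gamma> 1 0 j = width \<gamma> (name 1 0 j)" using j by (simp add: vec_def)
      with v[of "j - 1"] v[of j] v[of "Suc j"] j show ?thesis by auto
    qed
    then show ?thesis unfolding step_rel_def by (intro bex_cong ball_cong refl) auto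
  qed
  finally show ?thesis .
qed

lemma top_regex_correct:
  assumes T: "\<And>T u v w v'. T \<in> set Ts \<Longrightarrow> (u, v, w, v') \<in> set T \<Longrightarrow> v \<le> D \<and> v' \<le> D"
    and x: "\<And>j. 1 \<le> j \<Longrightarrow> j \<le> J \<Longrightarrow> x j \<le> D" "\<And>j. \<not> (1 \<le> j \<and> j \<le> J) \<Longrightarrow> x j = 0"
    and N: "2 * J * D \<le> N" "2 \<le> N" and J: "1 \<le> J"
  shows "has_match W (top_regex J Ts accs K x) (replicate N c) \<longleftrightarrow>
    (\<exists>y. (\<forall>j. \<not> (1 \<le> j \<and> j \<le> J) \<longrightarrow> y j = 0) \<and> y 1 \<in> set accs \<and> reach J (step_rel J Ts) K x y)"
proof -
  let ?ga = "map (name 0 K) [Suc 0..<Suc J]" and ?gb = "map (name 1 K) [Suc 0..<Suc J]"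
  let ?items = "map (\<lambda>j. (name 0 K j, char_power (x j) :: 'a regex)) [Suc 0..<Suc J] @
    map (\<lambda>j. (name 1 K j, any_star)) [Suc 0..<Suc J]"
  let ?gs = "map fst ?items"
  let ?acc = "alts (map (test (name 1 K 1)) accs) :: 'a regex"
  let ?body = "reach_regex J (base_regex J Ts) K :: 'a regex"
  let ?rest = "Seq ?acc (restart ?body)"
  let ?\<gamma> = "\<lambda>_. Undefined"
  let ?o = "outs W (replicate N c)"
  define V where "V g = (if g \<in> set ?ga then {n. \<exists>j. g = name 0 K j \<and> n = x j} else UNIV)" for g
  define GS where "GS = ?ga @ ?gb"
  have gs: "?gs = GS" by (simp only: GS_def map_append map_map comp_def fst_conv)
  have d: "distinct GS" unfolding GS_def by (auto simp: distinct_map inj_on_def)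
  have bound: "u j \<le> D \<and> v j \<le> D" if "step_rel J Ts u v" "1 \<le> j" "j \<le> J" for u v j
    using that T unfolding step_rel_def by fastforce
  have "has_match W (top_regex J Ts accs K x) (replicate N c) \<longleftrightarrow>
      (\<exists>k\<le>N. ?o (top_regex J Ts accs K x) k ?\<gamma> Forward \<noteq> {})"
    by (simp add: has_match_def outs_def)
  also have "\<dots> \<longleftrightarrow> ?o (capture_seq ?items ?rest) 0 ?\<gamma> Forward \<noteq> {}"
    by (auto simp: top_regex_def outs_Seq_Forward outs_Anchor simp del: upt_Suc)
  also have "\<dots> \<longleftrightarrow> (\<exists>v. (\<forall>g\<in>fst ` set ?items. v g \<in> V g) \<and> 0 + sum_list (map v ?gs) \<le> N \<and>
      ?o ?rest (0 + sum_list (map v ?gs)) (assign 0 ?\<gamma> v ?gs) Forward \<noteq> {})"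
  proof (rule routs_capture_seq[where G = UNIV and \<gamma>0 = ?\<gamma>])
    fix g r p \<gamma>' assume gr: "(g, r) \<in> set ?items" and p: "p \<le> N"
    from gr consider j where "1 \<le> j" "j \<le> J" "g = name 0 K j" "r = char_power (x j)"
      | j where "1 \<le> j" "j \<le> J" "g = name 1 K j" "r = any_star" by auto
    then show "?o r p \<gamma>' Forward = {(p + v, \<gamma>') |v. v \<in> V g \<and> p + v \<le> N}"
    proof cases
      case 1
      then have "V g = {x j}" by (auto simp: V_def)
      with 1 p show ?thesis by (auto simp: uouts_char_power_Forward)
    next
      case 2
      then have "V g = UNIV" by (auto simp: V_def)
      with 2 p show ?thesis by (auto simp: uouts_any_star_Forward le_iff_add)
    qed
  next
    show "distinct ?gs" unfolding gs by (rule d)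
  qed (auto simp: ranges_within_def)
  also have "\<dots> \<longleftrightarrow> (\<exists>v. (\<forall>g\<in>set GS. v g \<in> V g) \<and> sum_list (map v GS) \<le> N \<and>
      ?o ?rest (sum_list (map v GS)) (assign 0 ?\<gamma> v GS) Forward \<noteq> {})"
    by (simp only: set_map[symmetric] gs add_0)
  also have "\<dots> \<longleftrightarrow> (\<exists>y. (\<forall>j. \<not> (1 \<le> j \<and> j \<le> J) \<longrightarrow> y j = 0) \<and> y 1 \<in> set accs \<and>
      reach J (step_rel J Ts) K x y)" (is "?L \<longleftrightarrow> ?R")
  proof -
    let ?y = "\<lambda>v j. if 1 \<le> j \<and> j \<le> J then v (name 1 K j) else 0"
    have key: "?o ?rest (sum_list (map v GS)) (assign 0 ?\<gamma> v GS) Forward \<noteq> {} \<longleftrightarrow>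
        ?y v 1 \<in> set accs \<and> reach J (step_rel J Ts) K x (?y v)"
      if v: "\<forall>g\<in>set GS. v g \<in> V g" and s: "sum_list (map v GS) \<le> N" for v
    proof -
      let ?\<delta> = "assign 0 ?\<gamma> v GS"
      have f: "ranges_within N ?\<delta>" by (rule ranges_within_assign) (use s in \<open>simp_all add: ranges_within_def\<close>)
      have w: "width ?\<delta> g = (if g \<in> set GS then v g else 0)" for g
        by (subst width_assign[OF d]) (simp add: width_def)
      have "name t k 0 \<notin> set GS" "name t k (Suc J) \<notin> set GS" for t k unfolding GS_def by auto
      then have cl: "clean J ?\<delta>" by (simp only: clean_def w) simp
      have in_gs: "name 0 K j \<in> set GS" "name 1 K j \<in> set GS" if "1 \<le> j" "j \<le> J" for j
        unfolding GS_def using that by auto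
      have "v (name 0 K j) = x j" if "1 \<le> j" "j \<le> J" for j
      proof -
        have "name 0 K j \<in> set ?ga" using that by auto
        then have "V (name 0 K j) = {x j}" by (simp only: V_def if_True) auto
        with bspec[OF v in_gs(1)[OF that]] show ?thesis by simp
      qed
      then have v0: "vec J ?\<delta> 0 K = x" using x(2) in_gs by (auto simp: vec_def w fun_eq_iff)
      have v1: "vec J ?\<delta> 1 K = ?y v" using in_gs by (auto simp: vec_def w fun_eq_iff)
      have "pure W c N ?acc (\<lambda>\<gamma>. \<exists>a\<in>set accs. width \<gamma> (name 1 K 1) = a)"
        by (intro pure_alts pure_test')
      from pureD[OF this s f] have acc: "?o ?acc (sum_list (map v GS)) ?\<delta> Forward =
          (if width ?\<delta> (name 1 K 1) \<in> set accs then {(sum_list (map v GS), ?\<delta>)} else {})" by simp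
      have "?o ?rest (sum_list (map v GS)) ?\<delta> Forward \<noteq> {} \<longleftrightarrow>
          width ?\<delta> (name 1 K 1) \<in> set accs \<and> ?o ?body 0 ?\<delta> Forward \<noteq> {}"
        unfolding outs_Seq_Forward acc using uouts_restart_empty_iff[OF s, of W c ?body ?\<delta> Forward] by simp
      also have "?o ?body 0 ?\<delta> Forward \<noteq> {} \<longleftrightarrow> reach J (step_rel J Ts) K (vec J ?\<delta> 0 K) (vec J ?\<delta> 1 K)"
        by (rule reach_regex_correct[where D = D and St = "step_rel J Ts", OF _ _ _ N f cl])
          (erule (1) base_regex_correct, rule groups_base_regex, rule bound)
      also have "width ?\<delta> (name 1 K 1) = ?y v 1" using in_gs(2)[of 1] J by (simp add: w)
      finally show ?thesis unfolding v0 v1 .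
    qed
    show ?thesis
    proof
      assume ?L
      then obtain v where v: "\<forall>g\<in>set GS. v g \<in> V g" "sum_list (map v GS) \<le> N"
        "?o ?rest (sum_list (map v GS)) (assign 0 ?\<gamma> v GS) Forward \<noteq> {}" by blast
      with key[OF v(1,2)] show ?R by (intro exI[of _ "?y v"]) simp
    next
      assume ?R
      then obtain y where y: "\<forall>j. \<not> (1 \<le> j \<and> j \<le> J) \<longrightarrow> y j = 0" "y 1 \<in> set accs"
        "reach J (step_rel J Ts) K x y" by blast
      define v where "v g = (if g \<in> set ?ga then x (THE j. g = name 0 K j) else y (THE j. g = name 1 K j))" for g
      have v0: "v (name 0 K j) = x j" and v1: "v (name 1 K j) = y j" if "1 \<le> j" "j \<le> J" for j
        using that by (auto simp: v_def)
      have yv: "?y v = y" using y(1) v1 by auto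
      have v: "\<forall>g\<in>set GS. v g \<in> V g" unfolding GS_def using v0 by (auto simp: V_def)
      have "v g \<le> D" if "g \<in> set GS" for g
      proof -
        from that consider j where "1 \<le> j" "j \<le> J" "g = name 0 K j" | j where "1 \<le> j" "j \<le> J" "g = name 1 K j"
          unfolding GS_def by auto
        then show ?thesis
        proof cases
          case 2
          have "x j \<le> D \<and> y j \<le> D" by (rule reach_bound[where St = "step_rel J Ts"]) (fact bound y 2)+
          then show ?thesis unfolding 2(3) v1[OF 2(1,2)] by blast
        qed (simp add: v0 x)
      qed
      then have "sum_list (map v GS) \<le> length GS * D" by (rule sum_list_map_bound)
      also have "length GS = 2 * J" unfolding GS_def by simp
      finally have s: "sum_list (map v GS) \<le> N" using N(1) by simp
      have "?y v 1 \<in> set accs" using y(2) J v1[OF order_refl J] by simp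
      moreover have "reach J (step_rel J Ts) K x (?y v)" unfolding yv by (rule y)
      ultimately have "?y v 1 \<in> set accs \<and> reach J (step_rel J Ts) K x (?y v)" ..
      with key[OF v s] v s show ?L by blast
    qed
  qed
  finally show ?thesis .
qed

end

section \<open>Turing machine configurations as words of columns\<close>

instance symbol :: countable by countable_datatype

type_synonym column = "nat \<times> (symbol \<times> bool) list"

text \<open>The state is repeated in every column, so that all columns can be updated locally and
  agree on the state.\<close>

definition column_at :: "config \<Rightarrow> int \<Rightarrow> column" where
  "column_at = (\<lambda>(q, ts) z. (q, map (\<lambda>(t, h). (t z, h = z)) ts))"

text \<open>Code \<open>0\<close> is reserved for a missing column, in agreement with the width of a
  group that has not been captured.\<close>

definition column_code :: "column option \<Rightarrow> nat" where
  "column_code u = (case u of None \<Rightarrow> 0 | Some v \<Rightarrow> Suc (to_nat v))"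

lemma column_code_eq [simp]: "column_code u = column_code v \<longleftrightarrow> u = v"
  by (simp add: column_code_def split: option.splits)

text \<open>The cells from \<open>-(b + 1)\<close> to \<open>b + 1\<close>: the range of the heads
  and one more cell on each side.\<close>

definition num_columns :: "nat \<Rightarrow> nat" where "num_columns b = 2 * b + 3"

text \<open>Column \<open>j\<close> stands for cell \<open>j - (b + 2)\<close>, so that no head is on the first or last column.\<close>

definition column_opt :: "nat \<Rightarrow> config \<Rightarrow> nat \<Rightarrow> column option" where
  "column_opt b cf j = (if 1 \<le> j \<and> j \<le> num_columns b then Some (column_at cf (int j - int (b + 2))) else None)"

definition config_vec :: "nat \<Rightarrow> config \<Rightarrow> nat \<Rightarrow> nat" where
  "config_vec b cf j = column_code (column_opt b cf j)"

definition head_in :: "column option \<Rightarrow> nat \<Rightarrow> bool" where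
  "head_in u i = (case u of None \<Rightarrow> False | Some (q, l) \<Rightarrow> snd (l ! i))"

definition as_list :: "'b set \<Rightarrow> 'b list" where "as_list S = (SOME xs. set xs = S)"

lemma set_as_list: "finite S \<Longrightarrow> set (as_list S) = S"
  unfolding as_list_def using finite_list by (rule someI_ex)

context
  fixes M :: turing_machine
  assumes wf: "well_formed_tm M"
begin

definition columns :: "column set" where
  "columns = states M \<times> {l. set l \<subseteq> alphabet M \<times> UNIV \<and> length l = num_tapes M}"

lemma finite_columns: "finite columns"
proof -
  have "finite (alphabet M \<times> (UNIV :: bool set))" using wf by (auto simp: well_formed_tm_def)
  then have "finite {l. set l \<subseteq> alphabet M \<times> (UNIV :: bool set) \<and> length l = num_tapes M}"
    by (rule finite_lists_length_eq)
  then show ?thesis using wf by (auto simp: columns_def well_formed_tm_def)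
qed

definition scans :: "(nat \<times> symbol list) set" where
  "scans = states M \<times> {xs. set xs \<subseteq> alphabet M \<and> length xs = num_tapes M}"

lemma finite_scans: "finite scans"
proof -
  have "finite {xs. set xs \<subseteq> alphabet M \<and> length xs = num_tapes M}"
    using wf by (intro finite_lists_length_eq) (auto simp: well_formed_tm_def)
  then show ?thesis using wf by (auto simp: scans_def well_formed_tm_def)
qed

text \<open>A halted machine keeps its state, rewrites the scanned symbols and does not move. So
  halting needs no special case, and a run can be prolonged to length \<open>2^k\<close>.\<close>

definition moves :: "nat \<Rightarrow> symbol list \<Rightarrow> nat \<times> (symbol \<times> int) list" where
  "moves q xs = (if q \<in> halting_states M then (q, map (\<lambda>x. (x, 0)) xs) else transition M q xs)"

definition new_column :: "nat \<times> symbol list \<Rightarrow> column option \<Rightarrow> column \<Rightarrow> column option \<Rightarrow> column" where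
  "new_column = (\<lambda>(q, xs) u v w. (fst (moves q xs), map (\<lambda>i.
     (if snd (snd v ! i) then fst (snd (moves q xs) ! i) else fst (snd v ! i),
      snd (snd v ! i) \<and> snd (snd (moves q xs) ! i) = 0 \<or> head_in u i \<and> snd (snd (moves q xs) ! i) = 1 \<or>
      head_in w i \<and> snd (snd (moves q xs) ! i) = -1)) [0..<num_tapes M]))"

text \<open>The guess of the state and of all scanned symbols is verified locally: a column compares
  the state and, for the tapes whose heads it contains, its own symbol.\<close>

definition consistent :: "nat \<times> symbol list \<Rightarrow> column \<Rightarrow> bool" where
  "consistent = (\<lambda>(q, xs) v. fst v = q \<and> (\<forall>i<num_tapes M. snd (snd v ! i) \<longrightarrow> fst (snd v ! i) = xs ! i))"

definition windows_of :: "nat \<times> symbol list \<Rightarrow> (nat \<times> nat \<times> nat \<times> nat) set" where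
  "windows_of qx = (\<lambda>(u, v, w). (column_code u, column_code (Some v), column_code w,
      column_code (Some (new_column qx u v w)))) `
    {(u, v, w). u \<in> insert None (Some ` columns) \<and> v \<in> columns \<and> w \<in> insert None (Some ` columns) \<and> consistent qx v}"

definition window_lists :: "(nat \<times> nat \<times> nat \<times> nat) list list" where
  "window_lists = map (as_list \<circ> windows_of) (as_list scans)"

definition accepting :: "nat list" where
  "accepting = as_list ((\<lambda>v. column_code (Some v)) ` {v \<in> columns. fst v = accept_state M})"

lemma finite_windows: "finite (windows_of qx)"
proof -
  have "finite (insert None (Some ` columns) \<times> columns \<times> insert None (Some ` columns))"
    using finite_columns by auto
  then show ?thesis unfolding windows_of_def by (intro finite_imageI) (rule finite_subset, auto)
qed

definition valid_config :: "nat \<Rightarrow> config \<Rightarrow> bool" where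
  "valid_config b = (\<lambda>(q, ts). q \<in> states M \<and> length ts = num_tapes M \<and>
     (\<forall>(t, h)\<in>set ts. (\<forall>z. t z \<in> alphabet M) \<and> \<bar>h\<bar> \<le> int b))"

lemma moves_ok:
  assumes "q \<in> states M" "set xs \<subseteq> alphabet M" "length xs = num_tapes M"
  shows "fst (moves q xs) \<in> states M" "length (snd (moves q xs)) = num_tapes M"
    "set (snd (moves q xs)) \<subseteq> alphabet M \<times> {-1, 0, 1}"
proof -
  have "fst (moves q xs) \<in> states M \<and> length (snd (moves q xs)) = num_tapes M \<and>
    set (snd (moves q xs)) \<subseteq> alphabet M \<times> {-1, 0, 1}"
  proof (cases "q \<in> halting_states M")
    case True
    then have m: "moves q xs = (q, map (\<lambda>x. (x, 0)) xs)" by (simp add: moves_def)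
    show ?thesis unfolding m using assms by auto
  next
    case False
    have "\<forall>q\<in>states M - halting_states M. \<forall>xs\<in>lists (alphabet M). length xs = num_tapes M \<longrightarrow>
        (case transition M q xs of (q', acts) \<Rightarrow>
        q' \<in> states M \<and> length acts = num_tapes M \<and> set acts \<subseteq> alphabet M \<times> {-1, 0, 1})"
      using wf unfolding well_formed_tm_def by (elim conjE)
    moreover have "q \<in> states M - halting_states M" using False assms(1) by (rule DiffI[rotated])
    moreover have "xs \<in> lists (alphabet M)" using assms(2) by (simp add: lists_eq_set)
    ultimately have "case transition M q xs of (q', acts) \<Rightarrow>
        q' \<in> states M \<and> length acts = num_tapes M \<and> set acts \<subseteq> alphabet M \<times> {-1, 0, 1}"
      using assms(3) by (elim ballE[of _ _ q] ballE[of _ _ xs]) (simp_all only: simp_thms)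
    moreover obtain q' acts where "transition M q xs = (q', acts)" by force
    ultimately show ?thesis using False by (simp only: moves_def if_False prod.case fst_conv snd_conv)
  qed
  then show "fst (moves q xs) \<in> states M" "length (snd (moves q xs)) = num_tapes M"
    "set (snd (moves q xs)) \<subseteq> alphabet M \<times> {-1, 0, 1}" by - (elim conjE, assumption)+
qed

lemma tm_step_moves:
  "tm_step M (q, ts) = (fst (moves q (map scanned ts)), map2 tape_action ts (snd (moves q (map scanned ts))))"
proof (cases "q \<in> halting_states M")
  case True
  have "map2 tape_action ts (map (\<lambda>x. (x, 0)) (map scanned ts)) = ts"
    by (induction ts) (simp_all add: tape_action_scanned)
  with True show ?thesis by (simp add: moves_def del: map_map)
next
  case False
  have sc: "(\<lambda>(c, h). c h) = scanned" by (auto simp: scanned_def)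
  obtain q' acts where "transition M q (map scanned ts) = (q', acts)" by force
  with False show ?thesis by (simp add: moves_def sc)
qed

lemma column_in_columns: "valid_config b cf \<Longrightarrow> column_at cf z \<in> columns"
  by (auto simp: valid_config_def column_at_def columns_def split: prod.splits)

lemma column_opt_in: "valid_config b cf \<Longrightarrow> column_opt b cf j \<in> insert None (Some ` columns)"
  by (auto simp: column_opt_def column_in_columns)

lemma head_in_column_opt:
  assumes "valid_config b (q, ts)" "i < num_tapes M"
  shows "head_in (column_opt b (q, ts) j) i \<longleftrightarrow> snd (ts ! i) = int j - int (b + 2)"
proof -
  from assms have i: "i < length ts" by (simp add: valid_config_def)
  obtain t h where th: "ts ! i = (t, h)" by force
  then have "(t, h) \<in> set ts" using nth_mem[OF i] by simp
  then have "\<bar>snd (ts ! i)\<bar> \<le> int b" using assms(1) th by (auto simp: valid_config_def)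
  with i show ?thesis
    by (auto simp: head_in_def column_opt_def column_at_def num_columns_def split: prod.splits)
qed

lemma new_column_correct:
  assumes "valid_config b (q, ts)" "1 \<le> j" "j \<le> num_columns b"
  shows "new_column (q, map scanned ts) (column_opt b (q, ts) (j - 1)) (column_at (q, ts) (int j - int (b + 2)))
    (column_opt b (q, ts) (Suc j)) = column_at (tm_step M (q, ts)) (int j - int (b + 2))"
proof -
  let ?z = "int j - int (b + 2)"
  let ?xs = "map scanned ts"
  let ?a = "snd (moves q ?xs)"
  have len: "length ts = num_tapes M" and q: "q \<in> states M" using assms(1) by (auto simp: valid_config_def)
  have "set ?xs \<subseteq> alphabet M" using assms(1) by (auto simp: valid_config_def scanned_def split: prod.splits)
  note ok = moves_ok[OF q this, simplified, OF len]
  define F where "F i = (if snd (snd (column_at (q, ts) ?z) ! i) then fst (?a ! i) else fst (snd (column_at (q, ts) ?z) ! i),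
      snd (snd (column_at (q, ts) ?z) ! i) \<and> snd (?a ! i) = 0 \<or>
      head_in (column_opt b (q, ts) (j - 1)) i \<and> snd (?a ! i) = 1 \<or>
      head_in (column_opt b (q, ts) (Suc j)) i \<and> snd (?a ! i) = -1)" for i
  define G where "G = (\<lambda>(t :: int \<Rightarrow> symbol, h). (t ?z, h = ?z))"
  have key: "F i = G (tape_action (ts ! i) (?a ! i))" if i: "i < num_tapes M" for i
  proof -
    obtain t h where th: "ts ! i = (t, h)" by force
    obtain a m where am: "?a ! i = (a, m)" by force
    have "?a ! i \<in> set ?a" using ok(2) i by simp
    then have m: "m = -1 \<or> m = 0 \<or> m = 1" using ok(3) am by auto
    have col: "snd (column_at (q, ts) ?z) ! i = (t ?z, h = ?z)" using i len th by (simp add: column_at_def)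
    have hu: "head_in (column_opt b (q, ts) (j - 1)) i \<longleftrightarrow> h = ?z - 1"
      using head_in_column_opt[OF assms(1) i, of "j - 1"] assms(2) th by auto
    have hw: "head_in (column_opt b (q, ts) (Suc j)) i \<longleftrightarrow> h = ?z + 1"
      using head_in_column_opt[OF assms(1) i, of "Suc j"] th by auto
    show ?thesis unfolding F_def G_def col hu hw am th using m by auto
  qed
  have "new_column (q, ?xs) (column_opt b (q, ts) (j - 1)) (column_at (q, ts) ?z) (column_opt b (q, ts) (Suc j)) =
      (fst (moves q ?xs), map F [0..<num_tapes M])" unfolding new_column_def F_def prod.case ..
  also have "map F [0..<num_tapes M] = map G (map2 tape_action ts ?a)"
    by (rule nth_equalityI) (simp_all add: key len ok(2))
  also have "(fst (moves q ?xs), map G (map2 tape_action ts ?a)) = column_at (tm_step M (q, ts)) ?z"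
    unfolding tm_step_moves column_at_def G_def prod.case ..
  finally show ?thesis .
qed

lemma config_vec_consistent:
  assumes "valid_config b (q, ts)"
  shows "consistent (q, map scanned ts) (column_at (q, ts) z)"
  using assms by (auto simp: consistent_def column_at_def valid_config_def scanned_def split: prod.splits)

text \<open>Every head lies on some column, so consistency of all columns leaves only the true state
  and scanned symbols as a guess. Hence the relation is deterministic on vectors of
  configurations.\<close>

theorem step_rel_config:
  assumes v: "valid_config b cf" and y: "\<forall>j. \<not> (1 \<le> j \<and> j \<le> num_columns b) \<longrightarrow> y j = 0"
  shows "step_rel (num_columns b) window_lists (config_vec b cf) y \<longleftrightarrow> y = config_vec b (tm_step M cf)"
proof -
  obtain q ts where cf: "cf = (q, ts)" by force
  let ?J = "num_columns b" and ?xs = "map scanned ts"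
  let ?z = "\<lambda>j. int j - int (b + 2)"
  have len: "length ts = num_tapes M" and q: "q \<in> states M" using v by (auto simp: valid_config_def cf)
  have xs: "set ?xs \<subseteq> alphabet M" using v by (auto simp: valid_config_def cf scanned_def split: prod.splits)
  have x: "config_vec b cf j = column_code (Some (column_at cf (?z j)))" if "1 \<le> j" "j \<le> ?J" for j
    using that by (simp add: config_vec_def column_opt_def)
  have step_def': "step_rel ?J window_lists (config_vec b cf) y \<longleftrightarrow> (\<exists>qx\<in>scans. \<forall>j\<in>{1..?J}.
      (config_vec b cf (j - 1), config_vec b cf j, config_vec b cf (Suc j), y j) \<in> windows_of qx)"
    by (simp add: step_rel_def window_lists_def set_as_list finite_scans finite_windows)
  have win: "(config_vec b cf (j - 1), config_vec b cf j, config_vec b cf (Suc j), y j) \<in> windows_of qx \<longleftrightarrow>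
      consistent qx (column_at cf (?z j)) \<and>
      y j = column_code (Some (new_column qx (column_opt b cf (j - 1)) (column_at cf (?z j)) (column_opt b cf (Suc j))))"
    if j: "1 \<le> j" "j \<le> ?J" for j qx
  proof
    assume "(config_vec b cf (j - 1), config_vec b cf j, config_vec b cf (Suc j), y j) \<in> windows_of qx"
    then show "consistent qx (column_at cf (?z j)) \<and>
      y j = column_code (Some (new_column qx (column_opt b cf (j - 1)) (column_at cf (?z j)) (column_opt b cf (Suc j))))"
      unfolding windows_of_def x[OF j] config_vec_def[of b cf "j - 1"] config_vec_def[of b cf "Suc j"] by auto
  next
    assume "consistent qx (column_at cf (?z j)) \<and>
      y j = column_code (Some (new_column qx (column_opt b cf (j - 1)) (column_at cf (?z j)) (column_opt b cf (Suc j))))"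
    then show "(config_vec b cf (j - 1), config_vec b cf j, config_vec b cf (Suc j), y j) \<in> windows_of qx"
      unfolding windows_of_def x[OF j] config_vec_def[of b cf "j - 1"] config_vec_def[of b cf "Suc j"]
      using column_opt_in[OF v] column_in_columns[OF v]
      by (intro image_eqI[where x = "(column_opt b cf (j - 1), column_at cf (?z j), column_opt b cf (Suc j))"]) simp_all
  qed
  show ?thesis
  proof
    assume "step_rel ?J window_lists (config_vec b cf) y"
    then obtain qx where "qx \<in> scans" and qx: "\<And>j. 1 \<le> j \<Longrightarrow> j \<le> ?J \<Longrightarrow> consistent qx (column_at cf (?z j)) \<and>
      y j = column_code (Some (new_column qx (column_opt b cf (j - 1)) (column_at cf (?z j)) (column_opt b cf (Suc j))))"
      unfolding step_def' using win by auto
    obtain q' xs' where qx': "qx = (q', xs')" by force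
    have q': "q' = q" using qx[of 1] by (simp add: qx' consistent_def column_at_def cf num_columns_def)
    \<comment> \<open>The column that contains the head of tape \<open>i\<close> compares the
      guessed symbol with the scanned one.\<close>
    have "xs' ! i = ?xs ! i" if i: "i < num_tapes M" for i
    proof -
      obtain t h where th: "ts ! i = (t, h)" by force
      have "\<bar>h\<bar> \<le> int b" using v th nth_mem[of i ts] i len by (auto simp: valid_config_def cf)
      then have j: "1 \<le> nat (h + int (b + 2))" "nat (h + int (b + 2)) \<le> ?J" "?z (nat (h + int (b + 2))) = h"
        by (auto simp: num_columns_def)
      from qx[OF j(1,2)] i th len show ?thesis unfolding j(3)
        by (auto simp: qx' consistent_def column_at_def cf scanned_def)
    qed
    moreover have "length xs' = num_tapes M" using \<open>qx \<in> scans\<close> by (simp add: scans_def qx')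
    ultimately have "xs' = ?xs" using len by (auto intro!: nth_equalityI)
    with q' have "qx = (q, ?xs)" by (simp add: qx')
    then have "y j = config_vec b (tm_step M cf) j" for j
      using qx[of j] y new_column_correct[of b q ts j] v
      by (cases "1 \<le> j \<and> j \<le> ?J") (auto simp: config_vec_def column_opt_def cf column_code_def[of None])
    then show "y = config_vec b (tm_step M cf)" by auto
  next
    assume yy: "y = config_vec b (tm_step M cf)"
    have "(q, ?xs) \<in> scans" using q xs len by (auto simp: scans_def)
    moreover have "consistent (q, ?xs) (column_at cf (?z j)) \<and>
      y j = column_code (Some (new_column (q, ?xs) (column_opt b cf (j - 1)) (column_at cf (?z j)) (column_opt b cf (Suc j))))"
      if "1 \<le> j" "j \<le> ?J" for j
      using new_column_correct[of b q ts j] config_vec_consistent[of b q ts] v that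
      by (auto simp: cf yy config_vec_def column_opt_def)
    ultimately show "step_rel ?J window_lists (config_vec b cf) y"
      unfolding step_def' using win by (intro bexI[of _ "(q, ?xs)"]) auto
  qed
qed

end

section \<open>Runs as reachability between column vectors\<close>

context
  fixes M :: turing_machine
  assumes wf: "well_formed_tm M"
begin

definition max_code :: nat where
  "max_code = Max (insert 1 ((\<lambda>v. column_code (Some v)) ` columns M \<union>
     (\<Union>qx\<in>scans M. (\<lambda>(u, v, w, v'). v') ` windows_of M qx)))"

lemma max_code_ge:
  "1 \<le> max_code" "v \<in> columns M \<Longrightarrow> column_code (Some v) \<le> max_code"
  "qx \<in> scans M \<Longrightarrow> (u, a, e, v') \<in> windows_of M qx \<Longrightarrow> v' \<le> max_code"
proof -
  have fin: "finite (insert 1 ((\<lambda>v. column_code (Some v)) ` columns M \<union>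
     (\<Union>qx\<in>scans M. (\<lambda>(u, v, w, v'). v') ` windows_of M qx)))"
    by (simp add: finite_columns[OF wf] finite_scans[OF wf] finite_windows[OF wf])
  show "1 \<le> max_code" unfolding max_code_def by (rule Max_ge[OF fin]) simp
  show "column_code (Some v) \<le> max_code" if "v \<in> columns M"
    unfolding max_code_def by (rule Max_ge[OF fin]) (use that in blast)
  show "v' \<le> max_code" if "qx \<in> scans M" "(u, a, e, v') \<in> windows_of M qx"
    unfolding max_code_def by (rule Max_ge[OF fin]) (use that in force)
qed

lemma window_lists_le:
  assumes "T \<in> set (window_lists M)" "(u, v, w, v') \<in> set T"
  shows "v \<le> max_code \<and> v' \<le> max_code"
proof -
  from assms obtain qx where qx: "qx \<in> scans M" and t: "(u, v, w, v') \<in> windows_of M qx"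
    by (auto simp: window_lists_def[OF wf] set_as_list finite_scans[OF wf] finite_windows[OF wf])
  from t obtain x where "x \<in> columns M" "v = column_code (Some x)" unfolding windows_of_def[OF wf] by auto
  with max_code_ge(2) max_code_ge(3)[OF qx t] show ?thesis by auto
qed

lemma config_vec_outside: "\<not> (1 \<le> j \<and> j \<le> num_columns b) \<Longrightarrow> config_vec b cf j = 0"
  by (auto simp: config_vec_def column_opt_def column_code_def)

lemma config_vec_inside:
  "1 \<le> j \<Longrightarrow> j \<le> num_columns b \<Longrightarrow> config_vec b cf j = column_code (Some (column_at cf (int j - int (b + 2))))"
  by (simp add: config_vec_def column_opt_def)

lemma config_vec_le: "valid_config M b cf \<Longrightarrow> config_vec b cf j \<le> max_code"
  using config_vec_outside[of j b cf] config_vec_inside[of j b cf] column_in_columns[OF wf, of b cf] max_code_ge(2)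
  by (cases "1 \<le> j \<and> j \<le> num_columns b") auto

lemma fst_column_at [simp]: "fst (column_at cf z) = fst cf"
  by (cases cf) (simp add: column_at_def)

lemma accepting_iff:
  assumes "valid_config M b cf"
  shows "config_vec b cf 1 \<in> set (accepting M) \<longleftrightarrow> fst cf = accept_state M"
proof -
  have "finite ((\<lambda>v. column_code (Some v)) ` {v \<in> columns M. fst v = accept_state M})"
    using finite_columns[OF wf] by simp
  then have "set (accepting M) = (\<lambda>v. column_code (Some v)) ` {v \<in> columns M. fst v = accept_state M}"
    unfolding accepting_def[OF wf] by (rule set_as_list)
  then have "column_code (Some v) \<in> set (accepting M) \<longleftrightarrow> v \<in> columns M \<and> fst v = accept_state M" for v
    by auto
  then show ?thesis
    using config_vec_inside[of 1 b cf] column_in_columns[OF wf assms] by (simp add: num_columns_def)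
qed

lemma config_vec_state:
  "config_vec b cf = config_vec b cf' \<Longrightarrow> fst cf = fst cf'"
  using fun_cong[of "config_vec b cf" "config_vec b cf'" 1] config_vec_inside[of 1 b cf] config_vec_inside[of 1 b cf']
  by (simp add: num_columns_def) (metis fst_column_at)

lemma valid_run:
  assumes "runs_in_space M w b"
  shows "valid_config M b (tm_run M w t)"
proof -
  have heads: "\<forall>(c, h)\<in>set (snd (tm_run M w t)). \<bar>h\<bar> \<le> int b" for t
    using assms unfolding runs_in_space_def by blast
  have "fst (tm_run M w t) \<in> states M \<and> length (snd (tm_run M w t)) = num_tapes M \<and>
    (\<forall>t\<in>set (snd (tm_run M w t)). \<forall>z. fst t z \<in> alphabet M)"
  proof (induction t)
    case 0
    have a: "{Blank, Bit False, Bit True} \<subseteq> alphabet M" and s: "start_state M \<in> states M" and n: "0 < num_tapes M"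
      using wf by (auto simp: well_formed_tm_def)
    have "word_contents u z \<in> alphabet M" for u z
      using a by (cases "u ! nat z") (auto simp: word_contents_def)
    with s n show ?case by (auto simp: tm_run_def initial_config_def)
  next
    case (Suc t)
    obtain q ts where cf: "tm_run M w t = (q, ts)" by force
    let ?xs = "map scanned ts"
    from Suc cf have q: "q \<in> states M" and len: "length ts = num_tapes M"
      and al: "\<And>c h z. (c, h) \<in> set ts \<Longrightarrow> c z \<in> alphabet M" by fastforce+
    have "set ?xs \<subseteq> alphabet M" using al by (auto simp: scanned_def)
    note ok = moves_ok[OF wf q this, simplified, OF len]
    have step: "tm_run M w (Suc t) = (fst (moves M q ?xs), map2 tape_action ts (snd (moves M q ?xs)))"
      using cf by (simp only: tm_run_def funpow.simps comp_apply tm_step_moves[OF wf])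
    have "fst t z \<in> alphabet M" if "t \<in> set (map2 tape_action ts (snd (moves M q ?xs)))" for t z
    proof -
      from that obtain t' h' a m where th: "((t', h'), (a, m)) \<in> set (zip ts (snd (moves M q ?xs)))"
        and c: "fst t = t'(h' := a)" by auto
      from set_zip_leftD[OF th] set_zip_rightD[OF th] ok(3) al have "t' z \<in> alphabet M" "a \<in> alphabet M" by auto
      then show ?thesis by (simp add: c)
    qed
    moreover have "length (map2 tape_action ts (snd (moves M q ?xs))) = num_tapes M" using ok(2) len by simp
    ultimately show ?case using ok(1) unfolding step fst_conv snd_conv by blast
  qed
  with heads[of t] show ?thesis by (auto simp: valid_config_def[OF wf] split: prod.splits) (metis fst_conv)
qed

text \<open>By determinism the configuration after \<open>2 ^ k\<close> steps is the only possible
  midpoint, so the existential quantifier over midpoints collapses.\<close>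

lemma reach_run:
  assumes "runs_in_space M w b" and "\<forall>j. \<not> (1 \<le> j \<and> j \<le> num_columns b) \<longrightarrow> y j = 0"
  shows "reach (num_columns b) (step_rel (num_columns b) (window_lists M)) k (config_vec b (tm_run M w t)) y \<longleftrightarrow>
    y = config_vec b (tm_run M w (t + 2 ^ k))"
  using assms(2)
proof (induction k arbitrary: t y)
  case 0
  have "tm_run M w (t + 1) = tm_step M (tm_run M w t)" by (simp add: tm_run_def)
  with step_rel_config[OF wf valid_run[OF assms(1)] 0] show ?case by simp
next
  case (Suc k)
  let ?R = "reach (num_columns b) (step_rel (num_columns b) (window_lists M)) k"
  have "reach (num_columns b) (step_rel (num_columns b) (window_lists M)) (Suc k) (config_vec b (tm_run M w t)) y \<longleftrightarrow>
      (\<exists>m. (\<forall>j. \<not> (1 \<le> j \<and> j \<le> num_columns b) \<longrightarrow> m j = 0) \<and> m = config_vec b (tm_run M w (t + 2 ^ k)) \<and> ?R m y)"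
    unfolding reach.simps using Suc.IH by (intro ex_cong1) auto
  also have "\<dots> \<longleftrightarrow> ?R (config_vec b (tm_run M w (t + 2 ^ k))) y" using config_vec_outside by auto
  also have "\<dots> \<longleftrightarrow> y = config_vec b (tm_run M w (t + 2 ^ k + 2 ^ k))" by (rule Suc.IH) (rule Suc.prems)
  also have "t + 2 ^ k + 2 ^ k = t + 2 ^ Suc k" by simp
  finally show ?case .
qed

text \<open>The step relation mentions the vectors only. So configurations with equal vectors have
  successors with equal vectors.\<close>

lemma config_vec_run_Suc:
  assumes "runs_in_space M w b" "config_vec b (tm_run M w t) = config_vec b (tm_run M w t')"
  shows "config_vec b (tm_run M w (t + i)) = config_vec b (tm_run M w (t' + i))"
proof (induction i)
  case (Suc i)
  have "reach (num_columns b) (step_rel (num_columns b) (window_lists M)) 0 (config_vec b (tm_run M w (t + i)))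
      (config_vec b (tm_run M w (t + i + 2 ^ 0)))"
    by (subst reach_run[OF assms(1)]) (auto simp: config_vec_outside)
  then have "reach (num_columns b) (step_rel (num_columns b) (window_lists M)) 0 (config_vec b (tm_run M w (t' + i)))
      (config_vec b (tm_run M w (t + i + 2 ^ 0)))" unfolding Suc.IH .
  then show ?case by (subst (asm) reach_run[OF assms(1)]) (auto simp: config_vec_outside)
qed (simp add: assms)

text \<open>Until the machine halts the vectors are pairwise distinct, and there are at most
  \<open>Suc max_code ^ J\<close> of them, which is at most \<open>2 ^ (max_code * J)\<close>. As a
  halted machine no longer changes, the state at that very time is the final one.\<close>

lemma halting_time:
  assumes space: "runs_in_space M w b" and halts: "halts_in M w q"
  shows "fst (tm_run M w (2 ^ (max_code * num_columns b))) = q"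
proof -
  let ?J = "num_columns b"
  from halts obtain t where q: "q \<in> halting_states M" "fst (tm_run M w t) = q" by (auto simp: halts_in_def)
  define t0 where "t0 = (LEAST t. fst (tm_run M w t) \<in> halting_states M)"
  have h0: "fst (tm_run M w t0) \<in> halting_states M" unfolding t0_def by (rule LeastI[of _ t]) (simp add: q)
  have least: "t0 \<le> u" if "fst (tm_run M w u) \<in> halting_states M" for u
    unfolding t0_def using that by (rule Least_le)
  have late: "tm_run M w u = tm_run M w t0" if "t0 \<le> u" for u
  proof -
    have "tm_run M w u = (tm_step M ^^ ((u - t0) + t0)) (initial_config M w)" using that by (simp add: tm_run_def)
    also have "\<dots> = (tm_step M ^^ (u - t0)) (tm_run M w t0)" by (simp only: funpow_add comp_apply tm_run_def)
    also have "\<dots> = tm_run M w t0" by (rule tm_step_halted) (rule h0)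
    finally show ?thesis .
  qed
  have q0: "fst (tm_run M w t0) = q" using late[OF least[of t]] q by simp
  let ?f = "\<lambda>u. map (config_vec b (tm_run M w u)) [1..<Suc ?J]"
  have inj: "inj_on ?f {..t0}"
  proof -
    have "?f u \<noteq> ?f u'" if u: "u < u'" "u \<in> {..t0}" "u' \<in> {..t0}" for u u'
    proof
      assume eq: "?f u = ?f u'"
      have "config_vec b (tm_run M w u) j = config_vec b (tm_run M w u') j" for j
      proof (cases "1 \<le> j \<and> j \<le> ?J")
        case True
        then have "j \<in> set [1..<Suc ?J]" by auto
        with eq show ?thesis unfolding map_eq_conv by (rule bspec)
      qed (simp add: config_vec_outside)
      then have "config_vec b (tm_run M w u) = config_vec b (tm_run M w u')" by auto
      \<comment> \<open>If a vector occurred twice, the part of the run between the two occurrences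
        could be skipped and the machine would halt before its first halting time.\<close>
      from config_vec_run_Suc[OF space this, of "t0 - u'"] u
      have "config_vec b (tm_run M w (u + (t0 - u'))) = config_vec b (tm_run M w t0)" by simp
      from config_vec_state[OF this] h0 have "fst (tm_run M w (u + (t0 - u'))) \<in> halting_states M" by simp
      from least[OF this] u show False by simp
    qed
    note ne = this
    show ?thesis
    proof (rule inj_onI)
      fix u u' assume "u \<in> {..t0}" "u' \<in> {..t0}" "?f u = ?f u'"
      then show "u = u'" using ne[of u u'] ne[of u' u] by (cases u u' rule: linorder_cases) simp_all
    qed
  qed
  have fin: "finite {l. set l \<subseteq> {..max_code} \<and> length l = ?J}" by (rule finite_lists_length_eq) simp
  have "?f ` {..t0} \<subseteq> {l. set l \<subseteq> {..max_code} \<and> length l = ?J}"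
    using config_vec_le[OF valid_run[OF space]] by (auto simp del: upt_Suc)
  from card_inj_on_le[OF inj this fin] have "Suc t0 \<le> card {l. set l \<subseteq> {..max_code} \<and> length l = ?J}" by simp
  also have "\<dots> = Suc max_code ^ ?J" by (subst card_lists_length_eq) simp_all
  also have "\<dots> \<le> (2 ^ max_code) ^ ?J"
    using less_exp[of max_code] by (intro power_mono) (auto simp: Suc_le_eq)
  also have "\<dots> = 2 ^ (max_code * ?J)" by (simp add: power_mult)
  finally have "t0 \<le> 2 ^ (max_code * ?J)" by simp
  from late[OF this] q0 show ?thesis by simp
qed

text \<open>The string must hold two vectors captured in a row, hence
  \<open>2 * num_columns b * max_code\<close>; the summand \<open>2\<close> provides the positions
  up to \<open>2\<close> that the loop counter needs.\<close>

theorem has_match_top_regex: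
  fixes W :: "'a set"
  assumes dec: "decides M L" and space: "runs_in_space M w b"
  shows "has_match W (top_regex (num_columns b) (window_lists M) (accepting M) (max_code * num_columns b)
      (config_vec b (initial_config M w))) (replicate (2 * num_columns b * max_code + 2) c) \<longleftrightarrow> w \<in> L"
proof -
  let ?J = "num_columns b" and ?K = "max_code * num_columns b"
  let ?cf = "tm_run M w (2 ^ ?K)"
  have init: "initial_config M w = tm_run M w 0" by (simp add: tm_run_def)
  have "has_match W (top_regex ?J (window_lists M) (accepting M) ?K
      (config_vec b (initial_config M w))) (replicate (2 * ?J * max_code + 2) c) \<longleftrightarrow>
    (\<exists>y. (\<forall>j. \<not> (1 \<le> j \<and> j \<le> ?J) \<longrightarrow> y j = 0) \<and> y 1 \<in> set (accepting M) \<and>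
      reach ?J (step_rel ?J (window_lists M)) ?K (config_vec b (initial_config M w)) y)"
  proof (rule top_regex_correct[where D = max_code])
    show "config_vec b (initial_config M w) j \<le> max_code" for j
      unfolding init by (rule config_vec_le) (rule valid_run[OF space])
  qed (auto simp: num_columns_def config_vec_outside[unfolded num_columns_def] dest: window_lists_le)
  also have "\<dots> \<longleftrightarrow> config_vec b ?cf 1 \<in> set (accepting M)"
  proof -
    have z: "\<forall>j. \<not> (1 \<le> j \<and> j \<le> ?J) \<longrightarrow> config_vec b ?cf j = 0" using config_vec_outside by blast
    show ?thesis unfolding init using z reach_run[OF space, of _ ?K 0] unfolding add_0 by blast
  qed
  also have "\<dots> \<longleftrightarrow> fst ?cf = accept_state M" by (rule accepting_iff) (rule valid_run[OF space])
  also have "fst ?cf = (if w \<in> L then accept_state M else reject_state M)"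
    by (rule halting_time[OF space]) (use dec in \<open>simp add: decides_def\<close>)
  also have "(if w \<in> L then accept_state M else reject_state M) = accept_state M \<longleftrightarrow> w \<in> L"
    using wf by (auto simp: well_formed_tm_def)
  finally show ?thesis .
qed

end

section \<open>Writing down the regex in polynomial time\<close>

text \<open>
  The regex is written down by loops over the levels \<open>k\<close> and the columns \<open>j\<close>; so its parts are
  functions of the input word and of these two loop variables.
\<close>

definition env :: "bool list \<Rightarrow> nat \<Rightarrow> nat \<Rightarrow> tree" where
  "env w k j = Node (blist w) (Node (un k) (un j))"

definition unary :: "(bool list \<Rightarrow> nat \<Rightarrow> nat \<Rightarrow> nat) \<Rightarrow> bool" where
  "unary a \<longleftrightarrow> (\<exists>h. FP h \<and> (\<forall>w k j. h (env w k j) = un (a w k j)))"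

definition token_tree :: "'a::finite token list \<Rightarrow> tree" where
  "token_tree ts = blist (concat (map token_code ts))"

definition printable :: "(bool list \<Rightarrow> nat \<Rightarrow> nat \<Rightarrow> 'a::finite token list) \<Rightarrow> bool" where
  "printable f \<longleftrightarrow> (\<exists>h. FP h \<and> (\<forall>w k j. h (env w k j) = token_tree (f w k j)))"

lemma els_token_tree: "els (token_tree ts) = map tb (concat (map token_code ts))"
  by (simp add: token_tree_def)

lemma env_simps [simp]: "car (env w k j) = blist w" "car (cdr (env w k j)) = un k"
  "cdr (cdr (env w k j)) = un j"
  by (simp_all add: env_def)

lemma unary_const: "unary (\<lambda>w k j. n)"
  unfolding unary_def by (rule exI[of _ "\<lambda>t. un n"]) (simp add: FP_const)

lemma unary_level: "unary (\<lambda>w k j. k)"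
  unfolding unary_def by (rule exI[of _ "\<lambda>t. car (cdr t)"]) (auto intro!: FP_intros)

lemma unary_column: "unary (\<lambda>w k j. j)"
  unfolding unary_def by (rule exI[of _ "\<lambda>t. cdr (cdr t)"]) (auto intro!: FP_intros)

lemma unary_length: "unary (\<lambda>w k j. length w)"
  unfolding unary_def
proof (intro exI[of _ "\<lambda>t. tmap (\<lambda>a. Leaf) (car t)"] conjI allI)
  show "FP (\<lambda>t. tmap (\<lambda>a. Leaf) (car t))"
    by (rule FP_tmap[where h = "\<lambda>a c. Leaf" and c = "\<lambda>t. Leaf"]) (intro FP_intros)+
  show "tmap (\<lambda>a. Leaf) (car (env w k j)) = un (length w)" for w k j
    by (rule tree_eqI) (simp add: map_replicate_const comp_def)
qed

lemma unary_Suc: assumes "unary a" shows "unary (\<lambda>w k j. Suc (a w k j))"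
proof -
  from assms obtain h where "FP h" "\<And>w k j. h (env w k j) = un (a w k j)" by (auto simp: unary_def)
  then show ?thesis unfolding unary_def
    by (intro exI[of _ "\<lambda>t. Node Leaf (h t)"]) (auto intro: FP_Node FP_const)
qed

lemma unary_pred: assumes "unary a" shows "unary (\<lambda>w k j. a w k j - 1)"
proof -
  from assms obtain h where h: "FP h" "\<And>w k j. h (env w k j) = un (a w k j)" by (auto simp: unary_def)
  have "cdr (un n) = un (n - 1)" for n by (cases n) simp_all
  with h show ?thesis unfolding unary_def
    by (intro exI[of _ "\<lambda>t. cdr (h t)"]) (auto intro: FP_cdr')
qed

lemma unary_add: assumes "unary a" "unary b" shows "unary (\<lambda>w k j. a w k j + b w k j)"
proof -
  from assms obtain h h' where h: "FP h" "\<And>w k j. h (env w k j) = un (a w k j)"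
    "FP h'" "\<And>w k j. h' (env w k j) = un (b w k j)" unfolding unary_def by blast
  have "app (un m) (un n) = un (m + n)" for m n by (simp add: un_def replicate_add)
  with h show ?thesis unfolding unary_def
    by (intro exI[of _ "\<lambda>t. app (h t) (h' t)"]) (auto intro: FP_app)
qed

lemma unary_mult: assumes "unary a" "unary b" shows "unary (\<lambda>w k j. a w k j * b w k j)"
proof -
  from assms obtain h h' where h: "FP h" "\<And>w k j. h (env w k j) = un (a w k j)"
    "FP h'" "\<And>w k j. h' (env w k j) = un (b w k j)" unfolding unary_def by blast
  have "FP (\<lambda>t. tmaps (\<lambda>a. h' t) (h t))"
    by (rule FP_tmaps[where h = "\<lambda>a c. c"]) (intro FP_intros h)+
  moreover have "tmaps (\<lambda>a. un n) (un m) = un (m * n)" for m n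
  proof -
    have "concat (replicate m (replicate n Leaf)) = replicate (m * n) Leaf"
      by (induction m) (simp_all add: replicate_add)
    then show ?thesis by (intro tree_eqI) simp
  qed
  ultimately show ?thesis unfolding unary_def
    by (intro exI[of _ "\<lambda>t. tmaps (\<lambda>a. h' t) (h t)"]) (auto simp: h)
qed

lemma unary_poly: "unary (\<lambda>w k j. poly p (length w))"
proof (induction p)
  case (pCons a p)
  then have "unary (\<lambda>w k j. a + length w * poly p (length w))"
    by (intro unary_add unary_mult unary_const unary_length)
  then show ?case by simp
qed (simp add: unary_const)

lemma printable_const: "printable (\<lambda>w k j. ts)"
  unfolding printable_def by (rule exI[of _ "\<lambda>t. token_tree ts"]) (simp add: FP_const)

lemma printable_append:
  assumes "printable f" "printable g"
  shows "printable (\<lambda>w k j. f w k j @ g w k j)"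
proof -
  from assms obtain h h' where h: "FP h" "\<And>w k j. h (env w k j) = token_tree (f w k j)"
    "FP h'" "\<And>w k j. h' (env w k j) = token_tree (g w k j)" unfolding printable_def by blast
  have "app (token_tree xs) (token_tree ys) = token_tree (xs @ ys)" for xs ys :: "'a token list"
    by (rule tree_eqI) (simp add: els_token_tree)
  with h show ?thesis unfolding printable_def
    by (intro exI[of _ "\<lambda>t. app (h t) (h' t)"]) (auto intro: FP_app)
qed

lemma printable_Cons: "printable f \<Longrightarrow> printable (\<lambda>w k j. x # f w k j)"
  using printable_append[OF printable_const, of f "[x]"] by simp

lemma printable_replicate:
  assumes "printable f" "unary a"
  shows "printable (\<lambda>w k j. concat (replicate (a w k j) (f w k j)))"
proof -
  from assms obtain h h' where h: "FP h" "\<And>w k j. h (env w k j) = token_tree (f w k j)"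
    "FP h'" "\<And>w k j. h' (env w k j) = un (a w k j)" unfolding printable_def unary_def by blast
  have "FP (\<lambda>t. tmaps (\<lambda>a. h t) (h' t))"
    by (rule FP_tmaps[where h = "\<lambda>a c. c"]) (intro FP_intros h)+
  moreover have "tmaps (\<lambda>a. token_tree xs) (un n) = token_tree (concat (replicate n xs))" for n and xs :: "'a token list"
  proof -
    have "concat (replicate n (map tb (concat (map token_code xs)))) =
        map tb (concat (map token_code (concat (replicate n xs))))"
      by (induction n) simp_all
    then show ?thesis by (intro tree_eqI) (simp add: els_token_tree)
  qed
  ultimately show ?thesis unfolding printable_def
    by (intro exI[of _ "\<lambda>t. tmaps (\<lambda>a. h t) (h' t)"]) (auto simp: h)
qed

lemma printable_replicate_token:
  "unary a \<Longrightarrow> printable (\<lambda>w k j. replicate (a w k j) x)"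
  using printable_replicate[OF printable_const, of a "[x]"] by (simp add: concat_replicate_single)

lemma printable_name:
  assumes "unary a" "unary b"
  shows "printable (\<lambda>w k j. nat_tokens (name t (a w k j) (b w k j)))"
  unfolding nat_tokens_name name_bits_def map_append list.map map_replicate
  by (intro printable_append printable_Cons printable_replicate_token printable_const assms)

text \<open>Substitution for the loop variables: a part written for an arbitrary level or column can
  be used at a computed one.\<close>

lemma printable_at:
  assumes "printable f" "unary a" "unary b"
  shows "printable (\<lambda>w k j. f w (a w k j) (b w k j))"
proof -
  from assms obtain h g g' where h: "FP h" "\<And>w k j. h (env w k j) = token_tree (f w k j)"
    "FP g" "\<And>w k j. g (env w k j) = un (a w k j)" "FP g'" "\<And>w k j. g' (env w k j) = un (b w k j)"
    unfolding printable_def unary_def by blast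
  show ?thesis unfolding printable_def
  proof (intro exI[of _ "\<lambda>t. h (Node (car t) (Node (g t) (g' t)))"] conjI allI)
    show "FP (\<lambda>t. h (Node (car t) (Node (g t) (g' t))))" by (intro FP_comp[OF h(1)] FP_intros h)
    show "h (Node (car (env w k j)) (Node (g (env w k j)) (g' (env w k j)))) =
        token_tree (f w (a w k j) (b w k j))" for w k j
      using h(2)[of w "a w k j" "b w k j"] unfolding env_simps h(4) h(6) unfolding env_def .
  qed
qed

lemma printable_concat_list:
  "(\<And>x. x \<in> set xs \<Longrightarrow> printable (f x)) \<Longrightarrow> printable (\<lambda>w k j. concat (map (\<lambda>x. f x w k j) xs))"
proof (induction xs)
  case (Cons x xs)
  then have "printable (\<lambda>w k j. f x w k j @ concat (map (\<lambda>x. f x w k j) xs))"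
    by (intro printable_append) simp_all
  then show ?case by simp
qed (simp add: printable_const)

text \<open>For \<open>x = un n\<close> the list of the numbers from \<open>n\<close> down to
  \<open>1\<close>. The next number is cut out of the fixed \<open>x\<close> and not built by
  copying the previous number, because \<open>FP_foldl\<close> allows the growth of the accumulator
  to depend on the parameter but not on the accumulator itself.\<close>

definition countdown :: "tree \<Rightarrow> tree" where
  "countdown x = foldl (\<lambda>v a. Node (ttake (Node Leaf v) x) v) Leaf (els x)"

lemma tsize_ttake: "tsize (ttake x c) \<le> tsize c"
proof -
  have "ttake x c = tlist (take (length (els x)) (els c))" by (rule tree_eqI) simp
  then show ?thesis using tsize_take[of "length (els x)" "els c"] by simp
qed

lemma FP_countdown: "FP f \<Longrightarrow> FP (\<lambda>t. countdown (f t))"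
  unfolding countdown_def
proof (rule FP_foldl[where h = "\<lambda>a v c. Node (ttake (Node Leaf v) c) v" and q = "[:1, 1:]" and v = "\<lambda>_. Leaf"])
  show "tsize (Node (ttake (Node Leaf v) c) v) \<le> tsize v + poly [:1, 1:] (tsize a + tsize c)" for a v c
    using tsize_ttake[of "Node Leaf v" c] by simp
qed (intro FP_intros | assumption)+

lemma countdown_un: "countdown (un n) = tlist (map un (rev [Suc 0..<Suc n]))"
proof -
  have "foldl (\<lambda>v a. Node (ttake (Node Leaf v) (un n)) v) Leaf (replicate m Leaf) = tlist (map un (rev [Suc 0..<Suc m]))"
    if "m \<le> n" for m
    using that
  proof (induction m)
    case (Suc m)
    have "ttake (Node Leaf (tlist (map un (rev [Suc 0..<Suc m])))) (un n) = un (Suc m)"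
      using Suc.prems by (intro tree_eqI) simp
    moreover have "replicate (Suc m) Leaf = replicate m Leaf @ [Leaf]" by (simp add: replicate_append_same)
    moreover have "rev [Suc 0..<Suc (Suc m)] = Suc m # rev [Suc 0..<Suc m]" by simp
    ultimately show ?case using Suc
      by (simp only: foldl_append foldl.simps list.map tlist.simps Suc_leD)
  qed simp
  then show ?thesis by (simp add: countdown_def)
qed

lemma printable_concat_columns:
  assumes "printable f" "unary a"
  shows "printable (\<lambda>w k j. concat (map (f w k) [Suc 0..<Suc (a w k j)]))"
proof -
  from assms obtain h g where h: "FP h" "\<And>w k j. h (env w k j) = token_tree (f w k j)"
    "FP g" "\<And>w k j. g (env w k j) = un (a w k j)" unfolding printable_def unary_def by blast
  let ?g = "\<lambda>t. tmaps (\<lambda>i. h (Node (car t) (Node (car (cdr t)) i))) (rapp (countdown (g t)) Leaf)"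
  have "FP ?g"
    by (rule FP_tmaps[where h = "\<lambda>i t. h (Node (car t) (Node (car (cdr t)) i))"])
      (intro FP_comp[OF h(1)] FP_intros FP_countdown h(3))+
  moreover have "?g (env w k j) = token_tree (concat (map (f w k) [Suc 0..<Suc (a w k j)]))" for w k j
  proof (rule tree_eqI)
    have e: "h (Node (blist w) (Node (un k) (un i))) = token_tree (f w k i)" for i
      using h(2)[of w k i] by (simp add: env_def)
    have c: "concat (map (\<lambda>i. map tb (concat (map token_code (f w k i)))) xs) =
        map tb (concat (map token_code (concat (map (f w k) xs))))" for xs
      by (induction xs) simp_all
    show "els (?g (env w k j)) = els (token_tree (concat (map (f w k) [Suc 0..<Suc (a w k j)])))"
      unfolding els_token_tree els_tmaps els_rapp env_simps h(4) countdown_un els_tlist els.simps append_Nil2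
        rev_map[symmetric] rev_rev_ident map_map comp_def e c ..
  qed
  ultimately show ?thesis unfolding printable_def by blast
qed

lemma printable_concat_levels:
  assumes "printable f" "unary a"
  shows "printable (\<lambda>w k j. concat (map (\<lambda>i. f w i j) (rev [0..<a w k j])))"
proof -
  from assms obtain h g where h: "FP h" "\<And>w k j. h (env w k j) = token_tree (f w k j)"
    "FP g" "\<And>w k j. g (env w k j) = un (a w k j)" unfolding printable_def unary_def by blast
  \<comment> \<open>The countdown ends at \<open>1\<close> but the levels end at \<open>0\<close>,
    so \<open>cdr\<close> subtracts one.\<close>
  let ?g = "\<lambda>t. tmaps (\<lambda>i. h (Node (car t) (Node (cdr i) (cdr (cdr t))))) (countdown (g t))"
  have "FP ?g"
    by (rule FP_tmaps[where h = "\<lambda>i t. h (Node (car t) (Node (cdr i) (cdr (cdr t))))"])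
      (intro FP_comp[OF h(1)] FP_intros FP_countdown h(3))+
  moreover have "?g (env w k j) = token_tree (concat (map (\<lambda>i. f w i j) (rev [0..<a w k j])))" for w k j
  proof (rule tree_eqI)
    have e: "h (Node (blist w) (Node (un i) (un j))) = token_tree (f w i j)" for i
      using h(2)[of w i j] by (simp add: env_def)
    have c: "concat (map (\<lambda>i. map tb (concat (map token_code (f w i j)))) xs) =
        map tb (concat (map token_code (concat (map (\<lambda>i. f w i j) xs))))" for xs
      by (induction xs) simp_all
    have s: "rev [Suc 0..<Suc n] = map Suc (rev [0..<n])" for n by (simp only: map_Suc_upt[symmetric] rev_map)
    show "els (?g (env w k j)) = els (token_tree (concat (map (\<lambda>i. f w i j) (rev [0..<a w k j]))))"
      unfolding els_token_tree els_tmaps env_simps h(4) countdown_un els_tlist s map_map comp_def un_simps cdr.simps e c ..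
  qed
  ultimately show ?thesis unfolding printable_def by blast
qed

lemma nat_tokens_0 [simp]: "nat_tokens 0 = []" by (simp add: nat_tokens.simps)

lemma tokens_capture_seq:
  "regex_tokens (capture_seq xs r) = concat (map (\<lambda>(g, q). TSeq # TGroup # nat_tokens g @ regex_tokens q) xs) @ regex_tokens r"
  by (induction xs r rule: capture_seq.induct) simp_all

lemma tokens_alts: "regex_tokens (alts (map f xs)) = concat (map (\<lambda>x. TAlt # regex_tokens (f x)) xs) @ [TChars {}]"
  by (induction xs) (simp_all add: alts_def)

lemma tokens_seqs: "regex_tokens (seqs (map f xs)) = concat (map (\<lambda>x. TSeq # regex_tokens (f x)) xs) @ [TEps]"
  by (induction xs) (simp_all add: seqs_def)

lemma tokens_char_power: "regex_tokens (char_power v) = concat (replicate v [TSeq, TChars UNIV]) @ [TEps]"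
  by (induction v) (simp_all add: char_power_def)

definition restart_pre :: "'a token list" where
  "restart_pre = [TLook Backward Positive, TSeq, TLook Forward Positive]"

definition restart_post :: "'a token list" where
  "restart_post = TSeq # TAnchor Input_Start # regex_tokens any_star"

lemma tokens_restart: "regex_tokens (restart r) = restart_pre @ regex_tokens r @ restart_post"
  by (simp add: restart_def restart_pre_def restart_post_def)

lemmas printable_intros = printable_append printable_Cons printable_name printable_const
  unary_const unary_level unary_column unary_length unary_Suc unary_add unary_mult unary_poly

lemma printable_test:
  "unary a \<Longrightarrow> unary b \<Longrightarrow> printable (\<lambda>w k j. regex_tokens (test (name t (a w k j) (b w k j)) v))"
  unfolding test_def tokens_restart regex_tokens.simps append_Cons
  by (intro printable_intros)

lemma printable_select:
  assumes "unary a" "unary b"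
  shows "printable (\<lambda>w k j. regex_tokens (select k (name t (a w k j) (b w k j)) (name t' (a w k j) (b w k j))))"
  unfolding select_def regex_tokens.simps append_Cons append_assoc
  by (intro printable_intros printable_test assms)

section \<open>The tokens of the regex, level by level\<close>

context
  fixes J K :: "bool list \<Rightarrow> nat" and v :: "bool list \<Rightarrow> nat \<Rightarrow> nat"
    and Ts :: "(nat \<times> nat \<times> nat \<times> nat) list list" and accs :: "nat list"
  assumes J: "unary (\<lambda>w k j. J w)" and K: "unary (\<lambda>w k j. K w)" and v: "unary (\<lambda>w k j. v w j)"
begin

definition level_open :: "bool list \<Rightarrow> nat \<Rightarrow> 'a token list" where
  "level_open w k =
     concat (map (\<lambda>j. TSeq # TGroup # nat_tokens (name 2 (Suc k) j) @ regex_tokens any_star) [Suc 0..<Suc (J w)]) @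
     restart_pre @ [TSeq, TQuant Greedy, TComma, TInfinity, TSeq] @ regex_tokens (bit_capture k) @
     [TSeq] @ restart_pre @
     concat (map (\<lambda>j. TSeq # TGroup # nat_tokens (name 0 k j) @
        regex_tokens (select k (name 0 (Suc k) j) (name 2 (Suc k) j))) [Suc 0..<Suc (J w)]) @
     concat (map (\<lambda>j. TSeq # TGroup # nat_tokens (name 1 k j) @
        regex_tokens (select k (name 2 (Suc k) j) (name 1 (Suc k) j))) [Suc 0..<Suc (J w)]) @
     restart_pre"

definition level_close :: "'a token list" where
  "level_close = restart_post @ restart_post @ [TChars UNIV] @ regex_tokens (at_length 2) @ restart_post"

lemma tokens_reach_Suc:
  "regex_tokens (reach_regex (J w) base (Suc k)) =
    level_open w k @ regex_tokens (reach_regex (J w) base k) @ level_close"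
  by (simp add: tokens_capture_seq tokens_restart halves_def half_def copies_def level_open_def level_close_def
      comp_def del: upt_Suc)

lemma tokens_reach:
  "regex_tokens (reach_regex (J w) base k) =
    concat (map (level_open w) (rev [0..<k])) @ regex_tokens base @ concat (replicate k level_close)"
proof (induction k)
  case (Suc k)
  have eq: "concat (replicate (Suc k) level_close) = concat (replicate k level_close) @ level_close"
    by (simp only: replicate_append_same[symmetric] concat_append replicate.simps) simp
  have "rev [0..<Suc k] = k # rev [0..<k]" by simp
  then show ?case unfolding tokens_reach_Suc Suc eq by (simp only: list.map concat.simps append_assoc)
qed simp

lemma printable_level_open: "printable (\<lambda>w k j. level_open w k :: 'a::finite token list)"
  unfolding level_open_def bit_capture_def regex_tokens.simps append_Cons append_assoc append_Nil
  by (intro printable_intros printable_concat_columns J printable_select)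

lemma printable_base: "printable (\<lambda>w k j. regex_tokens (base_regex (J w) Ts) :: 'a::finite token list)"
proof -
  have pred: "unary (\<lambda>w k j. j - 1)" by (intro unary_pred unary_column)
  have win: "printable (\<lambda>w k j. regex_tokens (window j t) :: 'a token list)" for t
  proof (cases t)
    case (fields a b c d)
    show ?thesis unfolding fields window_def prod.case regex_tokens.simps append_Cons
      by (intro printable_intros printable_test pred)
  qed
  show ?thesis unfolding base_regex_def tokens_alts tokens_seqs
    by (intro printable_append printable_const printable_concat_list printable_Cons printable_concat_columns win J)
qed

lemma printable_top: "printable (\<lambda>w k j. regex_tokens (top_regex (J w) Ts accs (K w) (v w)) :: 'a::finite token list)"
proof -
  have 1: "printable (\<lambda>w k j. TSeq # TGroup # nat_tokens (name 0 k j) @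
      concat (replicate (v w j) [TSeq, TChars UNIV]) @ [TEps] :: 'a token list)"
    by (intro printable_intros printable_replicate v)
  have 2: "printable (\<lambda>w k j. TSeq # TGroup # nat_tokens (name 1 k j) @ regex_tokens any_star :: 'a token list)"
    by (intro printable_intros)
  have 3: "printable (\<lambda>w k j. regex_tokens (alts (map (test (name 1 k 1)) accs)) :: 'a token list)"
    unfolding tokens_alts
    by (intro printable_append printable_const printable_concat_list printable_Cons printable_test printable_intros)
  \<comment> \<open>The level is kept as the variable \<open>k\<close> here, since the loops over
    the columns need it in the environment; \<open>K w\<close> is substituted for it only
    afterwards.\<close>
  have 4: "printable (\<lambda>w k j. concat (map (\<lambda>j. TSeq # TGroup # nat_tokens (name 0 k j) @
      concat (replicate (v w j) [TSeq, TChars UNIV]) @ [TEps]) [Suc 0..<Suc (J w)]) @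
      concat (map (\<lambda>j. TSeq # TGroup # nat_tokens (name 1 k j) @ regex_tokens any_star) [Suc 0..<Suc (J w)]) @
      TSeq # regex_tokens (alts (map (test (name 1 k 1)) accs)) :: 'a token list)"
    by (intro printable_append printable_Cons printable_concat_columns 1 2 3 J)
  have 5: "printable (\<lambda>w k j. regex_tokens (reach_regex (J w) (base_regex (J w) Ts) (K w)) :: 'a token list)"
    unfolding tokens_reach
    by (intro printable_append printable_concat_levels printable_level_open printable_base printable_replicate
        printable_const K)
  have "printable (\<lambda>w k j. TSeq # TAnchor Input_Start # (concat (map (\<lambda>j. TSeq # TGroup # nat_tokens (name 0 (K w) j) @
      concat (replicate (v w j) [TSeq, TChars UNIV]) @ [TEps]) [Suc 0..<Suc (J w)]) @
      concat (map (\<lambda>j. TSeq # TGroup # nat_tokens (name 1 (K w) j) @ regex_tokens any_star) [Suc 0..<Suc (J w)]) @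
      TSeq # regex_tokens (alts (map (test (name 1 (K w) 1)) accs))) @
      restart_pre @ regex_tokens (reach_regex (J w) (base_regex (J w) Ts) (K w)) @ restart_post :: 'a token list)"
    by (rule printable_Cons[OF printable_Cons[OF printable_append[OF printable_at[OF 4 K unary_column]
          printable_append[OF printable_const printable_append[OF 5 printable_const]]]]])
  then show ?thesis
    by (simp add: top_regex_def tokens_capture_seq tokens_restart tokens_char_power comp_def del: upt_Suc)
qed

end

lemma printable_polytime:
  assumes "printable f"
  shows "polytime_computable (\<lambda>w. concat (map token_code (f w 0 0)))"
proof -
  from assms obtain h where h: "FP h" "\<And>w k j. h (env w k j) = token_tree (f w k j)"
    by (auto simp: printable_def)
  show ?thesis
  proof (rule FP_polytime_computable[where f = "\<lambda>t. h (Node t (Node Leaf Leaf))"])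
    show "FP (\<lambda>t. h (Node t (Node Leaf Leaf)))" by (intro FP_comp[OF h(1)] FP_intros)
    show "h (Node (blist w) (Node Leaf Leaf)) = blist (concat (map token_code (f w 0 0)))" for w
      using h(2)[of w 0 0] by (simp add: env_def token_tree_def)
  qed
qed

text \<open>The initial configuration: column \<open>b + 2\<close> has the heads and the first symbol of the input.\<close>

definition initial_column :: "turing_machine \<Rightarrow> symbol \<Rightarrow> bool \<Rightarrow> nat" where
  "initial_column M x f = column_code (Some (start_state M, (x, f) # replicate (num_tapes M - 1) (Blank, f)))"

lemma config_vec_initial:
  assumes "1 \<le> j" "j \<le> num_columns b" "length w \<le> b"
  shows "config_vec b (initial_config M w) j =
    (if j < b + 2 then initial_column M Blank False
     else initial_column M (if j - (b + 2) < length w then Bit (w ! (j - (b + 2))) else Blank) (j = b + 2))"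
proof -
  have "column_at (initial_config M w) z = (start_state M, (word_contents w z, z = 0) # replicate (num_tapes M - 1) (Blank, z = 0))" for z
    by (auto simp: column_at_def initial_config_def word_contents_def)
  moreover have "nat (2 + int b) = Suc (Suc b)" by simp
  ultimately show ?thesis using assms
    by (auto simp: config_vec_def column_opt_def initial_column_def word_contents_def nat_diff_distrib'
        of_nat_diff simp flip: of_nat_add)
qed

lemma unary_initial:
  assumes "unary (\<lambda>w k j. b w)"
  shows "unary (\<lambda>w k j. if j < b w + 2 then initial_column M Blank False
     else initial_column M (if j - (b w + 2) < length w then Bit (w ! (j - (b w + 2))) else Blank) (j = b w + 2))"
proof -
  have "unary (\<lambda>w k j. Suc (Suc (b w)))" by (intro unary_Suc assms)
  then obtain g where g: "FP g" "\<And>w k j. g (env w k j) = un (Suc (Suc (b w)))" by (auto simp: unary_def)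
  let ?c = "\<lambda>x f. un (initial_column M x f)"
  \<comment> \<open>For column \<open>j\<close>, \<open>?r\<close> is the difference
    \<open>j - (b w + 2)\<close> in unary, and \<open>?x\<close> is the input from that cell
    on.\<close>
  let ?r = "\<lambda>t. tdrop (g t) (cdr (cdr t))"
  let ?x = "\<lambda>t. tdrop (?r t) (car t)"
  let ?h = "\<lambda>t. if tdrop (cdr (cdr t)) (g t) \<noteq> Leaf then ?c Blank False
    else if ?r t = Leaf then (if ?x t = Leaf then ?c Blank True else if car (?x t) = Leaf then ?c (Bit False) True
      else ?c (Bit True) True)
    else (if ?x t = Leaf then ?c Blank False else if car (?x t) = Leaf then ?c (Bit False) False else ?c (Bit True) False)"
  have "FP ?h" by (intro FP_intros g)
  moreover have "?h (env w k j) = un (if j < b w + 2 then initial_column M Blank False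
     else initial_column M (if j - (b w + 2) < length w then Bit (w ! (j - (b w + 2))) else Blank) (j = b w + 2))" for w k j
  proof -
    have d: "tdrop (un m) (un n) = un (n - m)" for m n by (rule tree_eqI) simp
    have x: "tdrop (un m) (blist w) = blist (drop m w)" for m by (rule tree_eqI) (simp add: drop_map)
    have hd: "blist u = Leaf \<longleftrightarrow> u = []" "u \<noteq> [] \<Longrightarrow> car (blist u) = tb (hd u)" for u by (cases u; simp)+
    have d0: "tdrop Leaf y = y" for y by (simp add: tdrop_def)
    show ?thesis
      by (auto simp: g d d0 x hd hd_drop_conv_nth hd_conv_nth simp del: un_simps(2))
  qed
  ultimately show ?thesis unfolding unary_def by blast
qed

lemma top_regex_cong:
  assumes "\<And>j. 1 \<le> j \<Longrightarrow> j \<le> J \<Longrightarrow> u j = v j"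
  shows "top_regex J Ts accs K u = top_regex J Ts accs K v"
proof -
  have "map (\<lambda>j. (name 0 K j, char_power (u j) :: 'a regex)) [Suc 0..<Suc J] =
      map (\<lambda>j. (name 0 K j, char_power (v j))) [Suc 0..<Suc J]"
    by (rule map_cong) (auto simp: assms)
  then show ?thesis by (simp only: top_regex_def)
qed

theorem JSREGTEST_PSPACE_hard:
  fixes W :: "'a::finite set"
  assumes R: "{r \<in> js_regexes. no_lower_bounds r \<and> no_neg_lookarounds r} \<subseteq> R" "R \<subseteq> js_regexes"
  shows "PSPACE_hard (JSREGTEST W R)"
  unfolding PSPACE_hard_def
proof
  fix L assume "L \<in> PSPACE"
  then obtain M and p :: "nat poly" where wf: "well_formed_tm M" and dec: "decides M L"
    and space: "\<And>w. runs_in_space M w (poly p (length w))" by (auto simp: PSPACE_def)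
  \<comment> \<open>The length of the input is added so that all its symbols lie on columns of the
    initial vector.\<close>
  define b where "b w = poly p (length w) + length w" for w :: "bool list"
  have sp: "runs_in_space M w (b w)" for w
    using space[of w] unfolding runs_in_space_def b_def by fastforce
  define J where "J w = num_columns (b w)" for w
  define K where "K w = max_code M * J w" for w
  define N where "N w = 2 * J w * max_code M + 2" for w
  define v where "v w j = (if j < b w + 2 then initial_column M Blank False
     else initial_column M (if j - (b w + 2) < length w then Bit (w ! (j - (b w + 2))) else Blank) (j = b w + 2))" for w j
  define reg where "reg w = (top_regex (J w) (window_lists M) (accepting M) (K w) (v w) :: 'a regex)" for w
  define c where "c = (undefined :: 'a)"
  have b: "unary (\<lambda>w k j. b w)" unfolding b_def by (intro unary_add unary_poly unary_length)
  have J: "unary (\<lambda>w k j. J w)" unfolding J_def num_columns_def by (intro unary_add unary_mult unary_const b)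
  have K: "unary (\<lambda>w k j. K w)" unfolding K_def by (intro unary_mult unary_const J)
  have N: "unary (\<lambda>w k j. N w)" unfolding N_def by (intro unary_add unary_mult unary_const J)
  have v: "unary (\<lambda>w k j. v w j)" unfolding v_def by (rule unary_initial[OF b])
  have "printable (\<lambda>w k j. regex_tokens (reg w) @ replicate (N w) (TChar c))"
    unfolding reg_def by (intro printable_append printable_replicate_token N printable_top J K v)
  from printable_polytime[OF this]
  have "polytime_computable (\<lambda>w. encode_instance (reg w) (replicate (N w) c))"
    by (simp add: encode_instance_def)
  moreover have "w \<in> L \<longleftrightarrow> encode_instance (reg w) (replicate (N w) c) \<in> JSREGTEST W R" for w
  proof -
    have "reg w = top_regex (J w) (window_lists M) (accepting M) (K w) (config_vec (b w) (initial_config M w))"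
      unfolding reg_def
      by (rule top_regex_cong) (simp add: v_def J_def config_vec_initial b_def del: One_nat_def)
    then have "has_match W (reg w) (replicate (N w) c) \<longleftrightarrow> w \<in> L"
      using has_match_top_regex[OF wf dec sp, of W w c] by (simp add: J_def K_def N_def)
    moreover have "reg w \<in> R"
      using R(1) top_regex_js plain_top_regex unfolding reg_def plain_def by blast
    ultimately show ?thesis unfolding JSREGTEST_def using encode_instance_inj by blast
  qed
  ultimately show "polytime_reducible L (JSREGTEST W R)" unfolding polytime_reducible_def by blast
qed

section \<open>Parsing instances\<close>

text \<open>
  The tokens are read from right to left, so that the prefix notation can be evaluated with a stack.
  The parameter \<open>N\<close> says whether negative lookarounds are allowed; lower bounds are rejected.
\<close>

datatype pending = PNone | PInf | PComma enat

type_synonym 'a pstate = "bool list \<times> pending \<times> 'a regex list \<times> 'a list"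

text \<open>From right to left the most significant bit of a number comes first, hence a first bit
  \<open>False\<close> is rejected as a leading zero. At a quantifier the bits read since the comma
  must be empty, which is the notation of the minimum \<open>0\<close>.\<close>

fun parse_token :: "bool \<Rightarrow> 'a token \<Rightarrow> 'a pstate \<Rightarrow> 'a pstate option" where
  "parse_token N (TChar c) (bs, pd, st, s) =
     (if bs = [] \<and> pd = PNone \<and> st = [] then Some ([], PNone, [], c # s) else None)"
| "parse_token N (TBit b) (bs, pd, st, s) =
     (if pd \<noteq> PInf \<and> (b \<or> bs \<noteq> []) then Some (b # bs, pd, st, s) else None)"
| "parse_token N TInfinity (bs, pd, st, s) =
     (if bs = [] \<and> pd = PNone then Some ([], PInf, st, s) else None)"
| "parse_token N TComma (bs, pd, st, s) =
     (case pd of PNone \<Rightarrow> Some ([], PComma (enat (of_bits bs)), st, s)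
      | PInf \<Rightarrow> Some ([], PComma \<infinity>, st, s) | PComma \<Delta> \<Rightarrow> None)"
| "parse_token N (TQuant \<kappa>) (bs, pd, st, s) =
     (case pd of PComma \<Delta> \<Rightarrow>
        (case st of r # st' \<Rightarrow> if bs = [] then Some ([], PNone, Quant r 0 \<Delta> \<kappa> # st', s) else None | [] \<Rightarrow> None)
      | _ \<Rightarrow> None)"
| "parse_token N TGroup (bs, pd, st, s) =
     (case st of r # st' \<Rightarrow> if pd = PNone then Some ([], PNone, Group (of_bits bs) r # st', s) else None
      | [] \<Rightarrow> None)"
| "parse_token N TBackref (bs, pd, st, s) =
     (if pd = PNone then Some ([], PNone, Backref (of_bits bs) # st, s) else None)"
| "parse_token N TEps (bs, pd, st, s) =
     (if bs = [] \<and> pd = PNone then Some ([], PNone, Eps # st, s) else None)"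
| "parse_token N (TChars cd) (bs, pd, st, s) =
     (if bs = [] \<and> pd = PNone then Some ([], PNone, Chars cd # st, s) else None)"
| "parse_token N (TAnchor a) (bs, pd, st, s) =
     (if bs = [] \<and> pd = PNone then Some ([], PNone, Anchor a # st, s) else None)"
| "parse_token N TAlt (bs, pd, st, s) =
     (case st of r1 # r2 # st' \<Rightarrow> if bs = [] \<and> pd = PNone then Some ([], PNone, Alt r1 r2 # st', s) else None
      | _ \<Rightarrow> None)"
| "parse_token N TSeq (bs, pd, st, s) =
     (case st of r1 # r2 # st' \<Rightarrow> if bs = [] \<and> pd = PNone then Some ([], PNone, Seq r1 r2 # st', s) else None
      | _ \<Rightarrow> None)"
| "parse_token N (TLook d b) (bs, pd, st, s) =
     (case st of r # st' \<Rightarrow> if bs = [] \<and> pd = PNone \<and> (N \<or> b = Positive)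
        then Some ([], PNone, Look d b r # st', s) else None
      | [] \<Rightarrow> None)"

definition parse_step :: "bool \<Rightarrow> 'a token \<Rightarrow> 'a pstate option \<Rightarrow> 'a pstate option" where
  "parse_step N t st = Option.bind st (parse_token N t)"

lemma parse_step_Some [simp]: "parse_step N t (Some x) = parse_token N t x"
  by (simp add: parse_step_def)

definition parse :: "bool \<Rightarrow> 'a token list \<Rightarrow> 'a pstate option" where
  "parse N ts = foldr (parse_step N) ts (Some ([], PNone, [], []))"

definition canonical :: "bool list \<Rightarrow> bool" where "canonical bs \<longleftrightarrow> bs = [] \<or> last bs"

definition allowed :: "bool \<Rightarrow> 'a regex \<Rightarrow> bool" where
  "allowed N r \<longleftrightarrow> no_lower_bounds r \<and> (N \<or> no_neg_lookarounds r)"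

fun parse_ok :: "bool \<Rightarrow> 'a pstate \<Rightarrow> bool" where
  "parse_ok N (bs, pd, st, s) \<longleftrightarrow> canonical bs \<and> (pd = PInf \<longrightarrow> bs = []) \<and> (\<forall>r\<in>set st. allowed N r)"

text \<open>A parser state determines all tokens read so far. This gives soundness of the parser as
  an invariant and later a bound on the size of its states.\<close>

fun unparse :: "'a pstate \<Rightarrow> 'a token list" where
  "unparse (bs, pd, st, s) =
     (case pd of PNone \<Rightarrow> map TBit bs | PInf \<Rightarrow> [TInfinity] | PComma \<Delta> \<Rightarrow> map TBit bs @ TComma # enat_tokens \<Delta>) @
     concat (map regex_tokens st) @ map TChar s"

lemma nat_tokens_of_bits_canonical: "canonical bs \<Longrightarrow> nat_tokens (of_bits bs) = map TBit bs"
  unfolding canonical_def by (rule nat_tokens_of_bits)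

fun nat_bits :: "nat \<Rightarrow> bool list" where
  "nat_bits n = (if n = 0 then [] else odd n # nat_bits (n div 2))"

declare nat_bits.simps [simp del]

lemma nat_tokens_nat_bits: "nat_tokens n = map TBit (nat_bits n)"
proof (induction n rule: less_induct)
  case (less n)
  then show ?case by (subst nat_tokens.simps, subst nat_bits.simps) simp
qed

lemma of_bits_nat_bits [simp]: "of_bits (nat_bits n) = n"
proof (induction n rule: less_induct)
  case (less n)
  then show ?case by (subst nat_bits.simps) simp
qed

lemma canonical_nat_bits: "canonical (nat_bits n)"
proof (induction n rule: less_induct)
  case (less n)
  have "odd n" if "nat_bits (n div 2) = []" "n \<noteq> 0"
  proof -
    have "n div 2 = 0" using of_bits_nat_bits[of "n div 2"] that(1) by simp
    with that(2) have "n = 1" by simp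
    then show ?thesis by simp
  qed
  with less[of "n div 2"] show ?case
    by (subst nat_bits.simps) (auto simp: canonical_def)
qed

lemma parse_token_sound:
  assumes "parse_token N t x = Some y" "parse_ok N x"
  shows "parse_ok N y \<and> unparse y = t # unparse x"
proof -
  obtain bs pd st s where x: "x = (bs, pd, st, s)" by (cases x)
  show ?thesis using assms unfolding x
    by (cases t; cases pd)
      (auto simp: canonical_def allowed_def nat_tokens_of_bits split: if_splits list.splits)
qed

lemma parse_sound:
  "parse N ts = Some y \<Longrightarrow> parse_ok N y \<and> unparse y = ts"
proof (induction ts arbitrary: y)
  case Nil
  then show ?case by (auto simp: parse_def canonical_def)
next
  case (Cons t ts)
  then obtain x where "parse N ts = Some x" "parse_token N t x = Some y"
    by (auto simp: parse_def parse_step_def bind_eq_Some_conv)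
  with Cons.IH[of x] parse_token_sound[of N t x y] show ?case by simp
qed

lemma parse_bits:
  "canonical bs \<Longrightarrow> pd \<noteq> PInf \<Longrightarrow>
    foldr (parse_step N) (map TBit bs) (Some ([], pd, st, s)) = Some (bs, pd, st, s)"
proof (induction bs)
  case (Cons b bs)
  then have "foldr (parse_step N) (map TBit bs) (Some ([], pd, st, s)) = Some (bs, pd, st, s)"
    by (auto simp: canonical_def split: if_splits)
  with Cons.prems show ?case by (auto simp: canonical_def split: if_splits)
qed simp

lemma parse_regex:
  "allowed N r \<Longrightarrow> foldr (parse_step N) (regex_tokens r) (Some ([], PNone, st, s)) = Some ([], PNone, r # st, s)"
proof (induction r arbitrary: st)
  case (Quant r m \<Delta> \<kappa>)
  then have m: "m = 0" and r: "foldr (parse_step N) (regex_tokens r) (Some ([], PNone, st, s)) = Some ([], PNone, r # st, s)"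
    by (simp_all add: allowed_def)
  have "foldr (parse_step N) (TComma # enat_tokens \<Delta>) (Some ([], PNone, r # st, s)) = Some ([], PComma \<Delta>, r # st, s)"
    by (cases \<Delta>) (simp_all add: nat_tokens_nat_bits parse_bits canonical_nat_bits)
  with r show ?case by (simp add: m)
qed (auto simp: allowed_def nat_tokens_nat_bits parse_bits canonical_nat_bits)

theorem parse_iff:
  "parse N ts = Some ([], PNone, [r], s) \<longleftrightarrow> ts = regex_tokens r @ map TChar s \<and> allowed N r"
proof
  assume "parse N ts = Some ([], PNone, [r], s)"
  from parse_sound[OF this] show "ts = regex_tokens r @ map TChar s \<and> allowed N r" by auto
next
  assume a: "ts = regex_tokens r @ map TChar s \<and> allowed N r"
  have "foldr (parse_step N) (map TChar s) (Some ([], PNone, [], [])) = Some ([], PNone, [], s)"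
    by (induction s) simp_all
  with a parse_regex[of N r "[]" s] show "parse N ts = Some ([], PNone, [r], s)" by (simp add: parse_def)
qed

subsection \<open>Parsing on trees\<close>

definition etok :: "'a::finite token \<Rightarrow> tree" where "etok t = un (to_nat t)"

lemma etok_eq [simp]: "etok t = etok u \<longleftrightarrow> t = u"
  by (simp add: etok_def)

lemma etok_image [simp]: "etok t \<in> etok ` A \<longleftrightarrow> t \<in> A"
  by auto

lemma nat_bits_of_bits: "canonical bs \<Longrightarrow> nat_bits (of_bits bs) = bs"
proof -
  assume "canonical bs"
  then have "map TBit (nat_bits (of_bits bs)) = (map TBit bs :: unit token list)"
    by (simp add: nat_tokens_of_bits_canonical flip: nat_tokens_nat_bits)
  then show ?thesis by (simp add: inj_map_eq_map inj_def)
qed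

lemma nat_bits_eq [simp]: "nat_bits m = nat_bits n \<longleftrightarrow> m = n"
  using nat_tokens_append_inj[of m "[]" n "[] :: unit token list"] by (auto simp: nat_tokens_nat_bits)

definition enum_bits :: "nat \<Rightarrow> tree" where "enum_bits n = blist (nat_bits n)"

lemma blist_eq [simp]: "blist u = blist v \<longleftrightarrow> u = v"
proof
  assume "blist u = blist v"
  then have "map tb u = map tb v" by (metis blist_simps(3))
  then show "u = v" by (simp add: inj_map_eq_map inj_def)
qed simp

lemma enum_bits_eq [simp]: "enum_bits m = enum_bits n \<longleftrightarrow> m = n"
  by (simp add: enum_bits_def)

fun eenat :: "enat \<Rightarrow> tree" where
  "eenat (enat n) = Node Leaf (enum_bits n)"
| "eenat \<infinity> = Leaf"

definition egroups :: "'a regex \<Rightarrow> tree" where "egroups r = tlist (map enum_bits (groups r))"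

text \<open>A quantifier carries the list of the groups that it resets.\<close>

primrec eregex :: "'a::finite regex \<Rightarrow> tree" where
  "eregex Eps = Node (un 0) Leaf"
| "eregex (Chars cd) = Node (un 1) (etok (TChars cd))"
| "eregex (Alt r1 r2) = Node (un 2) (Node (eregex r1) (eregex r2))"
| "eregex (Seq r1 r2) = Node (un 3) (Node (eregex r1) (eregex r2))"
| "eregex (Group g r) = Node (un 4) (Node (enum_bits g) (eregex r))"
| "eregex (Backref g) = Node (un 5) (enum_bits g)"
| "eregex (Quant r m \<Delta> \<kappa>) =
     Node (un 6) (Node (etok (TQuant \<kappa> :: 'a token)) (Node (eenat \<Delta>) (Node (egroups r) (eregex r))))"
| "eregex (Look d b r) = Node (un 7) (Node (etok (TLook d b :: 'a token)) (eregex r))"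
| "eregex (Anchor a) = Node (un 8) (etok (TAnchor a :: 'a token))"

definition echar :: "'a::finite \<Rightarrow> tree" where "echar c = etok (TChar c)"

fun epending :: "pending \<Rightarrow> tree" where
  "epending PNone = Leaf"
| "epending PInf = Node Leaf Leaf"
| "epending (PComma \<Delta>) = Node (Node Leaf Leaf) (eenat \<Delta>)"

text \<open>The list of groups of each regex is built along with it, so that an enclosing quantifier
  can copy it and no recursion over regexes is required.\<close>

definition eentry :: "'a::finite regex \<Rightarrow> tree" where "eentry r = Node (egroups r) (eregex r)"

fun epstate :: "'a::finite pstate option \<Rightarrow> tree" where
  "epstate None = Leaf"
| "epstate (Some (bs, pd, st, s)) =
     Node (blist bs) (Node (epending pd) (Node (tlist (map eentry st)) (tlist (map echar s))))"

definition mk_pstate :: "tree \<Rightarrow> tree \<Rightarrow> tree \<Rightarrow> tree \<Rightarrow> tree" where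
  "mk_pstate bs pd st s = Node bs (Node pd (Node st s))"

lemma FP_mk_pstate [FP_intros]:
  "FP f1 \<Longrightarrow> FP f2 \<Longrightarrow> FP f3 \<Longrightarrow> FP f4 \<Longrightarrow> FP (\<lambda>t. mk_pstate (f1 t) (f2 t) (f3 t) (f4 t))"
  unfolding mk_pstate_def by (intro FP_intros)

definition tparse :: "'a::finite itself \<Rightarrow> bool \<Rightarrow> tree \<Rightarrow> tree \<Rightarrow> tree" where
  "tparse TYPE('a) N a v = (let bs = car v; pd = car (cdr v); st = car (cdr (cdr v)); s = cdr (cdr (cdr v));
      g = car (car st); r = cdr (car st); g2 = car (car (cdr st)); r2 = cdr (car (cdr st)) in
    if v = Leaf then Leaf
    else if a \<in> etok ` range (TChar :: 'a \<Rightarrow> 'a token) then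
      if bs = Leaf \<and> pd = Leaf \<and> st = Leaf then mk_pstate Leaf Leaf Leaf (Node a s) else Leaf
    else if a = etok (TBit True :: 'a token) then
      if pd \<noteq> Node Leaf Leaf then mk_pstate (Node (tb True) bs) pd st s else Leaf
    else if a = etok (TBit False :: 'a token) then
      if pd \<noteq> Node Leaf Leaf \<and> bs \<noteq> Leaf then mk_pstate (Node (tb False) bs) pd st s else Leaf
    else if a = etok (TInfinity :: 'a token) then
      if bs = Leaf \<and> pd = Leaf then mk_pstate Leaf (Node Leaf Leaf) st s else Leaf
    else if a = etok (TComma :: 'a token) then
      if pd = Leaf then mk_pstate Leaf (Node (Node Leaf Leaf) (Node Leaf bs)) st s
      else if pd = Node Leaf Leaf then mk_pstate Leaf (Node (Node Leaf Leaf) Leaf) st s else Leaf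
    else if a \<in> etok ` range (TQuant :: _ \<Rightarrow> 'a token) then
      if car pd \<noteq> Leaf \<and> st \<noteq> Leaf \<and> bs = Leaf then
        mk_pstate Leaf Leaf (Node (Node g (Node (un 6) (Node a (Node (cdr pd) (Node g r))))) (cdr st)) s else Leaf
    else if a = etok (TGroup :: 'a token) then
      if st \<noteq> Leaf \<and> pd = Leaf then
        mk_pstate Leaf Leaf (Node (Node (Node bs g) (Node (un 4) (Node bs r))) (cdr st)) s else Leaf
    else if a = etok (TBackref :: 'a token) then
      if pd = Leaf then mk_pstate Leaf Leaf (Node (Node Leaf (Node (un 5) bs)) st) s else Leaf
    else if a = etok (TEps :: 'a token) then
      if bs = Leaf \<and> pd = Leaf then mk_pstate Leaf Leaf (Node (Node Leaf (Node (un 0) Leaf)) st) s else Leaf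
    else if a \<in> etok ` range (TChars :: _ \<Rightarrow> 'a token) then
      if bs = Leaf \<and> pd = Leaf then mk_pstate Leaf Leaf (Node (Node Leaf (Node (un 1) a)) st) s else Leaf
    else if a \<in> etok ` range (TAnchor :: _ \<Rightarrow> 'a token) then
      if bs = Leaf \<and> pd = Leaf then mk_pstate Leaf Leaf (Node (Node Leaf (Node (un 8) a)) st) s else Leaf
    else if a = etok (TAlt :: 'a token) then
      if bs = Leaf \<and> pd = Leaf \<and> st \<noteq> Leaf \<and> cdr st \<noteq> Leaf then
        mk_pstate Leaf Leaf (Node (Node (app g g2) (Node (un 2) (Node r r2))) (cdr (cdr st))) s else Leaf
    else if a = etok (TSeq :: 'a token) then
      if bs = Leaf \<and> pd = Leaf \<and> st \<noteq> Leaf \<and> cdr st \<noteq> Leaf then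
        mk_pstate Leaf Leaf (Node (Node (app g g2) (Node (un 3) (Node r r2))) (cdr (cdr st))) s else Leaf
    else if a \<in> etok ` {TLook d b :: 'a token | d b. N \<or> b = Positive} then
      if bs = Leaf \<and> pd = Leaf \<and> st \<noteq> Leaf then
        mk_pstate Leaf Leaf (Node (Node g (Node (un 7) (Node a r))) (cdr st)) s else Leaf
    else Leaf)"

lemma FP_tparse: "FP (\<lambda>t. tparse TYPE('a::finite) N (car t) (cdr t))"
  unfolding tparse_def Let_def
  by (intro FP_intros) simp_all

lemma epending_eq_Leaf [simp]: "epending pd = Leaf \<longleftrightarrow> pd = PNone"
  by (cases pd) auto

lemma epending_eq_inf [simp]: "epending pd = Node Leaf Leaf \<longleftrightarrow> pd = PInf"
  by (cases pd) auto

text \<open>Since the bits collected are canonical, they are already the encoding of the number that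
  they denote and are copied without any arithmetic.\<close>

lemma tparse_correct:
  fixes t :: "'a::finite token" and st :: "'a pstate"
  assumes "parse_ok N st"
  shows "tparse TYPE('a) N (etok t) (epstate (Some st)) = epstate (parse_token N t st)"
proof -
  obtain bs pd rs s where st: "st = (bs, pd, rs, s)" by (cases st)
  have bs: "enum_bits (of_bits bs) = blist bs"
    using assms by (simp add: st enum_bits_def nat_bits_of_bits)
  have bl: "blist bs = Leaf \<longleftrightarrow> bs = []" by (cases bs) simp_all
  have tl: "tlist xs = Leaf \<longleftrightarrow> xs = []" for xs by (cases xs) simp_all
  have rg: "(x :: 'a token) \<in> range TChar \<longleftrightarrow> (\<exists>c. x = TChar c)" "x \<in> range TQuant \<longleftrightarrow> (\<exists>c. x = TQuant c)"
    "x \<in> range TChars \<longleftrightarrow> (\<exists>c. x = TChars c)" "x \<in> range TAnchor \<longleftrightarrow> (\<exists>c. x = TAnchor c)" for x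
    by auto
  note defs = rg st tparse_def Let_def mk_pstate_def bs bl tl
  show ?thesis
  proof (cases t)
    case TComma
    then show ?thesis by (cases pd) (simp_all add: defs)
  next
    case (TBit b)
    then show ?thesis by (cases b) (simp_all add: defs)
  next
    case (TQuant k)
    then show ?thesis by (cases pd; cases rs) (simp_all add: defs eentry_def egroups_def)
  next
    case TGroup
    then show ?thesis by (cases rs) (simp_all add: defs eentry_def egroups_def)
  next
    case TAlt
    then show ?thesis
      \<comment> \<open>This rule distinguishes lists of length zero, one, and at least two.\<close>
      by (cases rs rule: remdups_adj.cases) (simp_all add: defs eentry_def egroups_def)
  next
    case TSeq
    then show ?thesis
      by (cases rs rule: remdups_adj.cases) (simp_all add: defs eentry_def egroups_def)
  next
    case (TLook d b)
    then show ?thesis by (cases rs) (simp_all add: defs eentry_def egroups_def)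
  qed (simp_all add: defs eentry_def egroups_def echar_def)
qed

lemma tparse_Leaf [simp]: "tparse TYPE('a::finite) N a Leaf = Leaf"
  by (simp add: tparse_def Let_def)

lemma tparse_junk:
  assumes "a \<notin> range (etok :: 'a::finite token \<Rightarrow> tree)"
  shows "tparse TYPE('a) N a v = Leaf"
proof -
  have "a \<notin> etok ` A" "a \<noteq> etok t" for A :: "'a token set" and t :: "'a token" using assms by auto
  then show ?thesis by (simp add: tparse_def Let_def)
qed

section \<open>A backtracking machine\<close>

text \<open>\<open>Choice\<close> is an untried alternative. \<open>Resume\<close> marks a
  lookaround whose body is being evaluated and stores the point at which to go on.\<close>

datatype 'a frame =
    Choice "'a action list" nat group_map direction
  | Resume polarity "'a action list" nat group_map direction

datatype 'a mconf =
    Run "'a action list" nat group_map direction "'a frame list"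
  | Succeed group_map "'a frame list"
  | Fail "'a frame list"

text \<open>A success removes the alternatives above the nearest \<open>Resume\<close>, which is the
  atomicity of lookarounds. It carries only a group map, because the position after a lookaround is
  the one stored in the frame.\<close>

fun mstep :: "'a set \<Rightarrow> 'a list \<Rightarrow> 'a mconf \<Rightarrow> 'a mconf" where
  "mstep W s (Run [] p \<gamma> d fs) = Succeed \<gamma> fs"
| "mstep W s (Run (Acheck k # l) p \<gamma> d fs) = (if further d p k then Run l p \<gamma> d fs else Fail fs)"
| "mstep W s (Run (Aclose g # l) p \<gamma> d fs) =
     (case \<gamma> g of
        Opened a \<Rightarrow> Run l p (\<gamma>(g := Closed (min a p) (max a p))) d fs
      | _ \<Rightarrow> Run l p \<gamma> d fs)"
| "mstep W s (Run (Areg Eps # l) p \<gamma> d fs) = Run l p \<gamma> d fs"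
| "mstep W s (Run (Areg (Chars cd) # l) p \<gamma> d fs) =
     (case read_char s cd p d of Some p' \<Rightarrow> Run l p' \<gamma> d fs | None \<Rightarrow> Fail fs)"
| "mstep W s (Run (Areg (Alt r1 r2) # l) p \<gamma> d fs) =
     Run (Areg r1 # l) p \<gamma> d (Choice (Areg r2 # l) p \<gamma> d # fs)"
| "mstep W s (Run (Areg (Seq r1 r2) # l) p \<gamma> d fs) =
     (case d of
        Forward \<Rightarrow> Run (Areg r1 # Areg r2 # l) p \<gamma> d fs
      | Backward \<Rightarrow> Run (Areg r2 # Areg r1 # l) p \<gamma> d fs)"
| "mstep W s (Run (Areg (Quant r m \<Delta> \<kappa>) # l) p \<gamma> d fs) =
     (if \<Delta> = 0 then Run l p \<gamma> d fs
      else case \<kappa> of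
        Greedy \<Rightarrow> Run (Areg r # Acheck p # Areg (Quant r 0 (\<Delta> - 1) \<kappa>) # l) p (reset \<gamma> r) d (Choice l p \<gamma> d # fs)
      | Lazy \<Rightarrow> Run l p \<gamma> d (Choice (Areg r # Acheck p # Areg (Quant r 0 (\<Delta> - 1) \<kappa>) # l) p (reset \<gamma> r) d # fs))"
| "mstep W s (Run (Areg (Group g r) # l) p \<gamma> d fs) = Run (Areg r # Aclose g # l) p (\<gamma>(g := Opened p)) d fs"
| "mstep W s (Run (Areg (Look d' b r) # l) p \<gamma> d fs) = Run [Areg r] p \<gamma> d' (Resume b l p \<gamma> d # fs)"
| "mstep W s (Run (Areg (Anchor a) # l) p \<gamma> d fs) = (if anchor_holds W s a p then Run l p \<gamma> d fs else Fail fs)"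
| "mstep W s (Run (Areg (Backref g) # l) p \<gamma> d fs) =
     (case \<gamma> g of
        Closed a b \<Rightarrow>
          (case read_factor s (factor s a b) p d of Some p' \<Rightarrow> Run l p' \<gamma> d fs | None \<Rightarrow> Fail fs)
      | _ \<Rightarrow> Run l p \<gamma> d fs)"
| "mstep W s (Succeed \<gamma> (Choice l p \<gamma>' d # fs)) = Succeed \<gamma> fs"
| "mstep W s (Succeed \<gamma> (Resume Positive l p \<gamma>' d # fs)) = Run l p \<gamma> d fs"
| "mstep W s (Succeed \<gamma> (Resume Negative l p \<gamma>' d # fs)) = Fail fs"
| "mstep W s (Fail (Choice l p \<gamma> d # fs)) = Run l p \<gamma> d fs"
| "mstep W s (Fail (Resume Positive l p \<gamma> d # fs)) = Fail fs"
| "mstep W s (Fail (Resume Negative l p \<gamma> d # fs)) = Run l p \<gamma> d fs"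
| "mstep W s (Succeed \<gamma> []) = Succeed \<gamma> []"
| "mstep W s (Fail []) = Fail []"

subsection \<open>Correctness\<close>

definition leads_to :: "'a set \<Rightarrow> 'a list \<Rightarrow> 'a mconf \<Rightarrow> 'a mconf \<Rightarrow> bool" where
  "leads_to W s X Y \<longleftrightarrow> (\<exists>n. (mstep W s ^^ n) X = Y)"

lemma leads_to_refl: "leads_to W s X X"
  unfolding leads_to_def by (rule exI[of _ 0]) simp

lemma leads_to_trans: "leads_to W s X Y \<Longrightarrow> leads_to W s Y Z \<Longrightarrow> leads_to W s X Z"
  unfolding leads_to_def by (metis comp_apply funpow_add)

lemma leads_to_step: "leads_to W s (mstep W s X) Y \<Longrightarrow> leads_to W s X Y"
  unfolding leads_to_def by (metis comp_apply funpow_Suc_right)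

lemma leads_to_snoc: "leads_to W s X Y \<Longrightarrow> leads_to W s X (mstep W s Y)"
  by (rule leads_to_trans[OF _ leads_to_step[OF leads_to_refl]])

definition choices :: "'a frame list \<Rightarrow> bool" where
  "choices cs \<longleftrightarrow> (\<forall>f\<in>set cs. \<exists>l p \<gamma> d. f = Choice l p \<gamma> d)"

lemma drop_choices: "choices cs \<Longrightarrow> leads_to W s (Succeed \<gamma> (cs @ fs)) (Succeed \<gamma> fs)"
proof (induction cs)
  case (Cons f cs)
  then obtain l p \<gamma>' d where f: "f = Choice l p \<gamma>' d" by (auto simp: choices_def)
  show ?case by (rule leads_to_step) (use Cons in \<open>simp add: f choices_def\<close>)
qed (simp add: leads_to_refl)

text \<open>Only the first leaf can be observed. When it is found, alternatives \<open>cs\<close>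
  may still be on the stack; they stand for the remaining leaves and are discarded by the
  success.\<close>

definition yields :: "'a set \<Rightarrow> 'a list \<Rightarrow> 'a mconf \<Rightarrow> (nat \<times> group_map) list \<Rightarrow> 'a frame list \<Rightarrow> bool" where
  "yields W s X L fs \<longleftrightarrow> (case L of [] \<Rightarrow> leads_to W s X (Fail fs)
     | (p, \<gamma>) # _ \<Rightarrow> \<exists>cs. choices cs \<and> leads_to W s X (Succeed \<gamma> (cs @ fs)))"

lemma yields_step: "yields W s (mstep W s X) L fs \<Longrightarrow> yields W s X L fs"
  unfolding yields_def by (auto split: list.splits intro: leads_to_step)

lemma yields_Fail: "yields W s (Fail fs) [] fs"
  by (simp add: yields_def leads_to_refl)

lemma yields_append:
  assumes "yields W s X L1 (Choice l p \<gamma> d # fs)" "yields W s (Run l p \<gamma> d fs) L2 fs"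
  shows "yields W s X (L1 @ L2) fs"
proof (cases L1)
  case Nil
  have "leads_to W s X (Run l p \<gamma> d fs)"
    using assms(1) leads_to_trans[OF _ leads_to_step[of W s "Fail (Choice l p \<gamma> d # fs)"]] Nil
    by (auto simp: yields_def leads_to_refl)
  with assms(2) Nil show ?thesis
    by (auto simp: yields_def split: list.splits intro: leads_to_trans)
next
  case (Cons x L)
  obtain q \<delta> where x: "x = (q, \<delta>)" by force
  from assms(1) obtain cs where "choices cs" "leads_to W s X (Succeed \<delta> (cs @ Choice l p \<gamma> d # fs))"
    by (auto simp: yields_def Cons x)
  then show ?thesis by (auto simp: yields_def Cons x choices_def intro!: exI[of _ "cs @ [Choice l p \<gamma> d]"])
qed

fun unbounded_action :: "'a action \<Rightarrow> bool" where
  "unbounded_action (Areg r) \<longleftrightarrow> no_lower_bounds r"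
| "unbounded_action _ \<longleftrightarrow> True"

lemma mstep_correct:
  "\<forall>a\<in>set l. unbounded_action a \<Longrightarrow> yields W s (Run l p \<gamma> d fs) (leaves W s l p \<gamma> d) fs"
proof (induction W s l p \<gamma> d arbitrary: fs rule: leaves.induct)
  case (1 W s p \<gamma> d)
  have y: "yields W s (Succeed \<gamma> fs) [(p, \<gamma>)] fs"
    by (auto simp: yields_def choices_def leads_to_refl intro!: exI[of _ "[]"])
  show ?case by (rule yields_step) (use y in simp)
next
  case (2 W s k l p \<gamma> d)
  show ?case by (rule yields_step) (use 2 in \<open>simp add: yields_Fail\<close>)
next
  case (3 W s g l p \<gamma> d)
  show ?case by (rule yields_step) (use 3 in \<open>cases "\<gamma> g"; simp add: fun_upd_def\<close>)
next
  case (4 W s l p \<gamma> d)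
  show ?case by (rule yields_step) (use 4 in simp)
next
  case (5 W s cd l p \<gamma> d)
  show ?case by (rule yields_step) (use 5 in \<open>cases "read_char s cd p d"; simp add: yields_Fail\<close>)
next
  case (6 W s r1 r2 l p \<gamma> d)
  have y: "yields W s (Run (Areg r1 # l) p \<gamma> d (Choice (Areg r2 # l) p \<gamma> d # fs))
      (leaves W s (Areg r1 # l) p \<gamma> d @ leaves W s (Areg r2 # l) p \<gamma> d) fs"
    by (rule yields_append) (use 6 in simp_all)
  show ?case by (rule yields_step) (use y in simp)
next
  case (7 W s r1 r2 l p \<gamma> d)
  show ?case by (rule yields_step) (use 7 in \<open>cases d; simp\<close>)
next
  case (8 W s r m \<Delta> \<kappa> l p \<gamma> d)
  then show ?case by simp
next
  case (9 W s r \<Delta> \<kappa> l p \<gamma> d)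
  show ?case
  proof (rule yields_step, cases "\<Delta> = 0")
    case True
    with 9 show "yields W s (mstep W s (Run (Areg (Quant r 0 \<Delta> \<kappa>) # l) p \<gamma> d fs))
        (leaves W s (Areg (Quant r 0 \<Delta> \<kappa>) # l) p \<gamma> d) fs" by simp
  next
    case False
    from 9 False have I: "yields W s (Run (Areg r # Acheck p # Areg (Quant r 0 (\<Delta> - 1) \<kappa>) # l) p (reset \<gamma> r) d gs)
        (leaves W s (Areg r # Acheck p # Areg (Quant r 0 (\<Delta> - 1) \<kappa>) # l) p (reset \<gamma> r) d) gs"
      and S: "yields W s (Run l p \<gamma> d gs) (leaves W s l p \<gamma> d) gs" for gs
      by auto
    show "yields W s (mstep W s (Run (Areg (Quant r 0 \<Delta> \<kappa>) # l) p \<gamma> d fs))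
        (leaves W s (Areg (Quant r 0 \<Delta> \<kappa>) # l) p \<gamma> d) fs"
    proof (cases \<kappa>)
      case Greedy
      show ?thesis using yields_append[OF I S] False Greedy by (simp add: Let_def)
    next
      case Lazy
      show ?thesis using yields_append[OF S I] False Lazy by (simp add: Let_def)
    qed
  qed
next
  case (10 W s g r l p \<gamma> d)
  show ?case by (rule yields_step) (use 10 in \<open>simp add: fun_upd_def\<close>)
next
  case (11 W s d' b r l p \<gamma> d)
  let ?M = "leaves W s [Areg r] p \<gamma> d'"
  have body: "yields W s (Run [Areg r] p \<gamma> d' gs) ?M gs" for gs using 11(1,4) by simp
  have rest: "\<forall>a\<in>set l. unbounded_action a" using 11(4) by simp
  show ?case
  proof (rule yields_step, cases ?M)
    case Nil
    with body[of "Resume b l p \<gamma> d # fs"]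
    have "leads_to W s (Run [Areg r] p \<gamma> d' (Resume b l p \<gamma> d # fs)) (Fail (Resume b l p \<gamma> d # fs))"
      by (simp add: yields_def)
    then have l: "leads_to W s (Run [Areg r] p \<gamma> d' (Resume b l p \<gamma> d # fs)) (mstep W s (Fail (Resume b l p \<gamma> d # fs)))"
      by (rule leads_to_snoc)
    show "yields W s (mstep W s (Run (Areg (Look d' b r) # l) p \<gamma> d fs)) (leaves W s (Areg (Look d' b r) # l) p \<gamma> d) fs"
    proof (cases b)
      case Positive
      with l Nil show ?thesis by (simp add: yields_def)
    next
      case Negative
      have "yields W s (Run l p \<gamma> d fs) (leaves W s l p \<gamma> d) fs" using 11(3) Negative Nil rest by simp
      with l Nil Negative show ?thesis
        by (cases "leaves W s l p \<gamma> d") (auto simp: yields_def intro: leads_to_trans)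
    qed
  next
    case (Cons x xs)
    obtain q \<delta> where x: "x = (q, \<delta>)" by force
    from body[of "Resume b l p \<gamma> d # fs"] obtain cs where "choices cs"
      "leads_to W s (Run [Areg r] p \<gamma> d' (Resume b l p \<gamma> d # fs)) (Succeed \<delta> (cs @ Resume b l p \<gamma> d # fs))"
      by (auto simp: yields_def Cons x)
    then have "leads_to W s (Run [Areg r] p \<gamma> d' (Resume b l p \<gamma> d # fs)) (Succeed \<delta> (Resume b l p \<gamma> d # fs))"
      by (blast intro: leads_to_trans drop_choices)
    then have l: "leads_to W s (Run [Areg r] p \<gamma> d' (Resume b l p \<gamma> d # fs)) (mstep W s (Succeed \<delta> (Resume b l p \<gamma> d # fs)))"
      by (rule leads_to_snoc)
    show "yields W s (mstep W s (Run (Areg (Look d' b r) # l) p \<gamma> d fs)) (leaves W s (Areg (Look d' b r) # l) p \<gamma> d) fs"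
    proof (cases b)
      case Positive
      have "yields W s (Run l p \<delta> d fs) (leaves W s l p \<delta> d) fs" using 11(2) Positive Cons x rest by simp
      with l Cons x Positive show ?thesis
        by (cases "leaves W s l p \<delta> d") (auto simp: yields_def intro: leads_to_trans)
    next
      case Negative
      with l Cons x show ?thesis by (simp add: yields_def)
    qed
  qed
next
  case (12 W s a l p \<gamma> d)
  show ?case by (rule yields_step) (use 12 in \<open>simp add: yields_Fail\<close>)
next
  case (13 W s g l p \<gamma> d)
  show ?case
  proof (rule yields_step, cases "\<gamma> g")
    case (Closed a b)
    with 13 show "yields W s (mstep W s (Run (Areg (Backref g) # l) p \<gamma> d fs)) (leaves W s (Areg (Backref g) # l) p \<gamma> d) fs"
      by (cases "read_factor s (factor s a b) p d") (auto simp: yields_Fail)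
  qed (use 13 in simp_all)
qed

text \<open>The search for a starting position is backtracking as well: the machine starts with a
  failure and has all positions as alternatives.\<close>

definition start_frames :: "'a regex \<Rightarrow> nat \<Rightarrow> 'a frame list" where
  "start_frames r n = map (\<lambda>k. Choice [Areg r] k (\<lambda>_. Undefined) Forward) [0..<Suc n]"

lemma machine_correct:
  assumes "no_lower_bounds r"
  shows "if has_match W r s then \<exists>\<gamma>. leads_to W s (Fail (start_frames r (length s))) (Succeed \<gamma> [])
    else leads_to W s (Fail (start_frames r (length s))) (Fail [])"
proof -
  let ?F = "\<lambda>ks. map (\<lambda>k. Choice [Areg r] k (\<lambda>_. Undefined) Forward) ks"
  let ?L = "\<lambda>k. leaves W s [Areg r] k (\<lambda>_. Undefined) Forward"
  have ch: "choices (?F ks)" for ks by (auto simp: choices_def)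
  have "if \<exists>k\<in>set ks. ?L k \<noteq> [] then \<exists>\<gamma>. leads_to W s (Fail (?F ks)) (Succeed \<gamma> [])
    else leads_to W s (Fail (?F ks)) (Fail [])" for ks
  proof (induction ks)
    case (Cons k ks)
    have y: "yields W s (Run [Areg r] k (\<lambda>_. Undefined) Forward (?F ks)) (?L k) (?F ks)"
      by (rule mstep_correct) (simp add: assms)
    have st: "leads_to W s (Run [Areg r] k (\<lambda>_. Undefined) Forward (?F ks)) Y \<Longrightarrow> leads_to W s (Fail (?F (k # ks))) Y"
      for Y using leads_to_step[of W s "Fail (?F (k # ks))" Y] by simp
    show ?case
    proof (cases "?L k")
      case Nil
      with y have "leads_to W s (Fail (?F (k # ks))) (Fail (?F ks))"
        by (intro st) (simp add: yields_def)
      with Cons Nil show ?thesis by (auto intro: leads_to_trans split: if_splits)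
    next
      case (Cons x xs)
      obtain q \<delta> where x: "x = (q, \<delta>)" by force
      with y Cons obtain cs where "choices cs"
        "leads_to W s (Run [Areg r] k (\<lambda>_. Undefined) Forward (?F ks)) (Succeed \<delta> (cs @ ?F ks))"
        by (auto simp: yields_def)
      moreover from this ch[of ks] have "choices (cs @ ?F ks)" by (auto simp: choices_def)
      from drop_choices[OF this, of W s \<delta> "[]"] have "leads_to W s (Succeed \<delta> (cs @ ?F ks)) (Succeed \<delta> [])" by simp
      ultimately have "leads_to W s (Run [Areg r] k (\<lambda>_. Undefined) Forward (?F ks)) (Succeed \<delta> [])"
        by (blast intro: leads_to_trans)
      then have "leads_to W s (Fail (?F (k # ks))) (Succeed \<delta> [])" by (rule st)
      with Cons show ?thesis by auto
    qed
  qed (simp add: leads_to_refl)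
  from this[of "[0..<Suc (length s)]"] show ?thesis
    by (simp add: has_match_def start_frames_def less_Suc_eq_le Bex_def del: upt_Suc)
qed

subsection \<open>The depth of the stack\<close>

text \<open>
  Along a branch of the backtracking tree, outside of lookarounds, there are only polynomially many
  steps: an iteration of a quantifier that reads no character is paid for by the weight of the
  quantifier itself, and all other iterations by the characters that are read. Actions behind a
  check that has not been passed yet cost nothing, as they are reached after progress only.
\<close>

primrec weight :: "'a regex \<Rightarrow> nat" where
  "weight Eps = 1"
| "weight (Chars cd) = 1"
| "weight (Alt r1 r2) = 1 + weight r1 + weight r2"
| "weight (Seq r1 r2) = 1 + weight r1 + weight r2"
| "weight (Group g r) = 2 + weight r"
| "weight (Backref g) = 1"
| "weight (Quant r m \<Delta> \<kappa>) = 2 + weight r"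
| "weight (Look d b r) = 1"
| "weight (Anchor a) = 1"

text \<open>Bounds the total weight of the actions that unfolding \<open>r\<close> can produce. An
  optional iteration leaves a check and the quantifier itself behind its body, of weights
  \<open>1\<close> and \<open>2 + weight r\<close>; this explains the case of quantifiers.\<close>

primrec peak :: "'a regex \<Rightarrow> nat" where
  "peak Eps = 1"
| "peak (Chars cd) = 1"
| "peak (Alt r1 r2) = 1 + peak r1 + peak r2"
| "peak (Seq r1 r2) = 1 + peak r1 + peak r2"
| "peak (Group g r) = 2 + peak r"
| "peak (Backref g) = 1"
| "peak (Quant r m \<Delta> \<kappa>) = 3 + peak r + weight r"
| "peak (Look d b r) = 1 + peak r"
| "peak (Anchor a) = 1"

primrec look_depth :: "'a regex \<Rightarrow> nat" where
  "look_depth Eps = 0"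
| "look_depth (Chars cd) = 0"
| "look_depth (Alt r1 r2) = max (look_depth r1) (look_depth r2)"
| "look_depth (Seq r1 r2) = max (look_depth r1) (look_depth r2)"
| "look_depth (Group g r) = look_depth r"
| "look_depth (Backref g) = 0"
| "look_depth (Quant r m \<Delta> \<kappa>) = look_depth r"
| "look_depth (Look d b r) = Suc (look_depth r)"
| "look_depth (Anchor a) = 0"

lemma weight_le_peak: "weight r \<le> peak r"
  by (induction r) simp_all

fun action_weight :: "'a action \<Rightarrow> nat" where
  "action_weight (Areg r) = weight r" | "action_weight _ = 1"

fun action_peak :: "'a action \<Rightarrow> nat" where
  "action_peak (Areg r) = peak r" | "action_peak _ = 1"

fun action_depth :: "'a action \<Rightarrow> nat" where
  "action_depth (Areg r) = look_depth r" | "action_depth _ = 0"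

primrec mass :: "'a action list \<Rightarrow> nat" where
  "mass [] = 0" | "mass (a # l) = action_weight a + mass l"

primrec list_peak :: "'a action list \<Rightarrow> nat" where
  "list_peak [] = 0" | "list_peak (a # l) = max (action_peak a + mass l) (list_peak l)"

primrec list_depth :: "'a action list \<Rightarrow> nat" where
  "list_depth [] = 0" | "list_depth (a # l) = max (action_depth a) (list_depth l)"

fun active :: "direction \<Rightarrow> nat \<Rightarrow> 'a action list \<Rightarrow> nat" where
  "active d p [] = 0"
| "active d p (Areg r # l) = weight r + active d p l"
| "active d p (Aclose g # l) = 1 + active d p l"
| "active d p (Acheck k # l) = (if further d p k then 1 + active d p l else 1)"

lemma active_le_mass: "active d p l \<le> mass l"
  by (induction d p l rule: active.induct) simp_all

lemma action_weight_le_peak: "action_weight a \<le> action_peak a"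
  by (cases a) (simp_all add: weight_le_peak)

lemma mass_le_list_peak: "mass l \<le> list_peak l"
proof (cases l)
  case (Cons a l')
  then show ?thesis using action_weight_le_peak[of a] by (simp add: le_max_iff_disj)
qed simp

lemma length_le_mass: "length l \<le> mass l"
proof (induction l)
  case (Cons a l)
  have "1 \<le> weight r" for r :: "'a regex" by (induction r) simp_all
  then have "1 \<le> action_weight a" by (cases a) simp_all
  with Cons show ?case by simp
qed simp

text \<open>
  Decrementing a bound may enlarge its encoding, as the bits \<open>True\<close> are larger trees than the bits
  \<open>False\<close>; hence all bits of a bound count the same.
\<close>

fun enat_size :: "enat \<Rightarrow> nat" where
  "enat_size (enat n) = 4 * length (nat_bits n) + 3" | "enat_size \<infinity> = 1"

primrec msize :: "'a::finite regex \<Rightarrow> nat" where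
  "msize Eps = tsize (eregex (Eps :: 'a regex))"
| "msize (Chars cd) = tsize (eregex (Chars cd))"
| "msize (Alt r1 r2) = 7 + msize r1 + msize r2"
| "msize (Seq r1 r2) = 9 + msize r1 + msize r2"
| "msize (Group g r) = 11 + tsize (enum_bits g) + msize r"
| "msize (Backref g) = tsize (eregex (Backref g :: 'a regex))"
| "msize (Quant r m \<Delta> \<kappa>) = 17 + tsize (etok (TQuant \<kappa> :: 'a token)) + enat_size \<Delta> + tsize (egroups r) + msize r"
| "msize (Look d b r) = 17 + tsize (etok (TLook d b :: 'a token)) + msize r"
| "msize (Anchor a) = tsize (eregex (Anchor a :: 'a regex))"

lemma tsize_eenat: "tsize (eenat \<Delta>) \<le> enat_size \<Delta>"
  by (cases \<Delta>) (use tsize_blist in \<open>auto simp: enum_bits_def\<close>)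

lemma tsize_eregex: "tsize (eregex r) \<le> msize r"
proof (induction r)
  case (Quant r m \<Delta> \<kappa>)
  then show ?case using tsize_eenat[of \<Delta>] by simp
qed simp_all

lemma length_nat_bits_mono: "m \<le> n \<Longrightarrow> length (nat_bits m) \<le> length (nat_bits n)"
proof (induction n arbitrary: m rule: less_induct)
  case (less n)
  show ?case
  proof (cases "m = 0")
    case False
    with less.prems have "length (nat_bits (m div 2)) \<le> length (nat_bits (n div 2))"
      by (intro less.IH) (auto intro: div_le_mono)
    with False less.prems show ?thesis by (simp add: nat_bits.simps[of m] nat_bits.simps[of n])
  qed (simp add: nat_bits.simps[of 0])
qed

lemma enat_size_dec: "enat_size (\<Delta> - 1) \<le> enat_size \<Delta>"
proof (cases \<Delta>)
  case (enat n)
  then have "\<Delta> - 1 = enat (n - 1)" by (simp add: one_enat_def)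
  with enat show ?thesis using length_nat_bits_mono[of "n - 1" n] by simp
qed simp

section \<open>The invariant that bounds the stack\<close>

context
  fixes W :: "'a::finite set" and s :: "'a list" and G :: "nat list" and P D Z R :: nat
begin

fun action_ok :: "'a action \<Rightarrow> bool" where
  "action_ok (Areg r) \<longleftrightarrow> no_lower_bounds r \<and> set (groups r) \<subseteq> set G \<and> msize r \<le> Z"
| "action_ok (Aclose g) \<longleftrightarrow> g \<in> set G"
| "action_ok (Acheck k) \<longleftrightarrow> k \<le> length s"

definition map_ok :: "group_map \<Rightarrow> bool" where
  "map_ok \<gamma> \<longleftrightarrow> ranges_within (length s) \<gamma> \<and> (\<forall>g. g \<notin> set G \<longrightarrow> \<gamma> g = Undefined)"

definition goal_ok :: "'a action list \<Rightarrow> nat \<Rightarrow> group_map \<Rightarrow> bool" where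
  "goal_ok l p \<gamma> \<longleftrightarrow> list_peak l \<le> P \<and> list_depth l \<le> D \<and> p \<le> length s \<and> map_ok \<gamma> \<and> (\<forall>a\<in>set l. action_ok a)"

definition span :: nat where "span = (P + 1) * (length s + 1)"

text \<open>A lexicographic order in one number: depth of lookarounds, characters left, active
  weight. The active weight is at most \<open>P\<close>, so the factor \<open>P + 1\<close>
  dominates it, and \<open>span\<close> exceeds the sum of the last two parts.\<close>

definition rank :: "'a action list \<Rightarrow> nat \<Rightarrow> direction \<Rightarrow> nat" where
  "rank l p d = list_depth l * span + (P + 1) * remaining (length s) d p + active d p l"

text \<open>The rank of the actions to run plus the height of the stack never exceeds
  \<open>R\<close>: whenever the stack grows by one, the rank drops. A frame remembers this for its
  own height \<open>k\<close>, so that the inequality holds again when the frame is popped.\<close>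

fun frame_ok :: "'a frame \<Rightarrow> nat \<Rightarrow> bool" where
  "frame_ok (Choice l p \<gamma> d) k \<longleftrightarrow> goal_ok l p \<gamma> \<and> rank l p d + k < R"
| "frame_ok (Resume b l p \<gamma> d) k \<longleftrightarrow> goal_ok l p \<gamma> \<and> rank l p d + k < R"

primrec stack_ok :: "'a frame list \<Rightarrow> bool" where
  "stack_ok [] \<longleftrightarrow> True"
| "stack_ok (f # fs) \<longleftrightarrow> frame_ok f (length fs) \<and> stack_ok fs"

fun conf_ok :: "'a mconf \<Rightarrow> bool" where
  "conf_ok (Run l p \<gamma> d fs) \<longleftrightarrow> goal_ok l p \<gamma> \<and> rank l p d + length fs \<le> R \<and> stack_ok fs"
| "conf_ok (Succeed \<gamma> fs) \<longleftrightarrow> map_ok \<gamma> \<and> stack_ok fs"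
| "conf_ok (Fail fs) \<longleftrightarrow> stack_ok fs"

lemma rank_less_span:
  assumes "list_peak l \<le> P" "p \<le> length s"
  shows "rank l p d < Suc (list_depth l) * span"
proof -
  have "remaining (length s) d p \<le> length s" using remaining_le assms(2) by blast
  then have "(P + 1) * remaining (length s) d p \<le> (P + 1) * length s" by (rule mult_le_mono2)
  moreover have "active d p l \<le> P"
    using active_le_mass[of d p l] mass_le_list_peak[of l] assms(1) by simp
  ultimately have "(P + 1) * remaining (length s) d p + active d p l < span" by (simp add: span_def)
  then show ?thesis by (simp add: rank_def)
qed

text \<open>Reading a character may let pending checks pass and thus activate more actions, but only
  up to the weight \<open>P\<close>, which the factor \<open>P + 1\<close> of the characters left
  pays for.\<close>

lemma rank_progress:
  assumes "list_peak l \<le> P" "list_depth l \<le> list_depth l'" "remaining (length s) d p' < remaining (length s) d p"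
  shows "rank l p' d < rank l' p d"
proof -
  have "active d p' l \<le> P"
    using active_le_mass[of d p' l] mass_le_list_peak[of l] assms(1) by simp
  moreover have "(P + 1) * Suc (remaining (length s) d p') \<le> (P + 1) * remaining (length s) d p"
    using assms(3) by (intro mult_le_mono2) simp
  moreover have "(P + 1) * Suc (remaining (length s) d p') = (P + 1) * remaining (length s) d p' + (P + 1)" by simp
  moreover have "list_depth l * span \<le> list_depth l' * span" using assms(2) by (rule mult_le_mono1)
  ultimately show ?thesis unfolding rank_def by linarith
qed

lemma rank_same:
  assumes "list_depth l \<le> list_depth l'" "active d p l < active d p l'"
  shows "rank l p d < rank l' p d"
proof -
  have "list_depth l * span \<le> list_depth l' * span" using assms(1) by (rule mult_le_mono1)
  with assms(2) show ?thesis unfolding rank_def by linarith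
qed

lemma map_ok_reset: "map_ok \<gamma> \<Longrightarrow> map_ok (reset \<gamma> r)"
  unfolding map_ok_def by (simp add: ranges_within_reset) (simp add: reset_def)

lemma weight_pos: "0 < weight r"
  by (induction r) simp_all

lemma read_char_remaining:
  "read_char s cd p d = Some p' \<Longrightarrow> p \<le> length s \<Longrightarrow> p' \<le> length s \<and> remaining (length s) d p' < remaining (length s) d p"
  by (cases d) (auto split: if_splits)

lemma read_factor_remaining:
  assumes "read_factor s w p d = Some p'" "p \<le> length s"
  shows "p' \<le> length s \<and> (p' = p \<or> remaining (length s) d p' < remaining (length s) d p)"
proof -
  have p': "p' \<le> length s" using read_factor_within[OF assms] .
  from assms p' show ?thesis by (cases d) (auto split: if_splits)
qed

lemma goal_step:
  assumes "goal_ok (a # l) p \<gamma>"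
  shows "goal_ok l p \<gamma>" "rank l p d < rank (a # l) p d \<or> (\<exists>k. a = Acheck k \<and> \<not> further d p k)"
proof -
  show "goal_ok l p \<gamma>" using assms by (auto simp: goal_ok_def)
  have "active d p l < active d p (a # l) \<or> (\<exists>k. a = Acheck k \<and> \<not> further d p k)"
    by (cases a) (auto simp: weight_pos)
  then show "rank l p d < rank (a # l) p d \<or> (\<exists>k. a = Acheck k \<and> \<not> further d p k)"
    using rank_same[of l "a # l" d p] by auto
qed

lemma conf_ok_next:
  assumes "conf_ok (Run l p \<gamma> d fs)" "goal_ok l' p' \<gamma>'" "rank l' p' d' < rank l p d"
  shows "conf_ok (Run l' p' \<gamma>' d' fs)"
  using assms by simp

lemma conf_ok_choice:
  assumes "conf_ok (Run l p \<gamma> d fs)" "goal_ok l1 p1 \<gamma>1" "rank l1 p1 d1 < rank l p d"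
    "goal_ok l2 p2 \<gamma>2" "rank l2 p2 d2 < rank l p d"
  shows "conf_ok (Run l1 p1 \<gamma>1 d1 (Choice l2 p2 \<gamma>2 d2 # fs))"
  using assms by simp

lemma conf_ok_resume:
  assumes "conf_ok (Run l p \<gamma> d fs)" "goal_ok l1 p1 \<gamma>1" "rank l1 p1 d1 < rank l p d"
    "goal_ok l2 p2 \<gamma>2" "rank l2 p2 d2 < rank l p d"
  shows "conf_ok (Run l1 p1 \<gamma>1 d1 (Resume b l2 p2 \<gamma>2 d2 # fs))"
  using assms by simp

lemma map_ok_upd:
  assumes "map_ok \<gamma>" "g \<in> set G" "p \<le> length s"
  shows "map_ok (\<gamma>(g := Opened p))" "\<gamma> g = Opened a \<Longrightarrow> map_ok (\<gamma>(g := Closed (min a p) (max a p)))"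
  using assms ranges_within_open[of "length s" \<gamma> p g] ranges_within_close[of "length s" \<gamma> p g a]
  by (auto simp: map_ok_def)

lemma conf_ok_mstep:
  assumes ok: "conf_ok X"
  shows "conf_ok (mstep W s X)"
proof (cases X)
  case (Run l p \<gamma> d fs)
  note run = ok[unfolded Run]
  then have g: "goal_ok l p \<gamma>" and fs: "stack_ok fs" by simp_all
  then have p: "p \<le> length s" and m: "map_ok \<gamma>" by (simp_all add: goal_ok_def)
  have F: "conf_ok (Fail fs)" and S: "conf_ok (Succeed \<gamma> fs)" using fs m by simp_all
  show ?thesis
  proof (cases l)
    case Nil
    with S show ?thesis by (simp add: Run)
  next
    case (Cons a l')
    note g' = goal_step(1)[OF g[unfolded Cons]]
    have lt: "rank l' p d < rank l p d" if "\<nexists>k. a = Acheck k \<and> \<not> further d p k"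
      using goal_step(2)[OF g[unfolded Cons], of d] that by (auto simp: Cons)
    have dl: "list_depth l' \<le> list_depth l" and pl: "list_peak l' \<le> P" using g' by (simp_all add: Cons goal_ok_def)
    have next': "conf_ok (Run l' p \<gamma>' d fs)" if "map_ok \<gamma>'" "\<nexists>k. a = Acheck k \<and> \<not> further d p k" for \<gamma>'
      by (rule conf_ok_next[OF run _ lt[OF that(2)]]) (use g' that(1) in \<open>simp add: goal_ok_def\<close>)
    show ?thesis
    proof (cases a)
      case (Acheck k)
      with next'[OF m] F show ?thesis by (simp add: Run Cons)
    next
      case (Aclose h)
      then have "h \<in> set G" using g by (simp add: Cons goal_ok_def)
      with next' map_ok_upd(2)[OF m this p] m Aclose show ?thesis
        by (cases "\<gamma> h") (simp_all add: Run Cons del: conf_ok.simps)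
    next
      case (Areg r)
      show ?thesis
      proof (cases r)
        case Eps
        with next'[OF m] Areg show ?thesis by (simp add: Run Cons)
      next
        case (Chars cd)
        show ?thesis
        proof (cases "read_char s cd p d")
          case None
          with F Areg Chars show ?thesis by (simp add: Run Cons)
        next
          case (Some p')
          note pr = read_char_remaining[OF Some p]
          have "conf_ok (Run l' p' \<gamma> d fs)"
            by (rule conf_ok_next[OF run _ rank_progress[OF pl dl conjunct2[OF pr]]])
              (use g' pr in \<open>simp add: goal_ok_def\<close>)
          with Some Areg Chars show ?thesis by (simp add: Run Cons del: conf_ok.simps)
        qed
      next
        case (Alt r1 r2)
        have "conf_ok (Run (Areg r1 # l') p \<gamma> d (Choice (Areg r2 # l') p \<gamma> d # fs))"
          using g by (intro conf_ok_choice[OF run] rank_same) (auto simp: Cons Areg Alt goal_ok_def)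
        then show ?thesis by (simp add: Run Cons Areg Alt del: conf_ok.simps)
      next
        case (Seq r1 r2)
        have "conf_ok (Run (Areg r1 # Areg r2 # l') p \<gamma> d fs)" "conf_ok (Run (Areg r2 # Areg r1 # l') p \<gamma> d fs)"
          using g weight_le_peak[of r1] weight_le_peak[of r2]
          by (intro conf_ok_next[OF run] rank_same; auto simp: Cons Areg Seq goal_ok_def)+
        then show ?thesis by (cases d) (simp_all add: Run Cons Areg Seq del: conf_ok.simps)
      next
        case (Group h r')
        then have h: "h \<in> set G" using g by (simp add: Cons Areg goal_ok_def)
        have "conf_ok (Run (Areg r' # Aclose h # l') p (\<gamma>(h := Opened p)) d fs)"
          using g map_ok_upd(1)[OF m h p] by (intro conf_ok_next[OF run] rank_same) (auto simp: Cons Areg Group goal_ok_def)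
        then show ?thesis by (simp add: Run Cons Areg Group del: conf_ok.simps)
      next
        case (Backref h)
        show ?thesis
        proof (cases "\<gamma> h")
          case (Closed x y)
          show ?thesis
          proof (cases "read_factor s (factor s x y) p d")
            case None
            with F Areg Backref Closed show ?thesis by (simp add: Run Cons)
          next
            case (Some p')
            note pr = read_factor_remaining[OF Some p]
            then have "rank l' p' d < rank l p d"
              using rank_progress[OF pl dl, of d p' p] lt Areg by auto
            then have "conf_ok (Run l' p' \<gamma> d fs)"
              by (rule conf_ok_next[OF run, rotated]) (use g' pr in \<open>simp add: goal_ok_def\<close>)
            with Some Areg Backref Closed show ?thesis by (simp add: Run Cons del: conf_ok.simps)
          qed
        qed (use next'[OF m] Areg Backref in \<open>simp_all add: Run Cons del: conf_ok.simps\<close>)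
      next
        case (Quant r' m' \<Delta> \<kappa>)
        let ?I = "Areg r' # Acheck p # Areg (Quant r' 0 (\<Delta> - 1) \<kappa>) # l'"
        have gI: "goal_ok ?I p (reset \<gamma> r')"
          using g map_ok_reset[OF m, of r'] enat_size_dec[of \<Delta>] weight_le_peak[of r']
          by (auto simp: Cons Areg Quant goal_ok_def)
        \<comment> \<open>At position \<open>p\<close> the new check blocks all that follows it. So
          the active weight falls from at least \<open>2 + weight r'\<close> to
          \<open>weight r' + 1\<close>.\<close>
        have rI: "rank ?I p d < rank l p d"
          by (rule rank_same) (cases d; simp add: Cons Areg Quant)+
        have r': "rank l' p d < rank l p d" by (rule lt) (simp add: Areg)
        from next'[OF m] conf_ok_choice[OF run gI rI g' r'] conf_ok_choice[OF run g' r' gI rI] show ?thesis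
          by (cases \<kappa>) (simp_all add: Run Cons Areg Quant del: conf_ok.simps)
      next
        case (Look d' b r')
        have gB: "goal_ok [Areg r'] p \<gamma>" using g by (auto simp: Cons Areg Look goal_ok_def)
        \<comment> \<open>The body may run in the other direction and have more characters left;
          this is compensated by its smaller depth, as everything else is less than one
          \<open>span\<close>.\<close>
        have "rank [Areg r'] p d' < Suc (list_depth [Areg r']) * span"
          by (rule rank_less_span) (use gB in \<open>simp_all add: goal_ok_def\<close>)
        also have "\<dots> \<le> list_depth l * span" by (rule mult_le_mono1) (simp add: Cons Areg Look)
        also have "\<dots> \<le> rank l p d" by (simp add: rank_def)
        finally have rB: "rank [Areg r'] p d' < rank l p d" .
        have r': "rank l' p d < rank l p d" by (rule lt) (simp add: Areg)
        from conf_ok_resume[OF run gB rB g' r'] show ?thesis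
          by (simp add: Run Cons Areg Look del: conf_ok.simps)
      next
        case (Anchor x)
        with next'[OF m] F Areg show ?thesis by (simp add: Run Cons)
      qed
    qed
  qed
next
  case (Succeed \<gamma> fs)
  show ?thesis
  proof (cases fs)
    case (Cons f fs')
    show ?thesis
    proof (cases f)
      case (Resume b l p \<gamma>' d)
      with ok Succeed Cons show ?thesis by (cases b) (simp_all add: goal_ok_def)
    qed (use ok Succeed Cons in simp)
  qed (use ok Succeed in simp)
next
  case (Fail fs)
  show ?thesis
  proof (cases fs)
    case (Cons f fs')
    show ?thesis
    proof (cases f)
      case (Resume b l p \<gamma>' d)
      with ok Fail Cons show ?thesis by (cases b) simp_all
    qed (use ok Fail Cons in simp)
  qed (use ok Fail in simp)
qed

lemma conf_ok_funpow: "conf_ok X \<Longrightarrow> conf_ok ((mstep W s ^^ n) X)"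
  by (induction n) (simp_all add: conf_ok_mstep)

lemma stack_length: "stack_ok fs \<Longrightarrow> length fs \<le> R"
proof (cases fs)
  case (Cons f fs')
  assume "stack_ok fs"
  with Cons show ?thesis by (cases f) simp_all
qed simp

lemma start_ok:
  assumes "no_lower_bounds r" "set (groups r) \<subseteq> set G" "msize r \<le> Z" "peak r \<le> P" "look_depth r \<le> D"
    and R: "(D + 1) * span + length s + 1 \<le> R"
  shows "conf_ok (Fail (start_frames r (length s)))"
proof -
  have "stack_ok (map (\<lambda>k. Choice [Areg r] k (\<lambda>_. Undefined) Forward) ks)"
    if "set ks \<subseteq> {..length s}" "length ks \<le> length s + 1" for ks
    using that
  proof (induction ks)
    case (Cons k ks)
    have "rank [Areg r] k Forward < Suc (list_depth [Areg r]) * span"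
      by (rule rank_less_span) (use assms Cons.prems in simp_all)
    also have "\<dots> \<le> (D + 1) * span" by (rule mult_le_mono1) (use assms in simp)
    finally show ?case
      using Cons R assms by (auto simp: goal_ok_def map_ok_def ranges_within_def)
  qed simp
  note st = this
  have k: "set [0..<Suc (length s)] \<subseteq> {..length s}" by auto
  have "length [0..<Suc (length s)] \<le> length s + 1" by simp
  from st[OF k this] show ?thesis unfolding start_frames_def conf_ok.simps .
qed

end

section \<open>The backtracking machine on trees\<close>

text \<open>
  Equality of lists over a finite set of atoms: the state is \<open>Leaf\<close> after a mismatch and otherwise
  contains the part of the second list that is still to be matched.
\<close>

definition same_step :: "tree set \<Rightarrow> tree \<Rightarrow> tree \<Rightarrow> tree" where
  "same_step A a v = (if v \<noteq> Leaf \<and> cdr v \<noteq> Leaf \<and> Node a (car (cdr v)) \<in> (\<lambda>x. Node x x) ` A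
     then Node Leaf (cdr (cdr v)) else Leaf)"

lemma same_step_simps:
  "same_step A a Leaf = Leaf" "same_step A a (Node b Leaf) = Leaf"
  "same_step A a (Node b (Node c d)) = (if a = c \<and> a \<in> A then Node Leaf d else Leaf)"
  by (auto simp: same_step_def)

definition same :: "tree set \<Rightarrow> tree \<Rightarrow> tree \<Rightarrow> bool" where
  "same A x y \<longleftrightarrow> foldl (\<lambda>v a. same_step A a v) (Node Leaf y) (els x) = Node Leaf Leaf"

lemma same_iff: "same A (tlist xs) (tlist ys) \<longleftrightarrow> xs = ys \<and> set xs \<subseteq> A"
proof -
  have L: "foldl (\<lambda>v a. same_step A a v) Leaf xs = Leaf" for xs
    by (induction xs) (simp_all add: same_step_simps)
  have "foldl (\<lambda>v a. same_step A a v) (Node Leaf (tlist ys)) xs = Node Leaf Leaf \<longleftrightarrow> xs = ys \<and> set xs \<subseteq> A"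
  proof (induction xs arbitrary: ys)
    case Nil
    then show ?case by (cases ys) auto
  next
    case (Cons x xs)
    then show ?case by (cases ys) (auto simp: same_step_simps L)
  qed
  then show ?thesis by (simp add: same_def)
qed

lemma FPb_same [FP_intros]:
  assumes "finite A" "FP f" "FP g"
  shows "FPb (\<lambda>t. same A (f t) (g t))"
  unfolding same_def
proof (intro FPb_eq_const FP_foldl[where h = "\<lambda>a v c. same_step A a v" and q = 1 and c = "\<lambda>_. Leaf"])
  show "FP (\<lambda>t. same_step A (car t) (car (cdr t)))"
    unfolding same_step_def by (intro FP_intros) (simp add: assms)
  show "tsize (same_step A a v) \<le> tsize v + poly 1 (tsize a + tsize c)" for a v c
    by (cases v; cases "cdr v") (auto simp: same_step_def)
qed (intro FP_intros assms)+

definition same_bits :: "tree \<Rightarrow> tree \<Rightarrow> bool" where "same_bits = same (range tb)"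

lemma same_bits_iff [simp]: "same_bits (enum_bits m) (enum_bits n) \<longleftrightarrow> m = n"
  by (auto simp: same_bits_def enum_bits_def blist_def same_iff inj_map_eq_map inj_def)

lemma FPb_same_bits [FP_intros]: "FP f \<Longrightarrow> FP g \<Longrightarrow> FPb (\<lambda>t. same_bits (f t) (g t))"
  unfolding same_bits_def by (intro FP_intros) simp

definition tmember :: "tree \<Rightarrow> tree \<Rightarrow> bool" where
  "tmember x l \<longleftrightarrow> foldl (\<lambda>v a. if same_bits a x then Node Leaf Leaf else v) Leaf (els l) \<noteq> Leaf"

lemma tmember_iff [simp]: "tmember (enum_bits g) (tlist (map enum_bits gs)) \<longleftrightarrow> g \<in> set gs"
proof -
  have "foldl (\<lambda>v a. if same_bits a (enum_bits g) then Node Leaf Leaf else v) v (map enum_bits gs) \<noteq> Leaf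
      \<longleftrightarrow> v \<noteq> Leaf \<or> g \<in> set gs" for v
    by (induction gs arbitrary: v) auto
  then show ?thesis by (simp add: tmember_def)
qed

lemma FPb_tmember [FP_intros]:
  assumes "FP f" "FP g"
  shows "FPb (\<lambda>t. tmember (f t) (g t))"
  unfolding tmember_def
proof (intro FPb_not FPb_Leaf FP_foldl[where h = "\<lambda>a v c. if same_bits a c then Node Leaf Leaf else v" and q = 3])
  show "tsize (if same_bits a c then Node Leaf Leaf else v) \<le> tsize v + poly 3 (tsize a + tsize c)" for a v c
    by simp
qed (intro FP_intros assms)+

definition tdistinct :: "tree \<Rightarrow> bool" where
  "tdistinct l \<longleftrightarrow> car (foldl (\<lambda>v a. Node (tb (car v \<noteq> Leaf \<and> \<not> tmember a (cdr v))) (Node a (cdr v)))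
     (Node (Node Leaf Leaf) Leaf) (els l)) \<noteq> Leaf"

lemma tdistinct_iff [simp]: "tdistinct (tlist (map enum_bits gs)) \<longleftrightarrow> distinct gs"
proof -
  have "car (foldl (\<lambda>v a. Node (tb (car v \<noteq> Leaf \<and> \<not> tmember a (cdr v))) (Node a (cdr v)))
      (Node b (tlist (map enum_bits hs))) (map enum_bits gs)) \<noteq> Leaf \<longleftrightarrow>
      b \<noteq> Leaf \<and> distinct gs \<and> set gs \<inter> set hs = {}" for b hs
  proof (induction gs arbitrary: b hs)
    case (Cons g gs)
    from Cons[of "tb (b \<noteq> Leaf \<and> g \<notin> set hs)" "g # hs"] show ?case by auto
  qed simp
  from this[of _ "[]"] show ?thesis by (simp add: tdistinct_def)
qed

lemma FPb_tdistinct [FP_intros]: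
  assumes "FP f"
  shows "FPb (\<lambda>t. tdistinct (f t))"
  unfolding tdistinct_def
proof (intro FPb_not FPb_Leaf FP_car' FP_foldl[where
      h = "\<lambda>a v c. Node (tb (car v \<noteq> Leaf \<and> \<not> tmember a (cdr v))) (Node a (cdr v))" and q = "[:5, 1:]" and c = "\<lambda>_. Leaf"])
  show "tsize (Node (tb (car v \<noteq> Leaf \<and> \<not> tmember a (cdr v))) (Node a (cdr v))) \<le> tsize v + poly [:5, 1:] (tsize a + tsize c)"
    for a v c by (cases v) (simp_all add: tb_def)
qed (intro FP_intros assms)+

lemma tlist_eq [simp]: "tlist xs = tlist ys \<longleftrightarrow> xs = ys"
  by (metis els_tlist)

subsection \<open>Group maps\<close>

fun egstate :: "group_state \<Rightarrow> tree" where
  "egstate Undefined = Leaf"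
| "egstate (Opened a) = Node Leaf (un a)"
| "egstate (Closed a b) = Node (Node Leaf Leaf) (Node (un a) (un b))"

text \<open>Undefined groups of \<open>G\<close> are listed, too. So the list keeps its shape, and
  opening, closing and resetting are maps over it.\<close>

definition emap :: "nat list \<Rightarrow> group_map \<Rightarrow> tree" where
  "emap G \<gamma> = tlist (map (\<lambda>g. Node (enum_bits g) (egstate (\<gamma> g))) G)"

definition tlookup :: "tree \<Rightarrow> tree \<Rightarrow> tree" where
  "tlookup x m = foldl (\<lambda>v a. if same_bits (car a) x then cdr a else v) Leaf (els m)"

lemma tlookup_emap:
  assumes "\<And>g. g \<notin> set G \<Longrightarrow> \<gamma> g = Undefined"
  shows "tlookup (enum_bits g) (emap G \<gamma>) = egstate (\<gamma> g)"
proof -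
  have "foldl (\<lambda>v a. if same_bits (car a) (enum_bits g) then cdr a else v) v (map (\<lambda>g. Node (enum_bits g) (egstate (\<gamma> g))) G)
      = (if g \<in> set G then egstate (\<gamma> g) else v)" for v
    by (induction G arbitrary: v) auto
  with assms show ?thesis by (simp add: tlookup_def emap_def)
qed

lemma FP_tlookup [FP_intros]:
  assumes "FP f" "FP g"
  shows "FP (\<lambda>t. tlookup (f t) (g t))"
  unfolding tlookup_def
proof (intro FP_foldl[where h = "\<lambda>a v c. if same_bits (car a) c then cdr a else v" and q = "[:0, 1:]"])
  show "tsize (if same_bits (car a) c then cdr a else v) \<le> tsize v + poly [:0, 1:] (tsize a + tsize c)" for a v c
    by (cases a) simp_all
qed (intro FP_intros assms)+

text \<open>\<open>FP_tmap\<close> passes a single parameter to the mapped function; therefore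
  \<open>x\<close> and \<open>y\<close> are written as the components of one tree.\<close>

definition tupdate :: "tree \<Rightarrow> tree \<Rightarrow> tree \<Rightarrow> tree" where
  "tupdate x y m = tmap (\<lambda>a. if same_bits (car a) (car (Node x y)) then Node (car a) (cdr (Node x y)) else a) m"

lemma tupdate_emap: "tupdate (enum_bits g) (egstate z) (emap G \<gamma>) = emap G (\<gamma>(g := z))"
  by (simp add: tupdate_def emap_def)

lemma FP_tupdate [FP_intros]:
  assumes "FP f" "FP g" "FP h"
  shows "FP (\<lambda>t. tupdate (f t) (g t) (h t))"
  unfolding tupdate_def
  by (rule FP_tmap[where h = "\<lambda>a c. if same_bits (car a) (car c) then Node (car a) (cdr c) else a" and c = "\<lambda>t. Node (f t) (g t)"])
    (intro FP_intros assms)+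

definition treset :: "tree \<Rightarrow> tree \<Rightarrow> tree" where
  "treset gs m = tmap (\<lambda>a. if tmember (car a) gs then Node (car a) Leaf else a) m"

lemma treset_emap: "treset (egroups r) (emap G \<gamma>) = emap G (reset \<gamma> r)"
  by (simp add: treset_def emap_def egroups_def reset_def)

lemma FP_treset [FP_intros]:
  assumes "FP f" "FP g"
  shows "FP (\<lambda>t. treset (f t) (g t))"
  unfolding treset_def
  by (rule FP_tmap[where h = "\<lambda>a c. if tmember (car a) c then Node (car a) Leaf else a"]) (intro FP_intros assms)+

subsection \<open>Bounds of quantifiers\<close>

text \<open>Subtraction of one with a borrow, least significant bit first. From a canonical number
  at most one leading zero arises, which \<open>strip\<close> removes.\<close>

fun dec_bits :: "bool list \<Rightarrow> bool list" where
  "dec_bits [] = []"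
| "dec_bits (True # bs) = False # bs"
| "dec_bits (False # bs) = True # dec_bits bs"

definition strip :: "bool list \<Rightarrow> bool list" where
  "strip bs = (if bs \<noteq> [] \<and> \<not> last bs then butlast bs else bs)"

lemma of_bits_strip: "of_bits (strip bs) = of_bits bs"
  by (induction bs) (auto simp: strip_def)

lemma of_bits_dec: "0 < of_bits bs \<Longrightarrow> of_bits (dec_bits bs) + 1 = of_bits bs"
  by (induction bs rule: dec_bits.induct) auto

lemma dec_bits_Nil [simp]: "dec_bits bs = [] \<longleftrightarrow> bs = []"
  by (cases bs rule: dec_bits.cases) auto

lemma canonical_dec: "canonical bs \<Longrightarrow> canonical (strip (dec_bits bs))"
proof (induction bs rule: dec_bits.induct)
  case (3 bs)
  then have "canonical (strip (dec_bits bs))" and "bs \<noteq> []" by (auto simp: canonical_def split: if_splits)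
  then show ?case by (auto simp: canonical_def strip_def split: if_splits)
qed (auto simp: canonical_def strip_def split: if_splits)

lemma nat_bits_dec: "n \<noteq> 0 \<Longrightarrow> nat_bits (n - 1) = strip (dec_bits (nat_bits n))"
proof -
  assume "n \<noteq> 0"
  then have "of_bits (strip (dec_bits (nat_bits n))) = n - 1"
    using of_bits_dec[of "nat_bits n"] by (simp add: of_bits_strip)
  with nat_bits_of_bits[OF canonical_dec[OF canonical_nat_bits[of n]]] show ?thesis by simp
qed

text \<open>The first component is \<open>Leaf\<close> as long as the borrow is pending, and the
  second one collects the new bits in reverse. In \<open>tdec\<close> the most significant bit is
  therefore at the front, where a zero can be removed before the final reversal.\<close>

definition dec_step :: "tree \<Rightarrow> tree \<Rightarrow> tree" where
  "dec_step a v = (if car v \<noteq> Leaf then Node (car v) (Node a (cdr v))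
     else if a = Leaf then Node Leaf (Node (Node Leaf Leaf) (cdr v)) else Node (Node Leaf Leaf) (Node Leaf (cdr v)))"

lemma dec_step_simps:
  "dec_step a (Node (Node b c) v) = Node (Node b c) (Node a v)"
  "dec_step Leaf (Node Leaf v) = Node Leaf (Node (Node Leaf Leaf) v)"
  "dec_step (Node b c) (Node Leaf v) = Node (Node Leaf Leaf) (Node Leaf v)"
  by (simp_all add: dec_step_def)

definition tdec :: "tree \<Rightarrow> tree" where
  "tdec x = (let v = cdr (foldl (\<lambda>v a. dec_step a v) (Node Leaf Leaf) (els x)) in
     rapp (if car v = Leaf then cdr v else v) Leaf)"

lemma tdec_enum: "n \<noteq> 0 \<Longrightarrow> tdec (enum_bits n) = enum_bits (n - 1)"
proof -
  assume n: "n \<noteq> 0"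
  have 1: "foldl (\<lambda>v a. dec_step a v) (Node (Node Leaf Leaf) (tlist xs)) as = Node (Node Leaf Leaf) (tlist (rev as @ xs))" for xs as
  proof (induction as arbitrary: xs)
    case (Cons a as)
    from Cons[of "a # xs"] show ?case by (simp add: dec_step_simps)
  qed simp
  have 2: "cdr (foldl (\<lambda>v a. dec_step a v) (Node Leaf (tlist xs)) (map tb bs)) = tlist (rev (map tb (dec_bits bs)) @ xs)" for xs bs
  proof (induction bs arbitrary: xs rule: dec_bits.induct)
    case (2 bs)
    then show ?case using 1[of "Leaf # xs" "map tb bs"] by (simp add: dec_step_simps)
  next
    case (3 bs)
    from 3[of "tb True # xs"] show ?case by (simp add: dec_step_simps)
  qed simp
  obtain b bs where b: "dec_bits (nat_bits n) = bs @ [b]"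
    using n by (metis dec_bits_Nil of_bits_nat_bits nat_bits_eq nat_bits.simps rev_exhaust)
  have "strip (bs @ [b]) = (if b then bs @ [b] else bs)" by (simp add: strip_def)
  with 2[of "[]" "nat_bits n"] b nat_bits_dec[OF n] show ?thesis
    by (auto simp: tdec_def enum_bits_def blist_def Let_def rev_map intro!: tree_eqI)
qed

lemma FP_tdec [FP_intros]: "FP f \<Longrightarrow> FP (\<lambda>t. tdec (f t))"
proof -
  assume f: "FP f"
  have "FP (\<lambda>t. foldl (\<lambda>v a. dec_step a v) (Node Leaf Leaf) (els (f t)))"
  proof (rule FP_foldl[where h = "\<lambda>a v c. dec_step a v" and q = "[:6, 1:]" and c = "\<lambda>_. Leaf"])
    show "FP (\<lambda>t. dec_step (car t) (car (cdr t)))" unfolding dec_step_def by (intro FP_intros)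
    show "tsize (dec_step a v) \<le> tsize v + poly [:6, 1:] (tsize a + tsize c)" for a v c
      by (cases v) (simp_all add: dec_step_def)
  qed (intro FP_intros f)+
  then show ?thesis unfolding tdec_def Let_def by (intro FP_intros)
qed

definition tdecr :: "tree \<Rightarrow> tree" where "tdecr x = (if x = Leaf then Leaf else Node Leaf (tdec (cdr x)))"

lemma enum_bits_0 [simp]: "enum_bits 0 = Leaf" "enum_bits n = Leaf \<longleftrightarrow> n = 0"
proof -
  show "enum_bits 0 = Leaf" by (simp add: enum_bits_def nat_bits.simps)
  then show "enum_bits n = Leaf \<longleftrightarrow> n = 0" using enum_bits_eq[of n 0] by simp
qed

lemma tdecr_eenat: "\<Delta> \<noteq> 0 \<Longrightarrow> tdecr (eenat \<Delta>) = eenat (\<Delta> - 1)"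
proof (cases \<Delta>)
  case (enat n)
  assume "\<Delta> \<noteq> 0"
  with enat show ?thesis by (simp add: tdecr_def tdec_enum one_enat_def zero_enat_def)
qed (simp add: tdecr_def)

lemma eenat_0 [simp]: "eenat \<Delta> = Node Leaf Leaf \<longleftrightarrow> \<Delta> = 0"
  by (cases \<Delta>) (simp_all add: zero_enat_def)

lemma FP_tdecr [FP_intros]: "FP f \<Longrightarrow> FP (\<lambda>t. tdecr (f t))"
  unfolding tdecr_def by (intro FP_intros)

subsection \<open>Reading\<close>

fun edir :: "direction \<Rightarrow> tree" where
  "edir Forward = Leaf" | "edir Backward = Node Leaf Leaf"

definition estring :: "'a::finite list \<Rightarrow> tree" where "estring s = tlist (map echar s)"

primrec epos :: "nat option \<Rightarrow> tree" where
  "epos None = Leaf" | "epos (Some p) = Node Leaf (un p)"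

lemma echar_eq [simp]: "echar c = echar c' \<longleftrightarrow> c = c'"
  by (simp add: echar_def)

lemma tdrop_un [simp]: "tdrop (un a) (un b) = un (b - a)"
  by (rule tree_eqI) simp

lemma tdrop_estring [simp]: "tdrop (un p) (estring s) = estring (drop p s)"
  by (rule tree_eqI) (simp add: estring_def drop_map)

lemma estring_Leaf [simp]: "estring s = Leaf \<longleftrightarrow> s = []"
  by (cases s) (simp_all add: estring_def)

lemma car_estring: "s \<noteq> [] \<Longrightarrow> car (estring s) = echar (hd s)"
  by (cases s) (simp_all add: estring_def)

lemma cdr_un [simp]: "cdr (un p) = un (p - 1)"
  by (cases p) simp_all

definition tfurther :: "tree \<Rightarrow> tree \<Rightarrow> tree \<Rightarrow> bool" where
  "tfurther d p k \<longleftrightarrow> (if d = Leaf then tdrop k p \<noteq> Leaf else tdrop p k \<noteq> Leaf)"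

lemma tfurther_correct [simp]: "tfurther (edir d) (un p) (un k) \<longleftrightarrow> further d p k"
  by (cases d) (auto simp: tfurther_def)

lemma FPb_tfurther [FP_intros]: "FP f \<Longrightarrow> FP g \<Longrightarrow> FP h \<Longrightarrow> FPb (\<lambda>t. tfurther (f t) (g t) (h t))"
  unfolding tfurther_def by (intro FP_intros)

definition tat :: "tree set \<Rightarrow> tree \<Rightarrow> tree \<Rightarrow> tree \<Rightarrow> bool" where
  "tat C c p S \<longleftrightarrow> tdrop p S \<noteq> Leaf \<and> Node c (car (tdrop p S)) \<in> C"

lemma FPb_tat [FP_intros]: "finite C \<Longrightarrow> FP f \<Longrightarrow> FP g \<Longrightarrow> FP h \<Longrightarrow> FPb (\<lambda>t. tat C (f t) (g t) (h t))"
  unfolding tat_def by (intro FP_intros)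

text \<open>Membership of a character in a descriptor is looked up in a finite table of pairs of
  codes.\<close>

definition char_table :: "'a::finite itself \<Rightarrow> tree set" where
  "char_table TYPE('a) = (\<lambda>(cd, c). Node (etok (TChars cd)) (echar c)) ` {(cd, c :: 'a). c \<in> cd}"

definition word_table :: "'a::finite set \<Rightarrow> tree set" where
  "word_table W = (\<lambda>c. Node Leaf (echar c)) ` W"

lemma tat_chars: "tat (char_table TYPE('a)) (etok (TChars cd)) (un p) (estring s) \<longleftrightarrow> p < length s \<and> s ! p \<in> cd"
  for s :: "'a::finite list"
  by (auto simp: tat_def char_table_def car_estring hd_drop_conv_nth)

lemma tat_word: "tat (word_table W) Leaf (un p) (estring s) \<longleftrightarrow> p < length s \<and> s ! p \<in> W"
  by (auto simp: tat_def word_table_def car_estring hd_drop_conv_nth)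

definition tread_char :: "'a::finite itself \<Rightarrow> tree \<Rightarrow> tree \<Rightarrow> tree \<Rightarrow> tree \<Rightarrow> tree" where
  "tread_char TYPE('a) S c p d =
     (if d = Leaf then if tat (char_table TYPE('a)) c p S then Node Leaf (Node Leaf p) else Leaf
      else if p \<noteq> Leaf \<and> tat (char_table TYPE('a)) c (cdr p) S then Node Leaf (cdr p) else Leaf)"

lemma tread_char_correct:
  "p \<le> length s \<Longrightarrow> tread_char TYPE('a) (estring s) (etok (TChars cd)) (un p) (edir d) = epos (read_char s cd p d)"
  for s :: "'a::finite list"
  by (cases d) (auto simp: tread_char_def tat_chars)

lemma FP_tread_char [FP_intros]:
  "FP f \<Longrightarrow> FP g \<Longrightarrow> FP h \<Longrightarrow> FP k \<Longrightarrow> FP (\<lambda>t. tread_char TYPE('a::finite) (f t) (g t) (h t) (k t))"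
  unfolding tread_char_def by (intro FP_intros) (simp_all add: char_table_def)

definition tfactor :: "tree \<Rightarrow> tree \<Rightarrow> tree \<Rightarrow> tree" where
  "tfactor S a b = ttake (tdrop a b) (tdrop a S)"

lemma tfactor_correct: "tfactor (estring s) (un a) (un b) = estring (factor s a b)"
  by (rule tree_eqI) (simp add: tfactor_def factor_def, simp add: estring_def take_map)

lemma FP_tfactor [FP_intros]: "FP f \<Longrightarrow> FP g \<Longrightarrow> FP h \<Longrightarrow> FP (\<lambda>t. tfactor (f t) (g t) (h t))"
  unfolding tfactor_def by (intro FP_intros)

text \<open>The factor \<open>w\<close> itself serves as the unary representation of its length.\<close>

definition tread_factor :: "'a::finite itself \<Rightarrow> tree \<Rightarrow> tree \<Rightarrow> tree \<Rightarrow> tree \<Rightarrow> tree" where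
  "tread_factor TYPE('a) S w p d =
     (if d = Leaf then
        if same (range (echar :: 'a \<Rightarrow> tree)) (ttake w (tdrop p S)) w
        then Node Leaf (app (tmap (\<lambda>_. Leaf) w) p) else Leaf
      else if tdrop p w = Leaf \<and> same (range (echar :: 'a \<Rightarrow> tree)) (ttake w (tdrop (tdrop w p) S)) w
        then Node Leaf (tdrop w p) else Leaf)"

lemma ttake_estring: "ttake (estring w) (estring s) = estring (take (length w) s)"
  by (rule tree_eqI) (simp add: estring_def take_map)

lemma same_estring: "same (range (echar :: 'a::finite \<Rightarrow> tree)) (estring w) (estring s) \<longleftrightarrow> w = (s :: 'a list)"
  by (auto simp: estring_def same_iff inj_map_eq_map inj_def)

lemma tread_factor_correct:
  "tread_factor TYPE('a) (estring s) (estring w) (un p) (edir d) = epos (read_factor s w p d)"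
  for s :: "'a::finite list"
proof -
  have 1: "app (tmap (\<lambda>_. Leaf) (estring w)) (un p) = un (p + length w)"
    by (rule tree_eqI) (simp add: estring_def map_replicate_const o_def add.commute flip: replicate_add)
  have 2: "tdrop (estring w) (un p) = un (p - length w)" by (rule tree_eqI) (simp add: estring_def)
  have 3: "tdrop (un p) (estring w) = Leaf \<longleftrightarrow> length w \<le> p" by simp
  show ?thesis
    by (cases d) (auto simp: tread_factor_def 1 2 3 ttake_estring same_estring factor_def)
qed

lemma FP_tread_factor [FP_intros]:
  "FP f \<Longrightarrow> FP g \<Longrightarrow> FP h \<Longrightarrow> FP k \<Longrightarrow> FP (\<lambda>t. tread_factor TYPE('a::finite) (f t) (g t) (h t) (k t))"
  unfolding tread_factor_def
  by (intro FP_intros FP_tmap[where h = "\<lambda>_ _. Leaf" and c = "\<lambda>_. Leaf"]) simp_all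

definition tanchor :: "'a::finite set \<Rightarrow> tree \<Rightarrow> tree \<Rightarrow> tree \<Rightarrow> bool" where
  "tanchor W S a p = (let b = ((p \<noteq> Leaf \<and> tat (word_table W) Leaf (cdr p) S) = (\<not> tat (word_table W) Leaf p S)) in
     if a = etok (TAnchor Input_Start :: 'a token) then p = Leaf
     else if a = etok (TAnchor Input_End :: 'a token) then tdrop p S = Leaf
     else if a = etok (TAnchor Word_Boundary :: 'a token) then b else \<not> b)"

lemma tanchor_correct:
  fixes s :: "'a::finite list"
  assumes "p \<le> length s"
  shows "tanchor W (estring s) (etok (TAnchor a :: 'a token)) (un p) \<longleftrightarrow> anchor_holds W s a p"
proof -
  have "(p \<noteq> 0 \<and> p - 1 < length s \<and> s ! (p - 1) \<in> W) \<longleftrightarrow> (0 < p \<and> s ! (p - 1) \<in> W)" using assms by auto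
  with assms show ?thesis by (cases a) (auto simp: tanchor_def Let_def tat_word word_boundary_def)
qed

lemma FPb_tanchor [FP_intros]:
  "FP f \<Longrightarrow> FP g \<Longrightarrow> FP h \<Longrightarrow> FPb (\<lambda>t. tanchor W (f t) (g t) (h t))"
  unfolding tanchor_def Let_def by (intro FP_intros) (simp_all add: word_table_def)

subsection \<open>Configurations\<close>

fun eact :: "'a::finite action \<Rightarrow> tree" where
  "eact (Areg r) = Node Leaf (eregex r)"
| "eact (Aclose g) = Node (un 1) (enum_bits g)"
| "eact (Acheck k) = Node (un 2) (un k)"

definition eacts :: "'a::finite action list \<Rightarrow> tree" where "eacts l = tlist (map eact l)"

lemma eacts_simps [simp]: "eacts [] = Leaf" "eacts (a # l) = Node (eact a) (eacts l)" "eacts l = Leaf \<longleftrightarrow> l = []"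
  by (simp_all add: eacts_def) (cases l; simp)

lemma un_numeral [simp]: "un (numeral k) = Node Leaf (un (pred_numeral k))"
  by (simp add: numeral_eq_Suc)

definition goal :: "tree \<Rightarrow> tree \<Rightarrow> tree \<Rightarrow> tree \<Rightarrow> tree" where
  "goal l p \<gamma> d = Node l (Node p (Node \<gamma> d))"

definition mk_run :: "tree \<Rightarrow> tree \<Rightarrow> tree \<Rightarrow> tree \<Rightarrow> tree \<Rightarrow> tree \<Rightarrow> tree" where
  "mk_run S fs l p \<gamma> d = Node (un 1) (Node S (Node fs (goal l p \<gamma> d)))"

definition mk_succeed :: "tree \<Rightarrow> tree \<Rightarrow> tree \<Rightarrow> tree" where
  "mk_succeed S fs \<gamma> = Node (un 2) (Node S (Node fs \<gamma>))"

definition mk_fail :: "tree \<Rightarrow> tree \<Rightarrow> tree" where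
  "mk_fail S fs = Node (un 3) (Node S (Node fs Leaf))"

lemma FP_mk [FP_intros]:
  "FP f1 \<Longrightarrow> FP f2 \<Longrightarrow> FP f3 \<Longrightarrow> FP f4 \<Longrightarrow> FP (\<lambda>t. goal (f1 t) (f2 t) (f3 t) (f4 t))"
  "FP f1 \<Longrightarrow> FP f2 \<Longrightarrow> FP f3 \<Longrightarrow> FP f4 \<Longrightarrow> FP f5 \<Longrightarrow> FP f6 \<Longrightarrow> FP (\<lambda>t. mk_run (f1 t) (f2 t) (f3 t) (f4 t) (f5 t) (f6 t))"
  "FP f1 \<Longrightarrow> FP f2 \<Longrightarrow> FP f3 \<Longrightarrow> FP (\<lambda>t. mk_succeed (f1 t) (f2 t) (f3 t))"
  "FP f1 \<Longrightarrow> FP f2 \<Longrightarrow> FP (\<lambda>t. mk_fail (f1 t) (f2 t))"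
  unfolding goal_def mk_run_def mk_succeed_def mk_fail_def by (intro FP_intros; assumption)+

context
  fixes G :: "nat list"
begin

fun eframe :: "'a::finite frame \<Rightarrow> tree" where
  "eframe (Choice l p \<gamma> d) = Node Leaf (goal (eacts l) (un p) (emap G \<gamma>) (edir d))"
| "eframe (Resume Positive l p \<gamma> d) = Node (un 1) (goal (eacts l) (un p) (emap G \<gamma>) (edir d))"
| "eframe (Resume Negative l p \<gamma> d) = Node (un 2) (goal (eacts l) (un p) (emap G \<gamma>) (edir d))"

definition eframes :: "'a::finite frame list \<Rightarrow> tree" where "eframes fs = tlist (map eframe fs)"

fun emconf :: "'a::finite list \<Rightarrow> 'a mconf \<Rightarrow> tree" where
  "emconf s (Run l p \<gamma> d fs) = mk_run (estring s) (eframes fs) (eacts l) (un p) (emap G \<gamma>) (edir d)"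
| "emconf s (Succeed \<gamma> fs) = mk_succeed (estring s) (eframes fs) (emap G \<gamma>)"
| "emconf s (Fail fs) = mk_fail (estring s) (eframes fs)"

end

lemma eframes_simps [simp]: "eframes G [] = Leaf" "eframes G (f # fs) = Node (eframe G f) (eframes G fs)"
  by (simp_all add: eframes_def)

definition tclose :: "tree \<Rightarrow> tree \<Rightarrow> tree \<Rightarrow> tree" where
  "tclose g p \<gamma> = (let x = tlookup g \<gamma>; a = cdr x in
     if x \<noteq> Leaf \<and> car x = Leaf then
       tupdate g (if tdrop a p = Leaf then Node (Node Leaf Leaf) (Node p a) else Node (Node Leaf Leaf) (Node a p)) \<gamma>
     else \<gamma>)"

lemma tclose_correct:
  assumes "\<And>g. g \<notin> set G \<Longrightarrow> \<gamma> g = Undefined"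
  shows "tclose (enum_bits g) (un p) (emap G \<gamma>) =
    emap G (case \<gamma> g of Opened a \<Rightarrow> \<gamma>(g := Closed (min a p) (max a p)) | _ \<Rightarrow> \<gamma>)"
proof -
  have L: "tlookup (enum_bits g) (emap G \<gamma>) = egstate (\<gamma> g)" by (rule tlookup_emap) (rule assms)
  show ?thesis
  proof (cases "\<gamma> g")
    case (Opened a)
    have "tupdate (enum_bits g) (Node (Node Leaf Leaf) (Node (un (min a p)) (un (max a p)))) (emap G \<gamma>)
        = emap G (\<gamma>(g := Closed (min a p) (max a p)))"
      using tupdate_emap[of g "Closed (min a p) (max a p)" G \<gamma>] by simp
    with Opened L show ?thesis by (cases "p \<le> a") (simp_all add: tclose_def Let_def)
  qed (use L in \<open>simp_all add: tclose_def Let_def\<close>)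
qed

lemma FP_tclose [FP_intros]: "FP f \<Longrightarrow> FP g \<Longrightarrow> FP h \<Longrightarrow> FP (\<lambda>t. tclose (f t) (g t) (h t))"
  unfolding tclose_def Let_def by (intro FP_intros)

definition reg :: "tree \<Rightarrow> tree" where "reg r = Node Leaf r"

lemma FP_reg [FP_intros]: "FP f \<Longrightarrow> FP (\<lambda>t. reg (f t))"
  unfolding reg_def by (intro FP_intros)

definition tquant :: "'a::finite itself \<Rightarrow> tree \<Rightarrow> tree \<Rightarrow> tree \<Rightarrow> tree \<Rightarrow> tree \<Rightarrow> tree \<Rightarrow> tree \<Rightarrow> tree" where
  "tquant TYPE('a) S fs b l p \<gamma> d = (let k = car b; \<Delta> = car (cdr b); gs = car (cdr (cdr b)); r = cdr (cdr (cdr b));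
     body = Node (reg r) (Node (Node (un 2) p) (Node (reg (Node (un 6) (Node k (Node (tdecr \<Delta>) (Node gs r))))) l));
     \<gamma>' = treset gs \<gamma> in
     if \<Delta> = Node Leaf Leaf then mk_run S fs l p \<gamma> d
     else if k = etok (TQuant Greedy :: 'a token) then mk_run S (Node (Node Leaf (goal l p \<gamma> d)) fs) body p \<gamma>' d
     else mk_run S (Node (Node Leaf (goal body p \<gamma>' d)) fs) l p \<gamma> d)"

lemma FP_tquant [FP_intros]:
  "FP f1 \<Longrightarrow> FP f2 \<Longrightarrow> FP f3 \<Longrightarrow> FP f4 \<Longrightarrow> FP f5 \<Longrightarrow> FP f6 \<Longrightarrow> FP f7 \<Longrightarrow>
    FP (\<lambda>t. tquant TYPE('a::finite) (f1 t) (f2 t) (f3 t) (f4 t) (f5 t) (f6 t) (f7 t))"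
  unfolding tquant_def Let_def by (intro FP_intros)

definition treg :: "'a::finite set \<Rightarrow> tree \<Rightarrow> tree \<Rightarrow> tree \<Rightarrow> tree \<Rightarrow> tree \<Rightarrow> tree \<Rightarrow> tree \<Rightarrow> tree \<Rightarrow> tree" where
  "treg W S fs tag b l p \<gamma> d =
    (if tag = un 0 then mk_run S fs l p \<gamma> d
     else if tag = un 1 then
       (let q = tread_char TYPE('a) S b p d in if q = Leaf then mk_fail S fs else mk_run S fs l (cdr q) \<gamma> d)
     else if tag = un 2 then
       mk_run S (Node (Node Leaf (goal (Node (reg (cdr b)) l) p \<gamma> d)) fs) (Node (reg (car b)) l) p \<gamma> d
     else if tag = un 3 then
       mk_run S fs (if d = Leaf then Node (reg (car b)) (Node (reg (cdr b)) l) else Node (reg (cdr b)) (Node (reg (car b)) l)) p \<gamma> d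
     else if tag = un 4 then
       mk_run S fs (Node (reg (cdr b)) (Node (Node (un 1) (car b)) l)) p (tupdate (car b) (Node Leaf p) \<gamma>) d
     else if tag = un 5 then
       (let x = tlookup b \<gamma>; q = tread_factor TYPE('a) S (tfactor S (car (cdr x)) (cdr (cdr x))) p d in
        if car x = Leaf then mk_run S fs l p \<gamma> d
        else if q = Leaf then mk_fail S fs else mk_run S fs l (cdr q) \<gamma> d)
     else if tag = un 6 then tquant TYPE('a) S fs b l p \<gamma> d
     else if tag = un 7 then
       mk_run S (Node (Node (if car b \<in> etok ` {TLook d Positive :: 'a token | d. True} then un 1 else un 2) (goal l p \<gamma> d)) fs)
         (Node (reg (cdr b)) Leaf) p \<gamma> (if car b \<in> etok ` {TLook Forward b :: 'a token | b. True} then Leaf else Node Leaf Leaf)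
     else if tanchor W S b p then mk_run S fs l p \<gamma> d else mk_fail S fs)"

lemma FP_treg [FP_intros]:
  "FP f1 \<Longrightarrow> FP f2 \<Longrightarrow> FP f3 \<Longrightarrow> FP f4 \<Longrightarrow> FP f5 \<Longrightarrow> FP f6 \<Longrightarrow> FP f7 \<Longrightarrow> FP f8 \<Longrightarrow>
    FP (\<lambda>t. treg (W :: 'a::finite set) (f1 t) (f2 t) (f3 t) (f4 t) (f5 t) (f6 t) (f7 t) (f8 t))"
  unfolding treg_def Let_def by (intro FP_intros) simp_all

definition trun :: "'a::finite set \<Rightarrow> tree \<Rightarrow> tree \<Rightarrow> tree \<Rightarrow> tree \<Rightarrow> tree \<Rightarrow> tree \<Rightarrow> tree" where
  "trun W S fs l p \<gamma> d = (let a = car l; l' = cdr l; b = cdr a in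
     if l = Leaf then mk_succeed S fs \<gamma>
     else if car a = un 2 then if tfurther d p b then mk_run S fs l' p \<gamma> d else mk_fail S fs
     else if car a = un 1 then mk_run S fs l' p (tclose b p \<gamma>) d
     else treg W S fs (car b) (cdr b) l' p \<gamma> d)"

lemma FP_trun [FP_intros]:
  "FP f1 \<Longrightarrow> FP f2 \<Longrightarrow> FP f3 \<Longrightarrow> FP f4 \<Longrightarrow> FP f5 \<Longrightarrow> FP f6 \<Longrightarrow>
    FP (\<lambda>t. trun W (f1 t) (f2 t) (f3 t) (f4 t) (f5 t) (f6 t))"
  unfolding trun_def Let_def by (intro FP_intros)

text \<open>The three kinds of configurations have the tags \<open>1\<close> to \<open>3\<close>,
  none of which is \<open>Leaf\<close>. A success or failure with an empty stack takes one more step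
  to a pair with first component \<open>Leaf\<close>, which ends the loop and carries the
  answer.\<close>

definition tstep :: "'a::finite set \<Rightarrow> tree \<Rightarrow> tree" where
  "tstep W t = (let S = car (cdr t); fs = car (cdr (cdr t)); x = cdr (cdr (cdr t));
     k = car (car fs); g = cdr (car fs); fs' = cdr fs;
     l = car g; p = car (cdr g); \<gamma> = car (cdr (cdr g)); d = cdr (cdr (cdr g)) in
     if car t = un 1 then trun W S fs (car x) (car (cdr x)) (car (cdr (cdr x))) (cdr (cdr (cdr x)))
     else if car t = un 2 then
       if fs = Leaf then Node Leaf (Node Leaf Leaf)
       else if k = Leaf then mk_succeed S fs' x
       else if k = un 1 then mk_run S fs' l p x d
       else mk_fail S fs'
     else if fs = Leaf then Node Leaf Leaf
     else if k = un 1 then mk_fail S fs'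
     else mk_run S fs' l p \<gamma> d)"

lemma FP_tstep: "FP (tstep W)"
  unfolding tstep_def Let_def by (intro FP_intros)

lemma treg_correct:
  fixes s :: "'a::finite list" and r :: "'a regex"
  assumes p: "p \<le> length s" and u: "\<And>g. g \<notin> set G \<Longrightarrow> \<gamma> g = Undefined"
  shows "treg W (estring s) (eframes G fs) (car (eregex r)) (cdr (eregex r)) (eacts l) (un p) (emap G \<gamma>) (edir d) =
    emconf G s (mstep W s (Run (Areg r # l) p \<gamma> d fs))"
proof (cases r)
  case Eps
  then show ?thesis by (simp add: treg_def)
next
  case (Chars cd)
  then show ?thesis using tread_char_correct[OF p, of cd d]
    by (cases "read_char s cd p d") (simp_all add: treg_def Let_def)
next
  case (Alt r1 r2)
  then show ?thesis by (simp add: treg_def reg_def)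
next
  case (Seq r1 r2)
  then show ?thesis by (cases d) (simp_all add: treg_def reg_def)
next
  case (Group g r')
  then show ?thesis using tupdate_emap[of g "Opened p" G \<gamma>] by (simp add: treg_def reg_def)
next
  case (Backref g)
  have L: "tlookup (enum_bits g) (emap G \<gamma>) = egstate (\<gamma> g)" by (rule tlookup_emap) (rule u)
  show ?thesis
  proof (cases "\<gamma> g")
    case (Closed a b)
    with Backref L show ?thesis
      by (cases "read_factor s (factor s a b) p d") (simp_all add: treg_def Let_def tfactor_correct tread_factor_correct)
  qed (use Backref L in \<open>simp_all add: treg_def Let_def\<close>)
next
  case (Quant r' m \<Delta> \<kappa>)
  then show ?thesis
    by (cases \<kappa>) (simp_all add: treg_def tquant_def Let_def reg_def treset_emap tdecr_eenat)
next
  case (Look d' b r')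
  then show ?thesis by (cases d'; cases b) (auto simp: treg_def reg_def)
next
  case (Anchor a)
  then show ?thesis by (simp add: treg_def tanchor_correct[OF p])
qed

definition final :: "'a mconf \<Rightarrow> bool" where
  "final X \<longleftrightarrow> (\<exists>\<gamma>. X = Succeed \<gamma> []) \<or> X = Fail []"

fun running_ok :: "nat list \<Rightarrow> 'a list \<Rightarrow> 'a mconf \<Rightarrow> bool" where
  "running_ok G s (Run l p \<gamma> d fs) \<longleftrightarrow> p \<le> length s \<and> (\<forall>g. g \<notin> set G \<longrightarrow> \<gamma> g = Undefined)"
| "running_ok G s _ \<longleftrightarrow> True"

lemma tstep_correct:
  fixes s :: "'a::finite list"
  assumes "running_ok G s X" "\<not> final X"
  shows "tstep W (emconf G s X) = emconf G s (mstep W s X)"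
proof (cases X)
  case (Run l p \<gamma> d fs)
  with assms have p: "p \<le> length s" and u: "\<And>g. g \<notin> set G \<Longrightarrow> \<gamma> g = Undefined" by auto
  show ?thesis
  proof (cases l)
    case Nil
    with Run show ?thesis by (simp add: tstep_def trun_def Let_def mk_run_def goal_def)
  next
    case (Cons a l')
    show ?thesis
    proof (cases a)
      case (Areg r)
      then show ?thesis using treg_correct[where W = W and G = G and fs = fs and r = r and l = l' and d = d, OF p u]
        by (simp add: Run Cons tstep_def trun_def Let_def mk_run_def goal_def)
    next
      case (Aclose g)
      then show ?thesis using tclose_correct[where G = G and g = g and p = p, OF u]
        by (cases "\<gamma> g") (simp_all add: Run Cons tstep_def trun_def Let_def mk_run_def goal_def)
    next
      case (Acheck k)
      then show ?thesis
        by (simp add: Run Cons tstep_def trun_def Let_def mk_run_def goal_def)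
    qed
  qed
next
  case (Succeed \<gamma> fs)
  with assms(2) obtain f fs' where fs: "fs = f # fs'" by (cases fs) (auto simp: final_def)
  show ?thesis
  proof (cases f)
    case (Choice l p \<gamma>' d)
    with Succeed fs show ?thesis by (simp add: tstep_def Let_def mk_succeed_def)
  next
    case (Resume b l p \<gamma>' d)
    with Succeed fs show ?thesis
      by (cases b) (simp_all add: tstep_def Let_def mk_succeed_def goal_def)
  qed
next
  case (Fail fs)
  with assms(2) obtain f fs' where fs: "fs = f # fs'" by (cases fs) (auto simp: final_def)
  show ?thesis
  proof (cases f)
    case (Choice l p \<gamma>' d)
    with Fail fs show ?thesis by (simp add: tstep_def Let_def mk_fail_def goal_def)
  next
    case (Resume b l p \<gamma>' d)
    with Fail fs show ?thesis
      by (cases b) (simp_all add: tstep_def Let_def mk_fail_def goal_def)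
  qed
qed

lemma tstep_final:
  "tstep W (emconf G s (Succeed \<gamma> [])) = Node Leaf (Node Leaf Leaf)"
  "tstep W (emconf G s (Fail [])) = Node Leaf Leaf"
  by (simp_all add: tstep_def Let_def mk_succeed_def mk_fail_def)

subsection \<open>The size of configurations\<close>

lemma tsize_emap:
  assumes "ranges_within n \<gamma>"
  shows "tsize (emap G \<gamma>) \<le> tsize (tlist (map enum_bits G)) * (4 * n + 11)"
proof (induction G)
  case (Cons g G)
  have "tsize (egstate (\<gamma> g)) \<le> 4 * n + 8"
    using assms by (cases "\<gamma> g") (force simp: ranges_within_def)+
  with Cons show ?case by (simp add: emap_def algebra_simps)
qed (simp add: emap_def)

lemma tsize_enum_bits_le: "g \<in> set G \<Longrightarrow> tsize (enum_bits g) \<le> tsize (tlist (map enum_bits G))"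
  by (induction G) auto

lemma tsize_tlist_le: "(\<And>x. x \<in> set xs \<Longrightarrow> tsize x \<le> b) \<Longrightarrow> tsize (tlist xs) \<le> 1 + length xs * (b + 1)"
  by (induction xs) fastforce+

definition goal_bound :: "nat \<Rightarrow> nat" where "goal_bound B = 6 * B ^ 2 + 21 * B + 8"

definition conf_bound :: "nat \<Rightarrow> nat" where
  "conf_bound B = 30 + B * (B + 1) + (B + 1) * (goal_bound B + 7)"

context
  fixes s :: "'a::finite list" and G :: "nat list" and P D Z R B :: nat
  assumes B: "length s \<le> B" "tsize (tlist (map enum_bits G)) \<le> B" "P \<le> B" "Z \<le> B" "R \<le> B"
    "\<And>t :: 'a token. tsize (etok t) \<le> B"
begin

lemma tsize_goal:
  assumes "goal_ok s G P D Z l p \<gamma>"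
  shows "tsize (goal (eacts l) (un p) (emap G \<gamma>) (edir d)) \<le> goal_bound B"
proof -
  have "tsize (eact a) \<le> 2 * B + 7" if "a \<in> set l" for a
  proof (cases a)
    case (Areg r)
    with assms that have "msize r \<le> Z" by (auto simp: goal_ok_def)
    with tsize_eregex[of r] B(4) Areg show ?thesis by simp
  next
    case (Aclose g)
    with assms that have "g \<in> set G" by (auto simp: goal_ok_def)
    from tsize_enum_bits_le[OF this] B(2) Aclose show ?thesis by simp
  next
    case (Acheck k)
    with assms that have "k \<le> length s" by (auto simp: goal_ok_def)
    with B(1) Acheck show ?thesis by simp
  qed
  then have e: "tsize (eacts l) \<le> 1 + length l * (2 * B + 8)"
    using tsize_tlist_le[of "map eact l" "2 * B + 7"] by (auto simp: eacts_def add.commute)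
  have "length l \<le> B"
    using length_le_mass[of l] mass_le_list_peak[of l] assms B(3) by (simp add: goal_ok_def)
  then have "1 + length l * (2 * B + 8) \<le> 1 + B * (2 * B + 8)" by (intro add_left_mono mult_le_mono1)
  with e have "tsize (eacts l) \<le> 1 + B * (2 * B + 8)" by (rule order.trans)
  moreover have "p \<le> B" using assms B(1) by (simp add: goal_ok_def)
  moreover have "tsize (emap G \<gamma>) \<le> B * (4 * B + 11)"
  proof -
    have "tsize (emap G \<gamma>) \<le> tsize (tlist (map enum_bits G)) * (4 * length s + 11)"
      by (rule tsize_emap) (use assms in \<open>simp add: goal_ok_def map_ok_def\<close>)
    also have "\<dots> \<le> B * (4 * B + 11)" using B(1,2) by (intro mult_le_mono) simp_all
    finally show ?thesis .
  qed
  moreover have "tsize (edir d) \<le> 3" by (cases d) simp_all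
  ultimately have "tsize (goal (eacts l) (un p) (emap G \<gamma>) (edir d)) \<le>
      3 + (1 + B * (2 * B + 8)) + (2 * B + 1) + B * (4 * B + 11) + 3" by (simp add: goal_def)
  also have "\<dots> = goal_bound B" by (simp add: goal_bound_def algebra_simps power2_eq_square)
  finally show ?thesis .
qed

lemma tsize_frame: "frame_ok s G P D Z R f k \<Longrightarrow> tsize (eframe G f) \<le> goal_bound B + 6"
proof (cases f)
  case (Choice l p \<gamma> d)
  moreover assume "frame_ok s G P D Z R f k"
  ultimately show ?thesis using tsize_goal[of l p \<gamma> d] by simp
next
  case (Resume b l p \<gamma> d)
  moreover assume "frame_ok s G P D Z R f k"
  ultimately show ?thesis using tsize_goal[of l p \<gamma> d] by (cases b) simp_all
qed

lemma tsize_frames: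
  assumes "stack_ok s G P D Z R fs"
  shows "tsize (eframes G fs) \<le> 1 + B * (goal_bound B + 7)"
proof -
  have "\<exists>k. frame_ok s G P D Z R f k" if "f \<in> set fs" for f
    using assms that by (induction fs) auto
  then have "tsize (eframe G f) \<le> goal_bound B + 6" if "f \<in> set fs" for f
    using tsize_frame that by blast
  then have e: "tsize (eframes G fs) \<le> 1 + length fs * (goal_bound B + 7)"
    using tsize_tlist_le[of "map (eframe G) fs" "goal_bound B + 6"] by (auto simp: eframes_def add.commute)
  have "length fs \<le> B" using stack_length[OF assms] B(5) by simp
  then have "1 + length fs * (goal_bound B + 7) \<le> 1 + B * (goal_bound B + 7)"
    by (intro add_left_mono mult_le_mono1)
  with e show ?thesis by (rule order.trans)
qed

lemma tsize_emconf:
  assumes "conf_ok s G P D Z R X"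
  shows "tsize (emconf G s X) \<le> conf_bound B"
proof -
  have S: "tsize (estring s) \<le> 1 + B * (B + 1)"
  proof -
    have "tsize (estring s) \<le> 1 + length s * (B + 1)"
      using tsize_tlist_le[of "map echar s" B] B(6) by (auto simp: estring_def echar_def)
    moreover have "length s * (B + 1) \<le> B * (B + 1)" using B(1) by (rule mult_le_mono1)
    ultimately show ?thesis by simp
  qed
  have g: "B * (4 * B + 11) \<le> goal_bound B" by (simp add: goal_bound_def power2_eq_square algebra_simps)
  have m: "tsize (emap G \<gamma>) \<le> goal_bound B" if "map_ok s G \<gamma>" for \<gamma>
  proof -
    have "tsize (emap G \<gamma>) \<le> tsize (tlist (map enum_bits G)) * (4 * length s + 11)"
      by (rule tsize_emap) (use that in \<open>simp add: map_ok_def\<close>)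
    also have "\<dots> \<le> B * (4 * B + 11)" using B(1,2) by (intro mult_le_mono) simp_all
    finally show ?thesis using g by simp
  qed
  show ?thesis
  proof (cases X)
    case (Run l p \<gamma> d fs)
    then show ?thesis using assms S tsize_goal[of l p \<gamma> d] tsize_frames[of fs]
      by (simp add: mk_run_def conf_bound_def)
  next
    case (Succeed \<gamma> fs)
    then show ?thesis using assms S m[of \<gamma>] tsize_frames[of fs]
      by (simp add: mk_succeed_def conf_bound_def)
  next
    case (Fail fs)
    then show ?thesis using assms S tsize_frames[of fs]
      by (simp add: mk_fail_def conf_bound_def)
  qed
qed

end

subsection \<open>The size of the parser\<close>

lemma length_nat_tokens: "length (nat_tokens n :: 'a token list) = length (nat_bits n)"
  by (simp add: nat_tokens_nat_bits)

lemma tsize_enum_bits: "tsize (enum_bits n) \<le> 4 * length (nat_bits n) + 1"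
  using tsize_blist[of "nat_bits n"] by (simp add: enum_bits_def)

lemma enat_size_le: "enat_size \<Delta> \<le> 4 * length (enat_tokens \<Delta> :: 'a token list) + 3"
  by (cases \<Delta>) (simp_all add: length_nat_tokens)

lemma tsize_egroups: "tsize (egroups r) \<le> 4 * length (regex_tokens r) + 1"
proof (induction r)
  case (Alt r1 r2)
  then show ?case using tsize_tlist_append[of "map enum_bits (groups r1)" "map enum_bits (groups r2)"]
    by (simp add: egroups_def)
next
  case (Seq r1 r2)
  then show ?case using tsize_tlist_append[of "map enum_bits (groups r1)" "map enum_bits (groups r2)"]
    by (simp add: egroups_def)
next
  case (Group g r)
  then show ?case using tsize_enum_bits[of g] by (simp add: egroups_def length_nat_tokens)
qed (simp_all add: egroups_def)

lemma weight_le_tokens: "weight r \<le> 2 * length (regex_tokens r)"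
  by (induction r) simp_all

lemma look_depth_le_tokens: "look_depth r \<le> length (regex_tokens r)"
  by (induction r) simp_all

lemma square_mono_add: "(a :: nat) ^ 2 + b ^ 2 \<le> (a + b) ^ 2"
  by (simp add: power2_sum)

text \<open>The square comes from nested quantifiers, each of which adds the weight of its body once
  more.\<close>

lemma peak_le_tokens: "peak r \<le> 4 * length (regex_tokens r) ^ 2"
proof (induction r)
  case (Alt r1 r2)
  then show ?case by (simp add: power2_eq_square algebra_simps)
next
  case (Seq r1 r2)
  then show ?case by (simp add: power2_eq_square algebra_simps)
next
  case (Group g r)
  then show ?case by (simp add: power2_eq_square algebra_simps)
next
  case (Quant r m \<Delta> \<kappa>)
  then show ?case using weight_le_tokens[of r] by (simp add: power2_eq_square algebra_simps)
next
  case (Look d b r)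
  then show ?case by (simp add: power2_eq_square algebra_simps)
qed simp_all

context
  fixes K :: nat
  assumes K: "\<And>t :: 'a::finite token. tsize (etok t) \<le> K"
begin

text \<open>The square is due to the lists of groups stored at quantifiers: a group is listed at
  every quantifier around it.\<close>

lemma msize_le_tokens: "msize (r :: 'a regex) \<le> (K + 30) * length (regex_tokens r) ^ 2"
proof (induction r)
  case (Chars cd)
  then show ?case using K[of "TChars cd"] by simp
next
  case (Anchor a)
  then show ?case using K[of "TAnchor a"] by simp
next
  case (Backref g)
  then show ?case using tsize_enum_bits[of g] by (simp add: length_nat_tokens power2_eq_square algebra_simps)
next
  case (Alt r1 r2)
  then show ?case by (simp add: power2_eq_square algebra_simps)
next
  case (Seq r1 r2)
  then show ?case by (simp add: power2_eq_square algebra_simps)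
next
  case (Group g r)
  then show ?case using tsize_enum_bits[of g] by (simp add: length_nat_tokens power2_eq_square algebra_simps)
next
  case (Quant r m \<Delta> \<kappa>)
  then show ?case using K[of "TQuant \<kappa>"] tsize_egroups[of r] enat_size_le[of \<Delta>, where 'a = 'a]
    by (simp add: power2_eq_square algebra_simps)
next
  case (Look d b r)
  then show ?case using K[of "TLook d b"] by (simp add: power2_eq_square algebra_simps)
qed simp

end

subsection \<open>Decoding the input\<close>

text \<open>\<open>m\<close> counts the current run of \<open>True\<close> bits and
  \<open>ns\<close> lists the finished runs, the latest first. This is the order from right to left
  in which the parser wants the tokens.\<close>

fun split_bit :: "nat \<times> nat list \<Rightarrow> bool \<Rightarrow> nat \<times> nat list" where
  "split_bit (m, ns) b = (if b then (Suc m, ns) else (0, m # ns))"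

lemma split_bits_sound:
  "foldl split_bit (m, ns) w = (m', ns') \<Longrightarrow>
    concat (map (\<lambda>k. replicate k True @ [False]) (rev ns')) @ replicate m' True =
    concat (map (\<lambda>k. replicate k True @ [False]) (rev ns)) @ replicate m True @ w"
proof (induction w arbitrary: m ns)
  case (Cons b w)
  then show ?case by (cases b) (auto simp: replicate_app_Cons_same)
qed simp

lemma split_bits_tokens:
  "foldl split_bit (0, ns) (concat (map token_code ts)) = (0, rev (map to_nat ts) @ ns)"
proof -
  have 1: "foldl split_bit (m, ns) (replicate k True) = (m + k, ns)" for m k ns
    by (induction k arbitrary: m) simp_all
  show ?thesis by (induction ts arbitrary: ns) (simp_all add: token_code_def 1)
qed

definition split_step :: "tree \<Rightarrow> tree \<Rightarrow> tree" where
  "split_step a v = (if a = Leaf then Node Leaf (Node (car v) (cdr v)) else Node (Node Leaf (car v)) (cdr v))"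

definition tsplit :: "tree \<Rightarrow> tree" where
  "tsplit t = foldl (\<lambda>v a. split_step a v) (Node Leaf Leaf) (els t)"

fun esplit :: "nat \<times> nat list \<Rightarrow> tree" where
  "esplit (m, ns) = Node (un m) (tlist (map un ns))"

lemma tsplit_blist: "tsplit (blist w) = esplit (foldl split_bit (0, []) w)"
proof -
  have "foldl (\<lambda>v a. split_step a v) (esplit x) (map tb w) = esplit (foldl split_bit x w)" for x
  proof (induction w arbitrary: x)
    case (Cons b w)
    have "split_step (tb b) (esplit x) = esplit (split_bit x b)"
      by (cases x) (simp add: split_step_def)
    with Cons show ?case by simp
  qed simp
  from this[of "(0, [])"] show ?thesis by (simp add: tsplit_def)
qed

lemma FP_tsplit [FP_intros]:
  assumes "FP f"
  shows "FP (\<lambda>t. tsplit (f t))"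
  unfolding tsplit_def
proof (rule FP_foldl[where h = "\<lambda>a v c. split_step a v" and q = 4 and c = "\<lambda>_. Leaf"])
  show "FP (\<lambda>t. split_step (car t) (car (cdr t)))" unfolding split_step_def by (intro FP_intros)
  show "tsize (split_step a v) \<le> tsize v + poly 4 (tsize a + tsize c)" for a v c
    by (cases v) (simp_all add: split_step_def)
qed (intro FP_intros assms)+

definition tparse_all :: "'a::finite itself \<Rightarrow> bool \<Rightarrow> tree list \<Rightarrow> tree" where
  "tparse_all TYPE('a) N as = foldl (\<lambda>v a. tparse TYPE('a) N a v) (mk_pstate Leaf Leaf Leaf Leaf) as"

lemma tparse_all_tokens:
  "tparse_all TYPE('a::finite) N (map etok (rev ts)) = epstate (parse N (ts :: 'a token list))"
proof (induction ts)
  case Nil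
  then show ?case by (simp add: tparse_all_def parse_def mk_pstate_def)
next
  case (Cons t ts)
  have eq: "parse N (t # ts) = parse_step N t (parse N ts)" by (simp add: parse_def)
  have "tparse TYPE('a) N (etok t) (epstate (parse N ts)) = epstate (parse N (t # ts))"
  proof (cases "parse N ts")
    case None
    then show ?thesis by (simp add: eq parse_step_def)
  next
    case (Some st)
    from tparse_correct[of N st t] parse_sound[OF Some] show ?thesis by (simp add: eq Some)
  qed
  with Cons show ?case by (simp add: tparse_all_def)
qed

lemma tparse_all_junk:
  assumes "\<not> set as \<subseteq> range (etok :: 'a::finite token \<Rightarrow> tree)"
  shows "tparse_all TYPE('a) N as = Leaf"
proof -
  have L: "foldl (\<lambda>v a. tparse TYPE('a) N a v) Leaf as = Leaf" for as by (induction as) simp_all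
  have "foldl (\<lambda>v a. tparse TYPE('a) N a v) v as = Leaf" for v
    using assms by (induction as arbitrary: v) (auto simp: tparse_junk L)
  then show ?thesis by (simp add: tparse_all_def)
qed

context
  fixes K :: nat
  assumes K: "\<And>t :: 'a::finite token. tsize (etok t) \<le> K"
begin

lemma tsize_entries:
  "tsize (tlist (map eentry (rs :: 'a regex list))) \<le> 1 + (K + 37) * length (concat (map regex_tokens rs)) ^ 2"
proof (induction rs)
  case (Cons r rs)
  let ?t = "length (regex_tokens r)" and ?u = "length (concat (map regex_tokens rs))"
  have "1 \<le> ?t" by (cases r) simp_all
  then have t: "?t \<le> ?t ^ 2" "1 \<le> ?t ^ 2" by (simp_all add: power2_eq_square)
  have "tsize (eentry r) + 1 \<le> 3 + 4 * ?t + (K + 30) * ?t ^ 2"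
    using tsize_egroups[of r] tsize_eregex[of r] msize_le_tokens[OF K, of r] by (simp add: eentry_def)
  also have "\<dots> \<le> (K + 37) * ?t ^ 2" using t by (simp add: algebra_simps)
  finally have "tsize (tlist (map eentry (r # rs))) \<le> 1 + ((K + 37) * ?t ^ 2 + (K + 37) * ?u ^ 2)"
    using Cons by simp
  also have "\<dots> \<le> 1 + (K + 37) * (?t + ?u) ^ 2"
    using square_mono_add[of ?t ?u] by (simp flip: add_mult_distrib2)
  finally show ?case by simp
qed simp

lemma tsize_epstate:
  assumes "parse_ok N (st :: 'a pstate)"
  shows "tsize (epstate (Some st)) \<le> (K + 50) * (1 + length (unparse st)) ^ 2"
proof -
  obtain bs pd rs s where st: "st = (bs, pd, rs, s)" by (cases st)
  let ?e = "length (concat (map regex_tokens rs))" and ?n = "length s"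
  define u where "u = length (unparse st) - ?e - ?n"
  have T: "length (unparse st) = u + ?e + ?n" by (simp add: u_def st)
  have "tsize (blist bs) + tsize (epending pd) \<le> 8 + 4 * u"
  proof (cases pd)
    case (PComma \<Delta>)
    then show ?thesis using tsize_blist[of bs] tsize_eenat[of \<Delta>] enat_size_le[of \<Delta>, where 'a = 'a]
      by (simp add: u_def st)
  qed (use assms tsize_blist[of bs] in \<open>auto simp: u_def st\<close>)
  moreover have "tsize (tlist (map echar s)) \<le> 1 + ?n * (K + 1)"
    using tsize_tlist_le[of "map echar s" K] K by (auto simp: echar_def)
  ultimately have "tsize (epstate (Some st)) \<le> 13 + 4 * u + (K + 37) * ?e ^ 2 + ?n * (K + 1)"
    using tsize_entries[of rs] by (simp add: st)
  also have "\<dots> \<le> (K + 50) * (1 + u + ?e ^ 2 + ?n)" by (simp add: algebra_simps)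
  also have "\<dots> \<le> (K + 50) * (1 + (u + ?e + ?n)) ^ 2"
    by (intro mult_le_mono2) (simp add: power2_eq_square algebra_simps)
  finally show ?thesis by (simp only: T)
qed

text \<open>A state of the parser determines the tokens that led to it and has a size quadratic in
  their number; after a failure it is \<open>Leaf\<close>. So no analysis of single steps is
  required.\<close>

lemma tsize_tparse_all: "tsize (tparse_all TYPE('a) N as) \<le> (K + 50) * (1 + length as) ^ 2"
proof (cases "set as \<subseteq> range (etok :: 'a token \<Rightarrow> tree)")
  case True
  then obtain us :: "'a token list" where "as = map etok us" by (metis ex_map_conv subset_iff rangeE)
  then have as: "as = map etok (rev (rev us))" by simp
  show ?thesis
  proof (cases "parse N (rev us)")
    case (Some st)
    from parse_sound[OF this] tsize_epstate[of N st] have "tsize (epstate (Some st)) \<le> (K + 50) * (1 + length as) ^ 2"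
      by (simp add: as)
    with Some show ?thesis unfolding as tparse_all_tokens by simp
  qed (unfold as tparse_all_tokens, simp)
qed (simp add: tparse_all_junk)

end

lemma token_size_bound:
  obtains K where "\<And>t :: 'a::finite token. tsize (etok t) \<le> K"
proof
  show "tsize (etok t) \<le> Max (range (\<lambda>t :: 'a token. tsize (etok t)))" for t :: "'a token"
    by (rule Max_ge) simp_all
qed

text \<open>A quantifier copies a list of groups out of the accumulator, so the growth per step is
  not bounded by the token read. The bound on all prefixes takes the place of
  \<open>FP_foldl\<close>.\<close>

lemma FP_tparse_all [FP_intros]:
  assumes "FP x"
  shows "FP (\<lambda>t. tparse_all TYPE('a::finite) N (els (x t)))"
proof -
  obtain K where K: "\<And>t :: 'a token. tsize (etok t) \<le> K" using token_size_bound by blast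
  obtain q where q: "\<And>t. tsize (x t) \<le> poly q (tsize t)" using FP_size[OF assms] by blast
  have "FP (\<lambda>t. foldl (\<lambda>v a. (\<lambda>t. tparse TYPE('a) N (car t) (cdr t)) (Node a v)) (mk_pstate Leaf Leaf Leaf Leaf) (els (x t)))"
  proof (rule FP_foldl_bounded[OF FP_tparse assms FP_const])
    fix t k
    have "length (take k (els (x t))) \<le> poly q (tsize t)"
      using length_els_le[of "x t"] q[of t] by simp
    then have "(K + 50) * (1 + length (take k (els (x t)))) ^ 2 \<le> (K + 50) * (1 + poly q (tsize t)) ^ 2"
      by (intro mult_le_mono2 power_mono) simp_all
    with tsize_tparse_all[OF K, of N "take k (els (x t))"]
    have "tsize (tparse_all TYPE('a) N (take k (els (x t)))) \<le> (K + 50) * (1 + poly q (tsize t)) ^ 2"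
      by (rule order.trans)
    then show "tsize (foldl (\<lambda>v a. tparse TYPE('a) N (car (Node a v)) (cdr (Node a v))) (mk_pstate Leaf Leaf Leaf Leaf)
      (take k (els (x t)))) \<le> poly ([:K + 50:] * (1 + q) ^ 2) (tsize t)"
      by (simp add: tparse_all_def)
  qed
  then show ?thesis by (simp add: tparse_all_def)
qed

subsection \<open>The initial configuration\<close>

definition tpositions :: "tree list \<Rightarrow> tree" where
  "tpositions xs = foldl (\<lambda>v a. Node (Node Leaf (car v)) v) (Node Leaf Leaf) xs"

lemma tpositions: "tpositions xs = tlist (map un (rev [0..<Suc (length xs)]))"
  by (induction xs rule: rev_induct) (simp_all add: tpositions_def)

lemma FP_tpositions [FP_intros]:
  assumes "FP x"
  shows "FP (\<lambda>t. tpositions (els (x t)))"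
proof -
  obtain q where q: "\<And>t. tsize (x t) \<le> poly q (tsize t)" using FP_size[OF assms] by blast
  have "FP (\<lambda>t. foldl (\<lambda>v a. (\<lambda>t. Node (Node Leaf (car (cdr t))) (cdr t)) (Node a v)) (Node Leaf Leaf) (els (x t)))"
  proof (rule FP_foldl_bounded[OF _ assms FP_const])
    show "FP (\<lambda>t. Node (Node Leaf (car (cdr t))) (cdr t))" by (intro FP_intros)
    fix t k
    let ?xs = "take k (els (x t))" and ?p = "poly q (tsize t)"
    have le: "length ?xs \<le> ?p" using length_els_le[of "x t"] q[of t] by simp
    have "tsize (tpositions ?xs) \<le> 1 + Suc (length ?xs) * (2 * ?p + 1 + 1)"
      using tsize_tlist_le[of "map un (rev [0..<Suc (length ?xs)])" "2 * ?p + 1"] le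
      unfolding tpositions by fastforce
    also have "\<dots> \<le> 1 + Suc ?p * (2 * ?p + 1 + 1)" using le by (intro add_left_mono mult_le_mono1) simp
    finally show "tsize (foldl (\<lambda>v a. Node (Node Leaf (car (cdr (Node a v)))) (cdr (Node a v))) (Node Leaf Leaf) ?xs)
        \<le> poly (1 + (1 + q) * (2 * q + 1 + 1)) (tsize t)"
      by (simp add: tpositions_def)
  qed
  then show ?thesis by (simp add: tpositions_def)
qed

definition tstart_frames :: "tree \<Rightarrow> tree \<Rightarrow> tree \<Rightarrow> tree" where
  "tstart_frames gs r s = tmap (\<lambda>p. Node Leaf (goal (Node (reg (cdr (Node gs r))) Leaf) p
     (tmap (\<lambda>a. Node a Leaf) (car (Node gs r))) Leaf)) (rapp (tpositions (els s)) Leaf)"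

lemma tstart_frames_correct:
  "tstart_frames (egroups r) (eregex r) (estring s) = eframes (groups r) (start_frames r (length s))"
proof -
  have "rapp (tpositions (els (estring s))) Leaf = tlist (map un [0..<Suc (length s)])"
    using rapp_tlist[of "map un (rev [0..<Suc (length s)])" "[]"]
    by (simp add: tpositions estring_def rev_map del: upt_Suc)
  then show ?thesis
    by (simp add: tstart_frames_def eframes_def start_frames_def emap_def egroups_def reg_def o_def del: upt_Suc)
qed

lemma FP_tstart_frames [FP_intros]:
  assumes "FP f" "FP g" "FP h"
  shows "FP (\<lambda>t. tstart_frames (f t) (g t) (h t))"
  unfolding tstart_frames_def
proof (rule FP_tmap[where c = "\<lambda>t. Node (f t) (g t)"
      and h = "\<lambda>p c. Node Leaf (goal (Node (reg (cdr c)) Leaf) p (tmap (\<lambda>a. Node a Leaf) (car c)) Leaf)"])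
  have "FP (\<lambda>t. tmap (\<lambda>a. Node a Leaf) (car (cdr t)))"
    by (rule FP_tmap[where h = "\<lambda>a _. Node a Leaf" and c = "\<lambda>_. Leaf"]) (intro FP_intros)+
  then show "FP (\<lambda>t. Node Leaf (goal (Node (reg (cdr (cdr t))) Leaf) (car t) (tmap (\<lambda>a. Node a Leaf) (car (cdr t))) Leaf))"
    by (intro FP_intros)
qed (intro FP_intros assms)+

text \<open>\<open>Node Leaf Leaf\<close> is the finished, rejecting configuration; words that do
  not encode an allowed instance end here at once.\<close>

definition tinit :: "'a::finite itself \<Rightarrow> bool \<Rightarrow> tree \<Rightarrow> tree" where
  "tinit TYPE('a) N t = (let v = tsplit t; st = tparse_all TYPE('a) N (els (cdr v));
     rs = car (cdr (cdr st)); s = cdr (cdr (cdr st)); g = car (car rs); r = cdr (car rs) in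
     if car v = Leaf \<and> car st = Leaf \<and> car (cdr st) = Leaf \<and> rs \<noteq> Leaf \<and> cdr rs = Leaf \<and> tdistinct g
     then mk_fail s (tstart_frames g r s) else Node Leaf Leaf)"

lemma FP_tinit: "FP (tinit TYPE('a::finite) N)"
  unfolding tinit_def Let_def by (intro FP_intros)

definition instance_of :: "bool \<Rightarrow> 'a::finite regex \<Rightarrow> 'a list \<Rightarrow> bool list \<Rightarrow> bool" where
  "instance_of N r s w \<longleftrightarrow> w = encode_instance r s \<and> allowed N r \<and> r \<in> js_regexes"

lemma tinit_instance:
  fixes s :: "'a::finite list"
  assumes "instance_of N r s w"
  shows "tinit TYPE('a) N (blist w) = emconf (groups r) s (Fail (start_frames r (length s)))"
proof -
  let ?ts = "regex_tokens r @ map TChar s"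
  have p: "parse N ?ts = Some ([], PNone, [r], s)" using assms by (simp add: parse_iff instance_of_def)
  have "tsplit (blist w) = Node Leaf (tlist (map etok (rev ?ts)))"
    using assms split_bits_tokens[of "[]" ?ts]
    by (simp add: tsplit_blist instance_of_def encode_instance_def rev_map etok_def o_def)
  moreover have "tparse_all TYPE('a) N (map etok (rev ?ts)) = epstate (Some ([], PNone, [r], s))"
    using tparse_all_tokens[of N ?ts] by (simp only: p)
  ultimately show ?thesis
    using assms tstart_frames_correct[of r s]
    by (simp add: tinit_def Let_def eentry_def instance_of_def js_regexes_def egroups_def estring_def)
qed

lemma tinit_junk:
  assumes "\<nexists>(r :: 'a::finite regex) s. instance_of N r s w"
  shows "tinit TYPE('a) N (blist w) = Node Leaf Leaf"
proof (rule ccontr)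
  assume a: "tinit TYPE('a) N (blist w) \<noteq> Node Leaf Leaf"
  obtain m ns where mn: "foldl split_bit (0, []) w = (m, ns)" by force
  let ?st = "tparse_all TYPE('a) N (map un ns)"
  have v: "tsplit (blist w) = Node (un m) (tlist (map un ns))" by (simp add: tsplit_blist mn)
  from a have m: "m = 0" and st: "car ?st = Leaf" "car (cdr ?st) = Leaf"
    "car (cdr (cdr ?st)) \<noteq> Leaf" "cdr (car (cdr (cdr ?st))) = Leaf"
    and d: "tdistinct (car (car (car (cdr (cdr ?st)))))"
    by (auto simp: tinit_def Let_def v split: if_splits)
  from st(3) have "?st \<noteq> Leaf" by auto
  then have "set (map un ns) \<subseteq> range (etok :: 'a token \<Rightarrow> tree)" using tparse_all_junk by blast
  then obtain us :: "'a token list" where us: "map un ns = map etok us" by (metis ex_map_conv subset_iff rangeE)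
  then have "map un ns = map etok (rev (rev us))" by simp
  then have e: "?st = epstate (parse N (rev us))" by (simp only: tparse_all_tokens)
  with \<open>?st \<noteq> Leaf\<close> obtain x where x: "parse N (rev us) = Some x" by (cases "parse N (rev us)") auto
  obtain bs pd rs s where x': "x = (bs, pd, rs, s)" by (cases x)
  from st e x x' have "bs = []" "pd = PNone" by (cases bs; auto)+
  moreover from st e x x' obtain r where "rs = [r]" by (cases rs rule: remdups_adj.cases) auto
  ultimately have p: "parse N (rev us) = Some ([], PNone, [r], s)" by (simp add: x x')
  then have ts: "rev us = regex_tokens r @ map TChar s" "allowed N r" by (simp_all add: parse_iff)
  have "distinct (groups r)" using d by (simp add: e p eentry_def egroups_def)
  moreover have "ns = map to_nat us"
    using us inj_map_eq_map[of un ns "map to_nat us"] by (simp add: etok_def inj_def)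
  with split_bits_sound[OF mn] m have "w = concat (map (\<lambda>k. replicate k True @ [False]) (map to_nat (rev us)))"
    by (simp add: rev_map)
  then have "w = concat (map token_code (rev us))" by (simp add: token_code_def[abs_def] o_def)
  ultimately have "instance_of N r s w" using ts by (simp add: instance_of_def encode_instance_def js_regexes_def)
  with assms show False by blast
qed

subsection \<open>Membership in PSPACE\<close>

text \<open>A common bound for an instance of length \<open>n\<close>. The summands bound token
  codes, the list of all groups, the peak, the size of a regex, and the height of the stack as in
  \<open>start_ok\<close>.\<close>

definition size_param :: "nat \<Rightarrow> nat \<Rightarrow> nat" where
  "size_param K n = K + 4 * n + 1 + 4 * n ^ 2 + (K + 30) * n ^ 2 + ((n + 1) * ((4 * n ^ 2 + 1) * (n + 1)) + n + 1)"

lemma poly_bounded_conf_bound: "poly_bounded (\<lambda>n. conf_bound (size_param K n))"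
  unfolding conf_bound_def goal_bound_def size_param_def by (intro poly_bounded_intros)

lemma length_tokens_le: "length ts \<le> length (concat (map token_code ts))"
  by (induction ts) (simp_all add: token_code_def)

lemma tsize_reachable:
  fixes W :: "'a::finite set" and r :: "'a regex" and s :: "'a list"
  assumes K: "\<And>t :: 'a token. tsize (etok t) \<le> K" and inst: "instance_of N r s w"
  defines "X \<equiv> \<lambda>i. (mstep W s ^^ i) (Fail (start_frames r (length s)))"
  shows "tsize (emconf (groups r) s (X i)) \<le> conf_bound (size_param K (length w))"
    and "running_ok (groups r) s (X i)"
proof -
  let ?n = "length w" and ?B = "size_param K (length w)"
  let ?P = "peak r" and ?D = "look_depth r" and ?Z = "msize r"
  let ?R = "(?D + 1) * ((?P + 1) * (length s + 1)) + length s + 1"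
  have ts: "length (regex_tokens r) + length s \<le> ?n"
    using inst length_tokens_le[of "regex_tokens r @ map TChar s"] by (simp add: instance_of_def encode_instance_def)
  then have T: "length (regex_tokens r) \<le> ?n" and n: "length s \<le> ?n" by simp_all
  then have T2: "length (regex_tokens r) ^ 2 \<le> ?n ^ 2" by (simp add: power_mono)
  have "4 * length (regex_tokens r) ^ 2 \<le> 4 * ?n ^ 2" using T2 by (rule mult_le_mono2)
  with peak_le_tokens[of r] have P: "?P \<le> 4 * ?n ^ 2" by (rule order.trans)
  have "(K + 30) * length (regex_tokens r) ^ 2 \<le> (K + 30) * ?n ^ 2" using T2 by (rule mult_le_mono2)
  with msize_le_tokens[OF K, of r] have Z: "?Z \<le> (K + 30) * ?n ^ 2" by (rule order.trans)
  have D: "?D \<le> ?n" using look_depth_le_tokens[of r] T by simp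
  have R: "?R \<le> (?n + 1) * ((4 * ?n ^ 2 + 1) * (?n + 1)) + ?n + 1"
    using P D n by (intro add_le_mono mult_le_mono) simp_all
  have ok: "conf_ok s (groups r) ?P ?D ?Z ?R (X i)"
    unfolding X_def
  proof (intro conf_ok_funpow start_ok)
    show "no_lower_bounds r" using inst by (simp add: instance_of_def allowed_def)
  qed (simp_all add: span_def)
  show "tsize (emconf (groups r) s (X i)) \<le> conf_bound ?B"
  proof (rule tsize_emconf[OF _ _ _ _ _ _ ok])
    show "tsize (tlist (map enum_bits (groups r))) \<le> ?B"
      using tsize_egroups[of r] T by (simp add: egroups_def size_param_def)
    show "tsize (etok t) \<le> ?B" for t :: "'a token" using K[of t] by (simp add: size_param_def)
  qed (use n P Z R in \<open>simp_all add: size_param_def\<close>)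
  show "running_ok (groups r) s (X i)"
    using ok by (cases "X i") (simp_all add: goal_ok_def map_ok_def)
qed

lemma mstep_final: "final X \<Longrightarrow> mstep W s X = X"
  by (auto simp: final_def)

lemma tstep_reachable:
  fixes W :: "'a::finite set" and r :: "'a regex" and s :: "'a list"
  assumes K: "\<And>t :: 'a token. tsize (etok t) \<le> K" and inst: "instance_of N r s w"
  defines "C \<equiv> \<lambda>i. (tstep W ^^ i) (tinit TYPE('a) N (blist w))"
  shows "\<exists>n. (\<forall>i\<le>n. tsize (C i) \<le> conf_bound (size_param K (length w)) \<and> C i \<noteq> Leaf) \<and>
    (\<forall>i<n. car (C i) \<noteq> Leaf) \<and> car (C n) = Leaf \<and> (cdr (C n) \<noteq> Leaf \<longleftrightarrow> has_match W r s)"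
proof -
  let ?X = "\<lambda>i. (mstep W s ^^ i) (Fail (start_frames r (length s)))"
  let ?e = "emconf (groups r) s"
  have nlb: "no_lower_bounds r" using inst by (simp add: instance_of_def allowed_def)
  have "\<exists>i Y. ?X i = Y \<and> final Y \<and> (has_match W r s \<longleftrightarrow> Y \<noteq> Fail [])"
    using machine_correct[OF nlb, of W s]
    by (cases "has_match W r s") (auto simp: leads_to_def final_def)
  then obtain j where j: "final (?X j)" "has_match W r s \<longleftrightarrow> ?X j \<noteq> Fail []" by auto
  \<comment> \<open>The first final configuration, because \<open>tstep\<close> imitates
    \<open>mstep\<close> only on configurations that are not final.\<close>
  define n where "n = (LEAST i. final (?X i))"
  have n: "final (?X n)" unfolding n_def using j(1) by (rule LeastI)
  have less: "\<not> final (?X i)" if "i < n" for i using not_less_Least that unfolding n_def by blast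
  have "n \<le> j" unfolding n_def using j(1) by (rule Least_le)
  moreover have "?X (n + i) = ?X n" for i
    by (induction i) (simp_all add: mstep_final[OF n])
  ultimately have jn: "?X j = ?X n" by (metis le_add_diff_inverse)
  have C: "C i = ?e (?X i)" if "i \<le> n" for i
    using that
  proof (induction i)
    case 0
    show ?case using tinit_instance[OF inst] by (simp add: C_def)
  next
    case (Suc i)
    then have "C (Suc i) = tstep W (?e (?X i))" by (simp add: C_def)
    also have "\<dots> = ?e (mstep W s (?X i))"
      using Suc.prems by (intro tstep_correct tsize_reachable(2)[OF K inst] less) simp
    finally show ?case by simp
  qed
  have e: "car (?e Y) \<noteq> Leaf \<and> ?e Y \<noteq> Leaf" for Y
    by (cases Y) (simp_all add: mk_run_def mk_succeed_def mk_fail_def)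
  have last: "C (Suc n) = Node Leaf (tb (has_match W r s))"
  proof -
    have "C (Suc n) = tstep W (?e (?X n))" using C[of n] by (simp add: C_def)
    moreover have "tstep W (?e (?X n)) = Node Leaf (tb (?X n \<noteq> Fail []))"
      using n by (auto simp: final_def tstep_final simp del: emconf.simps)
    ultimately show ?thesis using j(2) jn by simp
  qed
  show ?thesis
  \<comment> \<open>One step beyond the final configuration, where its outcome is turned into the
    answer.\<close>
  proof (rule exI[of _ "Suc n"], intro conjI allI impI)
    fix i assume i: "i \<le> Suc n"
    show "tsize (C i) \<le> conf_bound (size_param K (length w))"
    proof (cases "i = Suc n")
      case True
      then show ?thesis by (simp only: last) (simp add: tb_def conf_bound_def)
    next
      case False
      with i C[of i] tsize_reachable(1)[OF K inst, where W = W and i = i] show ?thesis by simp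
    qed
    show "C i \<noteq> Leaf"
    proof (cases "i = Suc n")
      case False
      with i C[of i] e[of "?X i"] show ?thesis by simp
    qed (simp only: last, simp)
  next
    fix i assume "i < Suc n"
    with C[of i] e[of "?X i"] show "car (C i) \<noteq> Leaf" by simp
  qed (simp_all only: last, simp_all)
qed

theorem JSREGTEST_in_PSPACE:
  fixes W :: "'a::finite set"
  shows "JSREGTEST W {r \<in> js_regexes. allowed N r} \<in> PSPACE"
proof -
  let ?L = "JSREGTEST W {r \<in> js_regexes. allowed N r}"
  obtain K where K: "\<And>t :: 'a token. tsize (etok t) \<le> K" using token_size_bound by blast
  obtain q where q: "\<And>n. conf_bound (size_param K n) \<le> poly q n"
    using poly_bounded_conf_bound[of K] by (auto simp: poly_bounded_def)
  show ?thesis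
  proof (rule FP_loop_PSPACE[OF FP_tinit[where 'a = 'a and N = N] FP_tstep[of W], where q = q])
    fix w
    let ?C = "\<lambda>i. (tstep W ^^ i) (tinit TYPE('a) N (blist w))"
    show "\<exists>n. (\<forall>i\<le>n. tsize (?C i) \<le> poly q (length w) \<and> ?C i \<noteq> Leaf) \<and>
      (\<forall>i<n. car (?C i) \<noteq> Leaf) \<and> car (?C n) = Leaf \<and> (cdr (?C n) \<noteq> Leaf \<longleftrightarrow> w \<in> ?L)"
    proof (cases "\<exists>(r :: 'a regex) s. instance_of N r s w")
      case True
      then obtain r :: "'a regex" and s where inst: "instance_of N r s w" by blast
      have "w \<in> ?L \<longleftrightarrow> has_match W r s"
        using inst encode_instance_inj by (fastforce simp: JSREGTEST_def instance_of_def)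
      moreover obtain n where "\<forall>i\<le>n. tsize (?C i) \<le> conf_bound (size_param K (length w)) \<and> ?C i \<noteq> Leaf"
        "\<forall>i<n. car (?C i) \<noteq> Leaf" "car (?C n) = Leaf" "cdr (?C n) \<noteq> Leaf \<longleftrightarrow> has_match W r s"
        using tstep_reachable[OF K inst, of W] by blast
      ultimately show ?thesis using q[of "length w"] by (intro exI[of _ n]) (meson order.trans)
    next
      case False
      then have "w \<notin> ?L" by (auto simp: JSREGTEST_def instance_of_def)
      moreover have "3 \<le> poly q (length w)" using q[of "length w"] by (simp add: conf_bound_def)
      ultimately show ?thesis using tinit_junk[OF False] by (intro exI[of _ 0]) simp
    qed
  qed
qed

theorem mainTheorem4:
  fixes W :: "'a::finite set"
  shows "PSPACE_complete
           (JSREGTEST W {r \<in> js_regexes. no_lower_bounds r}) \<and>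
         PSPACE_complete
           (JSREGTEST W {r \<in> js_regexes. no_lower_bounds r \<and> no_neg_lookarounds r})"
proof -
  have "JSREGTEST W {r \<in> js_regexes. no_lower_bounds r} \<in> PSPACE"
    using JSREGTEST_in_PSPACE[of W True] by (simp add: allowed_def)
  moreover have "JSREGTEST W {r \<in> js_regexes. no_lower_bounds r \<and> no_neg_lookarounds r} \<in> PSPACE"
    using JSREGTEST_in_PSPACE[of W False] by (simp add: allowed_def)
  moreover have "PSPACE_hard (JSREGTEST W {r \<in> js_regexes. no_lower_bounds r})"
    "PSPACE_hard (JSREGTEST W {r \<in> js_regexes. no_lower_bounds r \<and> no_neg_lookarounds r})"
    by (rule JSREGTEST_PSPACE_hard; auto)+
  ultimately show ?thesis by (simp add: PSPACE_complete_def)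
qed

end
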